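(* Let $G$ be an algebraic group defined over $\mathbb Z$, let $M$ and $N$ be $G$-modules over $\mathbb Z$, finitely generated over $\mathbb Z$, and let $(k_i)_{i\in I}$ be a collection of fields. Let $M_i=M\otimes k_i$ and $N_i=N\otimes k_i$ denote the images of $M$ and $N$ in $\mathrm{Rep}_{k_i}G$, and let $[M_i],[N_i]$ denote the images of the tuples $(M_i),(N_i)$ in the restricted ultraproduct $\prod_R\mathrm{Rep}_{k_i}G$ (formed with respect to a non-principal ultrafilter on $I$). If the dimension of $\mathrm{Ext}^1([M_i],[N_i])$, computed in the category $\prod_R\mathrm{Rep}_{k_i}G$, is finite and is the same for every choice of non-principal ultrafilter on $I$, then $\dim\mathrm{Ext}^1_{G(k_i)}(M_i,N_i)$ is the same for all but finitely many $i$.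
   Context: An algebraic group over $\mathbb Z$ is an affine group scheme represented by a Hopf algebra $A$ finitely generated as a $\mathbb Z$-algebra; $G$-modules over $\mathbb Z$ are $A$-comodules. $\mathrm{Rep}_kG$ is the category of finite dimensional representations of $G$ over the field $k$, i.e. of finite dimensional comodules over $A\otimes k$. For a non-principal ultrafilter $\mathcal U$ on $I$, the ultraproduct $\prod_{\mathcal U}\mathrm{Rep}_{k_i}G$ has as objects and morphisms the classes $[X_i]$, $[\phi_i]$ of tuples of objects, resp. morphisms, modulo equality on a set in $\mathcal U$, with all structure componentwise. The restricted ultraproduct $\prod_R\mathrm{Rep}_{k_i}G$ is its full subcategory of objects $[X_i]$ with $\dim X_i$ bounded on a set in $\mathcal U$; it is a tannakian category, linear over the field $\prod_{\mathcal U}k_i$. In a $k$-linear abelian category, $\mathrm{Ext}^1(M,N)$ is the $k$-vector space (under Baer sum) of equivalence classes of extensions $0\to N\to X\to M\to0$ in that category, and dimension is over $k$. $\mathrm{Ext}^1_{G(k_i)}$ denotes $\mathrm{Ext}^1$ in $\mathrm{Rep}_{k_i}G$. *)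

theory Defs
  imports
    "HOL-Algebra.IntRing"
    "HOL-Algebra.Generated_Rings"
    "HOL-Algebra.Free_Abelian_Groups"
    "Jordan_Normal_Form.Missing_VectorSpace"
begin

section \<open>Tensor products\<close>

text \<open>The tensor product over \<open>R\<close> is the quotient of the free abelian group on
  \<open>carrier M \<times> carrier N\<close> by the bilinearity and balancing relations.  An element is a coset,
  that is, a set of formal integer combinations of pairs.\<close>

type_synonym ('m, 'n) tensor = "('m \<times> 'n \<Rightarrow>\<^sub>0 int) set"

definition tensor_rels ::
    "('r, 'x) ring_scheme \<Rightarrow> ('r, 'm, 'y) module_scheme \<Rightarrow> ('r, 'n, 'z) module_scheme
      \<Rightarrow> ('m \<times> 'n \<Rightarrow>\<^sub>0 int) set" where
  "tensor_rels R M N =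
     {frag_of (x \<oplus>\<^bsub>M\<^esub> x', y) - frag_of (x, y) - frag_of (x', y) | x x' y.
        x \<in> carrier M \<and> x' \<in> carrier M \<and> y \<in> carrier N} \<union>
     {frag_of (x, y \<oplus>\<^bsub>N\<^esub> y') - frag_of (x, y) - frag_of (x, y') | x y y'.
        x \<in> carrier M \<and> y \<in> carrier N \<and> y' \<in> carrier N} \<union>
     {frag_of (r \<odot>\<^bsub>M\<^esub> x, y) - frag_of (x, r \<odot>\<^bsub>N\<^esub> y) | r x y.
        r \<in> carrier R \<and> x \<in> carrier M \<and> y \<in> carrier N}"

definition tensor_null ::
    "('r, 'x) ring_scheme \<Rightarrow> ('r, 'm, 'y) module_scheme \<Rightarrow> ('r, 'n, 'z) module_scheme
      \<Rightarrow> ('m \<times> 'n \<Rightarrow>\<^sub>0 int) set" where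
  "tensor_null R M N =
     generate (free_Abelian_group (carrier M \<times> carrier N)) (tensor_rels R M N)"

definition pure_tensor ::
    "('r, 'x) ring_scheme \<Rightarrow> ('r, 'm, 'y) module_scheme \<Rightarrow> ('r, 'n, 'z) module_scheme
      \<Rightarrow> 'm \<Rightarrow> 'n \<Rightarrow> ('m, 'n) tensor" where
  "pure_tensor R M N x y =
     tensor_null R M N #>\<^bsub>free_Abelian_group (carrier M \<times> carrier N)\<^esub> frag_of (x, y)"

text \<open>For a balanced biadditive map \<open>b\<close> into the abelian group \<open>P\<close>, \<open>tensor_lift P b\<close> is the
  induced additive map on the tensor product, determined by \<open>x \<otimes> y \<mapsto> b x y\<close>; for such \<open>b\<close> the
  choice of a representative of the coset is immaterial.\<close>

definition tensor_lift ::
    "('p, 'x) ring_scheme \<Rightarrow> ('m \<Rightarrow> 'n \<Rightarrow> 'p) \<Rightarrow> ('m, 'n) tensor \<Rightarrow> 'p" where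
  "tensor_lift P b t =
     (let c = (SOME c. c \<in> t)
      in \<Oplus>\<^bsub>P\<^esub>z\<in>Poly_Mapping.keys c. [Poly_Mapping.lookup c z] \<cdot>\<^bsub>P\<^esub> b (fst z) (snd z))"

definition tensor_group ::
    "('r, 'x) ring_scheme \<Rightarrow> ('r, 'm, 'y) module_scheme \<Rightarrow> ('r, 'n, 'z) module_scheme
      \<Rightarrow> ('m, 'n) tensor ring" where
  "tensor_group R M N =
     (let Q = free_Abelian_group (carrier M \<times> carrier N) Mod tensor_null R M N
      in \<lparr>carrier = carrier Q, monoid.mult = undefined, monoid.one = undefined,
          ring.zero = monoid.one Q, ring.add = monoid.mult Q\<rparr>)"

text \<open>The components \<open>mult\<close> and \<open>one\<close> are meaningful only if \<open>M\<close> and \<open>N\<close> are algebras.\<close>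

definition tensor ::
    "('r, 'x) ring_scheme \<Rightarrow> ('r, 'm, 'y) module_scheme \<Rightarrow> ('r, 'n, 'z) module_scheme
      \<Rightarrow> ('r, ('m, 'n) tensor) module" where
  "tensor R M N =
     (let T = tensor_group R M N
      in \<lparr>carrier = carrier T,
          monoid.mult = (\<lambda>s t. tensor_lift T (\<lambda>x y. tensor_lift T (\<lambda>x' y'.
                    pure_tensor R M N (x \<otimes>\<^bsub>M\<^esub> x') (y \<otimes>\<^bsub>N\<^esub> y')) t) s),
          monoid.one = pure_tensor R M N \<one>\<^bsub>M\<^esub> \<one>\<^bsub>N\<^esub>,
          ring.zero = ring.zero T,
          ring.add = ring.add T,
          smult = (\<lambda>r. tensor_lift T (\<lambda>x y. pure_tensor R M N (r \<odot>\<^bsub>M\<^esub> x) y))\<rparr>)"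


section \<open>Commutative Hopf algebras and comodules\<close>

record ('r, 'a) hopf = "('r, 'a) module" +
  comult :: "'a \<Rightarrow> ('a, 'a) tensor"
  counit :: "'a \<Rightarrow> 'r"
  antipode :: "'a \<Rightarrow> 'a"

locale hopf_algebra = algebra R A for R (structure) and A :: "('r, 'a, 'x) hopf_scheme" (structure) +
  assumes comult_linear: "comult A \<in> module_hom R A (tensor R A A)"
    and comult_ring_hom: "comult A \<in> ring_hom A (tensor R A A)"
    and counit_linear: "\<lbrakk>r \<in> carrier R; a \<in> carrier A\<rbrakk> \<Longrightarrow>
      counit A (r \<odot>\<^bsub>A\<^esub> a) = r \<otimes>\<^bsub>R\<^esub> counit A a"
    and counit_ring_hom: "counit A \<in> ring_hom A R"
    and antipode_linear: "antipode A \<in> module_hom R A A"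
    and coassoc: "a \<in> carrier A \<Longrightarrow>
      tensor_lift (tensor R A (tensor R A A))
        (\<lambda>x y. pure_tensor R A (tensor R A A) x (comult A y)) (comult A a) =
      tensor_lift (tensor R A (tensor R A A))
        (\<lambda>x y. tensor_lift (tensor R A (tensor R A A))
          (\<lambda>u v. pure_tensor R A (tensor R A A) u (pure_tensor R A A v y)) (comult A x))
        (comult A a)"
    and counit_left: "a \<in> carrier A \<Longrightarrow>
      tensor_lift A (\<lambda>x y. counit A x \<odot>\<^bsub>A\<^esub> y) (comult A a) = a"
    and counit_right: "a \<in> carrier A \<Longrightarrow>
      tensor_lift A (\<lambda>x y. counit A y \<odot>\<^bsub>A\<^esub> x) (comult A a) = a"
    and antipode_left: "a \<in> carrier A \<Longrightarrow>
      tensor_lift A (\<lambda>x y. antipode A x \<otimes>\<^bsub>A\<^esub> y) (comult A a) = counit A a \<odot>\<^bsub>A\<^esub> \<one>\<^bsub>A\<^esub>"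
    and antipode_right: "a \<in> carrier A \<Longrightarrow>
      tensor_lift A (\<lambda>x y. x \<otimes>\<^bsub>A\<^esub> antipode A y) (comult A a) = counit A a \<odot>\<^bsub>A\<^esub> \<one>\<^bsub>A\<^esub>"

record ('r, 'a, 'v) comodule = "('r, 'v) module" +
  coact :: "'v \<Rightarrow> ('v, 'a) tensor"

locale comodule = module R V
  for R (structure) and A :: "('r, 'a, 'x) hopf_scheme"
    and V :: "('r, 'a, 'v, 'y) comodule_scheme" (structure) +
  assumes coact_linear: "coact V \<in> module_hom R V (tensor R V A)"
    and coact_coassoc: "v \<in> carrier V \<Longrightarrow>
      tensor_lift (tensor R V (tensor R A A))
        (\<lambda>w a. pure_tensor R V (tensor R A A) w (comult A a)) (coact V v) =
      tensor_lift (tensor R V (tensor R A A))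
        (\<lambda>w a. tensor_lift (tensor R V (tensor R A A))
          (\<lambda>u b. pure_tensor R V (tensor R A A) u (pure_tensor R A A b a)) (coact V w))
        (coact V v)"
    and coact_counit: "v \<in> carrier V \<Longrightarrow>
      tensor_lift V (\<lambda>w a. counit A a \<odot>\<^bsub>V\<^esub> w) (coact V v) = v"

definition comodule_hom ::
    "('r, 'x) ring_scheme \<Rightarrow> ('r, 'a, 'y) hopf_scheme \<Rightarrow> ('r, 'a, 'v, 'z) comodule_scheme
      \<Rightarrow> ('r, 'a, 'w, 'q) comodule_scheme \<Rightarrow> ('v \<Rightarrow> 'w) set" where
  "comodule_hom R A V W =
     {f \<in> module_hom R V W. \<forall>v\<in>carrier V.
        coact W (f v) = tensor_lift (tensor R W A) (\<lambda>u a. pure_tensor R W A (f u) a) (coact V v)}"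


section \<open>Base change from the integers to a field\<close>

definition int_algebra :: "('k, 'x) ring_scheme \<Rightarrow> (int, 'k) module" where
  "int_algebra K =
     \<lparr>carrier = carrier K, monoid.mult = monoid.mult K, monoid.one = monoid.one K,
      ring.zero = ring.zero K, ring.add = ring.add K, smult = (\<lambda>n x. [n] \<cdot>\<^bsub>K\<^esub> x)\<rparr>"

definition base_change ::
    "('k, 'x) ring_scheme \<Rightarrow> (int, 'm, 'y) module_scheme \<Rightarrow> ('k, ('m, 'k) tensor) module" where
  "base_change K M =
     (let T = tensor \<Z> M (int_algebra K)
      in \<lparr>carrier = carrier T, monoid.mult = monoid.mult T, monoid.one = monoid.one T,
          ring.zero = ring.zero T, ring.add = ring.add T,
          smult = (\<lambda>c. tensor_lift T (\<lambda>x d. pure_tensor \<Z> M (int_algebra K) x (c \<otimes>\<^bsub>K\<^esub> d)))\<rparr>)"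

abbreviation bc_pure ::
    "('k, 'x) ring_scheme \<Rightarrow> (int, 'm, 'y) module_scheme \<Rightarrow> 'm \<Rightarrow> 'k \<Rightarrow> ('m, 'k) tensor" where
  "bc_pure K M \<equiv> pure_tensor \<Z> M (int_algebra K)"

text \<open>In Sweedler notation the comultiplication of \<open>A \<otimes> K\<close> is
  \<open>a \<otimes> c \<mapsto> \<Sum> (a\<^sub>1 \<otimes> c) \<otimes> (a\<^sub>2 \<otimes> 1)\<close> and the coaction on \<open>M \<otimes> K\<close> is
  \<open>m \<otimes> c \<mapsto> \<Sum> (m\<^sub>0 \<otimes> c) \<otimes> (m\<^sub>1 \<otimes> 1)\<close>, the outer tensor product being over \<open>K\<close>.\<close>

definition base_change_hopf ::
    "('k, 'x) ring_scheme \<Rightarrow> (int, 'a, 'y) hopf_scheme \<Rightarrow> ('k, ('a, 'k) tensor) hopf" where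
  "base_change_hopf K A =
     (let B = base_change K A; T = tensor K B B
      in module.extend B (hopf.fields
           (tensor_lift T (\<lambda>a c. tensor_lift T
              (\<lambda>x y. pure_tensor K B B (bc_pure K A x c) (bc_pure K A y \<one>\<^bsub>K\<^esub>)) (comult A a)))
           (tensor_lift K (\<lambda>a c. [counit A a] \<cdot>\<^bsub>K\<^esub> c))
           (tensor_lift B (\<lambda>a c. bc_pure K A (antipode A a) c))))"

definition base_change_comodule ::
    "('k, 'x) ring_scheme \<Rightarrow> (int, 'a, 'y) hopf_scheme \<Rightarrow> (int, 'a, 'm, 'z) comodule_scheme
      \<Rightarrow> ('k, ('a, 'k) tensor, ('m, 'k) tensor) comodule" where
  "base_change_comodule K A M =
     (let V = base_change K M; B = base_change K A; T = tensor K V B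
      in module.extend V (comodule.fields
           (tensor_lift T (\<lambda>m c. tensor_lift T
              (\<lambda>x a. pure_tensor K V B (bc_pure K M x c) (bc_pure K A a \<one>\<^bsub>K\<^esub>)) (coact M m)))))"


section \<open>Linear categories and first extension groups\<close>

text \<open>Objects and arrows of a category whose hom-sets carry an addition, a zero and a scalar
  action.  Arrows know their domain and codomain; \<open>ccomp C g f\<close> is \<open>g\<close> after \<open>f\<close>.\<close>

record ('s, 'o, 'f) lincat =
  cobj :: "'o set"
  carr :: "'f set"
  cdom :: "'f \<Rightarrow> 'o"
  ccod :: "'f \<Rightarrow> 'o"
  cid :: "'o \<Rightarrow> 'f"
  ccomp :: "'f \<Rightarrow> 'f \<Rightarrow> 'f"
  czero :: "'o \<Rightarrow> 'o \<Rightarrow> 'f"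
  cadd :: "'f \<Rightarrow> 'f \<Rightarrow> 'f"
  cscale :: "'s \<Rightarrow> 'f \<Rightarrow> 'f"

definition chom :: "('s, 'o, 'f) lincat \<Rightarrow> 'o \<Rightarrow> 'o \<Rightarrow> 'f set" where
  "chom C X Y = {f \<in> carr C. cdom C f = X \<and> ccod C f = Y}"

definition is_kernel :: "('s, 'o, 'f) lincat \<Rightarrow> 'f \<Rightarrow> 'f \<Rightarrow> bool" where
  "is_kernel C f g \<longleftrightarrow>
     f \<in> carr C \<and> g \<in> carr C \<and> ccod C f = cdom C g \<and>
     ccomp C g f = czero C (cdom C f) (ccod C g) \<and>
     (\<forall>t\<in>carr C. ccod C t = cdom C g \<and> ccomp C g t = czero C (cdom C t) (ccod C g) \<longrightarrow>
        (\<exists>!u. u \<in> chom C (cdom C t) (cdom C f) \<and> ccomp C f u = t))"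

definition is_cokernel :: "('s, 'o, 'f) lincat \<Rightarrow> 'f \<Rightarrow> 'f \<Rightarrow> bool" where
  "is_cokernel C g f \<longleftrightarrow>
     f \<in> carr C \<and> g \<in> carr C \<and> ccod C f = cdom C g \<and>
     ccomp C g f = czero C (cdom C f) (ccod C g) \<and>
     (\<forall>t\<in>carr C. cdom C t = ccod C f \<and> ccomp C t f = czero C (cdom C f) (ccod C t) \<longrightarrow>
        (\<exists>!u. u \<in> chom C (ccod C g) (ccod C t) \<and> ccomp C u g = t))"

definition is_pullback :: "('s, 'o, 'f) lincat \<Rightarrow> 'f \<Rightarrow> 'f \<Rightarrow> 'f \<Rightarrow> 'f \<Rightarrow> bool" where
  "is_pullback C g h p q \<longleftrightarrow>
     g \<in> carr C \<and> h \<in> carr C \<and> p \<in> carr C \<and> q \<in> carr C \<and>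
     ccod C g = ccod C h \<and> cdom C p = cdom C q \<and> ccod C p = cdom C g \<and> ccod C q = cdom C h \<and>
     ccomp C g p = ccomp C h q \<and>
     (\<forall>s\<in>carr C. \<forall>t\<in>carr C.
        cdom C s = cdom C t \<and> ccod C s = cdom C g \<and> ccod C t = cdom C h \<and>
        ccomp C g s = ccomp C h t \<longrightarrow>
        (\<exists>!u. u \<in> chom C (cdom C s) (cdom C p) \<and> ccomp C p u = s \<and> ccomp C q u = t))"

definition is_iso :: "('s, 'o, 'f) lincat \<Rightarrow> 'f \<Rightarrow> bool" where
  "is_iso C f \<longleftrightarrow> f \<in> carr C \<and>
     (\<exists>g \<in> chom C (ccod C f) (cdom C f).
        ccomp C g f = cid C (cdom C f) \<and> ccomp C f g = cid C (ccod C f))"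

text \<open>A short exact sequence \<open>0 \<rightarrow> N \<rightarrow> X \<rightarrow> M \<rightarrow> 0\<close> is the pair of its two inner arrows
  \<open>(f, g)\<close>; exactness in an abelian category means that \<open>f\<close> is a kernel of \<open>g\<close> and \<open>g\<close> is a
  cokernel of \<open>f\<close>.\<close>

definition extensions :: "('s, 'o, 'f) lincat \<Rightarrow> 'o \<Rightarrow> 'o \<Rightarrow> ('f \<times> 'f) set" where
  "extensions C M N =
     {(f, g). cdom C f = N \<and> ccod C g = M \<and> is_kernel C f g \<and> is_cokernel C g f}"

definition ext_equiv :: "('s, 'o, 'f) lincat \<Rightarrow> 'o \<Rightarrow> 'o \<Rightarrow> (('f \<times> 'f) \<times> ('f \<times> 'f)) set" where
  "ext_equiv C M N =
     {((f, g), (f', g')). (f, g) \<in> extensions C M N \<and> (f', g') \<in> extensions C M N \<and>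
        (\<exists>h \<in> chom C (ccod C f) (ccod C f').
           is_iso C h \<and> ccomp C h f = f' \<and> ccomp C g' h = g)}"

text \<open>Baer sum of \<open>(f1, g1)\<close> and \<open>(f2, g2)\<close>: the quotient of the fibre product
  \<open>X1 \<times>\<^bsub>M\<^esub> X2\<close> by the skew diagonal \<open>s = (f1, -f2)\<close> of \<open>N\<close>, with
  \<open>N\<close> embedded through the first factor.\<close>

definition is_baer_sum ::
    "('s, 'o, 'f) lincat \<Rightarrow> 'o \<Rightarrow> 'o \<Rightarrow> 'f \<times> 'f \<Rightarrow> 'f \<times> 'f \<Rightarrow> 'f \<times> 'f \<Rightarrow> bool" where
  "is_baer_sum C M N E1 E2 E \<longleftrightarrow>
     (case (E1, E2, E) of ((f1, g1), (f2, g2), (f, g)) \<Rightarrow>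
        E1 \<in> extensions C M N \<and> E2 \<in> extensions C M N \<and> E \<in> extensions C M N \<and>
        (\<exists>p1 p2 s j q.
           is_pullback C g1 g2 p1 p2 \<and>
           s \<in> chom C N (cdom C p1) \<and> ccomp C p1 s = f1 \<and>
           cadd C (ccomp C p2 s) f2 = czero C N (ccod C f2) \<and>
           j \<in> chom C N (cdom C p1) \<and> ccomp C p1 j = f1 \<and>
           ccomp C p2 j = czero C N (ccod C f2) \<and>
           is_cokernel C q s \<and> ccod C q = ccod C f \<and>
           ccomp C q j = f \<and> ccomp C g q = ccomp C g1 p1))"

text \<open>The multiple \<open>c E\<close> is the extension, unique up to equivalence, that receives a
  morphism of extensions from \<open>E\<close> that is \<open>c\<close> on \<open>N\<close> and the identity on \<open>M\<close>, i.e. the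
  pushout of \<open>E\<close> along multiplication by \<open>c\<close> on \<open>N\<close>.\<close>

definition is_ext_multiple ::
    "('s, 'o, 'f) lincat \<Rightarrow> 'o \<Rightarrow> 'o \<Rightarrow> 's \<Rightarrow> 'f \<times> 'f \<Rightarrow> 'f \<times> 'f \<Rightarrow> bool" where
  "is_ext_multiple C M N c E E' \<longleftrightarrow>
     (case (E, E') of ((f, g), (f', g')) \<Rightarrow>
        E \<in> extensions C M N \<and> E' \<in> extensions C M N \<and>
        (\<exists>h \<in> chom C (ccod C f) (ccod C f').
           ccomp C h f = ccomp C f' (cscale C c (cid C N)) \<and> ccomp C g' h = g))"

definition Ext1 :: "('s, 'o, 'f) lincat \<Rightarrow> 'o \<Rightarrow> 'o \<Rightarrow> ('s, ('f \<times> 'f) set) module" where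
  "Ext1 C M N =
     \<lparr>carrier = extensions C M N // ext_equiv C M N,
      monoid.mult = undefined, monoid.one = undefined,
      ring.zero = {(f, g) \<in> extensions C M N.
                \<exists>s \<in> chom C M (ccod C f). ccomp C g s = cid C M},
      ring.add = (\<lambda>a b. {E. \<exists>E1\<in>a. \<exists>E2\<in>b. is_baer_sum C M N E1 E2 E}),
      smult = (\<lambda>c a. {E'. \<exists>E\<in>a. is_ext_multiple C M N c E E'})\<rparr>"

definition has_dim :: "('k, 'x) ring_scheme \<Rightarrow> ('k, 'v, 'y) module_scheme \<Rightarrow> nat \<Rightarrow> bool" where
  "has_dim K V n \<longleftrightarrow> vectorspace.fin_dim K V \<and> vectorspace.dim K V = n"


section \<open>Finite dimensional representations\<close>

text \<open>The category of finite dimensional \<open>A\<close>-comodules with carrier contained in the type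
  \<open>'v\<close>.  It represents the full category up to equivalence as soon as \<open>'v\<close> has, for every \<open>n\<close>,
  at least as many elements as \<open>K\<^sup>n\<close>.  This holds for the type of the carrier of
  \<open>base_change K M\<close>, which is infinite and has at least as many elements as \<open>K\<close>.\<close>

type_synonym ('k, 'a, 'v) rep_arrow =
  "('k, 'a, 'v) comodule \<times> ('k, 'a, 'v) comodule \<times> ('v \<Rightarrow> 'v)"

definition rep_objects ::
    "('k, 'x) ring_scheme \<Rightarrow> ('k, 'a, 'y) hopf_scheme \<Rightarrow> ('k, 'a, 'v) comodule set" where
  "rep_objects K A = {V. comodule K A V \<and> vectorspace.fin_dim K V}"

definition rep_cat ::
    "('k, 'x) ring_scheme \<Rightarrow> ('k, 'a, 'y) hopf_scheme
      \<Rightarrow> ('k, ('k, 'a, 'v) comodule, ('k, 'a, 'v) rep_arrow) lincat" where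
  "rep_cat K A =
     \<lparr>cobj = rep_objects K A,
      carr = {(V, W, f). V \<in> rep_objects K A \<and> W \<in> rep_objects K A \<and>
                f \<in> comodule_hom K A V W \<and> f \<in> extensional (carrier V)},
      cdom = (\<lambda>(V, W, f). V),
      ccod = (\<lambda>(V, W, f). W),
      cid = (\<lambda>V. (V, V, \<lambda>v\<in>carrier V. v)),
      ccomp = (\<lambda>(V', W', g) (V, W, f). (V, W', compose (carrier V) g f)),
      czero = (\<lambda>V W. (V, W, \<lambda>v\<in>carrier V. \<zero>\<^bsub>W\<^esub>)),
      cadd = (\<lambda>(V, W, f) (V', W', g). (V, W, \<lambda>v\<in>carrier V. f v \<oplus>\<^bsub>W\<^esub> g v)),
      cscale = (\<lambda>c (V, W, f). (V, W, \<lambda>v\<in>carrier V. c \<odot>\<^bsub>W\<^esub> f v))\<rparr>"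


section \<open>Ultraproducts\<close>

definition nonprincipal_ultrafilter :: "'i filter \<Rightarrow> bool" where
  "nonprincipal_ultrafilter U \<longleftrightarrow>
     U \<noteq> bot \<and> (\<forall>P. eventually P U \<or> eventually (\<lambda>i. \<not> P i) U) \<and> (\<forall>i. U \<noteq> principal {i})"

definition uclass :: "'i filter \<Rightarrow> ('i \<Rightarrow> 'a) \<Rightarrow> ('i \<Rightarrow> 'a) set" where
  "uclass U x = {y. \<forall>\<^sub>F i in U. y i = x i}"

definition uproduct :: "'i filter \<Rightarrow> ('i \<Rightarrow> 'a set) \<Rightarrow> ('i \<Rightarrow> 'a) set set" where
  "uproduct U S = {uclass U x | x. \<forall>i. x i \<in> S i}"

text \<open>Componentwise operations on classes: \<open>[x\<^sub>i] \<mapsto> [F\<^sub>i x\<^sub>i]\<close> and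
  \<open>[x\<^sub>i], [y\<^sub>i] \<mapsto> [F\<^sub>i x\<^sub>i y\<^sub>i]\<close>.\<close>

definition umap :: "'i filter \<Rightarrow> ('i \<Rightarrow> 'a \<Rightarrow> 'b) \<Rightarrow> ('i \<Rightarrow> 'a) set \<Rightarrow> ('i \<Rightarrow> 'b) set" where
  "umap U F X = {z. \<exists>x\<in>X. \<forall>\<^sub>F i in U. z i = F i (x i)}"

definition umap2 :: "'i filter \<Rightarrow> ('i \<Rightarrow> 'a \<Rightarrow> 'b \<Rightarrow> 'c)
      \<Rightarrow> ('i \<Rightarrow> 'a) set \<Rightarrow> ('i \<Rightarrow> 'b) set \<Rightarrow> ('i \<Rightarrow> 'c) set" where
  "umap2 U F X Y = {z. \<exists>x\<in>X. \<exists>y\<in>Y. \<forall>\<^sub>F i in U. z i = F i (x i) (y i)}"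

definition uproduct_ring :: "'i filter \<Rightarrow> ('i \<Rightarrow> 'k ring) \<Rightarrow> ('i \<Rightarrow> 'k) set ring" where
  "uproduct_ring U k =
     \<lparr>carrier = uproduct U (\<lambda>i. carrier (k i)),
      monoid.mult = umap2 U (\<lambda>i. monoid.mult (k i)),
      monoid.one = uclass U (\<lambda>i. monoid.one (k i)),
      ring.zero = uclass U (\<lambda>i. ring.zero (k i)),
      ring.add = umap2 U (\<lambda>i. ring.add (k i))\<rparr>"

definition uproduct_cat :: "'i filter \<Rightarrow> ('i \<Rightarrow> ('s, 'o, 'f) lincat)
      \<Rightarrow> (('i \<Rightarrow> 's) set, ('i \<Rightarrow> 'o) set, ('i \<Rightarrow> 'f) set) lincat" where
  "uproduct_cat U C =
     \<lparr>cobj = uproduct U (\<lambda>i. cobj (C i)),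
      carr = uproduct U (\<lambda>i. carr (C i)),
      cdom = umap U (\<lambda>i. cdom (C i)),
      ccod = umap U (\<lambda>i. ccod (C i)),
      cid = umap U (\<lambda>i. cid (C i)),
      ccomp = umap2 U (\<lambda>i. ccomp (C i)),
      czero = umap2 U (\<lambda>i. czero (C i)),
      cadd = umap2 U (\<lambda>i. cadd (C i)),
      cscale = umap2 U (\<lambda>i. cscale (C i))\<rparr>"

definition full_subcat :: "('s, 'o, 'f) lincat \<Rightarrow> ('o \<Rightarrow> bool) \<Rightarrow> ('s, 'o, 'f) lincat" where
  "full_subcat C P =
     C\<lparr>cobj := {X \<in> cobj C. P X}, carr := {f \<in> carr C. P (cdom C f) \<and> P (ccod C f)}\<rparr>"

definition restricted_uproduct ::
    "'i filter \<Rightarrow> ('i \<Rightarrow> 'k ring) \<Rightarrow> ('i \<Rightarrow> ('k, 'a) hopf)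
      \<Rightarrow> (('i \<Rightarrow> 'k) set, ('i \<Rightarrow> ('k, 'a, 'v) comodule) set, ('i \<Rightarrow> ('k, 'a, 'v) rep_arrow) set) lincat"
  where
  "restricted_uproduct U k A =
     full_subcat (uproduct_cat U (\<lambda>i. rep_cat (k i) (A i)))
       (\<lambda>X. \<exists>x\<in>X. \<exists>b. \<forall>\<^sub>F i in U. vectorspace.dim (k i) (x i) \<le> b)"

end

theory Submission
  imports Defs
begin

text \<open>Over a field \<open>k\<close> an extension of \<open>M\<close> by \<open>N\<close> splits linearly, and a linear splitting records
  the extension as a cocycle \<open>M \<rightarrow> N \<otimes> A\<close>.  Hence the middle object has dimension at most
  \<open>dim M + dim N\<close>, and kernels, cokernels and pullbacks of objects of bounded dimension are the same
  in the full subcategories of objects of dimension at most \<open>b\<close>, for large \<open>b\<close>.  Each such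
  subcategory is subject to the theorem of Los, so extensions, their equivalence, Baer sums and
  multiples in the restricted ultraproduct are those in the components, almost everywhere, and
  \<open>Ext\<^sup>1([M\<^sub>i], [N\<^sub>i])\<close> is the ultraproduct of the spaces \<open>Ext\<^sup>1(M\<^sub>i, N\<^sub>i)\<close>.  It has dimension \<open>n\<close> if and
  only if almost all of these have dimension \<open>n\<close>.  If infinitely many had not, a non-principal
  ultrafilter containing their index set would give a contradiction.\<close>


section \<open>Tensor products over a commutative ring\<close>

text \<open>The restricted ultraproduct is not itself an ultraproduct: each arrow has some bound,
  but a universal property there ranges over all bounds at once, outside the ultrafilter. For one
  fixed bound the test arrows are all tuples and Los applies; the statements obtained for different
  bounds must then be shown to agree. Hence universal properties are turned into conditions on
  elements, in which the ambient subcategory no longer occurs. The test objects are kernels,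
  cokernels and fibre products; the last are the reason why bounds double. Comparing dimensions
  requires that Ext1, defined by existence statements about arrows, is a vector space. Cocycles
  provide this: Baer sum and pushout become pointwise addition and scaling in N \<otimes> A, where
  the axioms are known. Dimension enters as generation by n vectors, a form that passes through an
  ultrafilter. All objects have carriers in one fixed type. So subobjects and quotients are images
  of idempotents, and direct sums are coded by an injection of pairs.\<close>

definition frag_sum :: "('p, 'x) ring_scheme \<Rightarrow> ('z \<Rightarrow> 'p) \<Rightarrow> ('z \<Rightarrow>\<^sub>0 int) \<Rightarrow> 'p" where
  "frag_sum P b c = (\<Oplus>\<^bsub>P\<^esub>z\<in>Poly_Mapping.keys c. [Poly_Mapping.lookup c z] \<cdot>\<^bsub>P\<^esub> b z)"

lemma add_pow_zero_int [simp]: "[(0::int)] \<cdot>\<^bsub>P\<^esub> x = \<zero>\<^bsub>P\<^esub>"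
  by (simp add: add_pow_def)

text \<open>Terms outside the support have coefficient 0, so the sum may run over any larger finite
  set. This lets two formal combinations be summed over a common index set.\<close>

lemma (in abelian_group) frag_sum_superset:
  assumes "finite F" "Poly_Mapping.keys c \<subseteq> F" "F \<subseteq> S" "b \<in> S \<rightarrow> carrier G"
  shows "frag_sum G b c = (\<Oplus>z\<in>F. [Poly_Mapping.lookup c z] \<cdot> b z)"
  unfolding frag_sum_def
  by (rule add.finprod_mono_neutral_cong_left)
    (use assms in \<open>auto simp: Pi_def in_keys_iff subset_iff\<close>)

lemma (in abelian_group) frag_sum_hom:
  fixes b :: "'z \<Rightarrow> 'a"
  assumes "b \<in> S \<rightarrow> carrier G"
  shows "frag_sum G b \<in> hom (free_Abelian_group S) (add_monoid G)"
proof (rule homI; simp)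
  fix c :: "'z \<Rightarrow>\<^sub>0 int" assume c: "Poly_Mapping.keys c \<subseteq> S"
  show "frag_sum G b c \<in> carrier G"
    unfolding frag_sum_def using assms c by (intro finsum_closed) auto
next
  fix c d :: "'z \<Rightarrow>\<^sub>0 int" assume c: "Poly_Mapping.keys c \<subseteq> S" and d: "Poly_Mapping.keys d \<subseteq> S"
  let ?F = "Poly_Mapping.keys c \<union> Poly_Mapping.keys d"
  have F: "finite ?F" "?F \<subseteq> S" using c d by auto
  \<comment> \<open>Coefficients may cancel in \<open>c + d\<close>, so all three sums are taken
    over the union of the two supports.\<close>
  have "frag_sum G b (c + d) = (\<Oplus>z\<in>?F. [Poly_Mapping.lookup (c + d) z] \<cdot> b z)"
    by (rule frag_sum_superset) (use F keys_add[of c d] assms in auto)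
  also have "\<dots> = (\<Oplus>z\<in>?F. [Poly_Mapping.lookup c z] \<cdot> b z \<oplus> [Poly_Mapping.lookup d z] \<cdot> b z)"
    by (rule finsum_cong') (use F assms in \<open>auto simp: lookup_add add.int_pow_mult Pi_def\<close>)
  also have "\<dots> = (\<Oplus>z\<in>?F. [Poly_Mapping.lookup c z] \<cdot> b z) \<oplus> (\<Oplus>z\<in>?F. [Poly_Mapping.lookup d z] \<cdot> b z)"
    by (rule finsum_addf) (use F assms in \<open>auto simp: Pi_def subset_iff\<close>)
  also have "\<dots> = frag_sum G b c \<oplus> frag_sum G b d"
    using frag_sum_superset[of ?F c S b] frag_sum_superset[of ?F d S b] F assms by auto
  finally show "frag_sum G b (c + d) = frag_sum G b c \<oplus> frag_sum G b d" .
qed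

lemma (in abelian_group) frag_sum_of [simp]:
  "b z \<in> carrier G \<Longrightarrow> frag_sum G b (frag_of z) = b z"
  unfolding frag_sum_def by (simp add: finsum_insert[of "{}", simplified] lookup_frag_of)

text \<open>The target is only an abelian group, not an \<open>R\<close>-module. Base change needs
  this generality: there the tensor product is over the integers and the target is a module over the
  field.\<close>

definition balanced :: "('r, 'x) ring_scheme \<Rightarrow> ('r, 'm, 'y) module_scheme \<Rightarrow> ('r, 'n, 'z) module_scheme
    \<Rightarrow> ('p, 'q) ring_scheme \<Rightarrow> ('m \<Rightarrow> 'n \<Rightarrow> 'p) \<Rightarrow> bool" where
  "balanced R M N P b \<longleftrightarrow>
     (\<forall>x\<in>carrier M. \<forall>y\<in>carrier N. b x y \<in> carrier P) \<and>
     (\<forall>x\<in>carrier M. \<forall>x'\<in>carrier M. \<forall>y\<in>carrier N. b (x \<oplus>\<^bsub>M\<^esub> x') y = b x y \<oplus>\<^bsub>P\<^esub> b x' y) \<and>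
     (\<forall>x\<in>carrier M. \<forall>y\<in>carrier N. \<forall>y'\<in>carrier N. b x (y \<oplus>\<^bsub>N\<^esub> y') = b x y \<oplus>\<^bsub>P\<^esub> b x y') \<and>
     (\<forall>r\<in>carrier R. \<forall>x\<in>carrier M. \<forall>y\<in>carrier N. b (r \<odot>\<^bsub>M\<^esub> x) y = b x (r \<odot>\<^bsub>N\<^esub> y))"

lemma balancedI:
  assumes "\<And>x y. x \<in> carrier M \<Longrightarrow> y \<in> carrier N \<Longrightarrow> b x y \<in> carrier P"
    and "\<And>x x' y. x \<in> carrier M \<Longrightarrow> x' \<in> carrier M \<Longrightarrow> y \<in> carrier N \<Longrightarrow>
      b (x \<oplus>\<^bsub>M\<^esub> x') y = b x y \<oplus>\<^bsub>P\<^esub> b x' y"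
    and "\<And>x y y'. x \<in> carrier M \<Longrightarrow> y \<in> carrier N \<Longrightarrow> y' \<in> carrier N \<Longrightarrow>
      b x (y \<oplus>\<^bsub>N\<^esub> y') = b x y \<oplus>\<^bsub>P\<^esub> b x y'"
    and "\<And>r x y. r \<in> carrier R \<Longrightarrow> x \<in> carrier M \<Longrightarrow> y \<in> carrier N \<Longrightarrow>
      b (r \<odot>\<^bsub>M\<^esub> x) y = b x (r \<odot>\<^bsub>N\<^esub> y)"
  shows "balanced R M N P b"
  using assms unfolding balanced_def by blast

locale two_modules = M: module R M + N: module R N
  for R (structure) and M :: "('r, 'm, 'y) module_scheme" and N :: "('r, 'n, 'z) module_scheme"
begin

abbreviation "FA \<equiv> free_Abelian_group (carrier M \<times> carrier N)"
abbreviation "T \<equiv> tensor R M N"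
abbreviation tpure (infixl "\<otimes>\<^sub>t" 70) where "x \<otimes>\<^sub>t y \<equiv> pure_tensor R M N x y"

lemma FA_group: "group FA" by simp

lemma tensor_rels_subset: "tensor_rels R M N \<subseteq> carrier FA"
  unfolding tensor_rels_def
  by (auto intro!: subset_trans[OF keys_diff] subset_trans[OF keys_add] dest!: subsetD[OF keys_diff])

lemma tensor_null_normal: "tensor_null R M N \<lhd> FA"
  unfolding tensor_null_def
  by (intro comm_group.subgroup_imp_normal abelian_free_Abelian_group
      group.generate_is_subgroup FA_group tensor_rels_subset)

lemma tensor_quotient: "comm_group (FA Mod tensor_null R M N)"
  by (intro comm_group.abelian_FactGroup abelian_free_Abelian_group normal_imp_subgroup tensor_null_normal)

lemma tensor_simps:
  "carrier T = carrier (FA Mod tensor_null R M N)"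
  "\<zero>\<^bsub>T\<^esub> = \<one>\<^bsub>FA Mod tensor_null R M N\<^esub>"
  "x \<oplus>\<^bsub>T\<^esub> y = x \<otimes>\<^bsub>FA Mod tensor_null R M N\<^esub> y"
  "carrier (tensor_group R M N) = carrier (FA Mod tensor_null R M N)"
  "\<zero>\<^bsub>tensor_group R M N\<^esub> = \<one>\<^bsub>FA Mod tensor_null R M N\<^esub>"
  "x \<oplus>\<^bsub>tensor_group R M N\<^esub> y = x \<otimes>\<^bsub>FA Mod tensor_null R M N\<^esub> y"
  unfolding tensor_def tensor_group_def by (simp_all add: Let_def)

text \<open>\<open>tensor_group\<close> is treated next to \<open>tensor\<close> because the scalar
  action on the tensor product is itself defined by a lift into \<open>tensor_group\<close>, which
  must be an abelian group before that action can be evaluated.\<close>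

lemma tensor_abelian_group: "abelian_group T" "abelian_group (tensor_group R M N)"
proof -
  interpret Q: comm_group "FA Mod tensor_null R M N" by (rule tensor_quotient)
  have comm: "x \<otimes>\<^bsub>FA Mod tensor_null R M N\<^esub> y = y \<otimes>\<^bsub>FA Mod tensor_null R M N\<^esub> x"
    if "x \<in> carrier (FA Mod tensor_null R M N)" "y \<in> carrier (FA Mod tensor_null R M N)" for x y
    using that by (rule Q.m_comm)
  show "abelian_group T"
    by (rule abelian_groupI) (auto simp: tensor_simps Q.m_assoc simp del: mult_FactGroup one_FactGroup intro: Q.l_inv_ex dest: comm)
  show "abelian_group (tensor_group R M N)"
    by (rule abelian_groupI) (auto simp: tensor_simps Q.m_assoc simp del: mult_FactGroup one_FactGroup intro: Q.l_inv_ex dest: comm)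
qed

sublocale T: abelian_group T by (rule tensor_abelian_group)

abbreviation "coset_map c \<equiv> tensor_null R M N #>\<^bsub>FA\<^esub> c"

lemma coset_map_hom: "coset_map \<in> hom FA (add_monoid T)"
proof -
  interpret normal "tensor_null R M N" FA by (rule tensor_null_normal)
  show ?thesis using r_coset_hom_Mod by (auto simp: hom_def tensor_simps)
qed

lemma carrier_tensor: "carrier T = coset_map ` carrier FA"
  by (auto simp: tensor_simps FactGroup_def RCOSETS_def)

lemma pure_closed [simp, intro]: "x \<in> carrier M \<Longrightarrow> y \<in> carrier N \<Longrightarrow> x \<otimes>\<^sub>t y \<in> carrier T"
  unfolding pure_tensor_def carrier_tensor by (rule imageI) simp

lemma coset_map_add:
  "c \<in> carrier FA \<Longrightarrow> d \<in> carrier FA \<Longrightarrow> coset_map (c + d) = coset_map c \<oplus>\<^bsub>T\<^esub> coset_map d"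
  using hom_mult[OF coset_map_hom, of c d] by simp

lemma coset_map_null: "c \<in> tensor_null R M N \<Longrightarrow> coset_map c = \<zero>\<^bsub>T\<^esub>"
  using group.coset_join2[of FA c "tensor_null R M N"] tensor_null_normal
    subgroup.subset[OF normal_imp_subgroup[OF tensor_null_normal]]
  by (auto simp: tensor_simps normal_imp_subgroup)

lemma coset_map_rel:
  assumes "c - d \<in> tensor_rels R M N" "d \<in> carrier FA"
  shows "coset_map c = coset_map d"
proof -
  have r: "c - d \<in> tensor_null R M N"
    unfolding tensor_null_def by (rule generate.incl) (rule assms)
  then have rc: "c - d \<in> carrier FA"
    using subgroup.subset[OF normal_imp_subgroup[OF tensor_null_normal]] by blast
  have "coset_map c = coset_map ((c - d) + d)" by simp
  also have "\<dots> = \<zero>\<^bsub>T\<^esub> \<oplus>\<^bsub>T\<^esub> coset_map d"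
    using coset_map_add[OF rc assms(2)] coset_map_null[OF r] by simp
  also have "\<dots> = coset_map d" using assms(2) by (intro T.l_zero) (auto simp: carrier_tensor)
  finally show ?thesis .
qed

lemma frag_of_FA [simp]: "x \<in> carrier M \<Longrightarrow> y \<in> carrier N \<Longrightarrow> frag_of (x, y) \<in> carrier FA"
  by simp

lemma pure_add_left:
  assumes "x \<in> carrier M" "x' \<in> carrier M" "y \<in> carrier N"
  shows "(x \<oplus>\<^bsub>M\<^esub> x') \<otimes>\<^sub>t y = x \<otimes>\<^sub>t y \<oplus>\<^bsub>T\<^esub> x' \<otimes>\<^sub>t y"
proof -
  have "coset_map (frag_of (x \<oplus>\<^bsub>M\<^esub> x', y)) = coset_map (frag_of (x, y) + frag_of (x', y))"
    by (rule coset_map_rel)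
      (use assms monoid.m_closed[OF group.is_monoid[OF FA_group], of "frag_of (x, y)" "frag_of (x', y)"]
       in \<open>auto simp: tensor_rels_def diff_diff_add simp del: carrier_free_Abelian_group_iff\<close>)
  then show ?thesis unfolding pure_tensor_def using assms coset_map_add[of "frag_of (x, y)" "frag_of (x', y)"]
    by simp
qed

lemma pure_add_right:
  assumes "x \<in> carrier M" "y \<in> carrier N" "y' \<in> carrier N"
  shows "x \<otimes>\<^sub>t (y \<oplus>\<^bsub>N\<^esub> y') = x \<otimes>\<^sub>t y \<oplus>\<^bsub>T\<^esub> x \<otimes>\<^sub>t y'"
proof -
  have "coset_map (frag_of (x, y \<oplus>\<^bsub>N\<^esub> y')) = coset_map (frag_of (x, y) + frag_of (x, y'))"
    by (rule coset_map_rel)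
      (use assms monoid.m_closed[OF group.is_monoid[OF FA_group], of "frag_of (x, y)" "frag_of (x, y')"]
       in \<open>auto simp: tensor_rels_def diff_diff_add simp del: carrier_free_Abelian_group_iff\<close>)
  then show ?thesis unfolding pure_tensor_def using assms coset_map_add[of "frag_of (x, y)" "frag_of (x, y')"]
    by simp
qed

lemma pure_balanced:
  assumes "r \<in> carrier R" "x \<in> carrier M" "y \<in> carrier N"
  shows "(r \<odot>\<^bsub>M\<^esub> x) \<otimes>\<^sub>t y = x \<otimes>\<^sub>t (r \<odot>\<^bsub>N\<^esub> y)"
  unfolding pure_tensor_def by (rule coset_map_rel) (use assms in \<open>auto simp: tensor_rels_def\<close>)

lemma pure_zero_left: "y \<in> carrier N \<Longrightarrow> \<zero>\<^bsub>M\<^esub> \<otimes>\<^sub>t y = \<zero>\<^bsub>T\<^esub>"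
  using pure_add_left[of "\<zero>\<^bsub>M\<^esub>" "\<zero>\<^bsub>M\<^esub>" y] by (auto intro: T.add.l_cancel_one[THEN iffD1, OF _ _ sym])

lemma pure_minus_left:
  assumes "x \<in> carrier M" "y \<in> carrier N"
  shows "\<ominus>\<^bsub>T\<^esub> (x \<otimes>\<^sub>t y) = (\<ominus>\<^bsub>M\<^esub> x) \<otimes>\<^sub>t y"
  using pure_add_left[of "\<ominus>\<^bsub>M\<^esub> x" x y] assms pure_zero_left
  by (intro T.minus_equality) (auto simp: M.M.l_neg)

lemma coset_map_uminus: "c \<in> carrier FA \<Longrightarrow> coset_map (- c) = \<ominus>\<^bsub>T\<^esub> coset_map c"
  using coset_map_add[of "- c" c] coset_map_null[of 0] carrier_tensor
    subgroup.one_closed[OF normal_imp_subgroup[OF tensor_null_normal]]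
  by (intro T.minus_equality[symmetric]) auto

text \<open>Sums of pure tensors suffice, without negatives, since a sign can be moved into the left
  factor of a pure tensor.\<close>

lemma tensor_induct [consumes 1, case_names pure add]:
  assumes "t \<in> carrier T"
    and pure: "\<And>x y. x \<in> carrier M \<Longrightarrow> y \<in> carrier N \<Longrightarrow> P (x \<otimes>\<^sub>t y)"
    and add: "\<And>s t. s \<in> carrier T \<Longrightarrow> t \<in> carrier T \<Longrightarrow> P s \<Longrightarrow> P t \<Longrightarrow> P (s \<oplus>\<^bsub>T\<^esub> t)"
  shows "P t"
proof -
  obtain c where c: "c \<in> carrier FA" "t = coset_map c" using assms(1) carrier_tensor by auto
  have cl: "coset_map c \<in> carrier T" if "c \<in> carrier FA" for c
    using that by (auto simp: carrier_tensor)
  from c(1) have "Poly_Mapping.keys c \<subseteq> carrier M \<times> carrier N" by simp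
  \<comment> \<open>The induction rule for free abelian groups closes under differences, so the
    claim is carried for a combination and its negative together.\<close>
  then have "P (coset_map c) \<and> P (coset_map (- c))"
  proof (induction c rule: free_Abelian_group_induct[consumes 1, case_names zero diff one])
    case zero
    show ?case
      using pure[of "\<zero>\<^bsub>M\<^esub>" "\<zero>\<^bsub>N\<^esub>"] coset_map_null[of 0] pure_zero_left[of "\<zero>\<^bsub>N\<^esub>"]
        subgroup.one_closed[OF normal_imp_subgroup[OF tensor_null_normal]]
      by simp
  next
    case (diff x y)
    have "coset_map (x - y) = coset_map x \<oplus>\<^bsub>T\<^esub> coset_map (- y)"
         "coset_map (- (x - y)) = coset_map (- x) \<oplus>\<^bsub>T\<^esub> coset_map y"
      using coset_map_add[of x "- y"] coset_map_add[of "- x" y] diff by auto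
    then show ?case using diff by (auto intro!: add cl)
  next
    case (one a)
    obtain x y where a: "a = (x, y)" "x \<in> carrier M" "y \<in> carrier N" using one by auto
    then show ?case using pure[of x y] pure[of "\<ominus>\<^bsub>M\<^esub> x" y] pure_minus_left[of x y]
      coset_map_uminus[of "frag_of (x, y)"]
      by (simp add: pure_tensor_def)
  qed
  then show ?thesis using c by simp
qed

text \<open>The additive extension \<open>F\<close> of \<open>b\<close> to formal combinations
  vanishes on the defining relations, because \<open>b\<close> is balanced, and therefore on the
  subgroup they generate. So it is constant on cosets, and the representative chosen in
  \<open>tensor_lift\<close> does not matter.\<close>

lemma tensor_lift:
  fixes P :: "('p, 'q) ring_scheme"
  assumes "abelian_group P" and b: "balanced R M N P b"
  shows tensor_lift_pure: "\<And>x y. x \<in> carrier M \<Longrightarrow> y \<in> carrier N \<Longrightarrow> tensor_lift P b (x \<otimes>\<^sub>t y) = b x y"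
    and tensor_lift_closed: "\<And>t. t \<in> carrier T \<Longrightarrow> tensor_lift P b t \<in> carrier P"
    and tensor_lift_add: "\<And>s t. s \<in> carrier T \<Longrightarrow> t \<in> carrier T \<Longrightarrow>
      tensor_lift P b (s \<oplus>\<^bsub>T\<^esub> t) = tensor_lift P b s \<oplus>\<^bsub>P\<^esub> tensor_lift P b t"
proof -
  interpret P: abelian_group P by fact
  interpret nml: normal "tensor_null R M N" FA by (rule tensor_null_normal)
  define F where "F = frag_sum P (\<lambda>z. b (fst z) (snd z))"
  have "(\<lambda>z. b (fst z) (snd z)) \<in> carrier M \<times> carrier N \<rightarrow> carrier P"
    using b by (auto simp: balanced_def)
  then have Fhom: "F \<in> hom FA (add_monoid P)"
    unfolding F_def by (rule P.frag_sum_hom)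
  interpret F: group_hom FA "add_monoid P" F
    using Fhom by (auto simp: group_hom_def group_hom_axioms_def P.add.is_group)
  have F_of: "F (frag_of (x, y)) = b x y" if "x \<in> carrier M" "y \<in> carrier N" for x y
    unfolding F_def using that b by (subst P.frag_sum_of) (auto simp: balanced_def)
  have Fadd: "F (c + d) = F c \<oplus>\<^bsub>P\<^esub> F d" if "c \<in> carrier FA" "d \<in> carrier FA" for c d
    using F.hom_mult[of c d] that by simp
  have Fcl: "F c \<in> carrier P" if "c \<in> carrier FA" for c
    using F.hom_closed[of c] that by simp
  have Fdiff: "F (c - d) = F c \<ominus>\<^bsub>P\<^esub> F d" if "c \<in> carrier FA" "d \<in> carrier FA" for c d
    using F.hom_mult[of c "- d"] F.hom_inv[of d] that by (simp add: a_minus_def a_inv_def)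
  have clFA: "c - d \<in> carrier FA" if "c \<in> carrier FA" "d \<in> carrier FA" for c d
    using that keys_diff[of c d] by auto
  have rel0: "F c = \<zero>\<^bsub>P\<^esub>" if "c \<in> tensor_rels R M N" for c
  proof -
    have aux: "(u \<oplus>\<^bsub>P\<^esub> v) \<ominus>\<^bsub>P\<^esub> u \<ominus>\<^bsub>P\<^esub> v = \<zero>\<^bsub>P\<^esub>" if "u \<in> carrier P" "v \<in> carrier P" for u v
      using that by (simp add: P.minus_eq P.a_assoc P.a_lcomm[of u] P.r_neg P.r_neg1)
    show ?thesis
      using that b unfolding tensor_rels_def balanced_def
      by (auto simp: Fdiff clFA F_of aux P.r_neg P.minus_eq[of "b _ _" "b _ _"]
        simp del: carrier_free_Abelian_group_iff)
  qed
  have "tensor_null R M N \<subseteq> kernel FA (add_monoid P) F"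
    unfolding tensor_null_def
    by (rule group.generate_subgroup_incl[OF FA_group _ F.subgroup_kernel])
      (use rel0 tensor_rels_subset in \<open>auto simp: kernel_def simp del: carrier_free_Abelian_group_iff\<close>)
  then have null0: "F c = \<zero>\<^bsub>P\<^esub>" if "c \<in> tensor_null R M N" for c
    using that by (auto simp: kernel_def)
  have lift: "tensor_lift P b (coset_map c) = F c" if c: "c \<in> carrier FA" for c
  proof -
    \<comment> \<open>The chosen representative differs from \<open>c\<close> by an element of
      \<open>tensor_null\<close>, which \<open>F\<close> kills.\<close>
    have "c \<in> coset_map c" using c nml.rcos_self[of c] nml.subgroup_axioms by blast
    then have "(SOME d. d \<in> coset_map c) \<in> coset_map c" by (rule someI)
    then obtain n where n: "n \<in> tensor_null R M N" "(SOME d. d \<in> coset_map c) = n + c"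
      by (auto simp: r_coset_def)
    moreover have "n \<in> carrier FA" using n nml.subset by blast
    ultimately have "F (SOME d. d \<in> coset_map c) = F c" using null0 Fadd[of n c] Fcl c by simp
    then show ?thesis unfolding tensor_lift_def Let_def F_def frag_sum_def .
  qed
  show "tensor_lift P b (x \<otimes>\<^sub>t y) = b x y" if "x \<in> carrier M" "y \<in> carrier N" for x y
    using lift[of "frag_of (x, y)"] F_of that by (simp add: pure_tensor_def)
  show "tensor_lift P b t \<in> carrier P" if "t \<in> carrier T" for t
    using that lift Fcl by (auto simp: carrier_tensor)
  show "tensor_lift P b (s \<oplus>\<^bsub>T\<^esub> t) = tensor_lift P b s \<oplus>\<^bsub>P\<^esub> tensor_lift P b t"
    if st: "s \<in> carrier T" "t \<in> carrier T" for s t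
  proof -
    obtain c d where c: "c \<in> carrier FA" "s = coset_map c" "d \<in> carrier FA" "t = coset_map d"
      using st carrier_tensor by auto
    moreover have "c + d \<in> carrier FA" using c keys_add[of c d] by auto
    ultimately show ?thesis
      using coset_map_add[of c d] lift[of "c + d"] lift[of c] lift[of d] Fadd[of c d] by simp
  qed
qed

text \<open>The properties of the scalar action on the tensor product stand among the premises
  because they are themselves obtained from lifts, further down; \<open>lift_hom\<close> is the form
  with these premises discharged.\<close>

lemma tensor_lift_hom:
  assumes "module R P" "balanced R M N P b"
    and "\<And>r x y. r \<in> carrier R \<Longrightarrow> x \<in> carrier M \<Longrightarrow> y \<in> carrier N \<Longrightarrow>
      b (r \<odot>\<^bsub>M\<^esub> x) y = r \<odot>\<^bsub>P\<^esub> b x y"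
    and smult_pure: "\<And>r x y. r \<in> carrier R \<Longrightarrow> x \<in> carrier M \<Longrightarrow> y \<in> carrier N \<Longrightarrow>
      r \<odot>\<^bsub>T\<^esub> (x \<otimes>\<^sub>t y) = (r \<odot>\<^bsub>M\<^esub> x) \<otimes>\<^sub>t y"
    and smult_closed: "\<And>r t. r \<in> carrier R \<Longrightarrow> t \<in> carrier T \<Longrightarrow> r \<odot>\<^bsub>T\<^esub> t \<in> carrier T"
    and smult_add: "\<And>r s t. r \<in> carrier R \<Longrightarrow> s \<in> carrier T \<Longrightarrow> t \<in> carrier T \<Longrightarrow>
      r \<odot>\<^bsub>T\<^esub> (s \<oplus>\<^bsub>T\<^esub> t) = r \<odot>\<^bsub>T\<^esub> s \<oplus>\<^bsub>T\<^esub> r \<odot>\<^bsub>T\<^esub> t"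
  shows "tensor_lift P b \<in> module_hom R T P"
proof -
  interpret P: module R P by fact
  note L = tensor_lift[OF P.abelian_group_axioms assms(2)]
  have "tensor_lift P b (r \<odot>\<^bsub>T\<^esub> t) = r \<odot>\<^bsub>P\<^esub> tensor_lift P b t"
    if r: "r \<in> carrier R" and "t \<in> carrier T" for r t
    using that(2)
  proof (induction t rule: tensor_induct)
    case (pure x y)
    then show ?case using r assms(3) by (simp add: smult_pure L(1))
  next
    case (add s t)
    then show ?case using r by (simp add: smult_add smult_closed L P.smult_r_distr)
  qed
  then show ?thesis using L by (auto simp: module_hom_def)
qed

text \<open>Balancing rests on the commutativity of the ring: \<open>r\<close> already acts on the
  left factor, and the scalar to be moved must be brought past it.\<close>

lemma smult_balanced:
  assumes "r \<in> carrier R"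
  shows "balanced R M N (tensor_group R M N) (\<lambda>x y. (r \<odot>\<^bsub>M\<^esub> x) \<otimes>\<^sub>t y)"
proof (rule balancedI)
  fix x x' y assume "x \<in> carrier M" "x' \<in> carrier M" "y \<in> carrier N"
  then show "(r \<odot>\<^bsub>M\<^esub> (x \<oplus>\<^bsub>M\<^esub> x')) \<otimes>\<^sub>t y =
      (r \<odot>\<^bsub>M\<^esub> x) \<otimes>\<^sub>t y \<oplus>\<^bsub>tensor_group R M N\<^esub> (r \<odot>\<^bsub>M\<^esub> x') \<otimes>\<^sub>t y"
    using pure_add_left[of "r \<odot>\<^bsub>M\<^esub> x" "r \<odot>\<^bsub>M\<^esub> x'" y] assms
    by (simp only: tensor_simps M.smult_r_distr M.smult_closed)
next
  fix x y y' assume "x \<in> carrier M" "y \<in> carrier N" "y' \<in> carrier N"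
  then show "(r \<odot>\<^bsub>M\<^esub> x) \<otimes>\<^sub>t (y \<oplus>\<^bsub>N\<^esub> y') =
      (r \<odot>\<^bsub>M\<^esub> x) \<otimes>\<^sub>t y \<oplus>\<^bsub>tensor_group R M N\<^esub> (r \<odot>\<^bsub>M\<^esub> x) \<otimes>\<^sub>t y'"
    using pure_add_right[of "r \<odot>\<^bsub>M\<^esub> x" y y'] assms by (simp only: tensor_simps M.smult_closed)
next
  fix s x y assume *: "s \<in> carrier R" "x \<in> carrier M" "y \<in> carrier N"
  have "r \<odot>\<^bsub>M\<^esub> (s \<odot>\<^bsub>M\<^esub> x) = s \<odot>\<^bsub>M\<^esub> (r \<odot>\<^bsub>M\<^esub> x)"
    using * assms by (metis M.R.m_comm M.smult_assoc1)
  then show "(r \<odot>\<^bsub>M\<^esub> (s \<odot>\<^bsub>M\<^esub> x)) \<otimes>\<^sub>t y = (r \<odot>\<^bsub>M\<^esub> x) \<otimes>\<^sub>t (s \<odot>\<^bsub>N\<^esub> y)"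
    using pure_balanced[of s "r \<odot>\<^bsub>M\<^esub> x" y] * assms by simp
next
  fix x y assume *: "x \<in> carrier M" "y \<in> carrier N"
  then show "(r \<odot>\<^bsub>M\<^esub> x) \<otimes>\<^sub>t y \<in> carrier (tensor_group R M N)"
    using pure_closed[of "r \<odot>\<^bsub>M\<^esub> x" y] assms by (simp only: tensor_simps M.smult_closed)
qed

lemma smult_tensor_eq: "r \<odot>\<^bsub>T\<^esub> t = tensor_lift (tensor_group R M N) (\<lambda>x y. (r \<odot>\<^bsub>M\<^esub> x) \<otimes>\<^sub>t y) t"
  by (simp add: tensor_def Let_def)

lemma smult_pure [simp]:
  assumes "r \<in> carrier R" "x \<in> carrier M" "y \<in> carrier N"
  shows "r \<odot>\<^bsub>T\<^esub> (x \<otimes>\<^sub>t y) = (r \<odot>\<^bsub>M\<^esub> x) \<otimes>\<^sub>t y"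
  unfolding smult_tensor_eq
  by (rule tensor_lift_pure[OF tensor_abelian_group(2) smult_balanced]) (use assms in auto)

lemma smult_tensor_closed:
  assumes "r \<in> carrier R" "t \<in> carrier T"
  shows "r \<odot>\<^bsub>T\<^esub> t \<in> carrier T"
  using tensor_lift_closed[OF tensor_abelian_group(2) smult_balanced[OF assms(1)] assms(2)]
  unfolding smult_tensor_eq by (simp only: tensor_simps)

lemma smult_tensor_add:
  assumes "r \<in> carrier R" "s \<in> carrier T" "t \<in> carrier T"
  shows "r \<odot>\<^bsub>T\<^esub> (s \<oplus>\<^bsub>T\<^esub> t) = r \<odot>\<^bsub>T\<^esub> s \<oplus>\<^bsub>T\<^esub> r \<odot>\<^bsub>T\<^esub> t"
  using tensor_lift_add[OF tensor_abelian_group(2) smult_balanced[OF assms(1)] assms(2,3)]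
  unfolding smult_tensor_eq by (simp only: tensor_simps)

text \<open>Each module axiom is additive in the tensor, so it reduces to pure tensors, where it is
  the corresponding axiom for the left factor.\<close>

lemma tensor_module: "module R T"
proof (rule moduleI)
  show "cring R" by (rule M.is_cring)
  show "abelian_group T" by (rule tensor_abelian_group)
  show "(a \<oplus> b) \<odot>\<^bsub>T\<^esub> t = a \<odot>\<^bsub>T\<^esub> t \<oplus>\<^bsub>T\<^esub> b \<odot>\<^bsub>T\<^esub> t"
    if ab: "a \<in> carrier R" "b \<in> carrier R" and t: "t \<in> carrier T" for a b t
    using t
  proof (induction t rule: tensor_induct)
    case (add s t)
    have "(x \<oplus>\<^bsub>T\<^esub> y) \<oplus>\<^bsub>T\<^esub> (z \<oplus>\<^bsub>T\<^esub> w) = (x \<oplus>\<^bsub>T\<^esub> z) \<oplus>\<^bsub>T\<^esub> (y \<oplus>\<^bsub>T\<^esub> w)"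
      if "x \<in> carrier T" "y \<in> carrier T" "z \<in> carrier T" "w \<in> carrier T" for x y z w
      using that by (simp add: T.a_ac)
    then show ?case using add ab by (simp add: smult_tensor_add smult_tensor_closed)
  qed (use ab in \<open>simp add: M.smult_l_distr pure_add_left\<close>)
  show "(a \<otimes> b) \<odot>\<^bsub>T\<^esub> t = a \<odot>\<^bsub>T\<^esub> (b \<odot>\<^bsub>T\<^esub> t)"
    if ab: "a \<in> carrier R" "b \<in> carrier R" and t: "t \<in> carrier T" for a b t
    using t by (induction t rule: tensor_induct)
      (use ab in \<open>simp_all add: M.smult_assoc1 smult_tensor_add smult_tensor_closed\<close>)
  show "\<one> \<odot>\<^bsub>T\<^esub> t = t" if t: "t \<in> carrier T" for t
    using t by (induction t rule: tensor_induct) (simp_all add: smult_tensor_add)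
qed (simp_all add: smult_tensor_add smult_tensor_closed)

sublocale T: module R T by (rule tensor_module)

lemmas lift_hom = tensor_lift_hom[OF _ _ _ smult_pure smult_tensor_closed smult_tensor_add]

end

section \<open>Linear maps and functoriality of the tensor product\<close>

lemma module_homI:
  assumes "\<And>x. x \<in> carrier M \<Longrightarrow> f x \<in> carrier N"
    and "\<And>x y. x \<in> carrier M \<Longrightarrow> y \<in> carrier M \<Longrightarrow> f (x \<oplus>\<^bsub>M\<^esub> y) = f x \<oplus>\<^bsub>N\<^esub> f y"
    and "\<And>r x. r \<in> carrier R \<Longrightarrow> x \<in> carrier M \<Longrightarrow> f (r \<odot>\<^bsub>M\<^esub> x) = r \<odot>\<^bsub>N\<^esub> f x"
  shows "f \<in> module_hom R M N"
  using assms unfolding module_hom_def by auto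

lemma module_hom_carrier: "f \<in> module_hom R M N \<Longrightarrow> x \<in> carrier M \<Longrightarrow> f x \<in> carrier N"
  unfolding module_hom_def by auto

lemmas module_hom_simps = module_hom_carrier module_hom_add module_hom_smult

lemma module_hom_zero:
  assumes "module R M" "module R N" "f \<in> module_hom R M N"
  shows "f \<zero>\<^bsub>M\<^esub> = \<zero>\<^bsub>N\<^esub>"
proof -
  interpret M: module R M by fact
  interpret N: module R N by fact
  have "f (\<zero>\<^bsub>R\<^esub> \<odot>\<^bsub>M\<^esub> \<zero>\<^bsub>M\<^esub>) = \<zero>\<^bsub>R\<^esub> \<odot>\<^bsub>N\<^esub> f \<zero>\<^bsub>M\<^esub>"
    using assms(3) by (intro module_hom_smult) auto
  then show ?thesis using module_hom_carrier[OF assms(3), of "\<zero>\<^bsub>M\<^esub>"] by simp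
qed

lemma module_hom_minus:
  assumes "module R M" "module R N" "f \<in> module_hom R M N" "x \<in> carrier M" "y \<in> carrier M"
  shows "f (x \<ominus>\<^bsub>M\<^esub> y) = f x \<ominus>\<^bsub>N\<^esub> f y"
proof -
  interpret M: module R M by fact
  interpret N: module R N by fact
  have "f (\<ominus>\<^bsub>M\<^esub> y) \<oplus>\<^bsub>N\<^esub> f y = f (\<ominus>\<^bsub>M\<^esub> y \<oplus>\<^bsub>M\<^esub> y)"
    using assms by (simp add: module_hom_add)
  also have "\<dots> = \<zero>\<^bsub>N\<^esub>"
    using assms module_hom_zero[OF assms(1-3)] by (simp add: M.l_neg)
  finally have "\<ominus>\<^bsub>N\<^esub> f y = f (\<ominus>\<^bsub>M\<^esub> y)"
    using assms module_hom_carrier[OF assms(3)] by (intro N.minus_equality) auto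
  then show ?thesis using assms by (simp add: a_minus_def module_hom_add)
qed

text \<open>The map h \<otimes> 1. The source of \<open>h\<close> is not an argument, since the lift
  only reads a representative of the tensor.\<close>

definition tmap where
  "tmap R W B h = tensor_lift (tensor R W B) (\<lambda>v a. pure_tensor R W B (h v) a)"

text \<open>The map 1 \<otimes> comultiplication. Together with \<open>tcoact\<close> (coaction
  \<otimes> 1, rebracketed into V \<otimes> (A \<otimes> A)) and \<open>tcounit\<close> (1 \<otimes>
  counit) it names the maps that occur in the comodule laws.\<close>

definition tcomult where
  "tcomult R V A = tensor_lift (tensor R V (tensor R A A))
     (\<lambda>w a. pure_tensor R V (tensor R A A) w (comult A a))"

definition tcoact where
  "tcoact R V A \<phi> = tensor_lift (tensor R V (tensor R A A))
     (\<lambda>w a. tensor_lift (tensor R V (tensor R A A))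
        (\<lambda>u b. pure_tensor R V (tensor R A A) u (pure_tensor R A A b a)) (\<phi> w))"

definition tcounit where
  "tcounit V A = tensor_lift V (\<lambda>w a. counit A a \<odot>\<^bsub>V\<^esub> w)"

lemma (in two_modules) tensor_hom_eq:
  assumes "f \<in> module_hom R T P" "g \<in> module_hom R T P"
    and "\<And>x y. x \<in> carrier M \<Longrightarrow> y \<in> carrier N \<Longrightarrow> f (x \<otimes>\<^sub>t y) = g (x \<otimes>\<^sub>t y)"
    and "t \<in> carrier T"
  shows "f t = g t"
  using assms(4)
  by (induction t rule: tensor_induct) (use assms(1-3) in \<open>simp_all add: module_hom_add\<close>)

lemma module_hom_compose:
  assumes "f \<in> module_hom R M N" "g \<in> module_hom R N P"
  shows "(\<lambda>x. g (f x)) \<in> module_hom R M P"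
  using assms by (auto intro!: module_homI simp: module_hom_simps)

lemma two_modules_intro [intro]: "module R V \<Longrightarrow> module R W \<Longrightarrow> two_modules R V W"
  by (simp add: two_modules_def)

lemma tensor_is_module: "module R V \<Longrightarrow> module R W \<Longrightarrow> module R (tensor R V W)"
  using two_modules.tensor_module two_modules_intro by blast

lemma hom_balanced:
  fixes R (structure)
  assumes "module R V" "module R W" "module R B" "h \<in> module_hom R V W"
  shows "balanced R V B (tensor R W B) (\<lambda>v a. pure_tensor R W B (h v) a)"
proof -
  interpret W: two_modules R W B using assms by blast
  interpret V: module R V by fact
  interpret B: module R B by fact
  show ?thesis
    using assms(4) by (intro balancedI) 
      (auto simp: module_hom_simps W.pure_add_left W.pure_add_right W.pure_balanced)
qed

lemma tmap:
  fixes R (structure)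
  assumes V: "module R V" and W: "module R W" and B: "module R B" and h: "h \<in> module_hom R V W"
  shows tmap_pure: "\<And>v a. v \<in> carrier V \<Longrightarrow> a \<in> carrier B \<Longrightarrow>
      tmap R W B h (pure_tensor R V B v a) = pure_tensor R W B (h v) a"
    and tmap_hom: "tmap R W B h \<in> module_hom R (tensor R V B) (tensor R W B)"
proof -
  interpret V: two_modules R V B using assms by blast
  interpret W: two_modules R W B using assms by blast
  show "tmap R W B h (pure_tensor R V B v a) = pure_tensor R W B (h v) a"
    if "v \<in> carrier V" "a \<in> carrier B" for v a
    unfolding tmap_def
    by (rule V.tensor_lift_pure[OF W.T.abelian_group_axioms hom_balanced[OF assms]]) (use that in auto)
  show "tmap R W B h \<in> module_hom R (tensor R V B) (tensor R W B)"
    unfolding tmap_def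
    by (rule V.lift_hom[OF W.tensor_module hom_balanced[OF assms]])
      (use h in \<open>simp add: module_hom_simps\<close>)
qed

text \<open>The composite enters as a separate function \<open>k\<close> that agrees with it on the
  carrier only. So the rule also simplifies composites that reduce there to another known map, as
  happens for sections and retractions.\<close>

lemma tmap_comp:
  assumes "module R V" "module R W" "module R X" "module R B"
    "h \<in> module_hom R V W" "g \<in> module_hom R W X"
    and "\<And>v. v \<in> carrier V \<Longrightarrow> k v = g (h v)" and "t \<in> carrier (tensor R V B)"
  shows "tmap R X B g (tmap R W B h t) = tmap R X B k t"
proof -
  interpret V: module R V by fact
  interpret V: two_modules R V B using assms by blast
  have k: "k \<in> module_hom R V X"
    using assms(5-7) by (auto intro!: module_homI simp: module_hom_simps)
  show ?thesis
    by (rule V.tensor_hom_eq[OF module_hom_compose[OF tmap_hom tmap_hom] tmap_hom])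
      (use assms k in \<open>simp_all add: tmap_pure[where V=V] tmap_pure[where V=W] module_hom_simps\<close>)
qed

lemma tmap_id:
  assumes "module R V" "module R B"
    and "\<And>v. v \<in> carrier V \<Longrightarrow> k v = v" and "t \<in> carrier (tensor R V B)"
  shows "tmap R V B k t = t"
proof -
  interpret V: module R V by fact
  interpret V: two_modules R V B using assms by blast
  have k: "k \<in> module_hom R V V"
    using assms by (auto intro!: module_homI)
  show ?thesis
    by (rule V.tensor_hom_eq[where f = "tmap R V B k" and g = "\<lambda>t. t", OF tmap_hom])
      (use assms k in \<open>auto intro!: module_homI simp: tmap_pure[where V=V]\<close>)
qed

lemma tmap_add:
  assumes "module R V" "module R W" "module R B"
    "g \<in> module_hom R V W" "h \<in> module_hom R V W"
    and "\<And>v. v \<in> carrier V \<Longrightarrow> k v = g v \<oplus>\<^bsub>W\<^esub> h v" and "t \<in> carrier (tensor R V B)"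
  shows "tmap R W B k t = tmap R W B g t \<oplus>\<^bsub>tensor R W B\<^esub> tmap R W B h t"
proof -
  interpret V: module R V by fact
  interpret W: module R W by fact
  interpret V: two_modules R V B using assms by blast
  interpret W: two_modules R W B using assms by blast
  have k: "k \<in> module_hom R V W"
    using assms(4-6) by (auto intro!: module_homI simp: module_hom_simps W.a_ac W.smult_r_distr)
  note H = module_hom_simps[OF tmap_hom[OF assms(1-3) k]] module_hom_simps[OF tmap_hom[OF assms(1-3) assms(4)]]
    module_hom_simps[OF tmap_hom[OF assms(1-3) assms(5)]]
  show ?thesis
    using assms(7)
  proof (induction t rule: V.tensor_induct)
    case (pure v a)
    then show ?case
      using assms k by (simp add: tmap_pure[where V=V] module_hom_simps W.pure_add_left)
  next
    case (add s t)
    then show ?case by (simp add: H W.T.a_ac)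
  qed
qed

lemma tmap_smult:
  fixes R (structure)
  assumes "module R V" "module R W" "module R B"
    "h \<in> module_hom R V W" "c \<in> carrier R"
    and "\<And>v. v \<in> carrier V \<Longrightarrow> k v = c \<odot>\<^bsub>W\<^esub> h v" and "t \<in> carrier (tensor R V B)"
  shows "tmap R W B k t = c \<odot>\<^bsub>tensor R W B\<^esub> tmap R W B h t"
proof -
  interpret V: module R V by fact
  interpret W: module R W by fact
  interpret V: two_modules R V B using assms by blast
  interpret W: two_modules R W B using assms by blast
  have comm: "c \<odot>\<^bsub>W\<^esub> (r \<odot>\<^bsub>W\<^esub> w) = r \<odot>\<^bsub>W\<^esub> (c \<odot>\<^bsub>W\<^esub> w)" if "r \<in> carrier R" "w \<in> carrier W" for r w
    using that assms(5) by (metis V.R.m_comm W.smult_assoc1)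
  have k: "k \<in> module_hom R V W"
    using assms(4-6) by (auto intro!: module_homI simp: module_hom_simps W.smult_r_distr comm)
  note H = module_hom_simps[OF tmap_hom[OF assms(1-3) k]] module_hom_simps[OF tmap_hom[OF assms(1-3) assms(4)]]
  show ?thesis
    using assms(7)
  proof (induction t rule: V.tensor_induct)
    case (pure v a)
    then show ?case
      using assms k by (simp add: tmap_pure[where V=V] module_hom_simps)
  next
    case (add s t)
    then show ?case using assms(5) by (simp add: H W.T.smult_r_distr)
  qed
qed

lemma tmap_zero:
  fixes R (structure)
  assumes "module R V" "module R W" "module R B"
    and "\<And>v. v \<in> carrier V \<Longrightarrow> k v = \<zero>\<^bsub>W\<^esub>" and "t \<in> carrier (tensor R V B)"
  shows "tmap R W B k t = \<zero>\<^bsub>tensor R W B\<^esub>"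
proof -
  interpret V: module R V by fact
  interpret W: module R W by fact
  interpret V: two_modules R V B using assms by blast
  interpret W: two_modules R W B using assms by blast
  have k: "k \<in> module_hom R V W"
    using assms(4) by (auto intro!: module_homI)
  show ?thesis
    by (rule V.tensor_hom_eq[where f = "tmap R W B k" and g = "\<lambda>t. \<zero>\<^bsub>tensor R W B\<^esub>", OF tmap_hom])
      (use assms k W.pure_zero_left in \<open>auto intro!: module_homI simp: tmap_pure[where V=V]\<close>)
qed

text \<open>Both the Hopf algebra over the integers and its base change to a field are instances, so
  the maps in the comodule laws are studied once for the two of them.\<close>

locale coalgebra_data = A: module R A
  for R (structure) and A :: "('r, 'a, 'x) hopf_scheme" +
  assumes comult_hom: "comult A \<in> module_hom R A (tensor R A A)"
    and counit_closed: "a \<in> carrier A \<Longrightarrow> counit A a \<in> carrier R"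
    and counit_add: "\<lbrakk>a \<in> carrier A; b \<in> carrier A\<rbrakk> \<Longrightarrow> counit A (a \<oplus>\<^bsub>A\<^esub> b) = counit A a \<oplus> counit A b"
    and counit_smult: "\<lbrakk>r \<in> carrier R; a \<in> carrier A\<rbrakk> \<Longrightarrow> counit A (r \<odot>\<^bsub>A\<^esub> a) = r \<otimes> counit A a"
begin

sublocale AA: two_modules R A A
  by (rule two_modules_intro) (rule A.module_axioms)+

abbreviation "TA V \<equiv> tensor R V A"
abbreviation "TAA V \<equiv> tensor R V (tensor R A A)"

lemma TAA_intro: "module R V \<Longrightarrow> two_modules R V (tensor R A A)"
  using AA.tensor_module by blast

lemma TA_intro: "module R V \<Longrightarrow> two_modules R V A"
  using A.module_axioms by blast

lemma tcomult_balanced: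
  assumes "module R V"
  shows "balanced R V A (TAA V) (\<lambda>w a. pure_tensor R V (tensor R A A) w (comult A a))"
proof -
  interpret V: two_modules R V "tensor R A A" using TAA_intro assms .
  interpret V: module R V by fact
  show ?thesis
    by (intro balancedI)
      (use comult_hom in \<open>auto simp: module_hom_simps V.pure_add_left V.pure_add_right V.pure_balanced\<close>)
qed

lemma tcomult:
  assumes "module R V"
  shows tcomult_pure: "\<And>v a. v \<in> carrier V \<Longrightarrow> a \<in> carrier A \<Longrightarrow>
      tcomult R V A (pure_tensor R V A v a) = pure_tensor R V (tensor R A A) v (comult A a)"
    and tcomult_hom: "tcomult R V A \<in> module_hom R (TA V) (TAA V)"
proof -
  interpret V: two_modules R V "tensor R A A" using TAA_intro assms .
  interpret VA: two_modules R V A using TA_intro assms .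
  show "tcomult R V A (pure_tensor R V A v a) = pure_tensor R V (tensor R A A) v (comult A a)"
    if "v \<in> carrier V" "a \<in> carrier A" for v a
    unfolding tcomult_def
    by (rule VA.tensor_lift_pure[OF V.T.abelian_group_axioms tcomult_balanced[OF assms]]) (use that in auto)
  show "tcomult R V A \<in> module_hom R (TA V) (TAA V)"
    unfolding tcomult_def
    by (rule VA.lift_hom[OF V.tensor_module tcomult_balanced[OF assms]])
      (use comult_hom in \<open>simp add: module_hom_simps\<close>)
qed

lemma append_balanced:
  assumes "module R V" "a \<in> carrier A"
  shows "balanced R V A (TAA V) (\<lambda>u b. pure_tensor R V (tensor R A A) u (pure_tensor R A A b a))"
proof -
  interpret V: two_modules R V "tensor R A A" using TAA_intro assms(1) .
  interpret V: module R V by fact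
  show ?thesis
    by (intro balancedI)
      (use assms(2) in \<open>auto simp: V.pure_add_left V.pure_add_right AA.pure_add_left V.pure_balanced\<close>)
qed

text \<open>The map v \<otimes> b to v \<otimes> (b \<otimes> a) for a fixed last factor.
  \<open>tcoact\<close> is the lift of the pairing that sends \<open>w\<close> and \<open>a\<close>
  to \<open>tappend V a (\<phi> w)\<close>, so linearity is needed in both arguments.\<close>

definition "tappend V a = tensor_lift (TAA V) (\<lambda>u b. pure_tensor R V (tensor R A A) u (pure_tensor R A A b a))"

lemma tappend:
  assumes "module R V" "a \<in> carrier A"
  shows tappend_pure: "\<And>v b. v \<in> carrier V \<Longrightarrow> b \<in> carrier A \<Longrightarrow>
      tappend V a (pure_tensor R V A v b) = pure_tensor R V (tensor R A A) v (pure_tensor R A A b a)"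
    and tappend_hom: "tappend V a \<in> module_hom R (TA V) (TAA V)"
proof -
  interpret V: two_modules R V "tensor R A A" using TAA_intro assms(1) .
  interpret VA: two_modules R V A using TA_intro assms(1) .
  show "tappend V a (pure_tensor R V A v b) = pure_tensor R V (tensor R A A) v (pure_tensor R A A b a)"
    if "v \<in> carrier V" "b \<in> carrier A" for v b
    unfolding tappend_def
    by (rule VA.tensor_lift_pure[OF V.T.abelian_group_axioms append_balanced[OF assms]]) (use that in auto)
  show "tappend V a \<in> module_hom R (TA V) (TAA V)"
    unfolding tappend_def
    by (rule VA.lift_hom[OF V.tensor_module append_balanced[OF assms]])
      (use assms(2) in \<open>simp add: module_hom_simps\<close>)
qed

lemma tappend_add_smult:
  assumes "module R V" "t \<in> carrier (TA V)"
  shows "\<lbrakk>a \<in> carrier A; b \<in> carrier A\<rbrakk> \<Longrightarrow> tappend V (a \<oplus>\<^bsub>A\<^esub> b) t = tappend V a t \<oplus>\<^bsub>TAA V\<^esub> tappend V b t"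
    and "\<lbrakk>r \<in> carrier R; a \<in> carrier A\<rbrakk> \<Longrightarrow> tappend V (r \<odot>\<^bsub>A\<^esub> a) t = r \<odot>\<^bsub>TAA V\<^esub> tappend V a t"
proof -
  interpret V: two_modules R V "tensor R A A" using TAA_intro assms(1) .
  interpret VA: two_modules R V A using TA_intro assms(1) .
  note H = tappend_pure[OF assms(1)] module_hom_simps[OF tappend_hom[OF assms(1)]]
  show "tappend V (a \<oplus>\<^bsub>A\<^esub> b) t = tappend V a t \<oplus>\<^bsub>TAA V\<^esub> tappend V b t" if "a \<in> carrier A" "b \<in> carrier A"
    using assms(2)
    by (induction t rule: VA.tensor_induct)
      (use that in \<open>auto simp: H AA.pure_add_right V.pure_add_right V.T.a_ac\<close>)
  show "tappend V (r \<odot>\<^bsub>A\<^esub> a) t = r \<odot>\<^bsub>TAA V\<^esub> tappend V a t" if "r \<in> carrier R" "a \<in> carrier A"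
    using assms(2)
  proof (induction t rule: VA.tensor_induct)
    case (pure x y)
    have "pure_tensor R A A y (r \<odot>\<^bsub>A\<^esub> a) = r \<odot>\<^bsub>tensor R A A\<^esub> pure_tensor R A A y a"
      using that pure by (simp add: AA.pure_balanced)
    then show ?case using pure that by (simp add: H V.pure_balanced)
  qed (use that in \<open>auto simp: H V.T.smult_r_distr\<close>)
qed

lemma tcoact_eq: "tcoact R V A \<phi> = tensor_lift (TAA V) (\<lambda>w a. tappend V a (\<phi> w))"
  by (simp add: tcoact_def tappend_def)

lemma tcoact_balanced:
  assumes "module R M" "module R V" "\<phi> \<in> module_hom R M (TA V)"
  shows "balanced R M A (TAA V) (\<lambda>w a. tappend V a (\<phi> w))"
  by (intro balancedI)
    (use assms(3) in \<open>simp_all add: module_hom_simps[OF tappend_hom[OF assms(2)]] tappend_add_smult[OF assms(2)] module_hom_simps\<close>)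

lemma tcoact:
  assumes "module R M" "module R V" "\<phi> \<in> module_hom R M (TA V)"
  shows tcoact_pure: "\<And>v a. v \<in> carrier M \<Longrightarrow> a \<in> carrier A \<Longrightarrow>
      tcoact R V A \<phi> (pure_tensor R M A v a) = tappend V a (\<phi> v)"
    and tcoact_hom: "tcoact R V A \<phi> \<in> module_hom R (TA M) (TAA V)"
proof -
  interpret V: two_modules R V "tensor R A A" using TAA_intro assms(2) .
  interpret MA: two_modules R M A using TA_intro assms(1) .
  show "tcoact R V A \<phi> (pure_tensor R M A v a) = tappend V a (\<phi> v)"
    if "v \<in> carrier M" "a \<in> carrier A" for v a
    unfolding tcoact_eq
    by (rule MA.tensor_lift_pure[OF V.T.abelian_group_axioms tcoact_balanced[OF assms]]) (use that in auto)
  show "tcoact R V A \<phi> \<in> module_hom R (TA M) (TAA V)"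
    unfolding tcoact_eq
    by (rule MA.lift_hom[OF V.tensor_module tcoact_balanced[OF assms]])
      (use assms(3) in \<open>simp add: module_hom_simps module_hom_simps[OF tappend_hom[OF assms(2)]]\<close>)
qed

lemma tcounit_balanced:
  assumes "module R V"
  shows "balanced R V A V (\<lambda>w a. counit A a \<odot>\<^bsub>V\<^esub> w)"
proof -
  interpret V: module R V by fact
  show ?thesis
    by (intro balancedI)
      (auto simp: counit_closed counit_add counit_smult V.smult_r_distr V.smult_l_distr V.smult_assoc1
         A.R.m_comm simp flip: V.smult_assoc1)
qed

lemma tcounit:
  assumes "module R V"
  shows tcounit_pure: "\<And>v a. v \<in> carrier V \<Longrightarrow> a \<in> carrier A \<Longrightarrow>
      tcounit V A (pure_tensor R V A v a) = counit A a \<odot>\<^bsub>V\<^esub> v"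
    and tcounit_hom: "tcounit V A \<in> module_hom R (TA V) V"
proof -
  interpret V: module R V by fact
  interpret VA: two_modules R V A using TA_intro assms .
  show "tcounit V A (pure_tensor R V A v a) = counit A a \<odot>\<^bsub>V\<^esub> v"
    if "v \<in> carrier V" "a \<in> carrier A" for v a
    unfolding tcounit_def
    by (rule VA.tensor_lift_pure[OF V.abelian_group_axioms tcounit_balanced[OF assms]]) (use that in auto)
  show "tcounit V A \<in> module_hom R (TA V) V"
    unfolding tcounit_def
    by (rule VA.lift_hom[OF assms tcounit_balanced[OF assms]])
      (simp add: counit_closed A.R.m_comm flip: V.smult_assoc1)
qed

text \<open>Both sides are linear in \<open>t\<close> and agree on pure tensors. With the naturality
  of \<open>tcoact\<close> and \<open>tcounit\<close> this transports the comodule laws along maps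
  compatible with the coactions: forwards along surjections, backwards along split
  injections.\<close>

lemma tcomult_natural:
  assumes "module R V" "module R W" "h \<in> module_hom R V W" "t \<in> carrier (TA V)"
  shows "tcomult R W A (tmap R W A h t) = tmap R W (tensor R A A) h (tcomult R V A t)"
proof -
  interpret VA: two_modules R V A using TA_intro assms(1) .
  note AM = A.module_axioms AA.tensor_module
  show ?thesis
    by (rule VA.tensor_hom_eq[OF module_hom_compose[OF tmap_hom tcomult_hom] module_hom_compose[OF tcomult_hom tmap_hom]])
      (use assms AM comult_hom in \<open>simp_all add: tmap_pure[where V=V] tcomult_pure module_hom_simps\<close>)
qed

lemma tappend_natural:
  assumes "module R V" "module R W" "h \<in> module_hom R V W" "t \<in> carrier (TA V)" "a \<in> carrier A"
  shows "tappend W a (tmap R W A h t) = tmap R W (tensor R A A) h (tappend V a t)"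
proof -
  interpret VA: two_modules R V A using TA_intro assms(1) .
  note AM = A.module_axioms AA.tensor_module
  show ?thesis
    by (rule VA.tensor_hom_eq[OF module_hom_compose[OF tmap_hom tappend_hom] module_hom_compose[OF tappend_hom tmap_hom]])
      (use assms AM comult_hom in \<open>simp_all add: tmap_pure[where V=V] tappend_pure module_hom_simps\<close>)
qed

lemma tcoact_natural:
  assumes "module R V" "module R W" "h \<in> module_hom R V W" "t \<in> carrier (TA V)"
    "\<rho> \<in> module_hom R V (TA V)" "\<sigma> \<in> module_hom R W (TA W)"
    and eq: "\<And>v. v \<in> carrier V \<Longrightarrow> \<sigma> (h v) = tmap R W A h (\<rho> v)"
  shows "tcoact R W A \<sigma> (tmap R W A h t) = tmap R W (tensor R A A) h (tcoact R V A \<rho> t)"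
proof -
  interpret VA: two_modules R V A using TA_intro assms(1) .
  note AM = A.module_axioms AA.tensor_module
  show ?thesis
    by (rule VA.tensor_hom_eq[OF module_hom_compose[OF tmap_hom tcoact_hom] module_hom_compose[OF tcoact_hom tmap_hom]])
      (use assms AM in \<open>simp_all add: tmap_pure[where V=V] tcoact_pure[where V=W and M=W] tcoact_pure[where V=V and M=V]
         module_hom_simps tappend_natural\<close>)
qed

lemma tcounit_natural:
  assumes "module R V" "module R W" "h \<in> module_hom R V W" "t \<in> carrier (TA V)"
  shows "tcounit W A (tmap R W A h t) = h (tcounit V A t)"
proof -
  interpret VA: two_modules R V A using TA_intro assms(1) .
  note AM = A.module_axioms AA.tensor_module
  show ?thesis
    by (rule VA.tensor_hom_eq[OF module_hom_compose[OF tmap_hom tcounit_hom] module_hom_compose[OF tcounit_hom]])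
      (use assms AM in \<open>simp_all add: tmap_pure[where V=V] tcounit_pure module_hom_simps counit_closed\<close>)
qed

end


section \<open>Generation by finitely many vectors\<close>

text \<open>Recursion on the number of terms instead of a sum over a finite set: the combination is
  then a term in zero, addition and scaling, and taking classes in an ultraproduct commutes with it
  by induction.\<close>

primrec lcomb :: "('k, 'v, 'y) module_scheme \<Rightarrow> (nat \<Rightarrow> 'k) \<Rightarrow> (nat \<Rightarrow> 'v) \<Rightarrow> nat \<Rightarrow> 'v" where
  "lcomb V c e 0 = \<zero>\<^bsub>V\<^esub>"
| "lcomb V c e (Suc n) = lcomb V c e n \<oplus>\<^bsub>V\<^esub> c n \<odot>\<^bsub>V\<^esub> e n"

text \<open>Over a field this says that the dimension is at most \<open>n\<close>. The vectors may
  be dependent, so it is monotone in \<open>n\<close>; and for fixed \<open>n\<close> it is a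
  first-order condition, suited to the theorem of Los.\<close>

definition generated_by :: "('k, 'x) ring_scheme \<Rightarrow> ('k, 'v, 'y) module_scheme \<Rightarrow> nat \<Rightarrow> bool" where
  "generated_by K V n \<longleftrightarrow> (\<exists>e. (\<forall>j<n. e j \<in> carrier V) \<and>
     (\<forall>v\<in>carrier V. \<exists>c. (\<forall>j<n. c j \<in> carrier K) \<and> v = lcomb V c e n))"

lemma lcomb_cong: "(\<And>j. j < n \<Longrightarrow> c j = c' j) \<Longrightarrow> (\<And>j. j < n \<Longrightarrow> e j = e' j) \<Longrightarrow> lcomb V c e n = lcomb V c' e' n"
  by (induction n) auto

context module
begin

lemma lcomb_closed: 
  "(\<And>j. j < n \<Longrightarrow> c j \<in> carrier R) \<Longrightarrow> (\<And>j. j < n \<Longrightarrow> e j \<in> carrier M) \<Longrightarrow> lcomb M c e n \<in> carrier M"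
  by (induction n) auto

lemma lcomb_pad:
  assumes "n \<le> m" "\<And>j. j < n \<Longrightarrow> c j \<in> carrier R" "\<And>j. j < n \<Longrightarrow> e j \<in> carrier M"
  shows "lcomb M (\<lambda>j. if j < n then c j else \<zero>) (\<lambda>j. if j < n then e j else \<zero>\<^bsub>M\<^esub>) m = lcomb M c e n"
  using assms(1)
proof (induction m rule: dec_induct)
  case base
  show ?case by (rule lcomb_cong) auto
next
  case (step m)
  then show ?case using lcomb_closed[of n c e] assms by simp
qed

lemma generated_by_mono:
  assumes "generated_by R M n" "n \<le> m"
  shows "generated_by R M m"
proof -
  obtain e where e: "\<And>j. j < n \<Longrightarrow> e j \<in> carrier M"
    "\<And>v. v \<in> carrier M \<Longrightarrow> \<exists>c. (\<forall>j<n. c j \<in> carrier R) \<and> v = lcomb M c e n"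
    using assms(1) unfolding generated_by_def by blast
  show ?thesis unfolding generated_by_def
  proof (intro exI[of _ "\<lambda>j. if j < n then e j else \<zero>\<^bsub>M\<^esub>"] conjI ballI)
    fix v assume "v \<in> carrier M"
    then obtain c where "\<And>j. j<n \<Longrightarrow> c j \<in> carrier R" "v = lcomb M c e n" using e(2) by blast
    then show "\<exists>c. (\<forall>j<m. c j \<in> carrier R) \<and> v = lcomb M c (\<lambda>j. if j < n then e j else \<zero>\<^bsub>M\<^esub>) m"
      using lcomb_pad[OF assms(2), of c e] e(1)
      by (intro exI[of _ "\<lambda>j. if j < n then c j else \<zero>"]) auto
  qed (use e(1) in auto)
qed

lemma lcomb_finsum:
  assumes "\<And>j. j < n \<Longrightarrow> c j \<in> carrier R" "\<And>j. j < n \<Longrightarrow> e j \<in> carrier M"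
  shows "lcomb M c e n = (\<Oplus>\<^bsub>M\<^esub>j\<in>{..<n}. c j \<odot>\<^bsub>M\<^esub> e j)"
  using assms
proof (induction n)
  case (Suc n)
  have "(\<Oplus>\<^bsub>M\<^esub>j\<in>{..<Suc n}. c j \<odot>\<^bsub>M\<^esub> e j) = c n \<odot>\<^bsub>M\<^esub> e n \<oplus>\<^bsub>M\<^esub> (\<Oplus>\<^bsub>M\<^esub>j\<in>{..<n}. c j \<odot>\<^bsub>M\<^esub> e j)"
    unfolding lessThan_Suc by (rule M.finsum_insert) (use Suc.prems in auto)
  then show ?case using Suc lcomb_closed[of n c e]
    by (simp add: M.a_comm)
qed simp

end

lemma lcomb_hom:
  assumes "module K V" "module K W" "h \<in> module_hom K V W"
    "\<And>j. j < n \<Longrightarrow> c j \<in> carrier K" "\<And>j. j < n \<Longrightarrow> e j \<in> carrier V"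
  shows "h (lcomb V c e n) = lcomb W c (\<lambda>j. h (e j)) n"
proof -
  interpret V: module K V by fact
  show ?thesis using assms(4,5)
    by (induction n) (use assms(1-3) V.lcomb_closed in \<open>auto simp: module_hom_zero module_hom_simps\<close>)
qed

lemma generated_by_surj:
  assumes "module K V" "module K W" "h \<in> module_hom K V W" "carrier W \<subseteq> h ` carrier V" "generated_by K V n"
  shows "generated_by K W n"
proof -
  obtain e where e: "\<And>j. j < n \<Longrightarrow> e j \<in> carrier V"
    "\<And>v. v \<in> carrier V \<Longrightarrow> \<exists>c. (\<forall>j<n. c j \<in> carrier K) \<and> v = lcomb V c e n"
    using assms(5) unfolding generated_by_def by blast
  show ?thesis unfolding generated_by_def
  proof (intro exI[of _ "\<lambda>j. h (e j)"] conjI ballI)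
    fix w assume "w \<in> carrier W"
    then obtain v where v: "v \<in> carrier V" "w = h v" using assms(4) by blast
    then obtain c where "\<And>j. j<n \<Longrightarrow> c j \<in> carrier K" "v = lcomb V c e n" using e(2) by blast
    then show "\<exists>c. (\<forall>j<n. c j \<in> carrier K) \<and> w = lcomb W c (\<lambda>j. h (e j)) n"
      using lcomb_hom[OF assms(1-3), of n c e] e(1) v by auto
  qed (use e(1) assms(3) in \<open>auto simp: module_hom_simps\<close>)
qed

text \<open>The concatenated images of the two lists of generators generate. As the sum need not be
  direct, this covers direct sums, joint retractions and extensions alike.\<close>

lemma generated_by_sum:
  assumes "module K V" "module K W" "module K X" "f \<in> module_hom K V X" "g \<in> module_hom K W X"
    "\<And>x. x \<in> carrier X \<Longrightarrow> \<exists>v\<in>carrier V. \<exists>w\<in>carrier W. x = f v \<oplus>\<^bsub>X\<^esub> g w"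
    "generated_by K V n" "generated_by K W m"
  shows "generated_by K X (n + m)"
proof -
  interpret X: module K X by fact
  obtain e where e: "\<And>j. j < n \<Longrightarrow> e j \<in> carrier V"
    "\<And>v. v \<in> carrier V \<Longrightarrow> \<exists>c. (\<forall>j<n. c j \<in> carrier K) \<and> v = lcomb V c e n"
    using assms(7) unfolding generated_by_def by blast
  obtain d where d: "\<And>j. j < m \<Longrightarrow> d j \<in> carrier W"
    "\<And>v. v \<in> carrier W \<Longrightarrow> \<exists>c. (\<forall>j<m. c j \<in> carrier K) \<and> v = lcomb W c d m"
    using assms(8) unfolding generated_by_def by blast
  let ?e = "\<lambda>j. if j < n then f (e j) else g (d (j - n))"
  have append: "lcomb X (\<lambda>j. if j < n then c j else c' (j - n)) ?e (n + k) =
      lcomb X c (\<lambda>j. f (e j)) n \<oplus>\<^bsub>X\<^esub> lcomb X c' (\<lambda>j. g (d j)) k"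
    if "\<And>j. j<n \<Longrightarrow> c j \<in> carrier K" "\<And>j. j<m \<Longrightarrow> c' j \<in> carrier K" "k \<le> m" for c c' k
    using that(3)
  proof (induction k)
    case 0
    have "lcomb X (\<lambda>j. if j < n then c j else c' (j - n)) ?e n = lcomb X c (\<lambda>j. f (e j)) n"
      by (rule lcomb_cong) auto
    then show ?case using that X.lcomb_closed[of n c "\<lambda>j. f (e j)"] e(1) assms(4) by (simp add: module_hom_simps)
  next
    case (Suc k)
    have "lcomb X c (\<lambda>j. f (e j)) n \<in> carrier X" "lcomb X c' (\<lambda>j. g (d j)) k \<in> carrier X"
       "c' k \<odot>\<^bsub>X\<^esub> g (d k) \<in> carrier X"
      using that Suc.prems e(1) d(1) assms(4,5) by (auto intro!: X.lcomb_closed simp: module_hom_simps)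
    then show ?case using Suc by (simp add: X.a_assoc)
  qed
  show ?thesis unfolding generated_by_def
  proof (intro exI[of _ ?e] conjI ballI)
    fix x assume "x \<in> carrier X"
    then obtain v w where vw: "v \<in> carrier V" "w \<in> carrier W" "x = f v \<oplus>\<^bsub>X\<^esub> g w" using assms(6) by blast
    obtain c where c: "\<And>j. j<n \<Longrightarrow> c j \<in> carrier K" "v = lcomb V c e n" using e(2) vw by blast
    obtain c' where c': "\<And>j. j<m \<Longrightarrow> c' j \<in> carrier K" "w = lcomb W c' d m" using d(2) vw by blast
    have "x = lcomb X (\<lambda>j. if j < n then c j else c' (j - n)) ?e (n + m)"
      using append[of c c' m, OF c(1) c'(1) order.refl] vw(3) c c'
        lcomb_hom[OF assms(1,3,4), of n c e] lcomb_hom[OF assms(2,3,5), of m c' d] e(1) d(1) by simp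
    then show "\<exists>c. (\<forall>j<n + m. c j \<in> carrier K) \<and> x = lcomb X c ?e (n + m)"
      using c c' by (intro exI[of _ "\<lambda>j. if j < n then c j else c' (j - n)"]) auto
  qed (use e(1) d(1) assms(4,5) in \<open>auto simp: module_hom_simps\<close>)
qed

lemma (in module) generated_by_span:
  assumes "finite A" "A \<subseteq> carrier M" "span A = carrier M"
  shows "generated_by R M (card A)"
proof -
  obtain e where e: "bij_betw e {..<card A} A"
    using ex_bij_betw_nat_finite[OF assms(1)] by (auto simp: atLeast0LessThan)
  then have eA: "\<And>j. j < card A \<Longrightarrow> e j \<in> carrier M" using assms(2) by (auto simp: bij_betw_def)
  show ?thesis unfolding generated_by_def
  proof (intro exI[of _ e] conjI ballI)
    fix v assume "v \<in> carrier M"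
    then obtain a where a: "a \<in> A \<rightarrow> carrier R" "v = lincomb a A"
      using finite_in_span[OF assms(1,2), of v] assms(3) by auto
    have ac: "\<And>j. j < card A \<Longrightarrow> a (e j) \<in> carrier R" using a e by (auto simp: bij_betw_def)
    have "v = (\<Oplus>\<^bsub>M\<^esub>j\<in>{..<card A}. a (e j) \<odot>\<^bsub>M\<^esub> e j)"
      unfolding a(2) lincomb_def using e a assms(2)
      by (subst M.add.finprod_reindex[of "\<lambda>v. a v \<odot>\<^bsub>M\<^esub> v" e "{..<card A}", symmetric]) (auto simp: bij_betw_def)
    then show "\<exists>c. (\<forall>j<card A. c j \<in> carrier R) \<and> v = lcomb M c e (card A)"
      using lcomb_finsum[of "card A" "\<lambda>j. a (e j)" e] ac eA
      by (intro exI[of _ "\<lambda>j. a (e j)"]) auto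
  qed (use eA in auto)
qed

lemma (in module) span_generated_by:
  assumes "generated_by R M n"
  shows "\<exists>A. finite A \<and> card A \<le> n \<and> A \<subseteq> carrier M \<and> span A = carrier M"
proof -
  obtain e where e: "\<And>j. j < n \<Longrightarrow> e j \<in> carrier M"
    "\<And>v. v \<in> carrier M \<Longrightarrow> \<exists>c. (\<forall>j<n. c j \<in> carrier R) \<and> v = lcomb M c e n"
    using assms(1) unfolding generated_by_def by blast
  let ?A = "e ` {..<n}"
  have A: "?A \<subseteq> carrier M" using e by auto
  interpret S: LinearCombinations.submodule R "span ?A" M by (rule span_is_submodule[OF A])
  have mem: "lcomb M c e k \<in> span ?A" if "\<forall>j<n. c j \<in> carrier R" "k \<le> n" for c k
    using that(2)
  proof (induction k)
    case 0 then show ?case using S.zero_closed by simp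
  next
    case (Suc k)
    have "e k \<in> span ?A" using in_own_span[OF A] Suc by auto
    then show ?case using Suc that by (auto intro!: S.m_closed S.smult_closed)
  qed
  have "span ?A = carrier M"
    using mem e(2) S.subset by blast
  then show ?thesis using A card_image_le[of "{..<n}" e] by auto
qed

text \<open>\<open>dim\<close> is the least size of a finite spanning set, and a spanning list of
  length \<open>n\<close> has at most \<open>n\<close> distinct entries. Conversely a spanning set
  of size \<open>dim\<close> is listed and padded with zero vectors.\<close>

lemma (in vectorspace) generated_by_iff: "generated_by K V n \<longleftrightarrow> fin_dim \<and> dim \<le> n"
proof
  assume "generated_by K V n"
  then obtain A where A: "finite A" "card A \<le> n" "A \<subseteq> carrier V" "span A = carrier V"
    using span_generated_by by blast
  then have "dim \<le> card A" unfolding dim_def by (intro Least_le) auto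
  then show "fin_dim \<and> dim \<le> n" using A unfolding fin_dim_def by auto
next
  assume *: "fin_dim \<and> dim \<le> n"
  then have "\<exists>m. \<exists>A. finite A \<and> card A = m \<and> A \<subseteq> carrier V \<and> span A = carrier V"
    unfolding fin_dim_def by auto
  then obtain A where "finite A" "card A = dim" "A \<subseteq> carrier V" "span A = carrier V"
    using LeastI_ex[of "\<lambda>m. \<exists>A. finite A \<and> card A = m \<and> A \<subseteq> carrier V \<and> span A = carrier V"]
    unfolding dim_def by auto
  then show "generated_by K V n"
    using generated_by_span[of A] generated_by_mono[of dim n] * by auto
qed

text \<open>Having dimension exactly \<open>n\<close> becomes a finite Boolean combination of
  generation statements, each of which passes to an ultraproduct.\<close>

lemma has_dim_iff:
  assumes "vectorspace K V"
  shows "has_dim K V n \<longleftrightarrow> generated_by K V n \<and> (\<forall>m<n. \<not> generated_by K V m)"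
  unfolding has_dim_def vectorspace.generated_by_iff[OF assms]
  by (meson le_refl linorder_not_le order.antisym order.strict_trans1)


text \<open>A section of \<open>t\<close> is built on larger and larger submodules, one vector at a time.\<close>

definition partial_section where
  "partial_section K V W t D s \<longleftrightarrow>
     D \<subseteq> carrier W \<and> \<zero>\<^bsub>W\<^esub> \<in> D \<and> (\<forall>x\<in>D. \<forall>y\<in>D. x \<oplus>\<^bsub>W\<^esub> y \<in> D) \<and>
     (\<forall>c\<in>carrier K. \<forall>x\<in>D. c \<odot>\<^bsub>W\<^esub> x \<in> D) \<and>
     (\<forall>x\<in>D. s x \<in> carrier V) \<and> (\<forall>x\<in>D. \<forall>y\<in>D. s (x \<oplus>\<^bsub>W\<^esub> y) = s x \<oplus>\<^bsub>V\<^esub> s y) \<and>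
     (\<forall>c\<in>carrier K. \<forall>x\<in>D. s (c \<odot>\<^bsub>W\<^esub> x) = c \<odot>\<^bsub>V\<^esub> s x) \<and>
     (\<forall>x\<in>D. x \<in> t ` carrier V \<longrightarrow> t (s x) = x)"

text \<open>Only points of the image of \<open>t\<close> impose a condition. The vector
  \<open>w\<close> is traded for a vector \<open>w'\<close> such that \<open>w\<close> lies in the
  span of \<open>D\<close> and \<open>w'\<close>: either \<open>w'\<close> is an image
  \<open>t v'\<close> and is sent to \<open>v'\<close>, or the larger subspace has no image points
  outside \<open>D\<close> and \<open>w'\<close> is sent to 0.\<close>

lemma partial_section_extend:
  fixes K (structure)
  assumes K: "field K" and V: "module K V" and W: "module K W" and t: "t \<in> module_hom K V W"
    and ps: "partial_section K V W t D s" and w: "w \<in> carrier W"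
  shows "\<exists>D' s'. partial_section K V W t D' s' \<and> D \<subseteq> D' \<and> w \<in> D'"
proof (cases "w \<in> D")
  case True
  then show ?thesis using ps by blast
next
  case False
  interpret K: field K by fact
  interpret V: module K V by fact
  interpret W: module K W by fact
  have D: "D \<subseteq> carrier W" "\<zero>\<^bsub>W\<^esub> \<in> D" "\<And>x y. x \<in> D \<Longrightarrow> y \<in> D \<Longrightarrow> x \<oplus>\<^bsub>W\<^esub> y \<in> D"
    "\<And>c x. c \<in> carrier K \<Longrightarrow> x \<in> D \<Longrightarrow> c \<odot>\<^bsub>W\<^esub> x \<in> D" "\<And>x. x \<in> D \<Longrightarrow> s x \<in> carrier V"
    "\<And>x y. x \<in> D \<Longrightarrow> y \<in> D \<Longrightarrow> s (x \<oplus>\<^bsub>W\<^esub> y) = s x \<oplus>\<^bsub>V\<^esub> s y"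
    "\<And>c x. c \<in> carrier K \<Longrightarrow> x \<in> D \<Longrightarrow> s (c \<odot>\<^bsub>W\<^esub> x) = c \<odot>\<^bsub>V\<^esub> s x"
    "\<And>x. x \<in> D \<Longrightarrow> x \<in> t ` carrier V \<Longrightarrow> t (s x) = x"
    using ps unfolding partial_section_def by blast+
  have Dc: "x \<in> carrier W" if "x \<in> D" for x using D(1) that by auto
  have Dneg: "\<ominus>\<^bsub>W\<^esub> x \<in> D" if "x \<in> D" for x
    using D(4)[of "\<ominus> \<one>" x] that Dc[OF that] by (simp add: W.smult_l_minus)
  have inv_smult: "(inv c) \<odot>\<^bsub>W\<^esub> (c \<odot>\<^bsub>W\<^esub> x) = x" if "c \<in> carrier K" "c \<noteq> \<zero>" "x \<in> carrier W" for c x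
    using that K.field_Units by (simp flip: W.smult_assoc1)
  have inv_closed: "inv c \<in> carrier K" if "c \<in> carrier K" "c \<noteq> \<zero>" for c
    using that K.field_Units by auto
  have smult_notin: "c \<odot>\<^bsub>W\<^esub> x \<notin> D" if "c \<in> carrier K" "c \<noteq> \<zero>" "x \<in> carrier W" "x \<notin> D" for c x
    using inv_smult[OF that(1-3)] D(4)[OF inv_closed[OF that(1,2)], of "c \<odot>\<^bsub>W\<^esub> x"] that(4) by auto
  have "\<exists>w' v'. w' \<in> carrier W \<and> v' \<in> carrier V \<and> w' \<notin> D \<and>
      (\<exists>d\<in>D. \<exists>a\<in>carrier K. w = d \<oplus>\<^bsub>W\<^esub> a \<odot>\<^bsub>W\<^esub> w') \<and>
      (\<forall>d\<in>D. \<forall>a\<in>carrier K. d \<oplus>\<^bsub>W\<^esub> a \<odot>\<^bsub>W\<^esub> w' \<in> t ` carrier V \<longrightarrow>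
         t (s d \<oplus>\<^bsub>V\<^esub> a \<odot>\<^bsub>V\<^esub> v') = d \<oplus>\<^bsub>W\<^esub> a \<odot>\<^bsub>W\<^esub> w')"
  proof (cases "\<exists>d\<in>D. \<exists>c\<in>carrier K. c \<noteq> \<zero> \<and> d \<oplus>\<^bsub>W\<^esub> c \<odot>\<^bsub>W\<^esub> w \<in> t ` carrier V")
    case True
    \<comment> \<open>The image point d0 + c w is taken as \<open>w'\<close>. As \<open>c\<close> is
      invertible, \<open>w\<close> is recovered from it modulo \<open>D\<close>.\<close>
    then obtain d0 c v' where d0: "d0 \<in> D" "c \<in> carrier K" "c \<noteq> \<zero>" "v' \<in> carrier V"
      "d0 \<oplus>\<^bsub>W\<^esub> c \<odot>\<^bsub>W\<^esub> w = t v'" by blast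
    have d0c: "d0 \<in> carrier W" using Dc d0 by auto
    have cw: "c \<odot>\<^bsub>W\<^esub> w = \<ominus>\<^bsub>W\<^esub> d0 \<oplus>\<^bsub>W\<^esub> t v'"
      unfolding d0(5)[symmetric] using d0(2) d0c w by (simp add: W.r_neg1)
    show ?thesis
    proof (intro exI[of _ "t v'"] exI[of _ v'] conjI ballI impI)
      show "t v' \<in> carrier W" "v' \<in> carrier V" using t d0 by (auto simp: module_hom_simps)
      show "t v' \<notin> D"
        using smult_notin[OF d0(2,3) w False] cw D(3)[OF Dneg[OF d0(1)], of "t v'"] by auto
      have "w = inv c \<odot>\<^bsub>W\<^esub> (\<ominus>\<^bsub>W\<^esub> d0) \<oplus>\<^bsub>W\<^esub> inv c \<odot>\<^bsub>W\<^esub> t v'"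
        using inv_smult[OF d0(2,3) w] cw inv_closed[OF d0(2,3)] d0c t d0(4)
        by (simp add: W.smult_r_distr module_hom_simps)
      then show "\<exists>d\<in>D. \<exists>a\<in>carrier K. w = d \<oplus>\<^bsub>W\<^esub> a \<odot>\<^bsub>W\<^esub> t v'"
        using inv_closed[OF d0(2,3)] D(4)[OF inv_closed[OF d0(2,3)] Dneg[OF d0(1)]] by blast
      fix d a assume da: "d \<in> D" "a \<in> carrier K" "d \<oplus>\<^bsub>W\<^esub> a \<odot>\<^bsub>W\<^esub> t v' \<in> t ` carrier V"
      then obtain u where u: "u \<in> carrier V" "d \<oplus>\<^bsub>W\<^esub> a \<odot>\<^bsub>W\<^esub> t v' = t u" by blast
      have tav: "t (a \<odot>\<^bsub>V\<^esub> v') = a \<odot>\<^bsub>W\<^esub> t v'" "t v' \<in> carrier W" "t u \<in> carrier W"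
        using t da d0 u by (auto simp: module_hom_simps)
      have "t (u \<ominus>\<^bsub>V\<^esub> a \<odot>\<^bsub>V\<^esub> v') = t u \<ominus>\<^bsub>W\<^esub> a \<odot>\<^bsub>W\<^esub> t v'"
        using module_hom_minus[OF V W t u(1), of "a \<odot>\<^bsub>V\<^esub> v'"] da d0 tav by simp
      also have "\<dots> = d"
        unfolding u(2)[symmetric] using Dc[OF da(1)] da tav by (simp add: W.minus_eq W.a_assoc W.r_neg)
      \<comment> \<open>Subtracting the multiple \<open>a\<close> of \<open>v'\<close> from a
        preimage shows that the part in \<open>D\<close> is an image point too, so the old section
        already inverts \<open>t\<close> there.\<close>
      finally have "d \<in> t ` carrier V" using u da d0 by (metis V.minus_closed V.smult_closed imageI)
      then show "t (s d \<oplus>\<^bsub>V\<^esub> a \<odot>\<^bsub>V\<^esub> v') = d \<oplus>\<^bsub>W\<^esub> a \<odot>\<^bsub>W\<^esub> t v'"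
        using D(5,8) da d0 t tav by (simp add: module_hom_simps)
    qed
  next
    case no: False
    show ?thesis
    proof (intro exI[of _ w] exI[of _ "\<zero>\<^bsub>V\<^esub>"] conjI ballI impI)
      show "\<exists>d\<in>D. \<exists>a\<in>carrier K. w = d \<oplus>\<^bsub>W\<^esub> a \<odot>\<^bsub>W\<^esub> w"
        using D(2) w by (intro bexI[of _ "\<zero>\<^bsub>W\<^esub>"] bexI[of _ \<one>]) auto
      fix d a assume da: "d \<in> D" "a \<in> carrier K" "d \<oplus>\<^bsub>W\<^esub> a \<odot>\<^bsub>W\<^esub> w \<in> t ` carrier V"
      then have "a = \<zero>" using no by blast
      then show "t (s d \<oplus>\<^bsub>V\<^esub> a \<odot>\<^bsub>V\<^esub> \<zero>\<^bsub>V\<^esub>) = d \<oplus>\<^bsub>W\<^esub> a \<odot>\<^bsub>W\<^esub> w"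
        using D(5,8) da Dc w by simp
    qed (use w False in auto)
  qed
  then obtain w' v' where w': "w' \<in> carrier W" "v' \<in> carrier V" "w' \<notin> D"
      "\<exists>d\<in>D. \<exists>a\<in>carrier K. w = d \<oplus>\<^bsub>W\<^esub> a \<odot>\<^bsub>W\<^esub> w'"
      "\<And>d a. d\<in>D \<Longrightarrow> a\<in>carrier K \<Longrightarrow> d \<oplus>\<^bsub>W\<^esub> a \<odot>\<^bsub>W\<^esub> w' \<in> t ` carrier V \<Longrightarrow>
         t (s d \<oplus>\<^bsub>V\<^esub> a \<odot>\<^bsub>V\<^esub> v') = d \<oplus>\<^bsub>W\<^esub> a \<odot>\<^bsub>W\<^esub> w'"
    by blast
  define E where "E = {d \<oplus>\<^bsub>W\<^esub> a \<odot>\<^bsub>W\<^esub> w' | d a. d \<in> D \<and> a \<in> carrier K}"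
  have unique: "d = d' \<and> a = a'"
    if "d \<in> D" "d' \<in> D" "a \<in> carrier K" "a' \<in> carrier K" "d \<oplus>\<^bsub>W\<^esub> a \<odot>\<^bsub>W\<^esub> w' = d' \<oplus>\<^bsub>W\<^esub> a' \<odot>\<^bsub>W\<^esub> w'"
    for d d' a a'
  proof -
    have c: "d \<in> carrier W" "d' \<in> carrier W" "a \<odot>\<^bsub>W\<^esub> w' \<in> carrier W" "a' \<odot>\<^bsub>W\<^esub> w' \<in> carrier W"
      using Dc that w' by auto
    have "(a \<ominus> a') \<odot>\<^bsub>W\<^esub> w' = a \<odot>\<^bsub>W\<^esub> w' \<ominus>\<^bsub>W\<^esub> a' \<odot>\<^bsub>W\<^esub> w'"
      using that w' by (simp add: K.minus_eq W.minus_eq W.smult_l_distr W.smult_l_minus)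
    also have "\<dots> = \<ominus>\<^bsub>W\<^esub> d \<oplus>\<^bsub>W\<^esub> (d \<oplus>\<^bsub>W\<^esub> a \<odot>\<^bsub>W\<^esub> w') \<ominus>\<^bsub>W\<^esub> a' \<odot>\<^bsub>W\<^esub> w'"
      using c by (simp add: W.r_neg1)
    also have "\<dots> = \<ominus>\<^bsub>W\<^esub> d \<oplus>\<^bsub>W\<^esub> d'"
      unfolding that(5) using c by (simp add: W.minus_eq W.a_assoc W.r_neg)
    finally have "(a \<ominus> a') \<odot>\<^bsub>W\<^esub> w' \<in> D" using D(3)[OF Dneg] that by auto
    then have "a \<ominus> a' = \<zero>" using smult_notin[of "a \<ominus> a'" w'] w' that by auto
    then have "a = a'" using that by simp
    then show ?thesis using that(5) c by simp
  qed
  \<comment> \<open>As \<open>w'\<close> lies outside \<open>D\<close>, the decomposition is unique,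
    which makes this description a function.\<close>
  define s' where "s' x = (THE u. \<exists>d\<in>D. \<exists>a\<in>carrier K. x = d \<oplus>\<^bsub>W\<^esub> a \<odot>\<^bsub>W\<^esub> w' \<and> u = s d \<oplus>\<^bsub>V\<^esub> a \<odot>\<^bsub>V\<^esub> v')" for x
  have s': "s' (d \<oplus>\<^bsub>W\<^esub> a \<odot>\<^bsub>W\<^esub> w') = s d \<oplus>\<^bsub>V\<^esub> a \<odot>\<^bsub>V\<^esub> v'" if "d \<in> D" "a \<in> carrier K" for d a
    unfolding s'_def by (rule the_equality) (use that unique in blast)+
  have add: "(d \<oplus>\<^bsub>W\<^esub> a \<odot>\<^bsub>W\<^esub> w') \<oplus>\<^bsub>W\<^esub> (d' \<oplus>\<^bsub>W\<^esub> a' \<odot>\<^bsub>W\<^esub> w') = (d \<oplus>\<^bsub>W\<^esub> d') \<oplus>\<^bsub>W\<^esub> (a \<oplus> a') \<odot>\<^bsub>W\<^esub> w'"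
    if "d \<in> D" "d' \<in> D" "a \<in> carrier K" "a' \<in> carrier K" for d d' a a'
    using that Dc w' by (simp add: W.smult_l_distr W.a_ac)
  have smult: "c \<odot>\<^bsub>W\<^esub> (d \<oplus>\<^bsub>W\<^esub> a \<odot>\<^bsub>W\<^esub> w') = c \<odot>\<^bsub>W\<^esub> d \<oplus>\<^bsub>W\<^esub> (c \<otimes> a) \<odot>\<^bsub>W\<^esub> w'"
    if "d \<in> D" "a \<in> carrier K" "c \<in> carrier K" for d a c
    using that Dc w' by (simp add: W.smult_r_distr W.smult_assoc1)
  have EI: "d \<oplus>\<^bsub>W\<^esub> a \<odot>\<^bsub>W\<^esub> w' \<in> E" if "d \<in> D" "a \<in> carrier K" for d a
    using that unfolding E_def by blast
  have "partial_section K V W t E s'"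
    unfolding partial_section_def
  proof (intro conjI ballI impI)
    show "E \<subseteq> carrier W" unfolding E_def using Dc w' by auto
    show "\<zero>\<^bsub>W\<^esub> \<in> E" using EI[OF D(2) K.zero_closed] w' by simp
    show "x \<oplus>\<^bsub>W\<^esub> y \<in> E" if xy: "x \<in> E" "y \<in> E" for x y
    proof -
      obtain d a d' a' where "d \<in> D" "a \<in> carrier K" "d' \<in> D" "a' \<in> carrier K"
        "x = d \<oplus>\<^bsub>W\<^esub> a \<odot>\<^bsub>W\<^esub> w'" "y = d' \<oplus>\<^bsub>W\<^esub> a' \<odot>\<^bsub>W\<^esub> w'" using xy unfolding E_def by blast
      then show ?thesis using EI[of "d \<oplus>\<^bsub>W\<^esub> d'" "a \<oplus> a'"] D(3) add by simp
    qed
    show "c \<odot>\<^bsub>W\<^esub> x \<in> E" if cx: "c \<in> carrier K" "x \<in> E" for c x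
    proof -
      obtain d a where "d \<in> D" "a \<in> carrier K" "x = d \<oplus>\<^bsub>W\<^esub> a \<odot>\<^bsub>W\<^esub> w'" using cx unfolding E_def by blast
      then show ?thesis using EI[of "c \<odot>\<^bsub>W\<^esub> d" "c \<otimes> a"] D(4) smult cx by simp
    qed
    show "s' x \<in> carrier V" if "x \<in> E" for x
      using that s' D(5) w' unfolding E_def by auto
    show "s' (x \<oplus>\<^bsub>W\<^esub> y) = s' x \<oplus>\<^bsub>V\<^esub> s' y" if xy: "x \<in> E" "y \<in> E" for x y
    proof -
      obtain d a d' a' where "d \<in> D" "a \<in> carrier K" "d' \<in> D" "a' \<in> carrier K"
        "x = d \<oplus>\<^bsub>W\<^esub> a \<odot>\<^bsub>W\<^esub> w'" "y = d' \<oplus>\<^bsub>W\<^esub> a' \<odot>\<^bsub>W\<^esub> w'" using xy unfolding E_def by blast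
      then show ?thesis using add s' D(3,5,6) w'
        by (simp add: V.smult_l_distr V.a_ac)
    qed
    show "s' (c \<odot>\<^bsub>W\<^esub> x) = c \<odot>\<^bsub>V\<^esub> s' x" if cx: "c \<in> carrier K" "x \<in> E" for c x
    proof -
      obtain d a where "d \<in> D" "a \<in> carrier K" "x = d \<oplus>\<^bsub>W\<^esub> a \<odot>\<^bsub>W\<^esub> w'" using cx unfolding E_def by blast
      then show ?thesis using smult s' D(4,5,7) w' cx
        by (simp add: V.smult_r_distr V.smult_assoc1)
    qed
    show "t (s' x) = x" if xE: "x \<in> E" "x \<in> t ` carrier V" for x
    proof -
      obtain d a where "d \<in> D" "a \<in> carrier K" "x = d \<oplus>\<^bsub>W\<^esub> a \<odot>\<^bsub>W\<^esub> w'" using xE(1) unfolding E_def by blast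
      then show ?thesis using s' w'(5)[of d a] xE(2) by simp
    qed
  qed
  moreover have "D \<subseteq> E"
  proof
    fix d assume "d \<in> D"
    then show "d \<in> E" using EI[of d \<zero>] w' Dc by simp
  qed
  moreover have "w \<in> E" using w'(4) EI by blast
  ultimately show ?thesis by blast
qed

text \<open>The identity t s t = t has several uses below: for surjective \<open>t\<close> it makes
  \<open>s\<close> a section, for injective \<open>t\<close> a retraction; in general 1 - s t
  projects onto the kernel of \<open>t\<close>, and 1 - t s has the image of \<open>t\<close> as its
  kernel. The domain of \<open>s\<close> grows by one generator of \<open>W\<close> at a time and is
  everything after \<open>n\<close> steps.\<close>

lemma generalized_inverse:
  assumes K: "field K" and V: "module K V" and W: "module K W" and t: "t \<in> module_hom K V W"
    and "generated_by K W n"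
  obtains s where "s \<in> module_hom K W V" "\<And>v. v \<in> carrier V \<Longrightarrow> t (s (t v)) = t v"
proof -
  interpret V: module K V by fact
  interpret W: module K W by fact
  obtain e where e: "\<And>j. j < n \<Longrightarrow> e j \<in> carrier W"
    "\<And>v. v \<in> carrier W \<Longrightarrow> \<exists>c. (\<forall>j<n. c j \<in> carrier K) \<and> v = lcomb W c e n"
    using assms(5) unfolding generated_by_def by blast
  have "\<exists>D s. partial_section K V W t D s \<and> e ` {..<k} \<subseteq> D" if "k \<le> n" for k
    using that
  proof (induction k)
    case 0
    have "partial_section K V W t {\<zero>\<^bsub>W\<^esub>} (\<lambda>_. \<zero>\<^bsub>V\<^esub>)"
      unfolding partial_section_def using module_hom_zero[OF V W t] by auto
    then show ?case by auto
  next
    case (Suc k)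
    then obtain D s where D: "partial_section K V W t D s" "e ` {..<k} \<subseteq> D" by auto
    obtain D' s' where "partial_section K V W t D' s'" "D \<subseteq> D'" "e k \<in> D'"
      using partial_section_extend[OF K V W t D(1), of "e k"] e(1) Suc.prems by auto
    then show ?case using D(2) by (intro exI[of _ D'] exI[of _ s']) (auto simp: lessThan_Suc)
  qed
  then obtain D s where D: "partial_section K V W t D s" "e ` {..<n} \<subseteq> D" by blast
  have "lcomb W c e k \<in> D" if "\<forall>j<n. c j \<in> carrier K" "k \<le> n" for c k
    using that(2)
    by (induction k) (use D that(1) in \<open>auto simp: partial_section_def image_subset_iff\<close>)
  then have "carrier W \<subseteq> D" using e(2) by blast
  then have DW: "D = carrier W" using D(1) unfolding partial_section_def by blast
  show ?thesis
  proof (rule that)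
    show "s \<in> module_hom K W V"
      using D(1) unfolding partial_section_def DW by (intro module_homI) blast+
    show "t (s (t v)) = t v" if "v \<in> carrier V" for v
      using D(1) that t unfolding partial_section_def DW by (auto simp: module_hom_simps)
  qed
qed


section \<open>The category of finite dimensional comodules\<close>

text \<open>Comodules are built below by first constructing a module and then installing a coaction.
  The tensor product reads only the module part, so statements about it survive the update.\<close>

lemma tensor_coact_update [simp]:
  "tensor R (V\<lparr>coact := c\<rparr>) A = tensor R V A" "pure_tensor R (V\<lparr>coact := c\<rparr>) A = pure_tensor R V A"
proof -
  have 1: "tensor_null R (V\<lparr>coact := c\<rparr>) A = tensor_null R V A"
    by (simp add: tensor_null_def tensor_rels_def)
  then show 2: "pure_tensor R (V\<lparr>coact := c\<rparr>) A = pure_tensor R V A"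
    by (simp add: pure_tensor_def fun_eq_iff)
  have "tensor_group R (V\<lparr>coact := c\<rparr>) A = tensor_group R V A"
    by (simp add: tensor_group_def 1)
  then show "tensor R (V\<lparr>coact := c\<rparr>) A = tensor R V A"
    by (simp add: tensor_def 2)
qed

lemma module_coact_update [simp]: "module R (V\<lparr>coact := c\<rparr>) \<longleftrightarrow> module R V"
proof -
  have "abelian_group (V\<lparr>coact := c\<rparr>) \<longleftrightarrow> abelian_group V"
    unfolding abelian_group_def abelian_monoid_def comm_monoid_def comm_monoid_axioms_def monoid_def
      abelian_group_axioms_def comm_group_def group_def group_axioms_def Units_def by simp
  then show ?thesis
    unfolding module_def module_axioms_def by simp
qed

lemma module_hom_coact_update [simp]:
  "module_hom R (V\<lparr>coact := c\<rparr>) W = module_hom R V W"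
  "module_hom R W (V\<lparr>coact := c\<rparr>) = module_hom R W V"
  by (simp_all add: module_hom_def)

lemma tmap_coact_update [simp]: "tmap R (V\<lparr>coact := c\<rparr>) A = tmap R V A"
  by (simp add: tmap_def fun_eq_iff)

lemma comodule_hom_iff:
  "f \<in> comodule_hom R A V W \<longleftrightarrow> f \<in> module_hom R V W \<and>
     (\<forall>v\<in>carrier V. coact W (f v) = tmap R W A f (coact V v))"
  by (auto simp: comodule_hom_def tmap_def)

text \<open>Carriers of objects are subsets of one type, so a direct sum needs pairs of elements of
  that type to be coded in it again.\<close>

lemma infinite_pairing:
  assumes "infinite (UNIV :: 'v set)"
  obtains p :: "'v \<times> 'v \<Rightarrow> 'v" where "inj p"
proof -
  have "|(UNIV :: 'v set) \<times> (UNIV :: 'v set)| =o |UNIV :: 'v set|"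
    by (rule card_of_Times_same_infinite) (use assms in simp)
  then obtain p where "bij_betw p ((UNIV :: 'v set) \<times> (UNIV :: 'v set)) (UNIV :: 'v set)"
    using card_of_ordIso by blast
  then show ?thesis using that[of p] by (auto simp: bij_betw_def)
qed

text \<open>\<open>vtype\<close> fixes the type of vectors. Its infinity makes room for direct sums,
  hence for fibre products and Baer sums.\<close>

locale rep_setting = coalgebra_data K A + K: field K
  for K (structure) and A :: "('k, 'a, 'x) hopf_scheme" and vtype :: "'v itself" +
  assumes infinite_vtype: "infinite (UNIV :: 'v set)"
begin

abbreviation Obj :: "('k, 'a, 'v) comodule set" where "Obj \<equiv> rep_objects K A"

abbreviation "Lin V W \<equiv> module_hom K V W"
abbreviation "Hom V W \<equiv> comodule_hom K A V W"
abbreviation "tm W h \<equiv> tmap K W A h"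
abbreviation "gen V n \<equiv> generated_by K V n"

lemma module_vectorspace: "module K V \<Longrightarrow> vectorspace K V"
  by (simp add: vectorspace_def K.field_axioms)

lemma Obj_iff:
  "V \<in> Obj \<longleftrightarrow> module K V \<and> coact V \<in> Lin V (TA V) \<and>
     (\<forall>v\<in>carrier V. tcomult K V A (coact V v) = tcoact K V A (coact V) (coact V v)) \<and>
     (\<forall>v\<in>carrier V. tcounit V A (coact V v) = v) \<and> (\<exists>n. gen V n)"
  by (auto simp: rep_objects_def comodule_def comodule_axioms_def tcomult_def tcoact_def tcounit_def
      vectorspace.generated_by_iff module_vectorspace)

lemma Obj_module: "V \<in> Obj \<Longrightarrow> module K V"
  and Obj_coact: "V \<in> Obj \<Longrightarrow> coact V \<in> Lin V (TA V)"
  and Obj_coassoc: "V \<in> Obj \<Longrightarrow> v \<in> carrier V \<Longrightarrow>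
    tcomult K V A (coact V v) = tcoact K V A (coact V) (coact V v)"
  and Obj_counit: "V \<in> Obj \<Longrightarrow> v \<in> carrier V \<Longrightarrow> tcounit V A (coact V v) = v"
  and Obj_gen: "V \<in> Obj \<Longrightarrow> \<exists>n. gen V n"
  by (auto simp: Obj_iff)

lemma Obj_vectorspace: "V \<in> Obj \<Longrightarrow> vectorspace K V"
  using Obj_module module_vectorspace by blast

lemma gen_iff_dim: "V \<in> Obj \<Longrightarrow> gen V n \<longleftrightarrow> vectorspace.dim K V \<le> n"
  using vectorspace.generated_by_iff[OF Obj_vectorspace] Obj_gen by blast

lemma Hom_Lin: "f \<in> Hom V W \<Longrightarrow> f \<in> Lin V W"
  and Hom_coact: "f \<in> Hom V W \<Longrightarrow> v \<in> carrier V \<Longrightarrow> coact W (f v) = tm W f (coact V v)"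
  by (auto simp: comodule_hom_iff)

lemma coact_closed: "V \<in> Obj \<Longrightarrow> v \<in> carrier V \<Longrightarrow> coact V v \<in> carrier (TA V)"
  using Obj_coact module_hom_carrier by metis

text \<open>By naturality, coassociativity and the counit law at \<open>h v\<close> are images of
  the laws at \<open>v\<close>.\<close>

lemma comodule_laws_image:
  assumes V: "V \<in> Obj" and W: "module K W" "coact W \<in> Lin W (TA W)" and h: "h \<in> Hom V W" and v: "v \<in> carrier V"
  shows "tcomult K W A (coact W (h v)) = tcoact K W A (coact W) (coact W (h v))"
    and "tcounit W A (coact W (h v)) = h v"
proof -
  note * = Obj_module[OF V] W(1) Hom_Lin[OF h] coact_closed[OF V v]
  show "tcomult K W A (coact W (h v)) = tcoact K W A (coact W) (coact W (h v))"
    using Hom_coact[OF h v] tcomult_natural[OF *] Obj_coassoc[OF V v]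
      tcoact_natural[OF * Obj_coact[OF V] W(2)] Hom_coact[OF h] by simp
  show "tcounit W A (coact W (h v)) = h v"
    using Hom_coact[OF h v] tcounit_natural[OF *] Obj_counit[OF V v] by simp
qed

lemma Obj_quotient:
  assumes V: "V \<in> Obj" and W: "module K W" "coact W \<in> Lin W (TA W)" and h: "h \<in> Hom V W"
    and "carrier W \<subseteq> h ` carrier V"
  shows "W \<in> Obj"
  using comodule_laws_image[OF V W h] assms(5) W Obj_gen[OF V]
    generated_by_surj[OF Obj_module[OF V] W(1) Hom_Lin[OF h] assms(5)]
  unfolding Obj_iff by blast

text \<open>The laws hold in \<open>W\<close> after applying h \<otimes> 1. The retraction
  \<open>r\<close> is merely linear, but it makes h \<otimes> 1 injective, so the laws hold already
  in \<open>W\<close>.\<close>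

lemma Obj_sub:
  assumes V: "V \<in> Obj" and W: "module K W" "coact W \<in> Lin W (TA W)" and h: "h \<in> Hom W V"
    and r: "r \<in> Lin V W" "\<And>w. w \<in> carrier W \<Longrightarrow> r (h w) = w"
  shows "W \<in> Obj"
proof -
  note VM = Obj_module[OF V]
  note AM = A.module_axioms AA.tensor_module
  have rW: "carrier W \<subseteq> r ` carrier V"
    using r(2) Hom_Lin[OF h] by (metis image_eqI module_hom_carrier subsetI)
  have "tcomult K W A (coact W w) = tcoact K W A (coact W) (coact W w)" "tcounit W A (coact W w) = w"
    if w: "w \<in> carrier W" for w
  proof -
    have cw: "coact W w \<in> carrier (TA W)" using W(2) w module_hom_carrier by metis
    have hw: "h w \<in> carrier V" using Hom_Lin[OF h] w module_hom_carrier by metis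
    note * = W(1) VM Hom_Lin[OF h] cw
    have cc: "tcomult K W A (coact W w) \<in> carrier (TAA W)" "tcoact K W A (coact W) (coact W w) \<in> carrier (TAA W)"
      using module_hom_carrier[OF tcomult_hom[OF W(1)] cw] module_hom_carrier[OF tcoact_hom[OF W(1) W(1) W(2)] cw] by auto
    have "tmap K V (tensor K A A) h (tcomult K W A (coact W w)) =
        tmap K V (tensor K A A) h (tcoact K W A (coact W) (coact W w))"
      using tcomult_natural[OF *] tcoact_natural[OF * W(2) Obj_coact[OF V]] Hom_coact[OF h] w
        Obj_coassoc[OF V hw] by simp
    then have "tmap K W (tensor K A A) r (tmap K V (tensor K A A) h (tcomult K W A (coact W w))) =
       tmap K W (tensor K A A) r (tmap K V (tensor K A A) h (tcoact K W A (coact W) (coact W w)))" by simp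
    then show "tcomult K W A (coact W w) = tcoact K W A (coact W) (coact W w)"
      using tmap_comp[OF W(1) VM W(1) AM(2) Hom_Lin[OF h] r(1), of "\<lambda>x. x"] r(2)
        tmap_id[OF W(1) AM(2), of "\<lambda>x. x"] cc by simp
    have "h (tcounit W A (coact W w)) = h w"
      using tcounit_natural[OF *] Hom_coact[OF h w] Obj_counit[OF V hw] by simp
    then show "tcounit W A (coact W w) = w"
      using r(2) w module_hom_carrier[OF tcounit_hom[OF W(1)] cw] by metis
  qed
  then show ?thesis using W Obj_gen[OF V] generated_by_surj[OF VM W(1) r(1) rW]
    unfolding Obj_iff by blast
qed

text \<open>Subobjects and quotients are both realised on the image of an idempotent endomorphism of
  \<open>X\<close>. A quotient then has its carrier inside that of \<open>X\<close>, instead of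
  consisting of cosets, which have another type.\<close>

lemma idempotent_image:
  assumes X: "module K X" and \<pi>: "\<pi> \<in> Lin X X" and idem: "\<And>x. x \<in> carrier X \<Longrightarrow> \<pi> (\<pi> x) = \<pi> x"
  shows "module K (X\<lparr>carrier := \<pi> ` carrier X\<rparr>)" 
    and "\<pi> \<in> Lin X (X\<lparr>carrier := \<pi> ` carrier X\<rparr>)"
    and "(\<lambda>x. x) \<in> Lin (X\<lparr>carrier := \<pi> ` carrier X\<rparr>) X"
proof -
  let ?I = "X\<lparr>carrier := \<pi> ` carrier X\<rparr>"
  interpret X: module K X by fact
  have sub: "\<pi> ` carrier X \<subseteq> carrier X" using \<pi> by (auto simp: module_hom_carrier)
  have "Module.submodule (\<pi> ` carrier X) K X"
  proof (rule X.submoduleI[OF sub])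
    show "\<zero>\<^bsub>X\<^esub> \<in> \<pi> ` carrier X" using module_hom_zero[OF X X \<pi>] by (metis X.zero_closed imageI)
    show "a \<oplus>\<^bsub>X\<^esub> b \<in> \<pi> ` carrier X" if "a \<in> \<pi> ` carrier X" "b \<in> \<pi> ` carrier X" for a b
      using that module_hom_add[OF \<pi>] by (auto simp flip: module_hom_add[OF \<pi>])
    show sm: "c \<odot>\<^bsub>X\<^esub> a \<in> \<pi> ` carrier X" if "c \<in> carrier K" "a \<in> \<pi> ` carrier X" for a c
      using that by (auto simp flip: module_hom_smult[OF \<pi>])
    show "\<ominus>\<^bsub>X\<^esub> a \<in> \<pi> ` carrier X" if "a \<in> \<pi> ` carrier X" for a
      using sm[of "\<ominus> \<one>" a] that sub by (auto simp: X.smult_l_minus)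
  qed
  then show "module K ?I" by (rule Module.submodule.submodule_is_module) fact
  show "\<pi> \<in> Lin X ?I" "(\<lambda>x. x) \<in> Lin ?I X" using \<pi> sub by (auto simp: module_hom_def)
qed

lemma Lin_id_minus:
  assumes X: "module K X" and f: "f \<in> Lin X X"
  shows "(\<lambda>x. x \<ominus>\<^bsub>X\<^esub> f x) \<in> Lin X X"
proof -
  interpret X: module K X by fact
  show ?thesis using f
    by (intro module_homI) (auto simp: module_hom_simps X.minus_eq X.minus_add X.a_ac X.smult_r_distr X.smult_r_minus)
qed

text \<open>For a generalized inverse \<open>s\<close> of \<open>t\<close> the map 1 - s t projects
  onto the kernel, and the coaction of \<open>X\<close> followed by \<pi> \<otimes> 1 is the
  coaction of the kernel.\<close>

lemma kernel_object:
  assumes X: "X \<in> Obj" and Y: "Y \<in> Obj" and t: "t \<in> Hom X Y"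
  obtains V where "V \<in> Obj" "carrier V = {x \<in> carrier X. t x = \<zero>\<^bsub>Y\<^esub>}" "(\<lambda>x. x) \<in> Hom V X" "\<zero>\<^bsub>V\<^esub> = \<zero>\<^bsub>X\<^esub>"
    "\<And>n. gen X n \<Longrightarrow> gen V n"
proof -
  note XM = Obj_module[OF X] and YM = Obj_module[OF Y] and tL = Hom_Lin[OF t]
  interpret X: module K X by (rule XM)
  interpret Y: module K Y by (rule YM)
  obtain n where "gen Y n" using Obj_gen[OF Y] by blast
  then obtain s where s: "s \<in> Lin Y X" "\<And>v. v \<in> carrier X \<Longrightarrow> t (s (t v)) = t v"
    using generalized_inverse[OF K.field_axioms XM YM tL] by blast
  define \<pi> where "\<pi> x = x \<ominus>\<^bsub>X\<^esub> s (t x)" for x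
  have st: "(\<lambda>x. s (t x)) \<in> Lin X X" by (rule module_hom_compose[OF tL s(1)])
  have \<pi>: "\<pi> \<in> Lin X X" unfolding \<pi>_def by (rule Lin_id_minus[OF XM st])
  have t\<pi>: "t (\<pi> x) = \<zero>\<^bsub>Y\<^esub>" if "x \<in> carrier X" for x
    unfolding \<pi>_def using that module_hom_minus[OF XM YM tL] s module_hom_carrier[OF st] module_hom_carrier[OF tL]
    by (simp add: Y.minus_eq Y.r_neg)
  have \<pi>k: "\<pi> x = x" if "x \<in> carrier X" "t x = \<zero>\<^bsub>Y\<^esub>" for x
    unfolding \<pi>_def using that module_hom_zero[OF YM XM s(1)] by (simp add: X.minus_eq)
  have idem: "\<pi> (\<pi> x) = \<pi> x" if "x \<in> carrier X" for x
    using \<pi>k[of "\<pi> x"] t\<pi> that module_hom_carrier[OF \<pi>] by simp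
  define I where "I = X\<lparr>carrier := \<pi> ` carrier X\<rparr>"
  have I: "module K I" "\<pi> \<in> Lin X I" "(\<lambda>x. x) \<in> Lin I X"
    unfolding I_def using idempotent_image[OF XM \<pi>] idem by auto
  define V where "V = I\<lparr>coact := \<lambda>x. tm I \<pi> (coact X x)\<rparr>"
  have cV: "carrier V = {x \<in> carrier X. t x = \<zero>\<^bsub>Y\<^esub>}"
    unfolding V_def I_def using \<pi>k t\<pi> module_hom_carrier[OF \<pi>] by (force intro: rev_image_eqI)
  have VI [simp]: "module K V = module K I" "\<And>W. Lin V W = Lin I W" "\<And>W. Lin W V = Lin W I" "TA V = TA I" "tm V = tm I"
    by (simp_all add: V_def)
  have coV: "coact V \<in> Lin V (TA V)"
    using module_hom_compose[OF I(3) module_hom_compose[OF Obj_coact[OF X] tmap_hom[OF XM I(1) A.module_axioms I(2)]]]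
    by (simp add: V_def)
  have incl: "(\<lambda>x. x) \<in> Hom V X"
    unfolding comodule_hom_iff
  proof (intro conjI ballI)
    show "(\<lambda>x. x) \<in> Lin V X" using I(3) by simp
    fix x assume "x \<in> carrier V"
    then have x: "x \<in> carrier X" "t x = \<zero>\<^bsub>Y\<^esub>" using cV by auto
    note cx = coact_closed[OF X x(1)]
    \<comment> \<open>On the kernel, the part of the coaction that \<pi> \<otimes> 1 removes is s
      \<otimes> 1 applied to the coaction of t x = 0, as \<open>t\<close> is a comodule map. So the
      coaction of \<open>X\<close> already lands in the kernel tensored with
      \<open>A\<close>.\<close>
    have xk: "tm X (\<lambda>x. s (t x)) (coact X x) = \<zero>\<^bsub>TA X\<^esub>"
    proof -
      have "tm X (\<lambda>x. s (t x)) (coact X x) = tm X s (tm Y t (coact X x))"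
        by (rule tmap_comp[OF XM YM XM A.module_axioms tL s(1) _ cx, symmetric]) simp
      also have "\<dots> = tm X s (coact Y \<zero>\<^bsub>Y\<^esub>)" using Hom_coact[OF t x(1)] x(2) by simp
      also have "\<dots> = \<zero>\<^bsub>TA X\<^esub>"
        using module_hom_zero[OF YM tensor_is_module[OF XM A.module_axioms]
          module_hom_compose[OF Obj_coact[OF Y] tmap_hom[OF YM XM A.module_axioms s(1)]]] .
      finally show ?thesis .
    qed
    have "coact X x = tm X (\<lambda>x. x) (coact X x)"
      using tmap_id[OF XM A.module_axioms, of "\<lambda>x. x"] cx by simp
    also have "\<dots> = tm X \<pi> (coact X x) \<oplus>\<^bsub>TA X\<^esub> tm X (\<lambda>x. s (t x)) (coact X x)"
      by (rule tmap_add[OF XM XM A.module_axioms \<pi> st _ cx])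
        (use module_hom_carrier[OF st] in \<open>simp add: \<pi>_def X.minus_eq X.a_assoc X.l_neg\<close>)
    also have "\<dots> = tm X \<pi> (coact X x)"
    proof -
      interpret TX: module K "TA X" by (rule tensor_is_module[OF XM A.module_axioms])
      show ?thesis unfolding xk using module_hom_carrier[OF tmap_hom[OF XM XM A.module_axioms \<pi>] cx] by simp
    qed
    also have "\<dots> = tm X (\<lambda>x. x) (tm I \<pi> (coact X x))"
      by (rule tmap_comp[where g = "\<lambda>x. x" and k = \<pi>, OF XM I(1) XM A.module_axioms I(2,3) refl cx, symmetric])
    finally show "coact X x = tm X (\<lambda>x. x) (coact V x)" by (simp add: V_def)
  qed
  have IM: "module K V" "\<pi> \<in> Lin X V" using I by auto
  have "\<And>w. w \<in> carrier V \<Longrightarrow> \<pi> w = w" using cV \<pi>k by auto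
  then have "V \<in> Obj" using Obj_sub[OF X IM(1) coV incl IM(2)] by blast
  moreover have "\<zero>\<^bsub>V\<^esub> = \<zero>\<^bsub>X\<^esub>" by (simp add: V_def I_def)
  moreover have "gen V n" if "gen X n" for n
    by (rule generated_by_surj[OF XM IM _ that]) (simp add: V_def I_def)
  ultimately show ?thesis using that cV incl by blast
qed

text \<open>With a generalized inverse \<open>s\<close> of \<open>f\<close>, the map 1 - f s is
  idempotent and its kernel is the image of \<open>f\<close>; its own image is a complement, which
  stands for the quotient.\<close>

lemma cokernel_object:
  assumes N: "N \<in> Obj" and X: "X \<in> Obj" and f: "f \<in> Hom N X"
  obtains Q q where "Q \<in> Obj" "q \<in> Hom X Q" "q ` carrier X = carrier Q"
    "\<And>x. x \<in> carrier X \<Longrightarrow> q x = \<zero>\<^bsub>Q\<^esub> \<longleftrightarrow> x \<in> f ` carrier N"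
    "\<And>n. gen X n \<Longrightarrow> gen Q n"
proof -
  note XM = Obj_module[OF X] and NM = Obj_module[OF N] and fL = Hom_Lin[OF f]
  interpret X: module K X by (rule XM)
  interpret N: module K N by (rule NM)
  obtain n where "gen X n" using Obj_gen[OF X] by blast
  then obtain s where s: "s \<in> Lin X N" "\<And>v. v \<in> carrier N \<Longrightarrow> f (s (f v)) = f v"
    using generalized_inverse[OF K.field_axioms NM XM fL] by blast
  define q where "q x = x \<ominus>\<^bsub>X\<^esub> f (s x)" for x
  have fs: "(\<lambda>x. f (s x)) \<in> Lin X X" by (rule module_hom_compose[OF s(1) fL])
  have q: "q \<in> Lin X X" unfolding q_def by (rule Lin_id_minus[OF XM fs])
  have qf: "q (f x) = \<zero>\<^bsub>X\<^esub>" if "x \<in> carrier N" for x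
    unfolding q_def using that s(2) module_hom_carrier[OF fL] by (simp add: X.minus_eq X.r_neg)
  have idem: "q (q x) = q x" if "x \<in> carrier X" for x
  proof -
    have "q (q x) = q (x \<ominus>\<^bsub>X\<^esub> f (s x))" by (simp only: q_def[of x])
    also have "\<dots> = q x \<ominus>\<^bsub>X\<^esub> q (f (s x))"
      by (rule module_hom_minus[OF XM XM q that module_hom_carrier[OF fs that]])
    also have "\<dots> = q x"
      using qf[of "s x"] module_hom_carrier[OF s(1) that] module_hom_carrier[OF q that]
      by (simp add: X.minus_eq)
    finally show ?thesis .
  qed
  define I where "I = X\<lparr>carrier := q ` carrier X\<rparr>"
  have I: "module K I" "q \<in> Lin X I" "(\<lambda>x. x) \<in> Lin I X"
    unfolding I_def using idempotent_image[OF XM q] idem by auto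
  define Q where "Q = I\<lparr>coact := \<lambda>x. tm I q (coact X x)\<rparr>"
  have QI [simp]: "module K Q = module K I" "\<And>W. Lin Q W = Lin I W" "\<And>W. Lin W Q = Lin W I" "TA Q = TA I" "tm Q = tm I"
    by (simp_all add: Q_def)
  have coQ: "coact Q \<in> Lin Q (TA Q)"
    using module_hom_compose[OF I(3) module_hom_compose[OF Obj_coact[OF X] tmap_hom[OF XM I(1) A.module_axioms I(2)]]]
    by (simp add: Q_def)
  interpret TX: module K "TA X" by (rule tensor_is_module[OF XM A.module_axioms])
  interpret TI: module K "TA I" by (rule tensor_is_module[OF I(1) A.module_axioms])
  have qHom: "q \<in> Hom X Q"
    unfolding comodule_hom_iff
  proof (intro conjI ballI)
    show "q \<in> Lin X Q" using I(2) by simp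
    fix x assume x: "x \<in> carrier X"
    note qx = module_hom_carrier[OF q x] and sx = module_hom_carrier[OF s(1) x] and fsx = module_hom_carrier[OF fs x]
    \<comment> \<open>\<kappa> is to be the coaction of the class of \<open>x\<close>. It vanishes
      on the image of \<open>f\<close>, because \<open>f\<close> is a comodule map and
      \<open>q\<close> kills that image; hence it has the same value at \<open>x\<close> and at the
      representative \<open>q x\<close>.\<close>
    define \<kappa> where "\<kappa> = (\<lambda>x. tm I q (coact X x))"
    have \<kappa>: "\<kappa> \<in> Lin X (TA I)"
      unfolding \<kappa>_def by (rule module_hom_compose[OF Obj_coact[OF X] tmap_hom[OF XM I(1) A.module_axioms I(2)]])
    have "\<kappa> (f (s x)) = tm I q (tm X f (coact N (s x)))"
      unfolding \<kappa>_def using Hom_coact[OF f sx] by simp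
    also have "\<dots> = tm I (\<lambda>x. q (f x)) (coact N (s x))"
      by (rule tmap_comp[where k = "\<lambda>x. q (f x)", OF NM XM I(1) A.module_axioms fL I(2) refl coact_closed[OF N sx]])
    also have "\<dots> = \<zero>\<^bsub>TA I\<^esub>"
      by (rule tmap_zero[OF NM I(1) A.module_axioms _ coact_closed[OF N sx]]) (use qf in \<open>simp add: I_def\<close>)
    finally have "\<kappa> (q x) = \<kappa> x"
      using module_hom_minus[OF XM TI.module_axioms \<kappa> x fsx] module_hom_carrier[OF \<kappa> x]
      by (simp add: q_def[of x] TI.minus_eq)
    then show "coact Q (q x) = tm Q q (coact X x)"
      by (simp add: Q_def \<kappa>_def)
  qed
  have IM: "module K Q" "q \<in> Lin X Q" using I by auto
  have cQ: "q ` carrier X = carrier Q" by (simp add: Q_def I_def)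
  have "Q \<in> Obj" using Obj_quotient[OF X IM(1) coQ qHom] cQ by blast
  moreover have "q x = \<zero>\<^bsub>Q\<^esub> \<longleftrightarrow> x \<in> f ` carrier N" if x: "x \<in> carrier X" for x
  proof
    assume "q x = \<zero>\<^bsub>Q\<^esub>"
    then have "x \<ominus>\<^bsub>X\<^esub> f (s x) = \<zero>\<^bsub>X\<^esub>" by (simp add: q_def Q_def I_def)
    then have "x = f (s x)" using x module_hom_carrier[OF fs x] by simp
    then show "x \<in> f ` carrier N" using module_hom_carrier[OF s(1) x] by blast
  qed (use qf in \<open>auto simp: Q_def I_def\<close>)
  moreover have "gen Q n" if "gen X n" for n
    by (rule generated_by_surj[OF XM IM _ that]) (simp add: Q_def I_def)
  ultimately show ?thesis using that qHom cQ by blast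
qed

lemma direct_sum_object:
  assumes X: "X \<in> Obj" and Y: "Y \<in> Obj"
  obtains S i1 i2 p1 p2 where "S \<in> Obj" "i1 \<in> Hom X S" "i2 \<in> Hom Y S" "p1 \<in> Hom S X" "p2 \<in> Hom S Y"
    "\<And>x. x \<in> carrier X \<Longrightarrow> p1 (i1 x) = x" "\<And>x. x \<in> carrier X \<Longrightarrow> p2 (i1 x) = \<zero>\<^bsub>Y\<^esub>"
    "\<And>y. y \<in> carrier Y \<Longrightarrow> p1 (i2 y) = \<zero>\<^bsub>X\<^esub>" "\<And>y. y \<in> carrier Y \<Longrightarrow> p2 (i2 y) = y"
    "\<And>z. z \<in> carrier S \<Longrightarrow> i1 (p1 z) \<oplus>\<^bsub>S\<^esub> i2 (p2 z) = z"
    "\<And>n m. gen X n \<Longrightarrow> gen Y m \<Longrightarrow> gen S (n + m)"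
proof -
  note XM = Obj_module[OF X] and YM = Obj_module[OF Y]
  note AM = A.module_axioms
  interpret X: module K X by (rule XM)
  interpret Y: module K Y by (rule YM)
  obtain pr :: "'v \<times> 'v \<Rightarrow> 'v" where pr: "inj pr" using infinite_pairing[OF infinite_vtype] .
  define p1 where "p1 z = fst (inv_into UNIV pr z)" for z
  define p2 where "p2 z = snd (inv_into UNIV pr z)" for z
  have p [simp]: "p1 (pr (x, y)) = x" "p2 (pr (x, y)) = y" for x y
    using pr by (simp_all add: p1_def p2_def)
  define I :: "('k, 'a, 'v) comodule" where
    "I = \<lparr>carrier = pr ` (carrier X \<times> carrier Y), monoid.mult = undefined, monoid.one = undefined,
        ring.zero = pr (\<zero>\<^bsub>X\<^esub>, \<zero>\<^bsub>Y\<^esub>), ring.add = (\<lambda>z w. pr (p1 z \<oplus>\<^bsub>X\<^esub> p1 w, p2 z \<oplus>\<^bsub>Y\<^esub> p2 w)),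
        smult = (\<lambda>c z. pr (c \<odot>\<^bsub>X\<^esub> p1 z, c \<odot>\<^bsub>Y\<^esub> p2 z)), coact = undefined\<rparr>"
  have I [simp]: "carrier I = pr ` (carrier X \<times> carrier Y)" "\<zero>\<^bsub>I\<^esub> = pr (\<zero>\<^bsub>X\<^esub>, \<zero>\<^bsub>Y\<^esub>)"
     "z \<oplus>\<^bsub>I\<^esub> w = pr (p1 z \<oplus>\<^bsub>X\<^esub> p1 w, p2 z \<oplus>\<^bsub>Y\<^esub> p2 w)" "c \<odot>\<^bsub>I\<^esub> z = pr (c \<odot>\<^bsub>X\<^esub> p1 z, c \<odot>\<^bsub>Y\<^esub> p2 z)" for z w c
    by (simp_all add: I_def)
  have IM: "module K I"
  proof (intro moduleI abelian_groupI)
    show "\<exists>y\<in>carrier I. y \<oplus>\<^bsub>I\<^esub> x = \<zero>\<^bsub>I\<^esub>" if "x \<in> carrier I" for x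
      using that X.l_neg Y.l_neg by (intro bexI[of _ "pr (\<ominus>\<^bsub>X\<^esub> p1 x, \<ominus>\<^bsub>Y\<^esub> p2 x)"]) auto
  qed (auto simp: X.a_assoc Y.a_assoc X.smult_r_distr Y.smult_r_distr X.smult_l_distr Y.smult_l_distr
      X.smult_assoc1 Y.smult_assoc1 A.R.is_cring X.a_comm Y.a_comm X.a_lcomm Y.a_lcomm)
  define i1 where "i1 x = pr (x, \<zero>\<^bsub>Y\<^esub>)" for x
  define i2 where "i2 y = pr (\<zero>\<^bsub>X\<^esub>, y)" for y
  have L: "i1 \<in> Lin X I" "i2 \<in> Lin Y I" "p1 \<in> Lin I X" "p2 \<in> Lin I Y"
    by (auto intro!: module_homI simp: i1_def i2_def)
  define \<rho> where "\<rho> z = tm I i1 (coact X (p1 z)) \<oplus>\<^bsub>TA I\<^esub> tm I i2 (coact Y (p2 z))" for z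
  define S where "S = I\<lparr>coact := \<rho>\<rparr>"
  have SI [simp]: "module K S = module K I" "\<And>W. Lin S W = Lin I W" "\<And>W. Lin W S = Lin W I" "TA S = TA I" "tm S = tm I"
     "carrier S = carrier I"
    by (simp_all add: S_def)
  interpret TI: module K "TA I" by (rule tensor_is_module[OF IM AM])
  interpret TX: module K "TA X" by (rule tensor_is_module[OF XM AM])
  interpret TY: module K "TA Y" by (rule tensor_is_module[OF YM AM])
  have R: "(\<lambda>z. tm I i1 (coact X (p1 z))) \<in> Lin I (TA I)" "(\<lambda>z. tm I i2 (coact Y (p2 z))) \<in> Lin I (TA I)"
    using module_hom_compose[OF L(3) module_hom_compose[OF Obj_coact[OF X] tmap_hom[OF XM IM AM L(1)]]]
      module_hom_compose[OF L(4) module_hom_compose[OF Obj_coact[OF Y] tmap_hom[OF YM IM AM L(2)]]] by auto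
  have \<rho>: "\<rho> \<in> Lin I (TA I)"
    unfolding \<rho>_def
    by (rule module_homI) (simp_all add: module_hom_simps[OF R(1)] module_hom_simps[OF R(2)] TI.a_ac TI.smult_r_distr
        del: I)
  then have coS: "coact S \<in> Lin S (TA S)" by (simp add: S_def)
  have z0: "tm I i1 (coact X \<zero>\<^bsub>X\<^esub>) = \<zero>\<^bsub>TA I\<^esub>" "tm I i2 (coact Y \<zero>\<^bsub>Y\<^esub>) = \<zero>\<^bsub>TA I\<^esub>"
    using module_hom_zero[OF XM TI.module_axioms module_hom_compose[OF Obj_coact[OF X] tmap_hom[OF XM IM AM L(1)]]]
      module_hom_zero[OF YM TI.module_axioms module_hom_compose[OF Obj_coact[OF Y] tmap_hom[OF YM IM AM L(2)]]] by auto
  have i1H: "i1 \<in> Hom X S"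
    unfolding comodule_hom_iff
    using L(1) z0 module_hom_carrier[OF tmap_hom[OF XM IM AM L(1)] coact_closed[OF X]]
    by (auto simp: S_def \<rho>_def i1_def)
  have i2H: "i2 \<in> Hom Y S"
    unfolding comodule_hom_iff
    using L(2) z0 module_hom_carrier[OF tmap_hom[OF YM IM AM L(2)] coact_closed[OF Y]]
    by (auto simp: S_def \<rho>_def i2_def)
  have dec: "i1 (p1 z) \<oplus>\<^bsub>S\<^esub> i2 (p2 z) = z" if "z \<in> carrier S" for z
    using that by (auto simp: S_def i1_def i2_def)
  \<comment> \<open>The laws are additive in the vector, and \<open>z\<close> is the sum of its two
    components, each of which lies in the image of a comodule map from an object.\<close>
  have law: "tcomult K S A (coact S z) = tcoact K S A (coact S) (coact S z) \<and> tcounit S A (coact S z) = z"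
    if z: "z \<in> carrier S" for z
  proof -
    have xy: "p1 z \<in> carrier X" "p2 z \<in> carrier Y" using z L(3,4) by (auto simp del: I simp: module_hom_carrier)
    have SM: "module K S" using IM by simp
    let ?x = "i1 (p1 z)" and ?y = "i2 (p2 z)"
    have s: "?x \<in> carrier S" "?y \<in> carrier S" using xy L(1,2) by (auto simp del: I simp: module_hom_carrier)
    note c = module_hom_carrier[OF coS]
    have cz: "coact S z = coact S ?x \<oplus>\<^bsub>TA S\<^esub> coact S ?y"
      using module_hom_add[OF coS s] dec[OF z] by simp
    show ?thesis
      using comodule_laws_image[OF X SM coS i1H xy(1)] comodule_laws_image[OF Y SM coS i2H xy(2)]
        module_hom_add[OF tcomult_hom[OF SM] c c, OF s] module_hom_add[OF tcoact_hom[OF SM SM coS] c c, OF s]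
        module_hom_add[OF tcounit_hom[OF SM] c c, OF s] dec[OF z]
      by (simp only: cz)
  qed
  have genS: "gen S (n + m)" if "gen X n" "gen Y m" for n m
  proof (rule generated_by_sum[OF XM YM _ _ _ _ that, of _ i1 i2])
    fix z assume z: "z \<in> carrier S"
    then have "p1 z \<in> carrier X" "p2 z \<in> carrier Y" using L(3,4) by (auto simp del: I simp: module_hom_carrier)
    then show "\<exists>v\<in>carrier X. \<exists>w\<in>carrier Y. z = i1 v \<oplus>\<^bsub>S\<^esub> i2 w" using dec[OF z] by metis
  qed (use IM L in auto)
  have SO: "S \<in> Obj"
  proof -
    obtain n m where "gen X n" "gen Y m" using Obj_gen[OF X] Obj_gen[OF Y] by blast
    then have "\<exists>n. gen S n" using genS by blast
    then show ?thesis using law coS IM unfolding Obj_iff by auto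
  qed
  have coactS: "coact S z = tm I i1 (coact X (p1 z)) \<oplus>\<^bsub>TA I\<^esub> tm I i2 (coact Y (p2 z))" for z
    by (simp add: S_def \<rho>_def)
  have p1H: "p1 \<in> Hom S X"
    unfolding comodule_hom_iff
  proof (intro conjI ballI)
    show "p1 \<in> Lin S X" using L by simp
    fix z assume z: "z \<in> carrier S"
    then have xy: "p1 z \<in> carrier X" "p2 z \<in> carrier Y" using L(3,4) by (auto simp del: I simp: module_hom_carrier)
    note cx = coact_closed[OF X xy(1)] and cy = coact_closed[OF Y xy(2)]
    have "tm X p1 (coact S z) = tm X p1 (tm I i1 (coact X (p1 z))) \<oplus>\<^bsub>TA X\<^esub> tm X p1 (tm I i2 (coact Y (p2 z)))"
      unfolding coactS
      by (rule module_hom_add[OF tmap_hom[OF IM XM AM L(3)]])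
        (use cx cy tmap_hom[OF XM IM AM L(1)] tmap_hom[OF YM IM AM L(2)] in \<open>auto simp: module_hom_carrier\<close>)
    also have "tm X p1 (tm I i1 (coact X (p1 z))) = tm X (\<lambda>x. x) (coact X (p1 z))"
      by (rule tmap_comp[OF XM IM XM AM L(1) L(3) _ cx]) (simp add: i1_def)
    also have "\<dots> = coact X (p1 z)" by (rule tmap_id[OF XM AM _ cx]) simp
    also have "tm X p1 (tm I i2 (coact Y (p2 z))) = tm X (\<lambda>x. \<zero>\<^bsub>X\<^esub>) (coact Y (p2 z))"
      by (rule tmap_comp[OF YM IM XM AM L(2) L(3) _ cy]) (simp add: i2_def)
    also have "\<dots> = \<zero>\<^bsub>TA X\<^esub>" by (rule tmap_zero[OF YM XM AM _ cy]) simp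
    finally show "coact X (p1 z) = tm X p1 (coact S z)" using cx by simp
  qed
  have p2H: "p2 \<in> Hom S Y"
    unfolding comodule_hom_iff
  proof (intro conjI ballI)
    show "p2 \<in> Lin S Y" using L by simp
    fix z assume z: "z \<in> carrier S"
    then have xy: "p1 z \<in> carrier X" "p2 z \<in> carrier Y" using L(3,4) by (auto simp del: I simp: module_hom_carrier)
    note cx = coact_closed[OF X xy(1)] and cy = coact_closed[OF Y xy(2)]
    have "tm Y p2 (coact S z) = tm Y p2 (tm I i1 (coact X (p1 z))) \<oplus>\<^bsub>TA Y\<^esub> tm Y p2 (tm I i2 (coact Y (p2 z)))"
      unfolding coactS
      by (rule module_hom_add[OF tmap_hom[OF IM YM AM L(4)]])
        (use cx cy tmap_hom[OF XM IM AM L(1)] tmap_hom[OF YM IM AM L(2)] in \<open>auto simp: module_hom_carrier\<close>)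
    also have "tm Y p2 (tm I i1 (coact X (p1 z))) = tm Y (\<lambda>x. \<zero>\<^bsub>Y\<^esub>) (coact X (p1 z))"
      by (rule tmap_comp[OF XM IM YM AM L(1) L(4) _ cx]) (simp add: i1_def)
    also have "\<dots> = \<zero>\<^bsub>TA Y\<^esub>" by (rule tmap_zero[OF XM YM AM _ cx]) simp
    also have "tm Y p2 (tm I i2 (coact Y (p2 z))) = tm Y (\<lambda>x. x) (coact Y (p2 z))"
      by (rule tmap_comp[OF YM IM YM AM L(2) L(4) _ cy]) (simp add: i2_def)
    also have "\<dots> = coact Y (p2 z)" by (rule tmap_id[OF YM AM _ cy]) simp
    finally show "coact Y (p2 z) = tm Y p2 (coact S z)" using cy by simp
  qed
  show ?thesis
    by (rule that[OF SO i1H i2H p1H p2H _ _ _ _ dec genS]) (simp_all add: i1_def i2_def)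
qed

end

section \<open>Operations on comodule maps and joint injectivity\<close>

context rep_setting
begin

lemma HomI:
  assumes "f \<in> Lin V W" "\<And>v. v \<in> carrier V \<Longrightarrow> coact W (f v) = tm W f (coact V v)"
  shows "f \<in> Hom V W"
  using assms unfolding comodule_hom_iff by auto

lemma Hom_carrier: "f \<in> Hom V W \<Longrightarrow> v \<in> carrier V \<Longrightarrow> f v \<in> carrier W"
  using Hom_Lin module_hom_carrier by metis

text \<open>Arrows are extensional functions while maps are mostly given by formulas. The coaction
  condition depends on the values on the carrier only, which makes the two interchangeable.\<close>

lemma Hom_cong:
  assumes V: "V \<in> Obj" and W: "W \<in> Obj" and f: "f \<in> Hom V W" and eq: "\<And>v. v \<in> carrier V \<Longrightarrow> g v = f v"
  shows "g \<in> Hom V W"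
proof (rule HomI)
  note VM = Obj_module[OF V]
  interpret V: module K V by (rule VM)
  note fL = Hom_Lin[OF f]
  show "g \<in> Lin V W" using fL eq by (auto intro!: module_homI simp: module_hom_simps)
  fix v assume v: "v \<in> carrier V"
  have id: "(\<lambda>v. v) \<in> Lin V V" by (auto intro!: module_homI)
  have "tm W f (tm V (\<lambda>v. v) (coact V v)) = tm W g (coact V v)"
    by (rule tmap_comp[OF VM VM Obj_module[OF W] A.module_axioms id fL _ coact_closed[OF V v]]) (simp add: eq)
  moreover have "tm V (\<lambda>v. v) (coact V v) = coact V v"
    by (rule tmap_id[OF VM A.module_axioms _ coact_closed[OF V v]]) simp
  ultimately show "coact W (g v) = tm W g (coact V v)"
    using Hom_coact[OF f v] eq[OF v] by simp
qed

lemma Hom_comp: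
  assumes V: "V \<in> Obj" and W: "W \<in> Obj" and X: "X \<in> Obj" and f: "f \<in> Hom V W" and g: "g \<in> Hom W X"
  shows "(\<lambda>v. g (f v)) \<in> Hom V X"
proof (rule HomI)
  show "(\<lambda>v. g (f v)) \<in> Lin V X" by (rule module_hom_compose[OF Hom_Lin[OF f] Hom_Lin[OF g]])
  fix v assume v: "v \<in> carrier V"
  have "tm X g (tm W f (coact V v)) = tm X (\<lambda>v. g (f v)) (coact V v)"
    by (rule tmap_comp[OF Obj_module[OF V] Obj_module[OF W] Obj_module[OF X] A.module_axioms
          Hom_Lin[OF f] Hom_Lin[OF g] _ coact_closed[OF V v]]) simp
  then show "coact X (g (f v)) = tm X (\<lambda>v. g (f v)) (coact V v)"
    using Hom_coact[OF f v] Hom_coact[OF g Hom_carrier[OF f v]] by simp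
qed

lemma Hom_id: "V \<in> Obj \<Longrightarrow> (\<lambda>v. v) \<in> Hom V V"
  by (rule HomI) (simp_all add: module_homI tmap_id[OF Obj_module A.module_axioms] coact_closed)

lemma Hom_zero:
  assumes V: "V \<in> Obj" and W: "W \<in> Obj"
  shows "(\<lambda>v. \<zero>\<^bsub>W\<^esub>) \<in> Hom V W"
proof (rule HomI)
  interpret V: module K V by (rule Obj_module[OF V])
  interpret W: module K W by (rule Obj_module[OF W])
  show "(\<lambda>v. \<zero>\<^bsub>W\<^esub>) \<in> Lin V W" by (auto intro!: module_homI)
  fix v assume "v \<in> carrier V"
  then have "tm W (\<lambda>v. \<zero>\<^bsub>W\<^esub>) (coact V v) = \<zero>\<^bsub>TA W\<^esub>"
    by (intro tmap_zero[OF V.module_axioms W.module_axioms A.module_axioms] coact_closed[OF V]) auto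
  then show "coact W \<zero>\<^bsub>W\<^esub> = tm W (\<lambda>v. \<zero>\<^bsub>W\<^esub>) (coact V v)"
    using module_hom_zero[OF W.module_axioms tensor_is_module[OF W.module_axioms A.module_axioms] Obj_coact[OF W]] by simp
qed

lemma Hom_add:
  assumes V: "V \<in> Obj" and W: "W \<in> Obj" and f: "f \<in> Hom V W" and g: "g \<in> Hom V W"
  shows "(\<lambda>v. f v \<oplus>\<^bsub>W\<^esub> g v) \<in> Hom V W"
proof (rule HomI)
  interpret V: module K V by (rule Obj_module[OF V])
  interpret W: module K W by (rule Obj_module[OF W])
  note fL = Hom_Lin[OF f] and gL = Hom_Lin[OF g]
  show "(\<lambda>v. f v \<oplus>\<^bsub>W\<^esub> g v) \<in> Lin V W"
    by (rule module_homI) (simp_all add: module_hom_simps[OF fL] module_hom_simps[OF gL] W.a_ac W.smult_r_distr)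
  fix v assume v: "v \<in> carrier V"
  have "tm W (\<lambda>v. f v \<oplus>\<^bsub>W\<^esub> g v) (coact V v) = tm W f (coact V v) \<oplus>\<^bsub>TA W\<^esub> tm W g (coact V v)"
    by (rule tmap_add[OF V.module_axioms W.module_axioms A.module_axioms fL gL _ coact_closed[OF V v]]) simp
  then show "coact W (f v \<oplus>\<^bsub>W\<^esub> g v) = tm W (\<lambda>v. f v \<oplus>\<^bsub>W\<^esub> g v) (coact V v)"
    using module_hom_add[OF Obj_coact[OF W] Hom_carrier[OF f v] Hom_carrier[OF g v]] Hom_coact[OF f v] Hom_coact[OF g v]
    by simp
qed

lemma Hom_smult:
  assumes V: "V \<in> Obj" and W: "W \<in> Obj" and f: "f \<in> Hom V W" and c: "c \<in> carrier K"
  shows "(\<lambda>v. c \<odot>\<^bsub>W\<^esub> f v) \<in> Hom V W"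
proof (rule HomI)
  interpret V: module K V by (rule Obj_module[OF V])
  interpret W: module K W by (rule Obj_module[OF W])
  note fL = Hom_Lin[OF f]
  have comm: "c \<odot>\<^bsub>W\<^esub> (r \<odot>\<^bsub>W\<^esub> w) = r \<odot>\<^bsub>W\<^esub> (c \<odot>\<^bsub>W\<^esub> w)" if "r \<in> carrier K" "w \<in> carrier W" for r w
    using that c by (metis A.R.m_comm W.smult_assoc1)
  show "(\<lambda>v. c \<odot>\<^bsub>W\<^esub> f v) \<in> Lin V W"
    by (rule module_homI) (use c in \<open>simp_all add: module_hom_simps[OF fL] W.smult_r_distr comm\<close>)
  fix v assume v: "v \<in> carrier V"
  have "tm W (\<lambda>v. c \<odot>\<^bsub>W\<^esub> f v) (coact V v) = c \<odot>\<^bsub>TA W\<^esub> tm W f (coact V v)"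
    by (rule tmap_smult[OF V.module_axioms W.module_axioms A.module_axioms fL c _ coact_closed[OF V v]]) simp
  then show "coact W (c \<odot>\<^bsub>W\<^esub> f v) = tm W (\<lambda>v. c \<odot>\<^bsub>W\<^esub> f v) (coact V v)"
    using module_hom_smult[OF Obj_coact[OF W] c Hom_carrier[OF f v]] Hom_coact[OF f v] by simp
qed

lemma Hom_minus:
  assumes V: "V \<in> Obj" and W: "W \<in> Obj" and f: "f \<in> Hom V W" and g: "g \<in> Hom V W"
  shows "(\<lambda>v. f v \<ominus>\<^bsub>W\<^esub> g v) \<in> Hom V W"
proof -
  interpret W: module K W by (rule Obj_module[OF W])
  have "(\<lambda>v. f v \<oplus>\<^bsub>W\<^esub> (\<ominus> \<one>) \<odot>\<^bsub>W\<^esub> g v) \<in> Hom V W"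
    by (intro Hom_add Hom_smult V W f g) auto
  then show ?thesis
    by (rule Hom_cong[OF V W]) (simp add: W.minus_eq W.smult_l_minus Hom_carrier[OF g])
qed

text \<open>Injectivity of the pair (p1, p2), stated without a direct sum. Equal \<open>p1\<close>
  and \<open>p2\<close> give plain injectivity, so one set of lemmas serves kernels and
  pullbacks.\<close>

definition "jointly_inj P p1 p2 \<longleftrightarrow>
  (\<forall>z\<in>carrier P. \<forall>w\<in>carrier P. p1 z = p1 w \<longrightarrow> p2 z = p2 w \<longrightarrow> z = w)"

text \<open>The pair (p1, p2) maps \<open>P\<close> injectively into a direct sum, and a generalized
  inverse of an injective map is a left inverse; \<open>r1\<close> and \<open>r2\<close> are its
  restrictions to the summands.\<close>

lemma joint_retraction:
  assumes P: "P \<in> Obj" and X: "X \<in> Obj" and Y: "Y \<in> Obj" and p: "p1 \<in> Lin P X" "p2 \<in> Lin P Y"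
    and inj: "jointly_inj P p1 p2"
  obtains r1 r2 where "r1 \<in> Lin X P" "r2 \<in> Lin Y P" "\<And>z. z \<in> carrier P \<Longrightarrow> r1 (p1 z) \<oplus>\<^bsub>P\<^esub> r2 (p2 z) = z"
proof -
  obtain S i1 i2 q1 q2 where S: "S \<in> Obj" "i1 \<in> Hom X S" "i2 \<in> Hom Y S" "q1 \<in> Hom S X" "q2 \<in> Hom S Y"
    "\<And>x. x \<in> carrier X \<Longrightarrow> q1 (i1 x) = x" "\<And>x. x \<in> carrier X \<Longrightarrow> q2 (i1 x) = \<zero>\<^bsub>Y\<^esub>"
    "\<And>y. y \<in> carrier Y \<Longrightarrow> q1 (i2 y) = \<zero>\<^bsub>X\<^esub>" "\<And>y. y \<in> carrier Y \<Longrightarrow> q2 (i2 y) = y"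
    "\<And>z. z \<in> carrier S \<Longrightarrow> i1 (q1 z) \<oplus>\<^bsub>S\<^esub> i2 (q2 z) = z"
    "\<And>n m. gen X n \<Longrightarrow> gen Y m \<Longrightarrow> gen S (n + m)"
    by (rule direct_sum_object[OF X Y]) (rule that; assumption)
  interpret P: module K P by (rule Obj_module[OF P])
  interpret S: module K S by (rule Obj_module[OF S(1)])
  interpret X: module K X by (rule Obj_module[OF X])
  interpret Y: module K Y by (rule Obj_module[OF Y])
  note L = Hom_Lin[OF S(2)] Hom_Lin[OF S(3)] Hom_Lin[OF S(4)] Hom_Lin[OF S(5)]
  define h where "h z = i1 (p1 z) \<oplus>\<^bsub>S\<^esub> i2 (p2 z)" for z
  have h: "h \<in> Lin P S"
    unfolding h_def
    by (rule module_homI) (simp_all add: module_hom_simps[OF L(1)] module_hom_simps[OF L(2)] module_hom_simps[OF p(1)]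
        module_hom_simps[OF p(2)] S.a_ac S.smult_r_distr)
  obtain n where "gen S n" using Obj_gen[OF S(1)] by blast
  then obtain r where r: "r \<in> Lin S P" "\<And>v. v \<in> carrier P \<Longrightarrow> h (r (h v)) = h v"
    using generalized_inverse[OF K.field_axioms P.module_axioms S.module_axioms h] by blast
  have q: "q1 (h z) = p1 z" "q2 (h z) = p2 z" if "z \<in> carrier P" for z
    using that module_hom_carrier[OF p(1)] module_hom_carrier[OF p(2)]
    by (simp_all add: h_def module_hom_simps[OF L(1)] module_hom_simps[OF L(2)] module_hom_add[OF L(3)] module_hom_add[OF L(4)] S(6-9))
  have rh: "r (h z) = z" if z: "z \<in> carrier P" for z
  proof -
    have "r (h z) \<in> carrier P" using z h r(1) by (simp add: module_hom_carrier)
    then show ?thesis using q[of "r (h z)"] q[OF z] r(2)[OF z] inj z unfolding jointly_inj_def by metis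
  qed
  show ?thesis
  proof (rule that)
    show "(\<lambda>x. r (i1 x)) \<in> Lin X P" "(\<lambda>x. r (i2 x)) \<in> Lin Y P"
      using module_hom_compose L r(1) by blast+
    show "r (i1 (p1 z)) \<oplus>\<^bsub>P\<^esub> r (i2 (p2 z)) = z" if "z \<in> carrier P" for z
      using rh[OF that] that module_hom_carrier[OF p(1)] module_hom_carrier[OF p(2)]
      by (simp add: h_def module_hom_add[OF r(1)] module_hom_carrier[OF L(1)] module_hom_carrier[OF L(2)])
  qed
qed

text \<open>This is the origin of the factor 2 in the statements about pullbacks: a fibre product is
  at most as large as the direct sum.\<close>

lemma gen_jointly_inj:
  assumes P: "P \<in> Obj" and X: "X \<in> Obj" and Y: "Y \<in> Obj" and p: "p1 \<in> Lin P X" "p2 \<in> Lin P Y"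
    and inj: "jointly_inj P p1 p2" and g: "gen X n" "gen Y m"
  shows "gen P (n + m)"
proof -
  obtain r1 r2 where r: "r1 \<in> Lin X P" "r2 \<in> Lin Y P" "\<And>z. z \<in> carrier P \<Longrightarrow> r1 (p1 z) \<oplus>\<^bsub>P\<^esub> r2 (p2 z) = z"
    by (rule joint_retraction[OF assms(1-6)]) (rule that; assumption)
  show ?thesis
  proof (rule generated_by_sum[OF Obj_module[OF X] Obj_module[OF Y] Obj_module[OF P] r(1,2) _ g])
    fix z assume z: "z \<in> carrier P"
    show "\<exists>v\<in>carrier X. \<exists>w\<in>carrier Y. z = r1 v \<oplus>\<^bsub>P\<^esub> r2 w"
      by (intro bexI[of _ "p1 z"] bexI[of _ "p2 z"] r(3)[symmetric] z
          module_hom_carrier[OF p(1)] module_hom_carrier[OF p(2)])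
  qed
qed

text \<open>The linear retractions survive tensoring with \<open>A\<close>, so an equation in P
  \<otimes> A may be checked after applying p1 \<otimes> 1 and p2 \<otimes> 1.\<close>

lemma tmap_jointly_inj:
  assumes P: "P \<in> Obj" and X: "X \<in> Obj" and Y: "Y \<in> Obj" and p: "p1 \<in> Lin P X" "p2 \<in> Lin P Y"
    and inj: "jointly_inj P p1 p2"
    and y: "y \<in> carrier (TA P)" "z \<in> carrier (TA P)" "tm X p1 y = tm X p1 z" "tm Y p2 y = tm Y p2 z"
  shows "y = z"
proof -
  obtain r1 r2 where r: "r1 \<in> Lin X P" "r2 \<in> Lin Y P" "\<And>z. z \<in> carrier P \<Longrightarrow> r1 (p1 z) \<oplus>\<^bsub>P\<^esub> r2 (p2 z) = z"
    by (rule joint_retraction[OF assms(1-6)]) (rule that; assumption)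
  note PM = Obj_module[OF P] and XM = Obj_module[OF X] and YM = Obj_module[OF Y] and AM = A.module_axioms
  have "tm P r1 (tm X p1 t) \<oplus>\<^bsub>TA P\<^esub> tm P r2 (tm Y p2 t) = t" if t: "t \<in> carrier (TA P)" for t
  proof -
    have "tm P (\<lambda>z. z) t = tm P (\<lambda>z. r1 (p1 z)) t \<oplus>\<^bsub>TA P\<^esub> tm P (\<lambda>z. r2 (p2 z)) t"
      by (rule tmap_add[OF PM PM AM module_hom_compose[OF p(1) r(1)] module_hom_compose[OF p(2) r(2)] _ t])
        (simp add: r(3))
    moreover have "tm P (\<lambda>z. z) t = t" by (rule tmap_id[OF PM AM _ t]) simp
    ultimately show ?thesis
      using tmap_comp[OF PM XM PM AM p(1) r(1) refl t] tmap_comp[OF PM YM PM AM p(2) r(2) refl t] by simp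
  qed
  from this[OF y(1), unfolded y(3,4)] this[OF y(2)] show ?thesis by (rule trans[OF sym])
qed

text \<open>Linearity and compatibility with the coactions are equations in \<open>P\<close> and in
  P \<otimes> A, and joint injectivity lets them be verified in \<open>X\<close> and
  \<open>Y\<close>. This turns a factorisation found on elements into a comodule map.\<close>

lemma Hom_lift:
  assumes T: "T \<in> Obj" and P: "P \<in> Obj" and X: "X \<in> Obj" and Y: "Y \<in> Obj" and p: "p1 \<in> Hom P X" "p2 \<in> Hom P Y"
    and inj: "jointly_inj P p1 p2"
    and u: "\<And>v. v \<in> carrier T \<Longrightarrow> u v \<in> carrier P" "(\<lambda>v. p1 (u v)) \<in> Hom T X" "(\<lambda>v. p2 (u v)) \<in> Hom T Y"
  shows "u \<in> Hom T P"
proof (rule HomI)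
  interpret P: module K P by (rule Obj_module[OF P])
  interpret T: module K T by (rule Obj_module[OF T])
  note PM = Obj_module[OF P] and XM = Obj_module[OF X] and YM = Obj_module[OF Y] and TM = Obj_module[OF T]
    and AM = A.module_axioms
  have jE: "z = w" if "p1 z = p1 w" "p2 z = p2 w" "z \<in> carrier P" "w \<in> carrier P" for z w
    using inj that unfolding jointly_inj_def by blast
  note pL = Hom_Lin[OF p(1)] Hom_Lin[OF p(2)]
  note uL = Hom_Lin[OF u(2)] Hom_Lin[OF u(3)]
  show uu: "u \<in> Lin T P"
  proof (rule module_homI)
    fix x y assume xy: "x \<in> carrier T" "y \<in> carrier T"
    show "u (x \<oplus>\<^bsub>T\<^esub> y) = u x \<oplus>\<^bsub>P\<^esub> u y"
      by (rule jE) (use module_hom_add[OF uL(1) xy] module_hom_add[OF uL(2) xy] module_hom_add[OF pL(1)]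
          module_hom_add[OF pL(2)] u(1) xy in auto)
  next
    fix c x assume cx: "c \<in> carrier K" "x \<in> carrier T"
    show "u (c \<odot>\<^bsub>T\<^esub> x) = c \<odot>\<^bsub>P\<^esub> u x"
      by (rule jE) (use module_hom_smult[OF uL(1) cx] module_hom_smult[OF uL(2) cx] module_hom_smult[OF pL(1)]
          module_hom_smult[OF pL(2)] u(1) cx in auto)
  qed (rule u(1))
  fix v assume v: "v \<in> carrier T"
  note cv = coact_closed[OF T v]
  show "coact P (u v) = tm P u (coact T v)"
  proof (rule tmap_jointly_inj[OF P X Y pL inj])
    show "coact P (u v) \<in> carrier (TA P)" using coact_closed[OF P u(1)[OF v]] .
    show "tm P u (coact T v) \<in> carrier (TA P)" using module_hom_carrier[OF tmap_hom[OF TM PM AM uu] cv] .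
    show "tm X p1 (coact P (u v)) = tm X p1 (tm P u (coact T v))"
      using Hom_coact[OF p(1) u(1)[OF v]] Hom_coact[OF u(2) v] tmap_comp[OF TM PM XM AM uu pL(1) refl cv] by simp
    show "tm Y p2 (coact P (u v)) = tm Y p2 (tm P u (coact T v))"
      using Hom_coact[OF p(2) u(1)[OF v]] Hom_coact[OF u(3) v] tmap_comp[OF TM PM YM AM uu pL(2) refl cv] by simp
  qed
qed

text \<open>The dual of \<open>Hom_lift\<close>: every vector of \<open>W\<close> comes from
  \<open>V\<close>, where the equations are known.\<close>

lemma Hom_descend:
  assumes V: "V \<in> Obj" and W: "W \<in> Obj" and T: "T \<in> Obj" and e: "e \<in> Hom V W" "carrier W \<subseteq> e ` carrier V"
    and u: "(\<lambda>v. u (e v)) \<in> Hom V T"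
  shows "u \<in> Hom W T"
proof (rule HomI)
  interpret V: module K V by (rule Obj_module[OF V])
  note VM = Obj_module[OF V] and WM = Obj_module[OF W] and TM = Obj_module[OF T] and AM = A.module_axioms
  note eL = Hom_Lin[OF e(1)] and uL = Hom_Lin[OF u]
  show uu: "u \<in> Lin W T"
  proof (rule module_homI)
    show "u w \<in> carrier T" if "w \<in> carrier W" for w
      using that e(2) module_hom_carrier[OF uL] by auto
    show "u (w \<oplus>\<^bsub>W\<^esub> w') = u w \<oplus>\<^bsub>T\<^esub> u w'" if ww: "w \<in> carrier W" "w' \<in> carrier W" for w w'
    proof -
      obtain v v' where v: "w = e v" "w' = e v'" "v \<in> carrier V" "v' \<in> carrier V" using ww e(2) by blast
      then show ?thesis using module_hom_add[OF uL, of v v'] module_hom_add[OF eL, of v v'] by simp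
    qed
    show "u (c \<odot>\<^bsub>W\<^esub> w) = c \<odot>\<^bsub>T\<^esub> u w" if cw: "c \<in> carrier K" "w \<in> carrier W" for c w
    proof -
      obtain v where v: "w = e v" "v \<in> carrier V" using cw e(2) by blast
      then show ?thesis using module_hom_smult[OF uL, of c v] module_hom_smult[OF eL, of c v] cw by simp
    qed
  qed
  fix w assume "w \<in> carrier W"
  then obtain v where v: "w = e v" "v \<in> carrier V" using e(2) by blast
  show "coact T (u w) = tm T u (coact W w)"
    using Hom_coact[OF u v(2)] Hom_coact[OF e(1) v(2)] tmap_comp[OF VM WM TM AM eL uu refl coact_closed[OF V v(2)]] v by simp
qed

end

section \<open>Kernels, cokernels and pullbacks in full subcategories\<close>

lemma extensional_eq_iff:
  "f \<in> extensional S \<Longrightarrow> g \<in> extensional S \<Longrightarrow> f = g \<longleftrightarrow> (\<forall>x\<in>S. f x = g x)"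
  by (auto intro: extensionalityI)

lemma compose_eq_iff:
  "t \<in> extensional S \<Longrightarrow> compose S g f = t \<longleftrightarrow> (\<forall>x\<in>S. g (f x) = t x)"
  by (subst extensional_eq_iff[of _ S]) (auto simp: compose_eq)

lemma compose_restrict_eq_iff:
  "compose S g f = restrict t S \<longleftrightarrow> (\<forall>x\<in>S. g (f x) = t x)"
  by (subst compose_eq_iff) auto

lemma ex1_implies_eq: "\<exists>!u. Q u \<Longrightarrow> Q a \<Longrightarrow> Q b \<Longrightarrow> a = b"
  by blast

context rep_setting
begin

abbreviation Cat :: "(('k, 'a, 'v) comodule \<Rightarrow> bool) \<Rightarrow> ('k, ('k, 'a, 'v) comodule, ('k, 'a, 'v) rep_arrow) lincat" where
  "Cat P \<equiv> full_subcat (rep_cat K A) P"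

lemma Cat_True: "Cat (\<lambda>_. True) = rep_cat K A"
  by (simp add: full_subcat_def)

lemma Cat_simps [simp]:
  "cdom (Cat P) (V, W, f) = V" "ccod (Cat P) (V, W, f) = W"
  "ccomp (Cat P) (V', W', g) (V, W, f) = (V, W', compose (carrier V) g f)"
  "czero (Cat P) V W = (V, W, \<lambda>v\<in>carrier V. \<zero>\<^bsub>W\<^esub>)"
  "cid (Cat P) V = (V, V, \<lambda>v\<in>carrier V. v)"
  "cadd (Cat P) (V, W, f) (V', W', g) = (V, W, \<lambda>v\<in>carrier V. f v \<oplus>\<^bsub>W\<^esub> g v)"
  "cscale (Cat P) c (V, W, f) = (V, W, \<lambda>v\<in>carrier V. c \<odot>\<^bsub>W\<^esub> f v)"
  by (simp_all add: full_subcat_def rep_cat_def)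

lemma Cat_carr:
  "(V, W, f) \<in> carr (Cat P) \<longleftrightarrow> V \<in> Obj \<and> W \<in> Obj \<and> P V \<and> P W \<and> f \<in> Hom V W \<and> f \<in> extensional (carrier V)"
  by (auto simp: full_subcat_def rep_cat_def)

lemma Cat_chom:
  "u \<in> chom (Cat P) V W \<longleftrightarrow> (\<exists>f. u = (V, W, f) \<and> V \<in> Obj \<and> W \<in> Obj \<and> P V \<and> P W \<and> f \<in> Hom V W \<and> f \<in> extensional (carrier V))"
  by (cases u) (auto simp: chom_def Cat_carr)

lemma ball_Cat_carr:
  "(\<forall>t\<in>carr (Cat P). Q t) \<longleftrightarrow>
     (\<forall>V W t. V \<in> Obj \<and> W \<in> Obj \<and> P V \<and> P W \<and> t \<in> Hom V W \<and> t \<in> extensional (carrier V) \<longrightarrow> Q (V, W, t))"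
  by (force simp: Cat_carr)

lemma Hom_restrict: "V \<in> Obj \<Longrightarrow> W \<in> Obj \<Longrightarrow> f \<in> Hom V W \<Longrightarrow> restrict f (carrier V) \<in> Hom V W"
  by (erule (2) Hom_cong) simp

text \<open>Domain and codomain of a competing arrow are fixed by the diagram, so unique existence
  of an arrow, which is a triple, becomes unique existence of an extensional function.\<close>

lemma is_kernel_Cat:
  assumes "(N, X, f) \<in> carr (Cat P)" "(X, M, g) \<in> carr (Cat P)"
  shows "is_kernel (Cat P) (N, X, f) (X, M, g) \<longleftrightarrow>
    (\<forall>v\<in>carrier N. g (f v) = \<zero>\<^bsub>M\<^esub>) \<and>
    (\<forall>T t. T \<in> Obj \<and> P T \<and> t \<in> Hom T X \<and> t \<in> extensional (carrier T) \<and> (\<forall>v\<in>carrier T. g (t v) = \<zero>\<^bsub>M\<^esub>) \<longrightarrow>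
      (\<exists>!u. u \<in> Hom T N \<and> u \<in> extensional (carrier T) \<and> (\<forall>v\<in>carrier T. f (u v) = t v)))"
proof -
  have NP: "N \<in> Obj" "P N" "X \<in> Obj" "P X" using assms by (auto simp: Cat_carr)
  define E where "E T t \<longleftrightarrow> (\<exists>!u. u \<in> Hom T N \<and> u \<in> extensional (carrier T) \<and> (\<forall>v\<in>carrier T. f (u v) = t v))"
    for T :: "('k, 'a, 'v) comodule" and t
  have ex1: "(\<exists>!u. u \<in> chom (Cat P) T N \<and> ccomp (Cat P) (N, X, f) u = (T, X, t)) \<longleftrightarrow> E T t"
    if "T \<in> Obj" "P T" "t \<in> extensional (carrier T)" for T t
  proof -
    have "u \<in> chom (Cat P) T N \<and> ccomp (Cat P) (N, X, f) u = (T, X, t) \<longleftrightarrow>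
      (\<exists>w. u = (T, N, w) \<and> w \<in> Hom T N \<and> w \<in> extensional (carrier T) \<and> (\<forall>v\<in>carrier T. f (w v) = t v))" for u
      using that NP by (cases u) (auto simp: Cat_chom compose_eq_iff compose_eq)
    then show ?thesis unfolding E_def by auto
  qed
  have "is_kernel (Cat P) (N, X, f) (X, M, g) \<longleftrightarrow> (\<forall>v\<in>carrier N. g (f v) = \<zero>\<^bsub>M\<^esub>) \<and>
    (\<forall>T t. T \<in> Obj \<and> P T \<and> t \<in> Hom T X \<and> t \<in> extensional (carrier T) \<and> (\<forall>v\<in>carrier T. g (t v) = \<zero>\<^bsub>M\<^esub>) \<longrightarrow> E T t)"
    unfolding is_kernel_def ball_Cat_carr
    using assms NP by (auto simp: compose_restrict_eq_iff ex1)
  then show ?thesis unfolding E_def .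
qed

lemma is_cokernel_Cat:
  assumes "(N, X, f) \<in> carr (Cat P)" "(X, M, g) \<in> carr (Cat P)"
  shows "is_cokernel (Cat P) (X, M, g) (N, X, f) \<longleftrightarrow>
    (\<forall>v\<in>carrier N. g (f v) = \<zero>\<^bsub>M\<^esub>) \<and>
    (\<forall>T t. T \<in> Obj \<and> P T \<and> t \<in> Hom X T \<and> t \<in> extensional (carrier X) \<and> (\<forall>v\<in>carrier N. t (f v) = \<zero>\<^bsub>T\<^esub>) \<longrightarrow>
      (\<exists>!u. u \<in> Hom M T \<and> u \<in> extensional (carrier M) \<and> (\<forall>v\<in>carrier X. u (g v) = t v)))"
proof -
  have NP: "M \<in> Obj" "P M" "X \<in> Obj" "P X" using assms by (auto simp: Cat_carr)
  define E where "E T t \<longleftrightarrow> (\<exists>!u. u \<in> Hom M T \<and> u \<in> extensional (carrier M) \<and> (\<forall>v\<in>carrier X. u (g v) = t v))"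
    for T :: "('k, 'a, 'v) comodule" and t
  have ex1: "(\<exists>!u. u \<in> chom (Cat P) M T \<and> ccomp (Cat P) u (X, M, g) = (X, T, t)) \<longleftrightarrow> E T t"
    if "T \<in> Obj" "P T" "t \<in> extensional (carrier X)" for T t
  proof -
    have "u \<in> chom (Cat P) M T \<and> ccomp (Cat P) u (X, M, g) = (X, T, t) \<longleftrightarrow>
      (\<exists>w. u = (M, T, w) \<and> w \<in> Hom M T \<and> w \<in> extensional (carrier M) \<and> (\<forall>v\<in>carrier X. w (g v) = t v))" for u
      using that NP by (cases u) (auto simp: Cat_chom compose_eq_iff compose_eq)
    then show ?thesis unfolding E_def by auto
  qed
  have "is_cokernel (Cat P) (X, M, g) (N, X, f) \<longleftrightarrow> (\<forall>v\<in>carrier N. g (f v) = \<zero>\<^bsub>M\<^esub>) \<and>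
    (\<forall>T t. T \<in> Obj \<and> P T \<and> t \<in> Hom X T \<and> t \<in> extensional (carrier X) \<and> (\<forall>v\<in>carrier N. t (f v) = \<zero>\<^bsub>T\<^esub>) \<longrightarrow> E T t)"
    unfolding is_cokernel_def ball_Cat_carr
    using assms NP by (auto simp: compose_restrict_eq_iff ex1)
  then show ?thesis unfolding E_def .
qed

lemma is_pullback_Cat:
  assumes "(X, Z, g) \<in> carr (Cat P)" "(Y, Z, h) \<in> carr (Cat P)" "(L, X, p) \<in> carr (Cat P)" "(L, Y, q) \<in> carr (Cat P)"
  shows "is_pullback (Cat P) (X, Z, g) (Y, Z, h) (L, X, p) (L, Y, q) \<longleftrightarrow>
    (\<forall>z\<in>carrier L. g (p z) = h (q z)) \<and>
    (\<forall>T s t. T \<in> Obj \<and> P T \<and> s \<in> Hom T X \<and> s \<in> extensional (carrier T) \<and> t \<in> Hom T Y \<and> t \<in> extensional (carrier T) \<and>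
        (\<forall>v\<in>carrier T. g (s v) = h (t v)) \<longrightarrow>
      (\<exists>!u. u \<in> Hom T L \<and> u \<in> extensional (carrier T) \<and> (\<forall>v\<in>carrier T. p (u v) = s v \<and> q (u v) = t v)))"
proof -
  have NP: "L \<in> Obj" "P L" using assms by (auto simp: Cat_carr)
  define E where "E T s t \<longleftrightarrow> (\<exists>!u. u \<in> Hom T L \<and> u \<in> extensional (carrier T) \<and> (\<forall>v\<in>carrier T. p (u v) = s v \<and> q (u v) = t v))"
    for T :: "('k, 'a, 'v) comodule" and s t
  have ex1: "(\<exists>!u. u \<in> chom (Cat P) T L \<and> ccomp (Cat P) (L, X, p) u = (T, X, s) \<and> ccomp (Cat P) (L, Y, q) u = (T, Y, t)) \<longleftrightarrow> E T s t"
    if "T \<in> Obj" "P T" "s \<in> extensional (carrier T)" "t \<in> extensional (carrier T)" for T s t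
  proof -
    have "u \<in> chom (Cat P) T L \<and> ccomp (Cat P) (L, X, p) u = (T, X, s) \<and> ccomp (Cat P) (L, Y, q) u = (T, Y, t) \<longleftrightarrow>
      (\<exists>w. u = (T, L, w) \<and> w \<in> Hom T L \<and> w \<in> extensional (carrier T) \<and> (\<forall>v\<in>carrier T. p (w v) = s v \<and> q (w v) = t v))" for u
      using that NP by (cases u) (auto simp: Cat_chom compose_eq_iff compose_eq)
    then show ?thesis unfolding E_def by auto
  qed
  have comp: "compose (carrier L) g p = compose (carrier L) h q \<longleftrightarrow> (\<forall>z\<in>carrier L. g (p z) = h (q z))" for L :: "('k, 'a, 'v) comodule" and p q
    by (subst compose_eq_iff) (auto simp: compose_eq)
  have "is_pullback (Cat P) (X, Z, g) (Y, Z, h) (L, X, p) (L, Y, q) \<longleftrightarrow> (\<forall>z\<in>carrier L. g (p z) = h (q z)) \<and>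
    (\<forall>T s t. T \<in> Obj \<and> P T \<and> s \<in> Hom T X \<and> s \<in> extensional (carrier T) \<and> t \<in> Hom T Y \<and> t \<in> extensional (carrier T) \<and>
        (\<forall>v\<in>carrier T. g (s v) = h (t v)) \<longrightarrow> E T s t)"
    unfolding is_pullback_def ball_Cat_carr
    using assms NP by (auto simp: comp ex1 Cat_carr)
  then show ?thesis unfolding E_def .
qed

text \<open>This and the next two conditions describe universal properties by elements. The
  predicate \<open>P\<close> that cuts out the subcategory does not occur in them; this is how
  independence of the dimension bound is obtained.\<close>

definition "ker_exact N X M f g \<longleftrightarrow> inj_on f (carrier N) \<and> f ` carrier N = {x \<in> carrier X. g x = \<zero>\<^bsub>M\<^esub>}"

definition "coker_exact N X M f g \<longleftrightarrow> g ` carrier X = carrier M \<and> f ` carrier N = {x \<in> carrier X. g x = \<zero>\<^bsub>M\<^esub>}"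

definition "pullback_exact X Y L g h p q \<longleftrightarrow> jointly_inj L p q \<and> (\<forall>z\<in>carrier L. g (p z) = h (q z)) \<and>
  (\<forall>x\<in>carrier X. \<forall>y\<in>carrier Y. g x = h y \<longrightarrow> (\<exists>z\<in>carrier L. p z = x \<and> q z = y))"

text \<open>The predicates used to cut out full subcategories: all objects, or those of dimension at most \<open>b\<close>.\<close>

definition dim_closed :: "(('k, 'a, 'v) comodule \<Rightarrow> bool) \<Rightarrow> bool" where
  "dim_closed P \<longleftrightarrow> (\<forall>V\<in>Obj. \<forall>Y\<in>Obj. P Y \<and> (\<forall>n. gen Y n \<longrightarrow> gen V n) \<longrightarrow> P V)"

lemma Hom_zero_eq: "f \<in> Hom V W \<Longrightarrow> V \<in> Obj \<Longrightarrow> W \<in> Obj \<Longrightarrow> f \<zero>\<^bsub>V\<^esub> = \<zero>\<^bsub>W\<^esub>"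
  using module_hom_zero[OF Obj_module Obj_module Hom_Lin] by blast

lemma Hom_inj_onI:
  assumes V: "V \<in> Obj" and W: "W \<in> Obj" and f: "f \<in> Hom V W"
    and "\<And>v. v \<in> carrier V \<Longrightarrow> f v = \<zero>\<^bsub>W\<^esub> \<Longrightarrow> v = \<zero>\<^bsub>V\<^esub>"
  shows "inj_on f (carrier V)"
proof (rule inj_onI)
  interpret V: module K V by (rule Obj_module[OF V])
  interpret W: module K W by (rule Obj_module[OF W])
  fix x y assume xy: "x \<in> carrier V" "y \<in> carrier V" "f x = f y"
  then have "f (x \<ominus>\<^bsub>V\<^esub> y) = \<zero>\<^bsub>W\<^esub>"
    using module_hom_minus[OF V.module_axioms W.module_axioms Hom_Lin[OF f] xy(1,2)] Hom_carrier[OF f]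
    by (simp add: W.minus_eq W.r_neg)
  then show "x = y" using assms(4)[of "x \<ominus>\<^bsub>V\<^esub> y"] xy by simp
qed

text \<open>To exploit the universal property, the kernels of \<open>f\<close> and of
  \<open>g\<close> serve as test objects. They are no larger than \<open>N\<close> and
  \<open>X\<close>, so they belong to the subcategory by \<open>dim_closed\<close>.\<close>

lemma kernel_iff:
  assumes f: "(N, X, f) \<in> carr (Cat P)" and g: "(X, M, g) \<in> carr (Cat P)" and P: "dim_closed P"
  shows "is_kernel (Cat P) (N, X, f) (X, M, g) \<longleftrightarrow> ker_exact N X M f g"
proof
  have O: "N \<in> Obj" "X \<in> Obj" "M \<in> Obj" "P N" "P X" "P M" "f \<in> Hom N X" "g \<in> Hom X M"
    using f g by (auto simp: Cat_carr)
  interpret N: module K N by (rule Obj_module[OF O(1)])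
  {
    assume "is_kernel (Cat P) (N, X, f) (X, M, g)"
    then have gf: "\<And>v. v \<in> carrier N \<Longrightarrow> g (f v) = \<zero>\<^bsub>M\<^esub>"
      and univ: "\<And>T t. T \<in> Obj \<Longrightarrow> P T \<Longrightarrow> t \<in> Hom T X \<Longrightarrow> t \<in> extensional (carrier T) \<Longrightarrow> (\<forall>v\<in>carrier T. g (t v) = \<zero>\<^bsub>M\<^esub>) \<Longrightarrow>
        (\<exists>!u. u \<in> Hom T N \<and> u \<in> extensional (carrier T) \<and> (\<forall>v\<in>carrier T. f (u v) = t v))"
      unfolding is_kernel_Cat[OF f g] by blast+
    \<comment> \<open>Test object: the kernel of \<open>f\<close>. Its inclusion into
      \<open>N\<close> and the zero map both factor the zero map through \<open>f\<close>, so they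
      are equal.\<close>
    have inj: "inj_on f (carrier N)"
    proof (rule Hom_inj_onI[OF O(1,2,7)])
      obtain V where V: "V \<in> Obj" "carrier V = {x \<in> carrier N. f x = \<zero>\<^bsub>X\<^esub>}" "(\<lambda>x. x) \<in> Hom V N" "\<zero>\<^bsub>V\<^esub> = \<zero>\<^bsub>N\<^esub>"
        "\<And>n. gen N n \<Longrightarrow> gen V n" using kernel_object[OF O(1,2,7)] by blast
      have PV: "P V" using P V(1,5) O(1,4) unfolding dim_closed_def by blast
      have z: "(\<lambda>v\<in>carrier V. \<zero>\<^bsub>X\<^esub>) \<in> Hom V X" by (intro Hom_restrict V O Hom_zero)
      have z': "(\<lambda>v\<in>carrier V. \<zero>\<^bsub>N\<^esub>) \<in> Hom V N" by (intro Hom_restrict V O Hom_zero)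
      have i: "(\<lambda>v\<in>carrier V. v) \<in> Hom V N" by (intro Hom_restrict V O)
      have "\<exists>!u. u \<in> Hom V N \<and> u \<in> extensional (carrier V) \<and> (\<forall>v\<in>carrier V. f (u v) = (\<lambda>v\<in>carrier V. \<zero>\<^bsub>X\<^esub>) v)"
        by (rule univ[OF V(1) PV z]) (use Hom_zero_eq[OF O(8,2,3)] in auto)
      then have eq: "(\<lambda>v\<in>carrier V. v) = (\<lambda>v\<in>carrier V. \<zero>\<^bsub>N\<^esub>)"
        by (rule ex1_implies_eq) (use i z' V(2) Hom_zero_eq[OF O(7,1,2)] in auto)
      show "v = \<zero>\<^bsub>N\<^esub>" if "v \<in> carrier N" "f v = \<zero>\<^bsub>X\<^esub>" for v
        using fun_cong[OF eq, of v] that V(2) by auto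
    qed
    \<comment> \<open>Test object: the kernel of \<open>g\<close>, whose inclusion into
      \<open>X\<close> has to factor through \<open>f\<close>.\<close>
    moreover have "x \<in> f ` carrier N" if x: "x \<in> carrier X" "g x = \<zero>\<^bsub>M\<^esub>" for x
    proof -
      obtain V where V: "V \<in> Obj" "carrier V = {x \<in> carrier X. g x = \<zero>\<^bsub>M\<^esub>}" "(\<lambda>x. x) \<in> Hom V X" "\<zero>\<^bsub>V\<^esub> = \<zero>\<^bsub>X\<^esub>"
        "\<And>n. gen X n \<Longrightarrow> gen V n" using kernel_object[OF O(2,3,8)] by blast
      have PV: "P V" using P V(1,5) O(2,5) unfolding dim_closed_def by blast
      have i: "(\<lambda>v\<in>carrier V. v) \<in> Hom V X" by (intro Hom_restrict V O)
      have "\<exists>!u. u \<in> Hom V N \<and> u \<in> extensional (carrier V) \<and> (\<forall>v\<in>carrier V. f (u v) = (\<lambda>v\<in>carrier V. v) v)"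
        by (rule univ[OF V(1) PV i]) (use V(2) in auto)
      then obtain u where "u \<in> Hom V N" "\<And>v. v \<in> carrier V \<Longrightarrow> f (u v) = v" by auto
      then show ?thesis using x V(2) Hom_carrier[of u V N x] by (metis (mono_tags, lifting) imageI mem_Collect_eq)
    qed
    ultimately show "ker_exact N X M f g"
      unfolding ker_exact_def using gf Hom_carrier[OF O(7)] by blast
  }
  {
    assume ex: "ker_exact N X M f g"
    then have inj: "inj_on f (carrier N)" and im: "f ` carrier N = {x \<in> carrier X. g x = \<zero>\<^bsub>M\<^esub>}"
      by (auto simp: ker_exact_def)
    show "is_kernel (Cat P) (N, X, f) (X, M, g)"
      unfolding is_kernel_Cat[OF f g]
    proof (intro conjI ballI allI impI; (elim conjE)?)
      show "g (f v) = \<zero>\<^bsub>M\<^esub>" if "v \<in> carrier N" for v using im that by blast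
      fix T t assume T: "T \<in> Obj" and t: "t \<in> Hom T X" and gt: "\<forall>v\<in>carrier T. g (t v) = \<zero>\<^bsub>M\<^esub>"
      define u where "u = (\<lambda>v\<in>carrier T. inv_into (carrier N) f (t v))"
      have tim: "t v \<in> f ` carrier N" if "v \<in> carrier T" for v
        using gt im that Hom_carrier[OF t] by auto
      have u: "u v \<in> carrier N" "f (u v) = t v" if "v \<in> carrier T" for v
        using inv_into_into[OF tim[OF that]] f_inv_into_f[OF tim[OF that]] that by (auto simp: u_def)
      \<comment> \<open>Plain injectivity of \<open>f\<close>, in the form that
        \<open>Hom_lift\<close> accepts.\<close>
      have jin: "jointly_inj N f f" using inj by (auto simp: jointly_inj_def inj_on_def)
      have fu: "(\<lambda>v. f (u v)) \<in> Hom T X" by (rule Hom_cong[OF T O(2) t]) (simp add: u)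
      have "u \<in> Hom T N" by (rule Hom_lift[OF T O(1,2,2,7,7) jin _ fu fu]) (rule u)
      then show "\<exists>!u. u \<in> Hom T N \<and> u \<in> extensional (carrier T) \<and> (\<forall>v\<in>carrier T. f (u v) = t v)"
      proof (intro ex1I[of _ u] conjI ballI; (elim conjE)?)
        fix w assume w: "w \<in> Hom T N" "w \<in> extensional (carrier T)" "\<forall>v\<in>carrier T. f (w v) = t v"
        show "w = u"
          by (rule extensionalityI[OF w(2)])
            (use w u inj Hom_carrier[OF w(1)] in \<open>auto simp: u_def inj_on_def\<close>)
      qed (use u in \<open>auto simp: u_def\<close>)
    qed
  }
qed

text \<open>Dually, the test objects are the cokernels of \<open>g\<close> and of \<open>f\<close>,
  which are quotients of \<open>M\<close> and \<open>X\<close>.\<close>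

lemma cokernel_iff:
  assumes f: "(N, X, f) \<in> carr (Cat P)" and g: "(X, M, g) \<in> carr (Cat P)" and P: "dim_closed P"
  shows "is_cokernel (Cat P) (X, M, g) (N, X, f) \<longleftrightarrow> coker_exact N X M f g"
proof
  have O: "N \<in> Obj" "X \<in> Obj" "M \<in> Obj" "P N" "P X" "P M" "f \<in> Hom N X" "g \<in> Hom X M"
    using f g by (auto simp: Cat_carr)
  interpret N: module K N by (rule Obj_module[OF O(1)])
  interpret M: module K M by (rule Obj_module[OF O(3)])
  interpret X: module K X by (rule Obj_module[OF O(2)])
  {
    assume "is_cokernel (Cat P) (X, M, g) (N, X, f)"
    then have gf: "\<And>v. v \<in> carrier N \<Longrightarrow> g (f v) = \<zero>\<^bsub>M\<^esub>"
      and univ: "\<And>T t. T \<in> Obj \<Longrightarrow> P T \<Longrightarrow> t \<in> Hom X T \<Longrightarrow> t \<in> extensional (carrier X) \<Longrightarrow> (\<forall>v\<in>carrier N. t (f v) = \<zero>\<^bsub>T\<^esub>) \<Longrightarrow>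
        (\<exists>!u. u \<in> Hom M T \<and> u \<in> extensional (carrier M) \<and> (\<forall>v\<in>carrier X. u (g v) = t v))"
      unfolding is_cokernel_Cat[OF f g] by blast+
    \<comment> \<open>The quotient map from \<open>M\<close> to the cokernel of \<open>g\<close> and
      the zero map have the same composite with \<open>g\<close>, so they are equal.\<close>
    have "g ` carrier X = carrier M"
    proof -
      obtain Q q where Q: "Q \<in> Obj" "q \<in> Hom M Q" "q ` carrier M = carrier Q"
        "\<And>x. x \<in> carrier M \<Longrightarrow> q x = \<zero>\<^bsub>Q\<^esub> \<longleftrightarrow> x \<in> g ` carrier X" "\<And>n. gen M n \<Longrightarrow> gen Q n"
        by (rule cokernel_object[OF O(2,3,8)]) (rule that; assumption)
      have PQ: "P Q" using P Q(1,5) O(3,6) unfolding dim_closed_def by blast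
      have z: "(\<lambda>v\<in>carrier X. \<zero>\<^bsub>Q\<^esub>) \<in> Hom X Q" by (intro Hom_restrict Q O Hom_zero)
      have z': "(\<lambda>v\<in>carrier M. \<zero>\<^bsub>Q\<^esub>) \<in> Hom M Q" by (intro Hom_restrict Q O Hom_zero)
      have i: "(\<lambda>v\<in>carrier M. q v) \<in> Hom M Q" by (intro Hom_restrict Q O)
      have "\<exists>!u. u \<in> Hom M Q \<and> u \<in> extensional (carrier M) \<and> (\<forall>v\<in>carrier X. u (g v) = (\<lambda>v\<in>carrier X. \<zero>\<^bsub>Q\<^esub>) v)"
        by (rule univ[OF Q(1) PQ z]) (use Hom_carrier[OF O(7)] in auto)
      then have eq: "(\<lambda>v\<in>carrier M. q v) = (\<lambda>v\<in>carrier M. \<zero>\<^bsub>Q\<^esub>)"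
        by (rule ex1_implies_eq) (use i z' Q(4) Hom_carrier[OF O(8)] in auto)
      have "v \<in> g ` carrier X" if "v \<in> carrier M" for v
        using fun_cong[OF eq, of v] that Q(4)[OF that] by auto
      then show ?thesis using Hom_carrier[OF O(8)] by blast
    qed
    moreover have "x \<in> f ` carrier N" if x: "x \<in> carrier X" "g x = \<zero>\<^bsub>M\<^esub>" for x
    proof -
      obtain Q q where Q: "Q \<in> Obj" "q \<in> Hom X Q" "q ` carrier X = carrier Q"
        "\<And>x. x \<in> carrier X \<Longrightarrow> q x = \<zero>\<^bsub>Q\<^esub> \<longleftrightarrow> x \<in> f ` carrier N" "\<And>n. gen X n \<Longrightarrow> gen Q n"
        by (rule cokernel_object[OF O(1,2,7)]) (rule that; assumption)
      have PQ: "P Q" using P Q(1,5) O(2,5) unfolding dim_closed_def by blast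
      have i: "(\<lambda>v\<in>carrier X. q v) \<in> Hom X Q" by (intro Hom_restrict Q O)
      have "\<exists>!u. u \<in> Hom M Q \<and> u \<in> extensional (carrier M) \<and> (\<forall>v\<in>carrier X. u (g v) = (\<lambda>v\<in>carrier X. q v) v)"
        by (rule univ[OF Q(1) PQ i]) (use Q(4) Hom_carrier[OF O(7)] in auto)
      then obtain u where u: "u \<in> Hom M Q" "\<And>v. v \<in> carrier X \<Longrightarrow> u (g v) = q v" by auto
      have "q x = \<zero>\<^bsub>Q\<^esub>" using u(2)[OF x(1)] x(2) Hom_zero_eq[OF u(1) O(3) Q(1)] by simp
      then show ?thesis using Q(4) x by blast
    qed
    ultimately show "coker_exact N X M f g"
      unfolding coker_exact_def using gf Hom_carrier[OF O(7)] by blast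
  }
  {
    assume ex: "coker_exact N X M f g"
    then have surj: "g ` carrier X = carrier M" and im: "f ` carrier N = {x \<in> carrier X. g x = \<zero>\<^bsub>M\<^esub>}"
      by (auto simp: coker_exact_def)
    show "is_cokernel (Cat P) (X, M, g) (N, X, f)"
      unfolding is_cokernel_Cat[OF f g]
    proof (intro conjI ballI allI impI; (elim conjE)?)
      show "g (f v) = \<zero>\<^bsub>M\<^esub>" if "v \<in> carrier N" for v using im that by blast
      fix T t assume T: "T \<in> Obj" and t: "t \<in> Hom X T" and tf: "\<forall>v\<in>carrier N. t (f v) = \<zero>\<^bsub>T\<^esub>"
      interpret T: module K T by (rule Obj_module[OF T])
      define u where "u = (\<lambda>v\<in>carrier M. t (inv_into (carrier X) g v))"
      \<comment> \<open>The preimage chosen by \<open>inv_into\<close> differs from \<open>x\<close>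
        by an element of the image of \<open>f\<close>, which \<open>t\<close> kills.\<close>
      have u: "u (g x) = t x" if x: "x \<in> carrier X" for x
      proof -
        have gx: "g x \<in> g ` carrier X" using x by blast
        define y where "y = inv_into (carrier X) g (g x)"
        have y: "y \<in> carrier X" "g y = g x" using inv_into_into[OF gx] f_inv_into_f[OF gx] by (auto simp: y_def)
        have "g (y \<ominus>\<^bsub>X\<^esub> x) = \<zero>\<^bsub>M\<^esub>"
          using module_hom_minus[OF X.module_axioms M.module_axioms Hom_Lin[OF O(8)] y(1) x] y Hom_carrier[OF O(8) x]
          by (simp add: M.minus_eq M.r_neg)
        then have "y \<ominus>\<^bsub>X\<^esub> x \<in> f ` carrier N" using im x y by simp
        then have "t (y \<ominus>\<^bsub>X\<^esub> x) = \<zero>\<^bsub>T\<^esub>" using tf by auto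
        then have "t y = t x"
          using module_hom_minus[OF X.module_axioms T.module_axioms Hom_Lin[OF t] y(1) x] Hom_carrier[OF t] x y by simp
        then show ?thesis using x Hom_carrier[OF O(8) x] by (simp add: u_def y_def)
      qed
      have ug: "(\<lambda>v. u (g v)) \<in> Hom X T" by (rule Hom_cong[OF O(2) T t]) (simp add: u)
      have "u \<in> Hom M T" by (rule Hom_descend[OF O(2,3) T O(8) _ ug]) (simp add: surj)
      then show "\<exists>!u. u \<in> Hom M T \<and> u \<in> extensional (carrier M) \<and> (\<forall>v\<in>carrier X. u (g v) = t v)"
      proof (intro ex1I[of _ u] conjI ballI; (elim conjE)?)
        fix w assume w: "w \<in> Hom M T" "w \<in> extensional (carrier M)" "\<forall>v\<in>carrier X. w (g v) = t v"
        show "w = u"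
        proof (rule extensionalityI[OF w(2)])
          show "u \<in> extensional (carrier M)" by (simp add: u_def)
          fix m assume "m \<in> carrier M"
          then obtain x where "x \<in> carrier X" "m = g x" using surj by blast
          then show "w m = u m" using w(3) u by simp
        qed
      qed (use u in \<open>auto simp: u_def\<close>)
    qed
  }
qed

text \<open>The fibre product that serves as test object is a kernel inside the direct sum of
  \<open>X\<close> and \<open>Y\<close>, so the subcategory has to contain objects up to that size;
  this is the premise \<open>sum\<close>.\<close>

lemma pullback_iff:
  assumes a: "(X, Z, g) \<in> carr (Cat P)" "(Y, Z, h) \<in> carr (Cat P)" "(L, X, p) \<in> carr (Cat P)" "(L, Y, q) \<in> carr (Cat P)"
    and P: "dim_closed P"
    and sum: "\<And>V. V \<in> Obj \<Longrightarrow> (\<And>n m. gen X n \<Longrightarrow> gen Y m \<Longrightarrow> gen V (n + m)) \<Longrightarrow> P V"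
  shows "is_pullback (Cat P) (X, Z, g) (Y, Z, h) (L, X, p) (L, Y, q) \<longleftrightarrow> pullback_exact X Y L g h p q"
proof
  have O: "X \<in> Obj" "Y \<in> Obj" "Z \<in> Obj" "L \<in> Obj" "P X" "P Y" "P Z" "P L"
    "g \<in> Hom X Z" "h \<in> Hom Y Z" "p \<in> Hom L X" "q \<in> Hom L Y"
    using a by (auto simp: Cat_carr)
  interpret X: module K X by (rule Obj_module[OF O(1)])
  interpret Y: module K Y by (rule Obj_module[OF O(2)])
  interpret Z: module K Z by (rule Obj_module[OF O(3)])
  interpret L: module K L by (rule Obj_module[OF O(4)])
  {
    assume "is_pullback (Cat P) (X, Z, g) (Y, Z, h) (L, X, p) (L, Y, q)"
    then have gp: "\<And>z. z\<in>carrier L \<Longrightarrow> g (p z) = h (q z)"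
     and univ: "\<And>T s t. T \<in> Obj \<Longrightarrow> P T \<Longrightarrow> s \<in> Hom T X \<Longrightarrow> s \<in> extensional (carrier T) \<Longrightarrow> t \<in> Hom T Y \<Longrightarrow> t \<in> extensional (carrier T) \<Longrightarrow>
        (\<forall>v\<in>carrier T. g (s v) = h (t v)) \<Longrightarrow>
      (\<exists>!u. u \<in> Hom T L \<and> u \<in> extensional (carrier T) \<and> (\<forall>v\<in>carrier T. p (u v) = s v \<and> q (u v) = t v))"
      unfolding is_pullback_Cat[OF a] by blast+
    obtain S i1 i2 q1 q2 where S: "S \<in> Obj" "i1 \<in> Hom X S" "i2 \<in> Hom Y S" "q1 \<in> Hom S X" "q2 \<in> Hom S Y"
      "\<And>x. x \<in> carrier X \<Longrightarrow> q1 (i1 x) = x" "\<And>x. x \<in> carrier X \<Longrightarrow> q2 (i1 x) = \<zero>\<^bsub>Y\<^esub>"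
      "\<And>y. y \<in> carrier Y \<Longrightarrow> q1 (i2 y) = \<zero>\<^bsub>X\<^esub>" "\<And>y. y \<in> carrier Y \<Longrightarrow> q2 (i2 y) = y"
      "\<And>z. z \<in> carrier S \<Longrightarrow> i1 (q1 z) \<oplus>\<^bsub>S\<^esub> i2 (q2 z) = z"
      "\<And>n m. gen X n \<Longrightarrow> gen Y m \<Longrightarrow> gen S (n + m)"
      by (rule direct_sum_object[OF O(1,2)]) (rule that; assumption)
    interpret S: module K S by (rule Obj_module[OF S(1)])
    have q1s: "q1 (i1 x \<oplus>\<^bsub>S\<^esub> i2 y) = x" "q2 (i1 x \<oplus>\<^bsub>S\<^esub> i2 y) = y" "i1 x \<oplus>\<^bsub>S\<^esub> i2 y \<in> carrier S"
      if "x \<in> carrier X" "y \<in> carrier Y" for x y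
      using that Hom_carrier[OF S(2)] Hom_carrier[OF S(3)] module_hom_add[OF Hom_Lin[OF S(4)]] module_hom_add[OF Hom_Lin[OF S(5)]]
      by (simp_all add: S(6-9))
    define e where "e z = i1 (p z) \<oplus>\<^bsub>S\<^esub> i2 (q z)" for z
    have e: "e \<in> Hom L S" unfolding e_def
      by (intro Hom_add Hom_comp[OF O(4) O(1) S(1) O(11) S(2)] Hom_comp[OF O(4) O(2) S(1) O(12) S(3)] O S)
    have pe: "q1 (e z) = p z" "q2 (e z) = q z" if "z \<in> carrier L" for z
      using q1s[of "p z" "q z"] that Hom_carrier[OF O(11)] Hom_carrier[OF O(12)] by (simp_all add: e_def)
    \<comment> \<open>\<open>e\<close> is the pair (p, q) as a map into the direct sum. On its
      kernel, the inclusion and the zero map have equal composites with \<open>p\<close> and with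
      \<open>q\<close>.\<close>
    have "inj_on e (carrier L)"
    proof (rule Hom_inj_onI[OF O(4) S(1) e])
      obtain V where V: "V \<in> Obj" "carrier V = {x \<in> carrier L. e x = \<zero>\<^bsub>S\<^esub>}" "(\<lambda>x. x) \<in> Hom V L" "\<zero>\<^bsub>V\<^esub> = \<zero>\<^bsub>L\<^esub>"
        "\<And>n. gen L n \<Longrightarrow> gen V n" using kernel_object[OF O(4) S(1) e] by blast
      have PV: "P V" using P V(1,5) O(4,8) unfolding dim_closed_def by blast
      have z: "(\<lambda>v\<in>carrier V. \<zero>\<^bsub>X\<^esub>) \<in> Hom V X" "(\<lambda>v\<in>carrier V. \<zero>\<^bsub>Y\<^esub>) \<in> Hom V Y" by (intro Hom_restrict V O Hom_zero)+
      have z': "(\<lambda>v\<in>carrier V. \<zero>\<^bsub>L\<^esub>) \<in> Hom V L" by (intro Hom_restrict V O Hom_zero)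
      have i: "(\<lambda>v\<in>carrier V. v) \<in> Hom V L" by (intro Hom_restrict V O)
      have pq0: "p v = \<zero>\<^bsub>X\<^esub>" "q v = \<zero>\<^bsub>Y\<^esub>" if "v \<in> carrier V" for v
        using pe[of v] that V(2) Hom_zero_eq[OF S(4) S(1) O(1)] Hom_zero_eq[OF S(5) S(1) O(2)] by auto
      have "\<exists>!u. u \<in> Hom V L \<and> u \<in> extensional (carrier V) \<and>
          (\<forall>v\<in>carrier V. p (u v) = (\<lambda>v\<in>carrier V. \<zero>\<^bsub>X\<^esub>) v \<and> q (u v) = (\<lambda>v\<in>carrier V. \<zero>\<^bsub>Y\<^esub>) v)"
        by (rule univ[OF V(1) PV z(1) _ z(2)]) (use Hom_zero_eq[OF O(9,1,3)] Hom_zero_eq[OF O(10,2,3)] in auto)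
      then have eq: "(\<lambda>v\<in>carrier V. v) = (\<lambda>v\<in>carrier V. \<zero>\<^bsub>L\<^esub>)"
        by (rule ex1_implies_eq) (use i z' pq0 Hom_zero_eq[OF O(11,4,1)] Hom_zero_eq[OF O(12,4,2)] in auto)
      show "v = \<zero>\<^bsub>L\<^esub>" if "v \<in> carrier L" "e v = \<zero>\<^bsub>S\<^esub>" for v
        using fun_cong[OF eq, of v] that V(2) by auto
    qed
    then have "jointly_inj L p q" unfolding jointly_inj_def inj_on_def e_def by auto
    moreover have "\<exists>z\<in>carrier L. p z = x \<and> q z = y" if xy: "x \<in> carrier X" "y \<in> carrier Y" "g x = h y" for x y
    proof -
      \<comment> \<open>The kernel of \<open>d\<close> is the fibre product inside \<open>S\<close>.
        Its two projections form the test pair, and the induced map sends the pair (x, y) to the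
        required element of \<open>L\<close>.\<close>
      define d where "d z = g (q1 z) \<ominus>\<^bsub>Z\<^esub> h (q2 z)" for z
      have d: "d \<in> Hom S Z" unfolding d_def
        by (intro Hom_minus Hom_comp[OF S(1) O(1) O(3) S(4) O(9)] Hom_comp[OF S(1) O(2) O(3) S(5) O(10)] O S)
      obtain V where V: "V \<in> Obj" "carrier V = {x \<in> carrier S. d x = \<zero>\<^bsub>Z\<^esub>}" "(\<lambda>x. x) \<in> Hom V S" "\<zero>\<^bsub>V\<^esub> = \<zero>\<^bsub>S\<^esub>"
        "\<And>n. gen S n \<Longrightarrow> gen V n" using kernel_object[OF S(1) O(3) d] by blast
      have PV: "P V" by (rule sum[OF V(1)]) (rule V(5)[OF S(11)])
      have i1: "(\<lambda>v\<in>carrier V. q1 v) \<in> Hom V X" and i2: "(\<lambda>v\<in>carrier V. q2 v) \<in> Hom V Y"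
        using Hom_restrict[OF V(1) O(1) Hom_comp[OF V(1) S(1) O(1) V(3) S(4)]]
          Hom_restrict[OF V(1) O(2) Hom_comp[OF V(1) S(1) O(2) V(3) S(5)]] by auto
      have eqv: "g (q1 v) = h (q2 v)" if "v \<in> carrier V" for v
        using that V(2) Hom_carrier[OF O(9) Hom_carrier[OF S(4)]] Hom_carrier[OF O(10) Hom_carrier[OF S(5)]]
        by (auto simp: d_def)
      have "\<exists>!u. u \<in> Hom V L \<and> u \<in> extensional (carrier V) \<and>
          (\<forall>v\<in>carrier V. p (u v) = (\<lambda>v\<in>carrier V. q1 v) v \<and> q (u v) = (\<lambda>v\<in>carrier V. q2 v) v)"
        by (rule univ[OF V(1) PV i1 _ i2]) (use eqv in auto)
      then obtain u where u: "u \<in> Hom V L" "\<And>v. v \<in> carrier V \<Longrightarrow> p (u v) = q1 v" "\<And>v. v \<in> carrier V \<Longrightarrow> q (u v) = q2 v"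
        by auto
      have zV: "i1 x \<oplus>\<^bsub>S\<^esub> i2 y \<in> carrier V"
        using V(2) q1s[OF xy(1,2)] xy Hom_carrier[OF O(9)] Hom_carrier[OF O(10)] by (simp add: d_def Z.minus_eq Z.r_neg)
      show ?thesis
        using u(2,3)[OF zV] q1s[OF xy(1,2)] Hom_carrier[OF u(1) zV] by auto
    qed
    ultimately show "pullback_exact X Y L g h p q"
      unfolding pullback_exact_def using gp by blast
  }
  {
    assume "pullback_exact X Y L g h p q"
    then have jin: "jointly_inj L p q" and comm: "\<And>z. z \<in> carrier L \<Longrightarrow> g (p z) = h (q z)"
      and ex: "\<And>x y. x\<in>carrier X \<Longrightarrow> y\<in>carrier Y \<Longrightarrow> g x = h y \<Longrightarrow> \<exists>z\<in>carrier L. p z = x \<and> q z = y"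
      unfolding pullback_exact_def by blast+
    show "is_pullback (Cat P) (X, Z, g) (Y, Z, h) (L, X, p) (L, Y, q)"
      unfolding is_pullback_Cat[OF a]
    proof (intro conjI ballI allI impI; (elim conjE)?)
      show "g (p z) = h (q z)" if "z \<in> carrier L" for z using comm that .
      fix T s t assume T: "T \<in> Obj" and s: "s \<in> Hom T X" and t: "t \<in> Hom T Y" and eq: "\<forall>v\<in>carrier T. g (s v) = h (t v)"
      define u where "u = (\<lambda>v\<in>carrier T. SOME z. z \<in> carrier L \<and> p z = s v \<and> q z = t v)"
      have u: "u v \<in> carrier L" "p (u v) = s v" "q (u v) = t v" if v: "v \<in> carrier T" for v
      proof -
        have "\<exists>z. z \<in> carrier L \<and> p z = s v \<and> q z = t v"
          using ex[OF Hom_carrier[OF s v] Hom_carrier[OF t v]] eq v by auto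
        from someI_ex[OF this] show "u v \<in> carrier L" "p (u v) = s v" "q (u v) = t v"
          using v by (auto simp: u_def)
      qed
      have pu: "(\<lambda>v. p (u v)) \<in> Hom T X" by (rule Hom_cong[OF T O(1) s]) (simp add: u)
      have qu: "(\<lambda>v. q (u v)) \<in> Hom T Y" by (rule Hom_cong[OF T O(2) t]) (simp add: u)
      have "u \<in> Hom T L" by (rule Hom_lift[OF T O(4,1,2,11,12) jin _ pu qu]) (rule u)
      then show "\<exists>!u. u \<in> Hom T L \<and> u \<in> extensional (carrier T) \<and> (\<forall>v\<in>carrier T. p (u v) = s v \<and> q (u v) = t v)"
      proof (intro ex1I[of _ u] conjI ballI; (elim conjE)?)
        fix w assume w: "w \<in> Hom T L" "w \<in> extensional (carrier T)" "\<forall>v\<in>carrier T. p (w v) = s v \<and> q (w v) = t v"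
        show "w = u"
          by (rule extensionalityI[OF w(2)])
            (use w u jin Hom_carrier[OF w(1)] in \<open>auto simp: u_def jointly_inj_def\<close>)
      qed (use u in \<open>auto simp: u_def\<close>)
    qed
  }
qed

end


section \<open>Extensions and their cocycles\<close>

abbreviation (in rep_setting) C :: "('k, ('k, 'a, 'v) comodule, ('k, 'a, 'v) rep_arrow) lincat" where
  "C \<equiv> rep_cat K A"

locale ext_setting = rep_setting K A vtype
  for K (structure) and A :: "('k, 'a, 'x) hopf_scheme" and vtype :: "'v itself" +
  fixes M N :: "('k, 'a, 'v) comodule"
  assumes M_Obj: "M \<in> Obj" and N_Obj: "N \<in> Obj"
begin

lemmas C_simps [simp] = Cat_simps[of "\<lambda>_. True", unfolded Cat_True]
lemmas C_carr = Cat_carr[of _ _ _ "\<lambda>_. True", unfolded Cat_True, simplified]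
lemmas C_chom = Cat_chom[of _ "\<lambda>_. True", unfolded Cat_True, simplified]

sublocale M: module K M by (rule Obj_module[OF M_Obj])
sublocale N: module K N by (rule Obj_module[OF N_Obj])
sublocale TM: module K "TA M" by (rule tensor_is_module[OF M.module_axioms A.module_axioms])
sublocale TN: module K "TA N" by (rule tensor_is_module[OF N.module_axioms A.module_axioms])

definition is_ext :: "('k, 'a, 'v) comodule \<Rightarrow> ('v \<Rightarrow> 'v) \<Rightarrow> ('v \<Rightarrow> 'v) \<Rightarrow> bool" where
  "is_ext X f g \<longleftrightarrow> X \<in> Obj \<and> f \<in> Hom N X \<and> f \<in> extensional (carrier N) \<and> g \<in> Hom X M \<and> g \<in> extensional (carrier X) \<and>
   inj_on f (carrier N) \<and> f ` carrier N = {x \<in> carrier X. g x = \<zero>\<^bsub>M\<^esub>} \<and> g ` carrier X = carrier M"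

lemma is_extD:
  assumes "is_ext X f g"
  shows "X \<in> Obj" "f \<in> Hom N X" "f \<in> extensional (carrier N)" "g \<in> Hom X M" "g \<in> extensional (carrier X)"
   "inj_on f (carrier N)" "f ` carrier N = {x \<in> carrier X. g x = \<zero>\<^bsub>M\<^esub>}" "g ` carrier X = carrier M"
   "module K X" "f \<in> Lin N X" "g \<in> Lin X M" "module K (TA X)"
   "\<And>n. n \<in> carrier N \<Longrightarrow> g (f n) = \<zero>\<^bsub>M\<^esub>"
  using assms Obj_module Hom_Lin tensor_is_module[OF Obj_module A.module_axioms] unfolding is_ext_def by auto

definition ext_pair :: "('k, 'a, 'v) comodule \<Rightarrow> ('v \<Rightarrow> 'v) \<Rightarrow> ('v \<Rightarrow> 'v) \<Rightarrow> ('k, 'a, 'v) rep_arrow \<times> ('k, 'a, 'v) rep_arrow"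
  where "ext_pair X f g = ((N, X, f), (X, M, g))"

lemma ext_pair_eq [simp]: "ext_pair X f g = ext_pair X' f' g' \<longleftrightarrow> X = X' \<and> f = f' \<and> g = g'"
  by (auto simp: ext_pair_def)

text \<open>This is \<open>kernel_iff\<close> and \<open>cokernel_iff\<close> for the full category,
  where \<open>P\<close> is constantly true.\<close>

lemma extensions_iff: "E \<in> extensions C M N \<longleftrightarrow> (\<exists>X f g. E = ext_pair X f g \<and> is_ext X f g)"
proof -
  have dc: "dim_closed (\<lambda>_. True)" by (simp add: dim_closed_def)
  have k: "is_kernel C (N, X, f) (X, M, g) \<and> is_cokernel C (X, M, g) (N, X, f) \<longleftrightarrow> is_ext X f g" for X f g
  proof (cases "(N, X, f) \<in> carr C \<and> (X, M, g) \<in> carr C")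
    case True
    then show ?thesis
      using kernel_iff[of N X f "\<lambda>_. True" M g] cokernel_iff[of N X f "\<lambda>_. True" M g] dc
      by (auto simp: Cat_True ker_exact_def coker_exact_def is_ext_def C_carr)
  next
    case False
    then show ?thesis using M_Obj N_Obj
      by (auto simp: is_kernel_def is_ext_def C_carr)
  qed
  have c: "X = X'" if "is_kernel C (N', X, f) (X', M', g)" for N' X f X' M' g
    using that by (simp add: is_kernel_def)
  show ?thesis
  proof
    assume E: "E \<in> extensions C M N"
    obtain N' X f' X' M' g' where EE: "E = ((N', X, f'), (X', M', g'))" by (metis prod_cases3 surj_pair)
    then have "N' = N" "M' = M" "is_kernel C (N', X, f') (X', M', g')" "is_cokernel C (X', M', g') (N', X, f')"
      using E by (auto simp: extensions_def)
    then show "\<exists>X f g. E = ext_pair X f g \<and> is_ext X f g"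
      using c[of N' X f' X' M' g'] k[of X f' g'] EE by (auto simp: ext_pair_def)
  next
    assume "\<exists>X f g. E = ext_pair X f g \<and> is_ext X f g"
    then obtain X f g where "E = ext_pair X f g" "is_ext X f g" by blast
    then show "E \<in> extensions C M N"
      using k[of X f g] by (simp add: extensions_def ext_pair_def)
  qed
qed

text \<open>\<open>\<phi>\<close> measures the failure of a linear section of \<open>g\<close> to be a comodule map.\<close>

definition "represents X f g \<phi> \<longleftrightarrow> is_ext X f g \<and> \<phi> \<in> Lin M (TA N) \<and>
  (\<exists>s\<in>Lin M X. \<forall>m\<in>carrier M. g (s m) = m \<and> coact X (s m) = tm X f (\<phi> m) \<oplus>\<^bsub>TA X\<^esub> tm X s (coact M m))"

lemma representsE:
  assumes "represents X f g \<phi>"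
  obtains s where "is_ext X f g" "\<phi> \<in> Lin M (TA N)" "s \<in> Lin M X" "\<And>m. m \<in> carrier M \<Longrightarrow> g (s m) = m"
    "\<And>m. m \<in> carrier M \<Longrightarrow> coact X (s m) = tm X f (\<phi> m) \<oplus>\<^bsub>TA X\<^esub> tm X s (coact M m)"
  using assms unfolding represents_def by blast

lemma represents_cong:
  assumes "represents X f g \<phi>" "\<And>m. m \<in> carrier M \<Longrightarrow> \<psi> m = \<phi> m"
  shows "represents X f g \<psi>"
proof -
  have "\<psi> \<in> Lin M (TA N)"
    using assms by (auto intro!: module_homI simp: module_hom_simps represents_def)
  then show ?thesis using assms unfolding represents_def by auto
qed

lemma ext_section:
  assumes "is_ext X f g"
  obtains s where "s \<in> Lin M X" "\<And>m. m \<in> carrier M \<Longrightarrow> g (s m) = m"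
proof -
  note D = is_extD[OF assms]
  obtain n where "gen M n" using Obj_gen[OF M_Obj] by blast
  then obtain s where s: "s \<in> Lin M X" "\<And>v. v \<in> carrier X \<Longrightarrow> g (s (g v)) = g v"
    using generalized_inverse[OF K.field_axioms D(9) M.module_axioms D(11)] by blast
  have "g (s m) = m" if "m \<in> carrier M" for m
    using that D(8) s(2) by (metis imageE)
  then show ?thesis using that s(1) by blast
qed

text \<open>A retraction adapted to the given section: composing any retraction with 1 - s g makes
  it vanish on the image of \<open>s\<close>, and then f r + s g = 1.\<close>

lemma ext_retraction:
  assumes E: "is_ext X f g" and s: "s \<in> Lin M X" "\<forall>m\<in>carrier M. g (s m) = m"
  obtains r where "r \<in> Lin X N" "\<And>x. x \<in> carrier X \<Longrightarrow> f (r x) \<oplus>\<^bsub>X\<^esub> s (g x) = x"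
    "\<And>n. n \<in> carrier N \<Longrightarrow> r (f n) = n" "\<And>m. m \<in> carrier M \<Longrightarrow> r (s m) = \<zero>\<^bsub>N\<^esub>"
proof -
  note D = is_extD[OF E]
  interpret X: module K X by (rule D(9))
  obtain n where "gen X n" using Obj_gen[OF D(1)] by blast
  then obtain r' where r': "r' \<in> Lin X N" "\<And>v. v \<in> carrier N \<Longrightarrow> f (r' (f v)) = f v"
    using generalized_inverse[OF K.field_axioms N.module_axioms D(9) D(10)] by blast
  have sg: "(\<lambda>x. s (g x)) \<in> Lin X X" by (rule module_hom_compose[OF D(11) s(1)])
  define r where "r x = r' (x \<ominus>\<^bsub>X\<^esub> s (g x))" for x
  have r: "r \<in> Lin X N" unfolding r_def by (rule module_hom_compose[OF Lin_id_minus[OF D(9) sg] r'(1)])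
  have dec: "f (r x) \<oplus>\<^bsub>X\<^esub> s (g x) = x" if x: "x \<in> carrier X" for x
  proof -
    have sgx: "s (g x) \<in> carrier X" using module_hom_carrier[OF sg x] .
    have gx: "g x \<in> carrier M" using module_hom_carrier[OF D(11) x] .
    have "g (x \<ominus>\<^bsub>X\<^esub> s (g x)) = \<zero>\<^bsub>M\<^esub>"
      using module_hom_minus[OF D(9) M.module_axioms D(11) x sgx] bspec[OF s(2) gx] gx by (simp add: M.minus_eq M.r_neg)
    then have "x \<ominus>\<^bsub>X\<^esub> s (g x) \<in> f ` carrier N" using D(7) x sgx by simp
    then obtain n where n: "n \<in> carrier N" "x \<ominus>\<^bsub>X\<^esub> s (g x) = f n" by blast
    then have "f (r x) = x \<ominus>\<^bsub>X\<^esub> s (g x)" unfolding r_def using r'(2) by simp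
    then show ?thesis using x sgx by (simp add: X.minus_eq X.a_assoc X.l_neg)
  qed
  have s0: "s \<zero>\<^bsub>M\<^esub> = \<zero>\<^bsub>X\<^esub>" using module_hom_zero[OF M.module_axioms D(9) s(1)] .
  have inj: "n = n'" if "f n = f n'" "n \<in> carrier N" "n' \<in> carrier N" for n n'
    using D(6) that by (auto simp: inj_on_def)
  have "r (f n) = n" if n: "n \<in> carrier N" for n
  proof (rule inj)
    have fn: "f n \<in> carrier X" "r (f n) \<in> carrier N" "f (r (f n)) \<in> carrier X"
      using n r D(10) by (auto simp: module_hom_carrier)
    show "f (r (f n)) = f n" using dec[OF fn(1)] D(13)[OF n] s0 fn by simp
    show "r (f n) \<in> carrier N" "n \<in> carrier N" using fn n by auto
  qed
  moreover have "r (s m) = \<zero>\<^bsub>N\<^esub>" if m: "m \<in> carrier M" for m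
  proof (rule inj)
    have sm: "s m \<in> carrier X" "r (s m) \<in> carrier N" "f (r (s m)) \<in> carrier X"
      using m s(1) r D(10) by (auto simp: module_hom_carrier)
    show "f (r (s m)) = f \<zero>\<^bsub>N\<^esub>"
      using dec[OF sm(1)] bspec[OF s(2) m] sm module_hom_zero[OF N.module_axioms D(9,10)] by simp
    show "r (s m) \<in> carrier N" "\<zero>\<^bsub>N\<^esub> \<in> carrier N" using sm by auto
  qed
  ultimately show ?thesis using that r dec by blast
qed

text \<open>The defect \<open>y\<close> of the section is annihilated by g \<otimes> 1, because
  \<open>g\<close> is a comodule map and g s = 1. Hence it comes from N \<otimes> A, and r \<otimes>
  1 recovers the preimage \<phi>.\<close>

lemma ext_represented:
  assumes E: "is_ext X f g"
  obtains \<phi> where "represents X f g \<phi>"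
proof -
  note D = is_extD[OF E]
  note AM = A.module_axioms
  interpret X: module K X by (rule D(9))
  interpret TX: module K "TA X" by (rule D(12))
  obtain s where s: "s \<in> Lin M X" "\<And>m. m \<in> carrier M \<Longrightarrow> g (s m) = m" using ext_section[OF E] by blast
  have s2: "\<forall>m\<in>carrier M. g (s m) = m" using s(2) by blast
  obtain r where r: "r \<in> Lin X N" "\<And>x. x \<in> carrier X \<Longrightarrow> f (r x) \<oplus>\<^bsub>X\<^esub> s (g x) = x"
    by (rule ext_retraction[OF E s(1) s2]) (rule that; assumption)
  define y where "y m = coact X (s m) \<ominus>\<^bsub>TA X\<^esub> tm X s (coact M m)" for m
  have L1: "(\<lambda>m. coact X (s m)) \<in> Lin M (TA X)" by (rule module_hom_compose[OF s(1) Obj_coact[OF D(1)]])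
  have L2: "(\<lambda>m. tm X s (coact M m)) \<in> Lin M (TA X)"
    by (rule module_hom_compose[OF Obj_coact[OF M_Obj] tmap_hom[OF M.module_axioms D(9) AM s(1)]])
  have y: "y \<in> Lin M (TA X)"
    unfolding y_def
    by (rule module_homI) (simp_all add: module_hom_simps[OF L1] module_hom_simps[OF L2] TX.minus_eq TX.minus_add TX.a_ac
        TX.smult_r_distr TX.smult_r_minus)
  define \<phi> where "\<phi> m = tm N r (y m)" for m
  have \<phi>: "\<phi> \<in> Lin M (TA N)" unfolding \<phi>_def by (rule module_hom_compose[OF y tmap_hom[OF D(9) N.module_axioms AM r(1)]])
  have "tm X f (\<phi> m) = y m" if m: "m \<in> carrier M" for m
  proof -
    note ym = module_hom_carrier[OF y m] and cm = coact_closed[OF M_Obj m] and sm = module_hom_carrier[OF s(1) m]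
    have "tm M g (tm X s (coact M m)) = tm M (\<lambda>m. g (s m)) (coact M m)"
      by (rule tmap_comp[OF M.module_axioms D(9) M.module_axioms AM s(1) D(11) refl cm])
    also have "\<dots> = coact M m" by (rule tmap_id[OF M.module_axioms AM _ cm]) (rule s(2))
    finally have gs: "tm M g (tm X s (coact M m)) = coact M m" .
    have "tm M g (y m) = tm M g (coact X (s m)) \<ominus>\<^bsub>TA M\<^esub> tm M g (tm X s (coact M m))"
      unfolding y_def
      by (rule module_hom_minus[OF TX.module_axioms TM.module_axioms tmap_hom[OF D(9) M.module_axioms AM D(11)]
            module_hom_carrier[OF L1 m] module_hom_carrier[OF L2 m]])
    also have "\<dots> = \<zero>\<^bsub>TA M\<^esub>"
      using Hom_coact[OF D(4) sm] s(2)[OF m] gs cm by (simp add: TM.minus_eq TM.r_neg)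
    finally have gy: "tm M g (y m) = \<zero>\<^bsub>TA M\<^esub>" .
    \<comment> \<open>The decomposition f r + s g = 1, tensored with \<open>A\<close>; its second
      summand vanishes at \<open>y m\<close>.\<close>
    have "y m = tm X (\<lambda>x. x) (y m)" by (rule tmap_id[OF D(9) AM _ ym, symmetric]) simp
    also have "\<dots> = tm X (\<lambda>x. f (r x)) (y m) \<oplus>\<^bsub>TA X\<^esub> tm X (\<lambda>x. s (g x)) (y m)"
      by (rule tmap_add[OF D(9) D(9) AM module_hom_compose[OF r(1) D(10)] module_hom_compose[OF D(11) s(1)] _ ym])
        (simp add: r(2))
    also have "tm X (\<lambda>x. f (r x)) (y m) = tm X f (\<phi> m)"
      unfolding \<phi>_def by (rule tmap_comp[OF D(9) N.module_axioms D(9) AM r(1) D(10) refl ym, symmetric])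
    also have "tm X (\<lambda>x. s (g x)) (y m) = tm X s (tm M g (y m))"
      by (rule tmap_comp[OF D(9) M.module_axioms D(9) AM D(11) s(1) refl ym, symmetric])
    also have "\<dots> = \<zero>\<^bsub>TA X\<^esub>"
      unfolding gy using module_hom_zero[OF TM.module_axioms TX.module_axioms tmap_hom[OF M.module_axioms D(9) AM s(1)]] .
    finally show ?thesis
      using module_hom_carrier[OF tmap_hom[OF N.module_axioms D(9) AM D(10)] module_hom_carrier[OF \<phi> m]] by simp
  qed
  then have "coact X (s m) = tm X f (\<phi> m) \<oplus>\<^bsub>TA X\<^esub> tm X s (coact M m)" if "m \<in> carrier M" for m
    using that module_hom_carrier[OF L1 that] module_hom_carrier[OF L2 that]
    by (simp add: y_def TX.minus_eq TX.a_assoc TX.l_neg)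
  then show ?thesis using that[of \<phi>] E \<phi> s unfolding represents_def by blast
qed

text \<open>A section identifies an extension linearly with the sum of \<open>N\<close> and
  \<open>M\<close>, and in these coordinates the coaction is determined by the cocycle. For equal
  cocycles the linear identification of the two extensions is therefore an isomorphism of
  comodules.\<close>

lemma represents_morphism:
  assumes "represents X f g \<phi>" "represents X' f' g' \<phi>"
  obtains h h' where "h \<in> Hom X X'" "\<And>n. n \<in> carrier N \<Longrightarrow> h (f n) = f' n" "\<And>x. x \<in> carrier X \<Longrightarrow> g' (h x) = g x"
    "h' \<in> Hom X' X" "\<And>x. x \<in> carrier X \<Longrightarrow> h' (h x) = x" "\<And>x. x \<in> carrier X' \<Longrightarrow> h (h' x) = x"
proof -
  \<comment> \<open>Proved for arbitrary extensions, so that exchanging the roles of the two yields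
    the inverse. Compatibility with the coactions is checked at \<open>f n\<close> and at
    \<open>s m\<close>; in the second case both sides contain the same \<phi>.\<close>
  have half: "\<exists>h. h \<in> Hom X X' \<and> (\<forall>n\<in>carrier N. h (f n) = f' n) \<and> (\<forall>m\<in>carrier M. h (s m) = s' m) \<and> (\<forall>x\<in>carrier X. g' (h x) = g x)"
    if E: "is_ext X f g" and E': "is_ext X' f' g'" and s: "s \<in> Lin M X" "\<And>m. m \<in> carrier M \<Longrightarrow> g (s m) = m"
      "\<And>m. m \<in> carrier M \<Longrightarrow> coact X (s m) = tm X f (\<phi> m) \<oplus>\<^bsub>TA X\<^esub> tm X s (coact M m)"
    and s': "s' \<in> Lin M X'" "\<And>m. m \<in> carrier M \<Longrightarrow> g' (s' m) = m"
      "\<And>m. m \<in> carrier M \<Longrightarrow> coact X' (s' m) = tm X' f' (\<phi> m) \<oplus>\<^bsub>TA X'\<^esub> tm X' s' (coact M m)"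
    and \<phi>: "\<phi> \<in> Lin M (TA N)"
    for X f g X' f' g' s s'
  proof -
    note D = is_extD[OF E] and D' = is_extD[OF E']
    note AM = A.module_axioms
    interpret X: module K X by (rule D(9))
    interpret TX: module K "TA X" by (rule D(12))
    interpret X': module K X' by (rule D'(9))
    interpret TX': module K "TA X'" by (rule D'(12))
  have s2: "\<forall>m\<in>carrier M. g (s m) = m" using s(2) by blast
    obtain r where r: "r \<in> Lin X N" "\<And>x. x \<in> carrier X \<Longrightarrow> f (r x) \<oplus>\<^bsub>X\<^esub> s (g x) = x"
      "\<And>n. n \<in> carrier N \<Longrightarrow> r (f n) = n" "\<And>m. m \<in> carrier M \<Longrightarrow> r (s m) = \<zero>\<^bsub>N\<^esub>"
      by (rule ext_retraction[OF E s(1) s2]) (rule that; assumption)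
    define h where "h x = f' (r x) \<oplus>\<^bsub>X'\<^esub> s' (g x)" for x
    have fr: "(\<lambda>x. f' (r x)) \<in> Lin X X'" and sg: "(\<lambda>x. s' (g x)) \<in> Lin X X'"
      by (rule module_hom_compose[OF r(1) D'(10)], rule module_hom_compose[OF D(11) s'(1)])
    have h: "h \<in> Lin X X'"
      unfolding h_def
      by (rule module_homI) (simp_all add: module_hom_simps[OF fr] module_hom_simps[OF sg] X'.a_ac X'.smult_r_distr)
    have f'0: "f' \<zero>\<^bsub>N\<^esub> = \<zero>\<^bsub>X'\<^esub>" and s'0: "s' \<zero>\<^bsub>M\<^esub> = \<zero>\<^bsub>X'\<^esub>"
      using module_hom_zero[OF N.module_axioms D'(9,10)] module_hom_zero[OF M.module_axioms D'(9) s'(1)] by auto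
    have hf: "h (f n) = f' n" if "n \<in> carrier N" for n
      using that r(3) D(13) s'0 module_hom_carrier[OF D'(10)] by (simp add: h_def)
    have hs: "h (s m) = s' m" if "m \<in> carrier M" for m
      using that r(4) s(2) f'0 module_hom_carrier[OF s'(1)] by (simp add: h_def)
    have gh: "g' (h x) = g x" if "x \<in> carrier X" for x
      using that module_hom_add[OF D'(11)] module_hom_carrier[OF r(1) that] module_hom_carrier[OF fr that]
        module_hom_carrier[OF sg that] D'(13) s'(2) module_hom_carrier[OF D(11) that] by (simp add: h_def)
    have co: "coact X' (h x) = tm X' h (coact X x)" if x: "x \<in> carrier X" for x
    proof -
      let ?n = "r x" and ?m = "g x"
      have n: "?n \<in> carrier N" "f ?n \<in> carrier X" and m: "?m \<in> carrier M" "s ?m \<in> carrier X"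
        using x r(1) D(10,11) s(1) by (auto simp: module_hom_carrier)
      note cn = coact_closed[OF N_Obj n(1)] and cm = coact_closed[OF M_Obj m(1)] and pm = module_hom_carrier[OF \<phi> m(1)]
      have 1: "coact X' (h (f ?n)) = tm X' h (coact X (f ?n))"
        using hf[OF n(1)] Hom_coact[OF D'(2) n(1)] Hom_coact[OF D(2) n(1)]
          tmap_comp[OF N.module_axioms D(9) D'(9) AM D(10) h, of f' "coact N ?n"] hf cn by simp
      have t: "tm X f (\<phi> ?m) \<in> carrier (TA X)" "tm X s (coact M ?m) \<in> carrier (TA X)"
        using module_hom_carrier[OF tmap_hom[OF N.module_axioms D(9) AM D(10)] pm]
          module_hom_carrier[OF tmap_hom[OF M.module_axioms D(9) AM s(1)] cm] by auto
      have 2: "coact X' (h (s ?m)) = tm X' h (coact X (s ?m))"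
        using hs[OF m(1)] s(3)[OF m(1)] s'(3)[OF m(1)] module_hom_add[OF tmap_hom[OF D(9) D'(9) AM h] t]
          tmap_comp[OF N.module_axioms D(9) D'(9) AM D(10) h, of f' "\<phi> ?m"]
          tmap_comp[OF M.module_axioms D(9) D'(9) AM s(1) h, of s' "coact M ?m"] hf hs pm cm by simp
      have cx: "coact X x = coact X (f ?n) \<oplus>\<^bsub>TA X\<^esub> coact X (s ?m)"
        using module_hom_add[OF Obj_coact[OF D(1)] n(2) m(2)] r(2)[OF x] by simp
      have chx: "coact X' (h x) = coact X' (h (f ?n)) \<oplus>\<^bsub>TA X'\<^esub> coact X' (h (s ?m))"
        using module_hom_add[OF module_hom_compose[OF h Obj_coact[OF D'(1)]] n(2) m(2)] r(2)[OF x] by simp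
      show ?thesis
        unfolding cx chx 1 2
        by (rule module_hom_add[OF tmap_hom[OF D(9) D'(9) AM h] coact_closed[OF D(1) n(2)] coact_closed[OF D(1) m(2)], symmetric])
    qed
    show ?thesis using HomI[OF h co] hf hs gh by blast
  qed
  obtain s where E: "is_ext X f g" and s: "s \<in> Lin M X" "\<And>m. m \<in> carrier M \<Longrightarrow> g (s m) = m"
      "\<And>m. m \<in> carrier M \<Longrightarrow> coact X (s m) = tm X f (\<phi> m) \<oplus>\<^bsub>TA X\<^esub> tm X s (coact M m)" and \<phi>: "\<phi> \<in> Lin M (TA N)"
    using assms(1) by (rule representsE) (rule that; assumption)
  obtain s' where E': "is_ext X' f' g'" and s': "s' \<in> Lin M X'" "\<And>m. m \<in> carrier M \<Longrightarrow> g' (s' m) = m"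
      "\<And>m. m \<in> carrier M \<Longrightarrow> coact X' (s' m) = tm X' f' (\<phi> m) \<oplus>\<^bsub>TA X'\<^esub> tm X' s' (coact M m)"
    using assms(2) by (rule representsE) (rule that; assumption)
  obtain h where h: "h \<in> Hom X X'" "\<forall>n\<in>carrier N. h (f n) = f' n" "\<forall>m\<in>carrier M. h (s m) = s' m" "\<forall>x\<in>carrier X. g' (h x) = g x"
    using half[OF E E' s s' \<phi>] by blast
  obtain h' where h': "h' \<in> Hom X' X" "\<forall>n\<in>carrier N. h' (f' n) = f n" "\<forall>m\<in>carrier M. h' (s' m) = s m"
    using half[OF E' E s' s \<phi>] by blast
  \<comment> \<open>Every vector is the sum of a value of \<open>f\<close> and a value of
    \<open>s\<close>, and \<open>k'\<close> undoes \<open>k\<close> on both.\<close>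
  have inverse: "k' (k x) = x"
    if E: "is_ext X f g" and s: "s \<in> Lin M X" "\<And>m. m \<in> carrier M \<Longrightarrow> g (s m) = m"
     and k: "k \<in> Hom X X'" "\<forall>n\<in>carrier N. k (f n) = f' n" "\<forall>m\<in>carrier M. k (s m) = s' m"
     and k': "k' \<in> Hom X' X" "\<forall>n\<in>carrier N. k' (f' n) = f n" "\<forall>m\<in>carrier M. k' (s' m) = s m"
     and x: "x \<in> carrier X" for X X' f g f' s s' k k' x
  proof -
    note D = is_extD[OF E]
  have s2: "\<forall>m\<in>carrier M. g (s m) = m" using s(2) by blast
    obtain r where r: "r \<in> Lin X N" "\<And>x. x \<in> carrier X \<Longrightarrow> f (r x) \<oplus>\<^bsub>X\<^esub> s (g x) = x"
      by (rule ext_retraction[OF E s(1) s2]) (rule that; assumption)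
    have n: "r x \<in> carrier N" "f (r x) \<in> carrier X" and m: "g x \<in> carrier M" "s (g x) \<in> carrier X"
      using x r(1) D(10,11) s(1) by (auto simp: module_hom_carrier)
    have "k' (k (f (r x) \<oplus>\<^bsub>X\<^esub> s (g x))) = f (r x) \<oplus>\<^bsub>X\<^esub> s (g x)"
      using module_hom_add[OF module_hom_compose[OF Hom_Lin[OF k(1)] Hom_Lin[OF k'(1)]] n(2) m(2)] k k' n m by simp
    then show ?thesis using r(2)[OF x] by simp
  qed
  show ?thesis
    by (rule that[of h h']) (use h h' inverse[OF E s(1,2) h(1-3) h'] inverse[OF E' s'(1,2) h' h(1-3)] in auto)
qed

text \<open>The section h s of the target has cocycle c \<phi>, since \<open>h\<close> carries the
  copy of \<open>N\<close> in \<open>X\<close> to that in \<open>X'\<close> through multiplication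
  by \<open>c\<close>. With c = 1 this shows that a morphism of extensions preserves
  cocycles.\<close>

lemma represents_pushforward:
  assumes R: "represents X f g \<phi>" and E': "is_ext X' f' g'" and h: "h \<in> Hom X X'" and c: "c \<in> carrier K"
    and hf: "\<And>n. n \<in> carrier N \<Longrightarrow> h (f n) = f' (c \<odot>\<^bsub>N\<^esub> n)" and gh: "\<And>x. x \<in> carrier X \<Longrightarrow> g' (h x) = g x"
  shows "represents X' f' g' (\<lambda>m. c \<odot>\<^bsub>TA N\<^esub> \<phi> m)"
proof -
  obtain s where E: "is_ext X f g" and s: "s \<in> Lin M X" "\<And>m. m \<in> carrier M \<Longrightarrow> g (s m) = m"
      "\<And>m. m \<in> carrier M \<Longrightarrow> coact X (s m) = tm X f (\<phi> m) \<oplus>\<^bsub>TA X\<^esub> tm X s (coact M m)" and \<phi>: "\<phi> \<in> Lin M (TA N)"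
    using R by (rule representsE) (rule that; assumption)
  note D = is_extD[OF E] and D' = is_extD[OF E'] and hL = Hom_Lin[OF h]
  note AM = A.module_axioms
  have comm: "c \<odot>\<^bsub>TA N\<^esub> (r \<odot>\<^bsub>TA N\<^esub> w) = r \<odot>\<^bsub>TA N\<^esub> (c \<odot>\<^bsub>TA N\<^esub> w)" if "r \<in> carrier K" "w \<in> carrier (TA N)" for r w
    using that c by (metis A.R.m_comm TN.smult_assoc1)
  have c\<phi>: "(\<lambda>m. c \<odot>\<^bsub>TA N\<^esub> \<phi> m) \<in> Lin M (TA N)"
    by (rule module_homI) (use c in \<open>simp_all add: module_hom_simps[OF \<phi>] TN.smult_r_distr comm\<close>)
  have cN: "(\<lambda>n. c \<odot>\<^bsub>N\<^esub> n) \<in> Lin N N"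
    using Hom_Lin[OF Hom_smult[OF N_Obj N_Obj Hom_id[OF N_Obj] c]] .
  have "coact X' (h (s m)) = tm X' f' (c \<odot>\<^bsub>TA N\<^esub> \<phi> m) \<oplus>\<^bsub>TA X'\<^esub> tm X' (\<lambda>m. h (s m)) (coact M m)"
    if m: "m \<in> carrier M" for m
  proof -
    note cm = coact_closed[OF M_Obj m] and pm = module_hom_carrier[OF \<phi> m]
    have t: "tm X f (\<phi> m) \<in> carrier (TA X)" "tm X s (coact M m) \<in> carrier (TA X)"
      using module_hom_carrier[OF tmap_hom[OF N.module_axioms D(9) AM D(10)] pm]
        module_hom_carrier[OF tmap_hom[OF M.module_axioms D(9) AM s(1)] cm] by auto
    have "tm X' h (tm X f (\<phi> m)) = tm X' (\<lambda>n. f' (c \<odot>\<^bsub>N\<^esub> n)) (\<phi> m)"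
      by (rule tmap_comp[OF N.module_axioms D(9) D'(9) AM D(10) hL _ pm]) (simp add: hf)
    also have "\<dots> = tm X' f' (tm N (\<lambda>n. c \<odot>\<^bsub>N\<^esub> n) (\<phi> m))"
      by (rule tmap_comp[OF N.module_axioms N.module_axioms D'(9) AM cN D'(10) refl pm, symmetric])
    also have "tm N (\<lambda>n. c \<odot>\<^bsub>N\<^esub> n) (\<phi> m) = c \<odot>\<^bsub>TA N\<^esub> tm N (\<lambda>n. n) (\<phi> m)"
      by (rule tmap_smult[OF N.module_axioms N.module_axioms AM Hom_Lin[OF Hom_id[OF N_Obj]] c refl pm])
    also have "tm N (\<lambda>n. n) (\<phi> m) = \<phi> m" by (rule tmap_id[OF N.module_axioms AM refl pm])
    finally show ?thesis
      using Hom_coact[OF h module_hom_carrier[OF s(1) m]] s(3)[OF m] module_hom_add[OF tmap_hom[OF D(9) D'(9) AM hL] t]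
        tmap_comp[OF M.module_axioms D(9) D'(9) AM s(1) hL refl cm] by simp
  qed
  then show ?thesis
    unfolding represents_def using E' c\<phi> module_hom_compose[OF s(1) hL] gh s(2) module_hom_carrier[OF s(1)]
    by (intro conjI bexI[of _ "\<lambda>m. h (s m)"]) auto
qed

end

section \<open>Baer sums and cocycles\<close>

context ext_setting
begin

text \<open>What \<open>is_baer_sum\<close> asks apart from the pullback, with the equations between
  arrows spelled out on carriers. The pullback condition is kept separate as
  \<open>pullback_exact\<close>.\<close>

definition baer_data where
  "baer_data X1 f1 g1 X2 f2 X f g L p1 p2 s j q \<longleftrightarrow>
     (L, X1, p1) \<in> carr C \<and> (L, X2, p2) \<in> carr C \<and>
     (N, L, s) \<in> carr C \<and> (N, L, j) \<in> carr C \<and> (L, X, q) \<in> carr C \<and>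
     (\<forall>n\<in>carrier N. p1 (s n) = f1 n) \<and> (\<forall>n\<in>carrier N. p2 (s n) \<oplus>\<^bsub>X2\<^esub> f2 n = \<zero>\<^bsub>X2\<^esub>) \<and>
     (\<forall>n\<in>carrier N. p1 (j n) = f1 n) \<and> (\<forall>n\<in>carrier N. p2 (j n) = \<zero>\<^bsub>X2\<^esub>) \<and>
     coker_exact N L X s q \<and> (\<forall>n\<in>carrier N. q (j n) = f n) \<and> (\<forall>z\<in>carrier L. g (q z) = g1 (p1 z))"

lemma ext_carr:
  assumes "is_ext X f g"
  shows "(N, X, f) \<in> carr C" "(X, M, g) \<in> carr C"
  using is_extD[OF assms] M_Obj N_Obj by (auto simp: C_carr)

lemma baer_iff:
  assumes E1: "is_ext X1 f1 g1" and E2: "is_ext X2 f2 g2" and E: "is_ext X f g"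
  shows "is_baer_sum C M N (ext_pair X1 f1 g1) (ext_pair X2 f2 g2) (ext_pair X f g) \<longleftrightarrow>
    (\<exists>L p1 p2 s j q. baer_data X1 f1 g1 X2 f2 X f g L p1 p2 s j q \<and> pullback_exact X1 X2 L g1 g2 p1 p2)"
proof -
  have dc: "dim_closed (\<lambda>_. True)" by (simp add: dim_closed_def)
  have ext: "ext_pair X1 f1 g1 \<in> extensions C M N" "ext_pair X2 f2 g2 \<in> extensions C M N" "ext_pair X f g \<in> extensions C M N"
    using assms extensions_iff by auto
  note ca = ext_carr[OF E1] ext_carr[OF E2] ext_carr[OF E]
  have pb: "is_pullback C (X1, M, g1) (X2, M, g2) (L, X1, p1) (L, X2, p2) \<longleftrightarrow> pullback_exact X1 X2 L g1 g2 p1 p2"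
    if "(L, X1, p1) \<in> carr C" "(L, X2, p2) \<in> carr C" for L p1 p2
    using pullback_iff[of X1 M g1 "\<lambda>_. True" X2 g2 L p1 p2] ca that dc unfolding Cat_True by simp
  have ck: "is_cokernel C (L, X, q) (N, L, s) \<longleftrightarrow> coker_exact N L X s q"
    if "(N, L, s) \<in> carr C" "(L, X, q) \<in> carr C" for L s q
    using cokernel_iff[of N L s "\<lambda>_. True" X q] that dc unfolding Cat_True by simp
  have pbD: "L' = L \<and> Y = X1 \<and> Y' = X2 \<and> (L, X1, p1) \<in> carr C \<and> (L, X2, p2) \<in> carr C"
    if "is_pullback C (X1, M, g1) (X2, M, g2) (L, Y, p1) (L', Y', p2)" for L L' Y Y' p1 p2
    using that unfolding is_pullback_def by auto
  have ckD: "(N', L, s) \<in> carr C \<and> (L', Y, q) \<in> carr C \<and> L' = L"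
    if "is_cokernel C (L', Y, q) (N', L, s)" for N' L L' Y s q
    using that unfolding is_cokernel_def by auto
  show ?thesis
  proof
    assume "is_baer_sum C M N (ext_pair X1 f1 g1) (ext_pair X2 f2 g2) (ext_pair X f g)"
    then obtain P1 P2 S J Q where *: "is_pullback C (X1, M, g1) (X2, M, g2) P1 P2"
      "S \<in> chom C N (cdom C P1)" "ccomp C P1 S = (N, X1, f1)"
      "cadd C (ccomp C P2 S) (N, X2, f2) = czero C N X2"
      "J \<in> chom C N (cdom C P1)" "ccomp C P1 J = (N, X1, f1)" "ccomp C P2 J = czero C N X2"
      "is_cokernel C Q S" "ccod C Q = X" "ccomp C Q J = (N, X, f)" "ccomp C (X, M, g) Q = ccomp C (X1, M, g1) P1"
      unfolding is_baer_sum_def ext_pair_def by auto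
    obtain L Y p1 where P1: "P1 = (L, Y, p1)" by (cases P1)
    obtain L' Y' p2 where P2: "P2 = (L', Y', p2)" by (cases P2)
    note pd = pbD[OF *(1)[unfolded P1 P2]]
    obtain s where S: "S = (N, L, s)" "(N, L, s) \<in> carr C" using *(2) P1 by (auto simp: C_chom C_carr)
    obtain j where J: "J = (N, L, j)" "(N, L, j) \<in> carr C" using *(5) P1 by (auto simp: C_chom C_carr)
    obtain L'' Z q where Q: "Q = (L'', Z, q)" by (cases Q)
    note cd = ckD[OF *(8)[unfolded Q S]]
    have "Z = X" using *(9) Q by simp
    have 1: "compose (carrier N) p1 s = f1" "compose (carrier N) p1 j = f1"
      "compose (carrier N) q j = f" "compose (carrier L) g q = compose (carrier L) g1 p1"
      using * P1 S J Q pd cd by auto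
    have 2: "(\<lambda>v\<in>carrier N. compose (carrier N) p2 s v \<oplus>\<^bsub>X2\<^esub> f2 v) = (\<lambda>v\<in>carrier N. \<zero>\<^bsub>X2\<^esub>)"
       "compose (carrier N) p2 j = (\<lambda>v\<in>carrier N. \<zero>\<^bsub>X2\<^esub>)"
      using *(4,7) P2 S J pd by auto
    have "baer_data X1 f1 g1 X2 f2 X f g L p1 p2 s j q"
      unfolding baer_data_def
    proof (intro conjI ballI)
      show "p1 (s n) = f1 n" "p1 (j n) = f1 n" "q (j n) = f n" if "n \<in> carrier N" for n
        using 1(1-3) that by (auto simp: compose_def fun_eq_iff split: if_splits)
      show "g (q z) = g1 (p1 z)" if "z \<in> carrier L" for z
        using fun_cong[OF 1(4), of z] that by (simp add: compose_eq)
      show "p2 (s n) \<oplus>\<^bsub>X2\<^esub> f2 n = \<zero>\<^bsub>X2\<^esub>" "p2 (j n) = \<zero>\<^bsub>X2\<^esub>" if "n \<in> carrier N" for n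
        using fun_cong[OF 2(1), of n] fun_cong[OF 2(2), of n] that by (simp_all add: compose_eq)
      show "coker_exact N L X s q" using *(8) ck[of L s q] Q S cd \<open>Z = X\<close> by auto
    qed (use pd cd S J \<open>Z = X\<close> in auto)
    moreover have "pullback_exact X1 X2 L g1 g2 p1 p2" using pb[of L p1 p2] *(1) P1 P2 pd by simp
    ultimately show "\<exists>L p1 p2 s j q. baer_data X1 f1 g1 X2 f2 X f g L p1 p2 s j q \<and> pullback_exact X1 X2 L g1 g2 p1 p2"
      by blast
  next
    assume "\<exists>L p1 p2 s j q. baer_data X1 f1 g1 X2 f2 X f g L p1 p2 s j q \<and> pullback_exact X1 X2 L g1 g2 p1 p2"
    then obtain L p1 p2 s j q where b: "baer_data X1 f1 g1 X2 f2 X f g L p1 p2 s j q" and p: "pullback_exact X1 X2 L g1 g2 p1 p2"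
      by blast
    note b = b[unfolded baer_data_def]
    have x: "f1 \<in> extensional (carrier N)" "f \<in> extensional (carrier N)" using is_extD(3)[OF E1] is_extD(3)[OF E] .
    have c: "(N, L, s) \<in> carr C" "(L, X, q) \<in> carr C" "(L, X1, p1) \<in> carr C" "(L, X2, p2) \<in> carr C" "(N, L, j) \<in> carr C"
      using b by auto
    show "is_baer_sum C M N (ext_pair X1 f1 g1) (ext_pair X2 f2 g2) (ext_pair X f g)"
      unfolding is_baer_sum_def ext_pair_def case_prod_conv
    proof (intro conjI exI)
      show "is_pullback C (X1, M, g1) (X2, M, g2) (L, X1, p1) (L, X2, p2)" using pb c p by simp
      show "is_cokernel C (L, X, q) (N, L, s)" using ck c b by simp
      show "(N, L, s) \<in> chom C N (cdom C (L, X1, p1))" "(N, L, j) \<in> chom C N (cdom C (L, X1, p1))"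
        using c by (auto simp: chom_def)
    qed (use b x ext[unfolded ext_pair_def] in \<open>auto simp: restrict_def fun_eq_iff compose_def extensional_def\<close>)
  qed
qed

text \<open>The sections \<open>s1\<close> and \<open>s2\<close> have equal composites to
  \<open>M\<close>, so they define a section \<sigma> into the fibre product. Its defect is the sum
  of the two cocycles, each placed in its own copy of \<open>N\<close>, and \<open>q\<close> merges
  the two copies into the copy of \<open>N\<close> in \<open>X\<close>.\<close>

lemma baer_represents:
  assumes R1: "represents X1 f1 g1 \<phi>1" and R2: "represents X2 f2 g2 \<phi>2" and E: "is_ext X f g"
    and b: "baer_data X1 f1 g1 X2 f2 X f g L p1 p2 s j q" and pe: "pullback_exact X1 X2 L g1 g2 p1 p2"
  shows "represents X f g (\<lambda>m. \<phi>1 m \<oplus>\<^bsub>TA N\<^esub> \<phi>2 m)"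
proof -
  obtain s1 where E1: "is_ext X1 f1 g1" and s1: "s1 \<in> Lin M X1" "\<And>m. m \<in> carrier M \<Longrightarrow> g1 (s1 m) = m"
      "\<And>m. m \<in> carrier M \<Longrightarrow> coact X1 (s1 m) = tm X1 f1 (\<phi>1 m) \<oplus>\<^bsub>TA X1\<^esub> tm X1 s1 (coact M m)" and \<phi>1: "\<phi>1 \<in> Lin M (TA N)"
    using R1 by (rule representsE) (rule that; assumption)
  obtain s2 where E2: "is_ext X2 f2 g2" and s2: "s2 \<in> Lin M X2" "\<And>m. m \<in> carrier M \<Longrightarrow> g2 (s2 m) = m"
      "\<And>m. m \<in> carrier M \<Longrightarrow> coact X2 (s2 m) = tm X2 f2 (\<phi>2 m) \<oplus>\<^bsub>TA X2\<^esub> tm X2 s2 (coact M m)" and \<phi>2: "\<phi>2 \<in> Lin M (TA N)"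
    using R2 by (rule representsE) (rule that; assumption)
  note D = is_extD[OF E] and D1 = is_extD[OF E1] and D2 = is_extD[OF E2]
  note AM = A.module_axioms
  note b = b[unfolded baer_data_def C_carr]
  have O: "L \<in> Obj" "p1 \<in> Hom L X1" "p2 \<in> Hom L X2" "s \<in> Hom N L" "j \<in> Hom N L" "q \<in> Hom L X" using b by auto
  have bs: "\<And>n. n\<in>carrier N \<Longrightarrow> p1 (s n) = f1 n" "\<And>n. n\<in>carrier N \<Longrightarrow> p2 (s n) \<oplus>\<^bsub>X2\<^esub> f2 n = \<zero>\<^bsub>X2\<^esub>"
     "\<And>n. n\<in>carrier N \<Longrightarrow> p1 (j n) = f1 n" "\<And>n. n\<in>carrier N \<Longrightarrow> p2 (j n) = \<zero>\<^bsub>X2\<^esub>"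
     "\<And>n. n\<in>carrier N \<Longrightarrow> q (j n) = f n" "\<And>z. z\<in>carrier L \<Longrightarrow> g (q z) = g1 (p1 z)" "coker_exact N L X s q"
    using b by auto
  have jin: "jointly_inj L p1 p2"
    and pb: "\<And>x y. x\<in>carrier X1 \<Longrightarrow> y\<in>carrier X2 \<Longrightarrow> g1 x = g2 y \<Longrightarrow> \<exists>z\<in>carrier L. p1 z = x \<and> p2 z = y"
    using pe unfolding pullback_exact_def by auto
  have qs: "q (s n) = \<zero>\<^bsub>X\<^esub>" if "n \<in> carrier N" for n
    using bs(7) that unfolding coker_exact_def by blast
  note LM = Obj_module[OF O(1)] and pL = Hom_Lin[OF O(2)] Hom_Lin[OF O(3)] and sL = Hom_Lin[OF O(4)] and jL = Hom_Lin[OF O(5)]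
    and qL = Hom_Lin[OF O(6)]
  interpret L: module K L by (rule LM)
  interpret X: module K X by (rule D(9))
  interpret X1: module K X1 by (rule D1(9))
  interpret X2: module K X2 by (rule D2(9))
  interpret TL: module K "TA L" by (rule tensor_is_module[OF LM AM])
  interpret TX: module K "TA X" by (rule D(12))
  interpret TX1: module K "TA X1" by (rule D1(12))
  interpret TX2: module K "TA X2" by (rule D2(12))
  obtain r1 r2 where r: "r1 \<in> Lin X1 L" "r2 \<in> Lin X2 L" "\<And>z. z \<in> carrier L \<Longrightarrow> r1 (p1 z) \<oplus>\<^bsub>L\<^esub> r2 (p2 z) = z"
    by (rule joint_retraction[OF O(1) D1(1) D2(1) pL jin]) (rule that; assumption)
  \<comment> \<open>Built from the retractions so as to be linear from the outset. It lifts the pair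
    (s1, s2) because that pair comes from an element of \<open>L\<close>.\<close>
  define \<sigma> where "\<sigma> m = r1 (s1 m) \<oplus>\<^bsub>L\<^esub> r2 (s2 m)" for m
  have rs: "(\<lambda>m. r1 (s1 m)) \<in> Lin M L" "(\<lambda>m. r2 (s2 m)) \<in> Lin M L"
    by (rule module_hom_compose[OF s1(1) r(1)], rule module_hom_compose[OF s2(1) r(2)])
  have \<sigma>: "\<sigma> \<in> Lin M L"
    unfolding \<sigma>_def
    by (rule module_homI) (simp_all add: module_hom_simps[OF rs(1)] module_hom_simps[OF rs(2)] L.a_ac L.smult_r_distr)
  have p\<sigma>: "p1 (\<sigma> m) = s1 m" "p2 (\<sigma> m) = s2 m" if m: "m \<in> carrier M" for m
  proof -
    obtain z where z: "z \<in> carrier L" "p1 z = s1 m" "p2 z = s2 m"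
      using pb[of "s1 m" "s2 m"] s1(2)[OF m] s2(2)[OF m] module_hom_carrier[OF s1(1) m] module_hom_carrier[OF s2(1) m] by auto
    have "\<sigma> m = z" using r(3)[OF z(1)] z by (simp add: \<sigma>_def)
    then show "p1 (\<sigma> m) = s1 m" "p2 (\<sigma> m) = s2 m" using z by auto
  qed
  \<comment> \<open>The copy of \<open>N\<close> in the second factor. It differs from
    \<open>j\<close> by the skew diagonal, which \<open>q\<close> kills, so \<open>q\<close> gives
    \<open>f\<close> on both copies.\<close>
  define j2 where "j2 n = j n \<ominus>\<^bsub>L\<^esub> s n" for n
  have j2: "j2 \<in> Lin N L" unfolding j2_def by (rule Hom_Lin[OF Hom_minus[OF N_Obj O(1) O(5) O(4)]])
  have pj2: "p1 (j2 n) = \<zero>\<^bsub>X1\<^esub>" "p2 (j2 n) = f2 n" "q (j2 n) = f n" if n: "n \<in> carrier N" for n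
  proof -
    note jn = module_hom_carrier[OF jL n] and sn = module_hom_carrier[OF sL n] and ps = module_hom_carrier[OF pL(2) sn]
    show "p1 (j2 n) = \<zero>\<^bsub>X1\<^esub>"
      unfolding j2_def using module_hom_minus[OF LM D1(9) pL(1) jn sn] bs(1,3)[OF n] module_hom_carrier[OF D1(10) n]
      by (simp add: X1.minus_eq X1.r_neg)
    have "p2 (s n) = \<ominus>\<^bsub>X2\<^esub> f2 n"
      using X2.minus_equality[OF bs(2)[OF n]] module_hom_carrier[OF D2(10) n] ps by simp
    then show "p2 (j2 n) = f2 n"
      unfolding j2_def using module_hom_minus[OF LM D2(9) pL(2) jn sn] bs(4)[OF n] module_hom_carrier[OF D2(10) n]
      by (simp add: X2.minus_eq)
    show "q (j2 n) = f n"
      unfolding j2_def using module_hom_minus[OF LM D(9) qL jn sn] bs(5)[OF n] qs[OF n] module_hom_carrier[OF D(10) n]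
      by (simp add: X.minus_eq)
  qed
  \<comment> \<open>Checked after p1 \<otimes> 1 and p2 \<otimes> 1: each projection keeps one of
    the two cocycles and gives the defining equation of \<open>s1\<close> or of
    \<open>s2\<close>.\<close>
  have co: "coact L (\<sigma> m) = (tm L j (\<phi>1 m) \<oplus>\<^bsub>TA L\<^esub> tm L j2 (\<phi>2 m)) \<oplus>\<^bsub>TA L\<^esub> tm L \<sigma> (coact M m)" if m: "m \<in> carrier M" for m
  proof -
    note cm = coact_closed[OF M_Obj m] and pm1 = module_hom_carrier[OF \<phi>1 m] and pm2 = module_hom_carrier[OF \<phi>2 m]
      and \<sigma>m = module_hom_carrier[OF \<sigma> m]
    have t: "tm L j (\<phi>1 m) \<in> carrier (TA L)" "tm L j2 (\<phi>2 m) \<in> carrier (TA L)" "tm L \<sigma> (coact M m) \<in> carrier (TA L)"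
      using module_hom_carrier[OF tmap_hom[OF N.module_axioms LM AM jL] pm1]
        module_hom_carrier[OF tmap_hom[OF N.module_axioms LM AM j2] pm2]
        module_hom_carrier[OF tmap_hom[OF M.module_axioms LM AM \<sigma>] cm] by auto
    show ?thesis
    proof (rule tmap_jointly_inj[OF O(1) D1(1) D2(1) pL jin coact_closed[OF O(1) \<sigma>m]])
      show "(tm L j (\<phi>1 m) \<oplus>\<^bsub>TA L\<^esub> tm L j2 (\<phi>2 m)) \<oplus>\<^bsub>TA L\<^esub> tm L \<sigma> (coact M m) \<in> carrier (TA L)"
        using t by simp
      have a: "tm X1 p1 (tm L j (\<phi>1 m)) = tm X1 f1 (\<phi>1 m)"
        by (rule tmap_comp[OF N.module_axioms LM D1(9) AM jL pL(1) _ pm1]) (simp add: bs(3))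
      have b: "tm X1 p1 (tm L j2 (\<phi>2 m)) = \<zero>\<^bsub>TA X1\<^esub>"
        using tmap_comp[OF N.module_axioms LM D1(9) AM j2 pL(1) refl pm2]
          tmap_zero[OF N.module_axioms D1(9) AM pj2(1) pm2] by simp
      have c: "tm X1 p1 (tm L \<sigma> (coact M m)) = tm X1 s1 (coact M m)"
        by (rule tmap_comp[OF M.module_axioms LM D1(9) AM \<sigma> pL(1) _ cm]) (simp add: p\<sigma>)
      note pa = module_hom_add[OF tmap_hom[OF LM D1(9) AM pL(1)]]
      have "tm X1 f1 (\<phi>1 m) \<in> carrier (TA X1)"
        using module_hom_carrier[OF tmap_hom[OF N.module_axioms D1(9) AM D1(10)] pm1] .
      then show "tm X1 p1 (coact L (\<sigma> m)) = tm X1 p1 ((tm L j (\<phi>1 m) \<oplus>\<^bsub>TA L\<^esub> tm L j2 (\<phi>2 m)) \<oplus>\<^bsub>TA L\<^esub> tm L \<sigma> (coact M m))"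
        using pa[OF t(1,2)] pa[of "tm L j (\<phi>1 m) \<oplus>\<^bsub>TA L\<^esub> tm L j2 (\<phi>2 m)" "tm L \<sigma> (coact M m)"] t a b c
          Hom_coact[OF O(2) \<sigma>m] s1(3)[OF m] p\<sigma>(1)[OF m] by simp
      have a: "tm X2 p2 (tm L j (\<phi>1 m)) = \<zero>\<^bsub>TA X2\<^esub>"
        using tmap_comp[OF N.module_axioms LM D2(9) AM jL pL(2) refl pm1]
          tmap_zero[OF N.module_axioms D2(9) AM bs(4) pm1] by simp
      have b: "tm X2 p2 (tm L j2 (\<phi>2 m)) = tm X2 f2 (\<phi>2 m)"
        by (rule tmap_comp[OF N.module_axioms LM D2(9) AM j2 pL(2) _ pm2]) (simp add: pj2)
      have c: "tm X2 p2 (tm L \<sigma> (coact M m)) = tm X2 s2 (coact M m)"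
        by (rule tmap_comp[OF M.module_axioms LM D2(9) AM \<sigma> pL(2) _ cm]) (simp add: p\<sigma>)
      note pa = module_hom_add[OF tmap_hom[OF LM D2(9) AM pL(2)]]
      have "tm X2 f2 (\<phi>2 m) \<in> carrier (TA X2)"
        using module_hom_carrier[OF tmap_hom[OF N.module_axioms D2(9) AM D2(10)] pm2] .
      then show "tm X2 p2 (coact L (\<sigma> m)) = tm X2 p2 ((tm L j (\<phi>1 m) \<oplus>\<^bsub>TA L\<^esub> tm L j2 (\<phi>2 m)) \<oplus>\<^bsub>TA L\<^esub> tm L \<sigma> (coact M m))"
        using pa[OF t(1,2)] pa[of "tm L j (\<phi>1 m) \<oplus>\<^bsub>TA L\<^esub> tm L j2 (\<phi>2 m)" "tm L \<sigma> (coact M m)"] t a b c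
          Hom_coact[OF O(3) \<sigma>m] s2(3)[OF m] p\<sigma>(2)[OF m] by simp
    qed
  qed
  have \<phi>: "(\<lambda>m. \<phi>1 m \<oplus>\<^bsub>TA N\<^esub> \<phi>2 m) \<in> Lin M (TA N)"
    by (rule module_homI) (simp_all add: module_hom_simps[OF \<phi>1] module_hom_simps[OF \<phi>2] TN.a_ac TN.smult_r_distr)
  have "coact X (q (\<sigma> m)) = tm X f (\<phi>1 m \<oplus>\<^bsub>TA N\<^esub> \<phi>2 m) \<oplus>\<^bsub>TA X\<^esub> tm X (\<lambda>m. q (\<sigma> m)) (coact M m)" if m: "m \<in> carrier M" for m
  proof -
    note cm = coact_closed[OF M_Obj m] and pm1 = module_hom_carrier[OF \<phi>1 m] and pm2 = module_hom_carrier[OF \<phi>2 m]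
      and \<sigma>m = module_hom_carrier[OF \<sigma> m]
    have t: "tm L j (\<phi>1 m) \<in> carrier (TA L)" "tm L j2 (\<phi>2 m) \<in> carrier (TA L)" "tm L \<sigma> (coact M m) \<in> carrier (TA L)"
      using module_hom_carrier[OF tmap_hom[OF N.module_axioms LM AM jL] pm1]
        module_hom_carrier[OF tmap_hom[OF N.module_axioms LM AM j2] pm2]
        module_hom_carrier[OF tmap_hom[OF M.module_axioms LM AM \<sigma>] cm] by auto
    note pa = module_hom_add[OF tmap_hom[OF LM D(9) AM qL]]
    have a: "tm X q (tm L j (\<phi>1 m)) = tm X f (\<phi>1 m)"
      by (rule tmap_comp[OF N.module_axioms LM D(9) AM jL qL _ pm1]) (simp add: bs(5))
    have b: "tm X q (tm L j2 (\<phi>2 m)) = tm X f (\<phi>2 m)"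
      by (rule tmap_comp[OF N.module_axioms LM D(9) AM j2 qL _ pm2]) (simp add: pj2)
    have c: "tm X q (tm L \<sigma> (coact M m)) = tm X (\<lambda>m. q (\<sigma> m)) (coact M m)"
      by (rule tmap_comp[OF M.module_axioms LM D(9) AM \<sigma> qL refl cm])
    show ?thesis
      using pa[OF t(1,2)] pa[of "tm L j (\<phi>1 m) \<oplus>\<^bsub>TA L\<^esub> tm L j2 (\<phi>2 m)" "tm L \<sigma> (coact M m)"] t a b c
        Hom_coact[OF O(6) \<sigma>m] co[OF m] module_hom_add[OF tmap_hom[OF N.module_axioms D(9) AM D(10)] pm1 pm2] by simp
  qed
  moreover have "g (q (\<sigma> m)) = m" if "m \<in> carrier M" for m
    using bs(6)[OF module_hom_carrier[OF \<sigma> that]] p\<sigma>(1)[OF that] s1(2)[OF that] by simp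
  ultimately show ?thesis
    unfolding represents_def using E \<phi>
    by (intro conjI bexI[OF _ module_hom_compose[OF \<sigma> qL]]) auto
qed

text \<open>The textbook construction: \<open>L\<close> is the kernel of the difference of the two
  maps from a direct sum to \<open>M\<close>, \<open>s\<close> is the skew diagonal,
  \<open>j\<close> the first copy of \<open>N\<close>, and \<open>Q\<close> the cokernel of
  \<open>s\<close>.\<close>

lemma baer_exists:
  assumes E1: "is_ext X1 f1 g1" and E2: "is_ext X2 f2 g2"
  obtains X f g L p1 p2 s j q where "is_ext X f g" "baer_data X1 f1 g1 X2 f2 X f g L p1 p2 s j q"
    "pullback_exact X1 X2 L g1 g2 p1 p2"
proof -
  note D1 = is_extD[OF E1] and D2 = is_extD[OF E2]
  obtain S i1 i2 q1 q2 where S: "S \<in> Obj" "i1 \<in> Hom X1 S" "i2 \<in> Hom X2 S" "q1 \<in> Hom S X1" "q2 \<in> Hom S X2"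
    "\<And>x. x \<in> carrier X1 \<Longrightarrow> q1 (i1 x) = x" "\<And>x. x \<in> carrier X1 \<Longrightarrow> q2 (i1 x) = \<zero>\<^bsub>X2\<^esub>"
    "\<And>y. y \<in> carrier X2 \<Longrightarrow> q1 (i2 y) = \<zero>\<^bsub>X1\<^esub>" "\<And>y. y \<in> carrier X2 \<Longrightarrow> q2 (i2 y) = y"
    "\<And>z. z \<in> carrier S \<Longrightarrow> i1 (q1 z) \<oplus>\<^bsub>S\<^esub> i2 (q2 z) = z"
    "\<And>n m. gen X1 n \<Longrightarrow> gen X2 m \<Longrightarrow> gen S (n + m)"
    by (rule direct_sum_object[OF D1(1) D2(1)]) (rule that; assumption)
  interpret S: module K S by (rule Obj_module[OF S(1)])
  interpret X1: module K X1 by (rule D1(9))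
  interpret X2: module K X2 by (rule D2(9))
  have inS: "q1 (i1 x \<oplus>\<^bsub>S\<^esub> i2 y) = x" "q2 (i1 x \<oplus>\<^bsub>S\<^esub> i2 y) = y" "i1 x \<oplus>\<^bsub>S\<^esub> i2 y \<in> carrier S"
    if "x \<in> carrier X1" "y \<in> carrier X2" for x y
    using that Hom_carrier[OF S(2)] Hom_carrier[OF S(3)] module_hom_add[OF Hom_Lin[OF S(4)]] module_hom_add[OF Hom_Lin[OF S(5)]]
    by (simp_all add: S(6-9))
  have S_eq: "z = w" if "q1 z = q1 w" "q2 z = q2 w" "z \<in> carrier S" "w \<in> carrier S" for z w
    using S(10)[OF that(3), unfolded that(1,2)] S(10)[OF that(4)] by (rule trans[OF sym])
  define d where "d z = g1 (q1 z) \<ominus>\<^bsub>M\<^esub> g2 (q2 z)" for z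
  have d: "d \<in> Hom S M" unfolding d_def
    by (intro Hom_minus Hom_comp[OF S(1) D1(1) M_Obj S(4) D1(4)] Hom_comp[OF S(1) D2(1) M_Obj S(5) D2(4)] M_Obj S)
  obtain L where L: "L \<in> Obj" "carrier L = {x \<in> carrier S. d x = \<zero>\<^bsub>M\<^esub>}" "(\<lambda>x. x) \<in> Hom L S" "\<zero>\<^bsub>L\<^esub> = \<zero>\<^bsub>S\<^esub>"
    by (rule kernel_object[OF S(1) M_Obj d]) (rule that; assumption)
  interpret L: module K L by (rule Obj_module[OF L(1)])
  have L_iff: "z \<in> carrier L \<longleftrightarrow> z \<in> carrier S \<and> g1 (q1 z) = g2 (q2 z)" for z
  proof (cases "z \<in> carrier S")
    case True
    have "g1 (q1 z) \<in> carrier M" "g2 (q2 z) \<in> carrier M"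
      using Hom_carrier[OF D1(4) Hom_carrier[OF S(4) True]] Hom_carrier[OF D2(4) Hom_carrier[OF S(5) True]] .
    then have "d z = \<zero>\<^bsub>M\<^esub> \<longleftrightarrow> g1 (q1 z) = g2 (q2 z)" unfolding d_def by simp
    then show ?thesis using True L(2) by simp
  qed (use L(2) in simp)
  have jS: "jointly_inj L (\<lambda>x. x) (\<lambda>x. x)" by (simp add: jointly_inj_def)
  have into_L: "u \<in> Hom N L" if "u \<in> Hom N S" "\<And>n. n \<in> carrier N \<Longrightarrow> u n \<in> carrier L" for u
    by (rule Hom_lift[OF N_Obj L(1) S(1) S(1) L(3) L(3) jS]) (use that in auto)
  define s where "s = (\<lambda>n\<in>carrier N. i1 (f1 n) \<ominus>\<^bsub>S\<^esub> i2 (f2 n))"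
  define j where "j = (\<lambda>n\<in>carrier N. i1 (f1 n))"
  define p1 where "p1 = restrict q1 (carrier L)"
  define p2 where "p2 = restrict q2 (carrier L)"
  have if1: "(\<lambda>n. i1 (f1 n)) \<in> Hom N S" and if2: "(\<lambda>n. i2 (f2 n)) \<in> Hom N S"
    using Hom_comp[OF N_Obj D1(1) S(1) D1(2) S(2)] Hom_comp[OF N_Obj D2(1) S(1) D2(2) S(3)] .
  have fn: "f1 n \<in> carrier X1" "f2 n \<in> carrier X2" "i1 (f1 n) \<in> carrier S" "i2 (f2 n) \<in> carrier S" if "n \<in> carrier N" for n
    using that Hom_carrier[OF D1(2)] Hom_carrier[OF D2(2)] Hom_carrier[OF if1] Hom_carrier[OF if2] by auto
  have qs: "q1 (s n) = f1 n" "q2 (s n) = \<ominus>\<^bsub>X2\<^esub> f2 n" "s n \<in> carrier S" if n: "n \<in> carrier N" for n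
  proof -
    note * = Obj_module[OF S(1)]
    show "q1 (s n) = f1 n"
      using module_hom_minus[OF * D1(9) Hom_Lin[OF S(4)] fn(3,4)[OF n]] fn[OF n] n S(6,8) by (simp add: s_def X1.minus_eq)
    show "q2 (s n) = \<ominus>\<^bsub>X2\<^esub> f2 n"
      using module_hom_minus[OF * D2(9) Hom_Lin[OF S(5)] fn(3,4)[OF n]] fn[OF n] n S(7,9) by (simp add: s_def X2.minus_eq)
    show "s n \<in> carrier S" using fn[OF n] n by (simp add: s_def)
  qed
  have qj: "q1 (j n) = f1 n" "q2 (j n) = \<zero>\<^bsub>X2\<^esub>" "j n \<in> carrier S" if n: "n \<in> carrier N" for n
    using fn[OF n] n S(6,7) by (simp_all add: j_def)
  have g2neg: "g2 (\<ominus>\<^bsub>X2\<^esub> f2 n) = \<zero>\<^bsub>M\<^esub>" if n: "n \<in> carrier N" for n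
    using module_hom_minus[OF D2(9) M.module_axioms D2(11), of "\<zero>\<^bsub>X2\<^esub>" "f2 n"] fn(2)[OF n] D2(13)[OF n]
      Hom_zero_eq[OF D2(4,1) M_Obj] by (simp add: X2.minus_eq M.minus_eq)
  have sL: "s n \<in> carrier L" "j n \<in> carrier L" if n: "n \<in> carrier N" for n
    using n qs[OF n] qj[OF n] D1(13)[OF n] g2neg[OF n] Hom_zero_eq[OF D2(4,1) M_Obj] by (auto simp: L_iff)
  have sH: "s \<in> Hom N L"
    unfolding s_def
    by (intro Hom_restrict N_Obj L into_L Hom_minus if1 if2 S) (use sL(1) in \<open>simp add: s_def\<close>)
  have jH: "j \<in> Hom N L"
    unfolding j_def
    by (intro Hom_restrict N_Obj L into_L if1) (use sL(2) in \<open>simp add: j_def\<close>)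
  have p1H: "p1 \<in> Hom L X1" and p2H: "p2 \<in> Hom L X2"
    unfolding p1_def p2_def
    by (intro Hom_restrict L D1 Hom_comp[OF L(1) S(1) D1(1) L(3) S(4)], intro Hom_restrict L D2 Hom_comp[OF L(1) S(1) D2(1) L(3) S(5)])
  have pe: "pullback_exact X1 X2 L g1 g2 p1 p2"
    unfolding pullback_exact_def
  proof (intro conjI ballI impI)
    show "jointly_inj L p1 p2"
      using S_eq by (auto simp: jointly_inj_def p1_def p2_def L_iff)
    show "g1 (p1 z) = g2 (p2 z)" if "z \<in> carrier L" for z
      using that by (simp add: p1_def p2_def L_iff)
    show "\<exists>z\<in>carrier L. p1 z = x \<and> p2 z = y" if "x \<in> carrier X1" "y \<in> carrier X2" "g1 x = g2 y" for x y
      using inS[OF that(1,2)] that(3) by (intro bexI[of _ "i1 x \<oplus>\<^bsub>S\<^esub> i2 y"]) (auto simp: p1_def p2_def L_iff)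
  qed
  obtain Q q0 where Q: "Q \<in> Obj" "q0 \<in> Hom L Q" "q0 ` carrier L = carrier Q"
    "\<And>x. x \<in> carrier L \<Longrightarrow> q0 x = \<zero>\<^bsub>Q\<^esub> \<longleftrightarrow> x \<in> s ` carrier N" "\<And>n. gen L n \<Longrightarrow> gen Q n"
    by (rule cokernel_object[OF N_Obj L(1) sH]) (rule that; assumption)
  interpret Q: module K Q by (rule Obj_module[OF Q(1)])
  define q where "q = restrict q0 (carrier L)"
  have qH: "q \<in> Hom L Q" unfolding q_def by (intro Hom_restrict L Q)
  have q_img: "q ` carrier L = carrier Q" using Q(3) by (auto simp: q_def)
  have q0: "q x = \<zero>\<^bsub>Q\<^esub> \<longleftrightarrow> x \<in> s ` carrier N" if "x \<in> carrier L" for x using Q(4) that by (simp add: q_def)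
  have ce: "coker_exact N L Q s q"
    unfolding coker_exact_def using q_img q0 sL(1) by auto
  define f where "f = (\<lambda>n\<in>carrier N. q (j n))"
  have fH: "f \<in> Hom N Q" unfolding f_def by (intro Hom_restrict N_Obj Q Hom_comp[OF N_Obj L(1) Q(1) jH qH])
  \<comment> \<open>The map to \<open>M\<close> comes from the universal property of
    \<open>q\<close>: the composite of \<open>p1\<close> and \<open>g1\<close> vanishes on the skew
    diagonal.\<close>
  have "\<exists>g. g \<in> Hom Q M \<and> g \<in> extensional (carrier Q) \<and> (\<forall>z\<in>carrier L. g (q z) = g1 (p1 z))"
  proof -
    have ca: "(N, L, s) \<in> carr (Cat (\<lambda>_. True))" "(L, Q, q) \<in> carr (Cat (\<lambda>_. True))"
      using sH qH L(1) Q(1) N_Obj by (auto simp: Cat_True C_carr s_def q_def)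
    define t where "t = (\<lambda>z\<in>carrier L. g1 (p1 z))"
    have "is_cokernel (Cat (\<lambda>_. True)) (L, Q, q) (N, L, s)"
      using cokernel_iff[OF ca] ce by (simp add: dim_closed_def)
    then have univ: "\<forall>T t. T \<in> Obj \<and> True \<and> t \<in> Hom L T \<and> t \<in> extensional (carrier L) \<and> (\<forall>v\<in>carrier N. t (s v) = \<zero>\<^bsub>T\<^esub>) \<longrightarrow>
      (\<exists>!u. u \<in> Hom Q T \<and> u \<in> extensional (carrier Q) \<and> (\<forall>v\<in>carrier L. u (q v) = t v))"
      unfolding is_cokernel_Cat[OF ca] by (rule conjunct2)
    have "t \<in> Hom L M"
      unfolding t_def by (intro Hom_restrict L M_Obj Hom_comp[OF L(1) D1(1) M_Obj p1H D1(4)])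
    moreover have "\<forall>n\<in>carrier N. t (s n) = \<zero>\<^bsub>M\<^esub>"
      using sL(1) qs(1) D1(13) by (simp add: t_def p1_def)
    moreover have "t \<in> extensional (carrier L)" by (simp add: t_def)
    ultimately have "\<exists>!u. u \<in> Hom Q M \<and> u \<in> extensional (carrier Q) \<and> (\<forall>v\<in>carrier L. u (q v) = t v)"
      using univ[THEN spec, THEN spec, of M t] M_Obj by simp
    then show ?thesis unfolding t_def by auto
  qed
  then obtain g where g: "g \<in> Hom Q M" "g \<in> extensional (carrier Q)" "\<And>z. z\<in>carrier L \<Longrightarrow> g (q z) = g1 (p1 z)" by blast
  have s0: "s \<zero>\<^bsub>N\<^esub> = \<zero>\<^bsub>L\<^esub>" using Hom_zero_eq[OF sH N_Obj L(1)] .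
  have inj1: "n = n'" if "f1 n = f1 n'" "n \<in> carrier N" "n' \<in> carrier N" for n n'
    using D1(6) that by (auto simp: inj_on_def)
  have "is_ext Q f g"
    unfolding is_ext_def
  proof (intro conjI)
    show "inj_on f (carrier N)"
    proof (rule Hom_inj_onI[OF N_Obj Q(1) fH])
      fix n assume n: "n \<in> carrier N" "f n = \<zero>\<^bsub>Q\<^esub>"
      \<comment> \<open>If j n = s n', the second components give f2 n' = 0, so n' = 0, and then the
        first components give n = 0.\<close>
      then obtain n' where n': "n' \<in> carrier N" "j n = s n'" using q0[OF sL(2)] by (auto simp: f_def)
      then have "\<ominus>\<^bsub>X2\<^esub> f2 n' = \<zero>\<^bsub>X2\<^esub>" using qj(2)[OF n(1)] qs(2)[OF n'(1)] by simp
      then have "f2 n' = \<zero>\<^bsub>X2\<^esub>" using fn(2)[OF n'(1)] by simp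
      then have "n' = \<zero>\<^bsub>N\<^esub>" using D2(6) n'(1) Hom_zero_eq[OF D2(2) N_Obj D2(1)] by (auto simp: inj_on_def)
      then have "f1 n = f1 \<zero>\<^bsub>N\<^esub>" using qj(1)[OF n(1)] qs(1)[OF n'(1)] n' by simp
      then show "n = \<zero>\<^bsub>N\<^esub>" using inj1 n by blast
    qed
    show "f ` carrier N = {x \<in> carrier Q. g x = \<zero>\<^bsub>M\<^esub>}"
    proof (intro equalityI subsetI)
      fix x assume "x \<in> f ` carrier N"
      then obtain n where n: "n \<in> carrier N" "x = q (j n)" by (auto simp: f_def)
      then show "x \<in> {x \<in> carrier Q. g x = \<zero>\<^bsub>M\<^esub>}"
        using g(3)[OF sL(2)] sL(2) qj(1) D1(13) Hom_carrier[OF qH sL(2)] by (simp add: p1_def)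
    next
      fix x assume x: "x \<in> {x \<in> carrier Q. g x = \<zero>\<^bsub>M\<^esub>}"
      then obtain z where z: "z \<in> carrier L" "x = q z" using q_img by auto
      then have z0: "z \<in> carrier S" "g1 (q1 z) = \<zero>\<^bsub>M\<^esub>" "g2 (q2 z) = \<zero>\<^bsub>M\<^esub>"
        using x g(3)[OF z(1)] L_iff[of z] by (auto simp: p1_def)
      obtain n1 where n1: "n1 \<in> carrier N" "q1 z = f1 n1" using D1(7) z0 Hom_carrier[OF S(4)] by blast
      obtain n2 where n2: "n2 \<in> carrier N" "q2 z = f2 n2" using D2(7) z0 Hom_carrier[OF S(5)] by blast
      have sj: "s n2 \<in> carrier L" "j (n1 \<oplus>\<^bsub>N\<^esub> n2) \<in> carrier L" "n1 \<oplus>\<^bsub>N\<^esub> n2 \<in> carrier N"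
         "s n2 \<oplus>\<^bsub>L\<^esub> z \<in> carrier L"
        using sL n1 n2 z by auto
      note iL = Hom_Lin[OF L(3)]
      have "s n2 \<oplus>\<^bsub>L\<^esub> z = s n2 \<oplus>\<^bsub>S\<^esub> z" using module_hom_add[OF iL sj(1) z(1)] by simp
      \<comment> \<open>An element over 0 is a pair (f1 n1, f2 n2). Adding the skew diagonal at
        \<open>n2\<close> turns it into (f1 (n1 + n2), 0), which lies in the first copy of
        \<open>N\<close>, without changing its class.\<close>
      moreover have "j (n1 \<oplus>\<^bsub>N\<^esub> n2) = s n2 \<oplus>\<^bsub>S\<^esub> z"
      proof (rule S_eq)
        note sz = qs(3)[OF n2(1)] z0(1)
        show "q1 (j (n1 \<oplus>\<^bsub>N\<^esub> n2)) = q1 (s n2 \<oplus>\<^bsub>S\<^esub> z)"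
          unfolding module_hom_add[OF Hom_Lin[OF S(4)] sz] qj(1)[OF sj(3)] qs(1)[OF n2(1)] n1(2)
            module_hom_add[OF D1(10) n1(1) n2(1)]
          using fn(1)[OF n1(1)] fn(1)[OF n2(1)] by (rule X1.a_comm)
        show "q2 (j (n1 \<oplus>\<^bsub>N\<^esub> n2)) = q2 (s n2 \<oplus>\<^bsub>S\<^esub> z)"
          unfolding module_hom_add[OF Hom_Lin[OF S(5)] sz] qj(2)[OF sj(3)] qs(2)[OF n2(1)] n2(2)
          using fn(2)[OF n2(1)] by (simp add: X2.l_neg)
        show "j (n1 \<oplus>\<^bsub>N\<^esub> n2) \<in> carrier S" "s n2 \<oplus>\<^bsub>S\<^esub> z \<in> carrier S" using qj(3)[OF sj(3)] sz by auto
      qed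
      ultimately have "j (n1 \<oplus>\<^bsub>N\<^esub> n2) = s n2 \<oplus>\<^bsub>L\<^esub> z" by simp
      then have "q (j (n1 \<oplus>\<^bsub>N\<^esub> n2)) = q (s n2) \<oplus>\<^bsub>Q\<^esub> q z"
        using module_hom_add[OF Hom_Lin[OF qH] sj(1) z(1)] by simp
      then have "f (n1 \<oplus>\<^bsub>N\<^esub> n2) = x"
        using q0[OF sj(1)] n2(1) z sj(3) Hom_carrier[OF qH z(1)] by (simp add: f_def)
      then show "x \<in> f ` carrier N" using sj(3) by blast
    qed
    show "g ` carrier Q = carrier M"
    proof (intro equalityI subsetI)
      fix m assume m: "m \<in> carrier M"
      have "m \<in> g1 ` carrier X1" "m \<in> g2 ` carrier X2" unfolding D1(8) D2(8) using m by auto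
      then obtain x1 x2 where x1: "x1 \<in> carrier X1" "g1 x1 = m" and x2: "x2 \<in> carrier X2" "g2 x2 = m" by auto
      have "\<forall>x\<in>carrier X1. \<forall>y\<in>carrier X2. g1 x = g2 y \<longrightarrow> (\<exists>z\<in>carrier L. p1 z = x \<and> p2 z = y)"
        using pe unfolding pullback_exact_def by (elim conjE)
      from this[rule_format, OF x1(1) x2(1)] obtain z where z: "z \<in> carrier L" "p1 z = x1" using x1 x2 by auto
      have "g (q z) = m" "q z \<in> carrier Q" using g(3)[OF z(1)] z(2) x1(2) Hom_carrier[OF qH z(1)] by auto
      then show "m \<in> g ` carrier Q" by (metis imageI)
    qed (use Hom_carrier[OF g(1)] in auto)
  qed (use Q fH g in \<open>auto simp: f_def\<close>)
  moreover have "baer_data X1 f1 g1 X2 f2 Q f g L p1 p2 s j q"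
    unfolding baer_data_def C_carr
    using sL qs qj ce g(3) sH jH p1H p2H qH Q(1) L(1) D1(1) D2(1) N_Obj fn X2.l_neg
    by (simp add: p1_def p2_def s_def j_def q_def f_def)
  ultimately show ?thesis using that pe by blast
qed

end

section \<open>The vector space structure of Ext1\<close>

context ext_setting
begin

lemma bex_chom:
  "(\<exists>h\<in>chom C V W. Q h) \<longleftrightarrow> V \<in> Obj \<and> W \<in> Obj \<and> (\<exists>h\<in>Hom V W. h \<in> extensional (carrier V) \<and> Q (V, W, h))"
  by (auto simp: C_chom)

definition "ext_class \<phi> = {ext_pair X f g | X f g. represents X f g \<phi>}"
text \<open>Defined by realisability through an extension rather than by a cocycle identity. Closure
  under addition and scaling then amounts to the existence of Baer sums and multiples.\<close>

definition "cocycles = {\<phi>. \<exists>X f g. represents X f g \<phi>}"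

lemma ext_class_mem [simp]: "ext_pair X f g \<in> ext_class \<phi> \<longleftrightarrow> represents X f g \<phi>"
  by (auto simp: ext_class_def)

lemma cocycleI: "represents X f g \<phi> \<Longrightarrow> \<phi> \<in> cocycles"
  by (auto simp: cocycles_def)

lemma cocycle_hom: "\<phi> \<in> cocycles \<Longrightarrow> \<phi> \<in> Lin M (TA N)"
  by (auto simp: cocycles_def represents_def)

lemma represents_ext: "represents X f g \<phi> \<Longrightarrow> is_ext X f g"
  by (simp add: represents_def)

lemma ext_class_cong:
  assumes "\<And>m. m \<in> carrier M \<Longrightarrow> \<phi> m = \<psi> m"
  shows "ext_class \<phi> = ext_class \<psi>"
proof -
  have "represents X f g \<phi> \<longleftrightarrow> represents X f g \<psi>" for X f g
    using represents_cong[of X f g \<phi> \<psi>] represents_cong[of X f g \<psi> \<phi>] assms by auto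
  then show ?thesis by (simp add: ext_class_def)
qed

lemma represents_along:
  assumes R: "represents X f g \<phi>" and E': "is_ext X' f' g'" and h: "h \<in> Hom X X'"
    and hf: "\<And>n. n \<in> carrier N \<Longrightarrow> h (f n) = f' n" and gh: "\<And>x. x \<in> carrier X \<Longrightarrow> g' (h x) = g x"
  shows "represents X' f' g' \<phi>"
proof -
  have \<phi>: "\<phi> \<in> Lin M (TA N)" using R by (simp add: represents_def)
  have "represents X' f' g' (\<lambda>m. \<one> \<odot>\<^bsub>TA N\<^esub> \<phi> m)"
    by (rule represents_pushforward[OF R E' h _ _ gh]) (use hf in auto)
  then show ?thesis by (rule represents_cong) (simp add: module_hom_carrier[OF \<phi>])
qed

text \<open>An extension has many cocycles, one for each section. Isomorphic extensions have the
  same set of cocycles, so sharing one means sharing all.\<close>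

lemma represents_transfer:
  assumes "represents X f g \<psi>" "represents X' f' g' \<psi>" "represents X f g \<phi>"
  shows "represents X' f' g' \<phi>"
proof -
  obtain h h' where h: "h \<in> Hom X X'" "\<And>n. n \<in> carrier N \<Longrightarrow> h (f n) = f' n" "\<And>x. x \<in> carrier X \<Longrightarrow> g' (h x) = g x"
    "h' \<in> Hom X' X" "\<And>x. x \<in> carrier X \<Longrightarrow> h' (h x) = x" "\<And>x. x \<in> carrier X' \<Longrightarrow> h (h' x) = x"
    by (rule represents_morphism[OF assms(1,2)]) (rule that; assumption)
  show ?thesis by (rule represents_along[OF assms(3) represents_ext[OF assms(2)] h(1-3)])
qed

text \<open>A morphism of extensions carries a cocycle along. Conversely a common cocycle yields
  mutually inverse maps, which are restricted to the carriers to become arrows.\<close>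

lemma ext_equiv_iff:
  "(ext_pair X f g, ext_pair X' f' g') \<in> ext_equiv C M N \<longleftrightarrow> (\<exists>\<phi>. represents X f g \<phi> \<and> represents X' f' g' \<phi>)"
proof
  assume "(ext_pair X f g, ext_pair X' f' g') \<in> ext_equiv C M N"
  then have E: "is_ext X f g" "is_ext X' f' g'"
    and "\<exists>h \<in> chom C X X'. ccomp C h (N, X, f) = (N, X', f') \<and> ccomp C (X', M, g') h = (X, M, g)"
    using extensions_iff[of "ext_pair X f g"] extensions_iff[of "ext_pair X' f' g'"]
    unfolding ext_equiv_def ext_pair_def by auto
  then obtain k where "k \<in> chom C X X'" "ccomp C k (N, X, f) = (N, X', f')" "ccomp C (X', M, g') k = (X, M, g)" by blast
  then obtain h where h: "h \<in> Hom X X'" "compose (carrier N) h f = f'" "compose (carrier X) g' h = g"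
    by (auto simp: C_chom)
  obtain \<phi> where \<phi>: "represents X f g \<phi>" by (rule ext_represented[OF E(1)])
  have "represents X' f' g' \<phi>"
    by (rule represents_along[OF \<phi> E(2) h(1)]) (simp_all add: compose_eq flip: h(2,3))
  then show "\<exists>\<phi>. represents X f g \<phi> \<and> represents X' f' g' \<phi>" using \<phi> by blast
next
  assume "\<exists>\<phi>. represents X f g \<phi> \<and> represents X' f' g' \<phi>"
  then obtain \<phi> where \<phi>: "represents X f g \<phi>" "represents X' f' g' \<phi>" by blast
  note D = is_extD[OF represents_ext[OF \<phi>(1)]] and D' = is_extD[OF represents_ext[OF \<phi>(2)]]
  obtain h h' where h: "h \<in> Hom X X'" "\<And>n. n \<in> carrier N \<Longrightarrow> h (f n) = f' n" "\<And>x. x \<in> carrier X \<Longrightarrow> g' (h x) = g x"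
    "h' \<in> Hom X' X" "\<And>x. x \<in> carrier X \<Longrightarrow> h' (h x) = x" "\<And>x. x \<in> carrier X' \<Longrightarrow> h (h' x) = x"
    by (rule represents_morphism[OF \<phi>]) (rule that; assumption)
  let ?h = "(X, X', restrict h (carrier X))" and ?h' = "(X', X, restrict h' (carrier X'))"
  have r: "restrict h (carrier X) \<in> Hom X X'" "restrict h' (carrier X') \<in> Hom X' X"
    by (intro Hom_restrict D D' h)+
  have "?h' \<in> chom C (ccod C ?h) (cdom C ?h)" "?h \<in> carr C"
    using r D(1) D'(1) by (simp_all add: C_chom C_carr)
  moreover have "ccomp C ?h' ?h = cid C (cdom C ?h)" "ccomp C ?h ?h' = cid C (ccod C ?h)"
    using h(5,6) Hom_carrier[OF h(1)] Hom_carrier[OF h(4)] by (auto simp: compose_def fun_eq_iff)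
  ultimately have "is_iso C ?h" unfolding is_iso_def by blast
  moreover have "?h \<in> chom C X X'" using r D(1) D'(1) by (auto simp: C_chom)
  moreover have "ccomp C ?h (N, X, f) = (N, X', f')"
    using h(2) D'(3) Hom_carrier[OF D(2)] by (auto simp: compose_def fun_eq_iff extensional_def)
  moreover have "ccomp C (X', M, g') ?h = (X, M, g)"
    using h(3) D(5) by (auto simp: compose_def fun_eq_iff extensional_def)
  ultimately have "\<exists>h \<in> chom C X X'. is_iso C h \<and> ccomp C h (N, X, f) = (N, X', f') \<and> ccomp C (X', M, g') h = (X, M, g)"
    by blast
  then show "(ext_pair X f g, ext_pair X' f' g') \<in> ext_equiv C M N"
    using extensions_iff[of "ext_pair X f g"] extensions_iff[of "ext_pair X' f' g'"] represents_ext[OF \<phi>(1)] represents_ext[OF \<phi>(2)]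
    unfolding ext_equiv_def by (auto simp: ext_pair_def)
qed

lemma ext_equiv_class:
  assumes R: "represents X f g \<phi>"
  shows "ext_equiv C M N `` {ext_pair X f g} = ext_class \<phi>"
proof (intro equalityI subsetI)
  fix E assume E: "E \<in> ext_equiv C M N `` {ext_pair X f g}"
  then have "E \<in> extensions C M N" by (auto simp: ext_equiv_def)
  then obtain X' f' g' where E': "E = ext_pair X' f' g'" using extensions_iff by blast
  then obtain \<psi> where "represents X f g \<psi>" "represents X' f' g' \<psi>"
    using E ext_equiv_iff by auto
  then show "E \<in> ext_class \<phi>" using represents_transfer[OF _ _ R] E' by auto
next
  fix E assume "E \<in> ext_class \<phi>"
  then obtain X' f' g' where "E = ext_pair X' f' g'" "represents X' f' g' \<phi>" by (auto simp: ext_class_def)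
  then show "E \<in> ext_equiv C M N `` {ext_pair X f g}" using R ext_equiv_iff by auto
qed

text \<open>Every extension has a cocycle, and the extensions with a given cocycle make up a whole
  equivalence class.\<close>

lemma Ext1_carrier: "carrier (Ext1 C M N) = ext_class ` cocycles"
proof (intro equalityI subsetI)
  fix a assume "a \<in> carrier (Ext1 C M N)"
  then obtain E where "E \<in> extensions C M N" "a = ext_equiv C M N `` {E}"
    by (auto simp: Ext1_def quotient_def)
  then obtain X f g where E: "is_ext X f g" "a = ext_equiv C M N `` {ext_pair X f g}" using extensions_iff by auto
  obtain \<phi> where "represents X f g \<phi>" by (rule ext_represented[OF E(1)])
  then show "a \<in> ext_class ` cocycles" using ext_equiv_class cocycleI E by auto
next
  fix a assume "a \<in> ext_class ` cocycles"
  then obtain X f g \<phi> where R: "represents X f g \<phi>" "a = ext_class \<phi>" by (auto simp: cocycles_def)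
  have "ext_pair X f g \<in> extensions C M N" using extensions_iff represents_ext[OF R(1)] by blast
  then show "a \<in> carrier (Ext1 C M N)"
    unfolding R(2) ext_equiv_class[OF R(1), symmetric] by (auto simp: Ext1_def quotient_def)
qed

text \<open>It realises the zero cocycle and provides the multiple of an extension by 0.\<close>

lemma split_extension:
  obtains X f g s where "is_ext X f g" "s \<in> Hom M X" "\<And>m. m \<in> carrier M \<Longrightarrow> g (s m) = m"
proof -
  obtain S i1 i2 p1 p2 where S: "S \<in> Obj" "i1 \<in> Hom N S" "i2 \<in> Hom M S" "p1 \<in> Hom S N" "p2 \<in> Hom S M"
    "\<And>x. x \<in> carrier N \<Longrightarrow> p1 (i1 x) = x" "\<And>x. x \<in> carrier N \<Longrightarrow> p2 (i1 x) = \<zero>\<^bsub>M\<^esub>"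
    "\<And>y. y \<in> carrier M \<Longrightarrow> p1 (i2 y) = \<zero>\<^bsub>N\<^esub>" "\<And>y. y \<in> carrier M \<Longrightarrow> p2 (i2 y) = y"
    "\<And>z. z \<in> carrier S \<Longrightarrow> i1 (p1 z) \<oplus>\<^bsub>S\<^esub> i2 (p2 z) = z"
    "\<And>n m. gen N n \<Longrightarrow> gen M m \<Longrightarrow> gen S (n + m)"
    by (rule direct_sum_object[OF N_Obj M_Obj]) (rule that; assumption)
  interpret S: module K S by (rule Obj_module[OF S(1)])
  let ?f = "restrict i1 (carrier N)" and ?g = "restrict p2 (carrier S)"
  have ker: "z \<in> i1 ` carrier N" if z: "z \<in> carrier S" "p2 z = \<zero>\<^bsub>M\<^esub>" for z
  proof
    show "z = i1 (p1 z)"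
      using S(10)[OF z(1)] z(2) Hom_zero_eq[OF S(3) M_Obj S(1)] Hom_carrier[OF S(2) Hom_carrier[OF S(4) z(1)]] by simp
    show "p1 z \<in> carrier N" by (rule Hom_carrier[OF S(4) z(1)])
  qed
  have "is_ext S ?f ?g"
    unfolding is_ext_def
  proof (intro conjI)
    show "?f \<in> Hom N S" "?g \<in> Hom S M" by (intro Hom_restrict N_Obj M_Obj S)+
    show "inj_on ?f (carrier N)" by (rule inj_on_inverseI[of _ p1]) (simp add: S(6))
    show "?f ` carrier N = {x \<in> carrier S. ?g x = \<zero>\<^bsub>M\<^esub>}"
      using ker Hom_carrier[OF S(2)] S(7) by auto
    show "?g ` carrier S = carrier M"
    proof (intro equalityI subsetI)
      fix m assume m: "m \<in> carrier M"
      show "m \<in> ?g ` carrier S"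
        using S(9)[OF m] Hom_carrier[OF S(3) m] by (intro image_eqI[of _ _ "i2 m"]) auto
    qed (use Hom_carrier[OF S(5)] in auto)
  qed (use S in auto)
  then show ?thesis
    by (rule that[OF _ S(3)]) (simp add: S(9) Hom_carrier[OF S(3)])
qed

text \<open>For \<phi> = 0 the defining equation of a cocycle says that the section is a comodule
  map.\<close>

lemma represents_zero_iff:
  assumes E: "is_ext X f g"
  shows "represents X f g (\<lambda>m. \<zero>\<^bsub>TA N\<^esub>) \<longleftrightarrow> (\<exists>s\<in>Hom M X. \<forall>m\<in>carrier M. g (s m) = m)"
proof -
  note D = is_extD[OF E]
  interpret TX: module K "TA X" by (rule D(12))
  have z: "(\<lambda>m. \<zero>\<^bsub>TA N\<^esub>) \<in> Lin M (TA N)" by (auto intro!: module_homI)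
  have f0: "tm X f \<zero>\<^bsub>TA N\<^esub> = \<zero>\<^bsub>TA X\<^esub>"
    by (rule module_hom_zero[OF TN.module_axioms D(12) tmap_hom[OF N.module_axioms D(9) A.module_axioms D(10)]])
  have c: "tm X s (coact M m) \<in> carrier (TA X)" if "s \<in> Lin M X" "m \<in> carrier M" for s m
    using module_hom_carrier[OF tmap_hom[OF M.module_axioms D(9) A.module_axioms that(1)] coact_closed[OF M_Obj that(2)]] .
  show ?thesis
    unfolding represents_def f0 using E z c by (auto simp: comodule_hom_iff)
qed

lemma Ext1_zero: "\<zero>\<^bsub>Ext1 C M N\<^esub> = ext_class (\<lambda>m. \<zero>\<^bsub>TA N\<^esub>)"
proof -
  have *: "(\<exists>s \<in> chom C M X. ccomp C (X, M, g) s = cid C M) \<longleftrightarrow> represents X f g (\<lambda>m. \<zero>\<^bsub>TA N\<^esub>)"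
    if E: "is_ext X f g" for X f g
  proof -
    have "(\<exists>s \<in> chom C M X. ccomp C (X, M, g) s = cid C M) \<longleftrightarrow> (\<exists>s\<in>Hom M X. s \<in> extensional (carrier M) \<and> (\<forall>m\<in>carrier M. g (s m) = m))"
      using is_extD(1)[OF E] M_Obj by (simp add: bex_chom compose_restrict_eq_iff)
    also have "\<dots> \<longleftrightarrow> (\<exists>s\<in>Hom M X. \<forall>m\<in>carrier M. g (s m) = m)"
    proof
      assume "\<exists>s\<in>Hom M X. \<forall>m\<in>carrier M. g (s m) = m"
      then obtain s where "s \<in> Hom M X" "\<forall>m\<in>carrier M. g (s m) = m" by blast
      then show "\<exists>s\<in>Hom M X. s \<in> extensional (carrier M) \<and> (\<forall>m\<in>carrier M. g (s m) = m)"
        using Hom_restrict[OF M_Obj is_extD(1)[OF E], of s] by (intro bexI[of _ "restrict s (carrier M)"]) auto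
    qed blast
    finally show ?thesis using represents_zero_iff[OF E] by simp
  qed
  show ?thesis
  proof (intro equalityI subsetI)
    fix E assume "E \<in> \<zero>\<^bsub>Ext1 C M N\<^esub>"
    then have "E \<in> extensions C M N" and s: "case E of (f, g) \<Rightarrow> \<exists>s \<in> chom C M (ccod C f). ccomp C g s = cid C M"
      by (auto simp: Ext1_def)
    then obtain X f g where XE: "E = ext_pair X f g" "is_ext X f g" using extensions_iff by blast
    then show "E \<in> ext_class (\<lambda>m. \<zero>\<^bsub>TA N\<^esub>)" using *[OF XE(2)] s by (simp add: ext_pair_def[of X f g])
        (simp flip: ext_pair_def)
  next
    fix E assume "E \<in> ext_class (\<lambda>m. \<zero>\<^bsub>TA N\<^esub>)"
    then obtain X f g where XE: "E = ext_pair X f g" "represents X f g (\<lambda>m. \<zero>\<^bsub>TA N\<^esub>)" by (auto simp: ext_class_def)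
    then have "E \<in> extensions C M N" using extensions_iff represents_ext by blast
    then show "E \<in> \<zero>\<^bsub>Ext1 C M N\<^esub>"
      using *[OF represents_ext[OF XE(2)]] XE by (simp add: Ext1_def ext_pair_def)
  qed
qed

lemma zero_cocycle: "(\<lambda>m. \<zero>\<^bsub>TA N\<^esub>) \<in> cocycles"
proof -
  obtain X f g s where "is_ext X f g" "s \<in> Hom M X" "\<And>m. m \<in> carrier M \<Longrightarrow> g (s m) = m"
    by (rule split_extension) (rule that; assumption)
  then have "represents X f g (\<lambda>m. \<zero>\<^bsub>TA N\<^esub>)" using represents_zero_iff by blast
  then show ?thesis by (rule cocycleI)
qed

text \<open>\<open>baer_represents\<close> computes a cocycle of every Baer sum, which gives one
  inclusion. For the other, each extension with that cocycle has to be exhibited as a Baer sum of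
  representatives.\<close>

lemma Ext1_add:
  assumes "\<phi> \<in> cocycles" "\<psi> \<in> cocycles"
  shows "ext_class \<phi> \<oplus>\<^bsub>Ext1 C M N\<^esub> ext_class \<psi> = ext_class (\<lambda>m. \<phi> m \<oplus>\<^bsub>TA N\<^esub> \<psi> m)"
    and "(\<lambda>m. \<phi> m \<oplus>\<^bsub>TA N\<^esub> \<psi> m) \<in> cocycles"
proof -
  obtain X1 f1 g1 where R1: "represents X1 f1 g1 \<phi>" using assms(1) by (auto simp: cocycles_def)
  obtain X2 f2 g2 where R2: "represents X2 f2 g2 \<psi>" using assms(2) by (auto simp: cocycles_def)
  note E1 = represents_ext[OF R1] and E2 = represents_ext[OF R2]
  obtain X f g L p1 p2 s j q where B: "is_ext X f g" "baer_data X1 f1 g1 X2 f2 X f g L p1 p2 s j q"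
    "pullback_exact X1 X2 L g1 g2 p1 p2"
    by (rule baer_exists[OF E1 E2]) (rule that; assumption)
  note R = baer_represents[OF R1 R2 B]
  then show "(\<lambda>m. \<phi> m \<oplus>\<^bsub>TA N\<^esub> \<psi> m) \<in> cocycles" by (rule cocycleI)
  show "ext_class \<phi> \<oplus>\<^bsub>Ext1 C M N\<^esub> ext_class \<psi> = ext_class (\<lambda>m. \<phi> m \<oplus>\<^bsub>TA N\<^esub> \<psi> m)"
  proof (intro equalityI subsetI)
    fix E assume "E \<in> ext_class \<phi> \<oplus>\<^bsub>Ext1 C M N\<^esub> ext_class \<psi>"
    then obtain F G where FG: "F \<in> ext_class \<phi>" "G \<in> ext_class \<psi>" "is_baer_sum C M N F G E"
      by (auto simp: Ext1_def)
    obtain Y1 h1 k1 where F: "F = ext_pair Y1 h1 k1" "represents Y1 h1 k1 \<phi>" using FG(1) by (auto simp: ext_class_def)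
    obtain Y2 h2 k2 where G: "G = ext_pair Y2 h2 k2" "represents Y2 h2 k2 \<psi>" using FG(2) by (auto simp: ext_class_def)
    have "E \<in> extensions C M N" using FG(3) by (auto simp: is_baer_sum_def split: prod.splits)
    then obtain Y h k where E: "E = ext_pair Y h k" "is_ext Y h k" using extensions_iff by blast
    have "\<exists>L p1 p2 s j q. baer_data Y1 h1 k1 Y2 h2 Y h k L p1 p2 s j q \<and> pullback_exact Y1 Y2 L k1 k2 p1 p2"
      using FG(3) baer_iff[OF represents_ext[OF F(2)] represents_ext[OF G(2)] E(2)] unfolding E F G by blast
    then show "E \<in> ext_class (\<lambda>m. \<phi> m \<oplus>\<^bsub>TA N\<^esub> \<psi> m)"
      using baer_represents[OF F(2) G(2) E(2)] unfolding E(1) ext_class_mem by blast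
  next
    fix E assume "E \<in> ext_class (\<lambda>m. \<phi> m \<oplus>\<^bsub>TA N\<^esub> \<psi> m)"
    then obtain Y h k where E: "E = ext_pair Y h k" "represents Y h k (\<lambda>m. \<phi> m \<oplus>\<^bsub>TA N\<^esub> \<psi> m)" by (auto simp: ext_class_def)
    note EY = represents_ext[OF E(2)]
    note D = is_extD[OF B(1)] and DY = is_extD[OF EY]
    obtain u u' where u: "u \<in> Hom X Y" "\<And>n. n \<in> carrier N \<Longrightarrow> u (f n) = h n" "\<And>x. x \<in> carrier X \<Longrightarrow> k (u x) = g x"
      "u' \<in> Hom Y X" "\<And>x. x \<in> carrier X \<Longrightarrow> u' (u x) = x" "\<And>x. x \<in> carrier Y \<Longrightarrow> u (u' x) = x"
      by (rule represents_morphism[OF R E(2)]) (rule that; assumption)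
    have b: "L \<in> Obj" "q \<in> Hom L X" "coker_exact N L X s q" "s \<in> Hom N L" "j \<in> Hom N L" "(L, X1, p1) \<in> carr C" "(L, X2, p2) \<in> carr C"
      "(N, L, s) \<in> carr C" "(N, L, j) \<in> carr C" "\<And>n. n \<in> carrier N \<Longrightarrow> q (j n) = f n" "\<And>z. z \<in> carrier L \<Longrightarrow> g (q z) = g1 (p1 z)"
      using B(2) by (auto simp: baer_data_def C_carr)
    \<comment> \<open>The constructed Baer sum is isomorphic to the given extension through
      \<open>u\<close>, so composing its quotient map with \<open>u\<close> makes the given
      extension a Baer sum as well.\<close>
    define v where "v = (\<lambda>z\<in>carrier L. u (q z))"
    have vH: "v \<in> Hom L Y" unfolding v_def by (intro Hom_restrict b DY Hom_comp[OF b(1) D(1) DY(1) b(2) u(1)])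
    have inj: "v z = \<zero>\<^bsub>Y\<^esub> \<longleftrightarrow> q z = \<zero>\<^bsub>X\<^esub>" if z: "z \<in> carrier L" for z
    proof -
      have "u (q z) = \<zero>\<^bsub>Y\<^esub> \<longleftrightarrow> q z = \<zero>\<^bsub>X\<^esub>"
        using Hom_zero_eq[OF u(1) D(1) DY(1)] Hom_zero_eq[OF u(4) DY(1) D(1)] u(5)[OF Hom_carrier[OF b(2) z]] by metis
      then show ?thesis using z by (simp add: v_def)
    qed
    have "baer_data X1 f1 g1 X2 f2 Y h k L p1 p2 s j v"
      unfolding baer_data_def
    proof (intro conjI ballI)
      show "(L, Y, v) \<in> carr C" using vH b(1) DY(1) by (auto simp: C_carr v_def)
      show "v (j n) = h n" if "n \<in> carrier N" for n
        using that Hom_carrier[OF b(5) that] b(10) u(2) by (simp add: v_def)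
      show "k (v z) = g1 (p1 z)" if "z \<in> carrier L" for z
        using that b(11) u(3)[OF Hom_carrier[OF b(2) that]] by (simp add: v_def)
      have "q ` carrier L = carrier X" using b(3) by (simp add: coker_exact_def)
      then have "carrier Y \<subseteq> v ` carrier L"
      proof (intro subsetI)
        fix y assume y: "y \<in> carrier Y"
        have "u' y \<in> q ` carrier L" using Hom_carrier[OF u(4) y] \<open>q ` carrier L = carrier X\<close> by simp
        then obtain z where z: "z \<in> carrier L" "u' y = q z" by blast
        then have "v z = y" using u(6)[OF y] by (simp add: v_def)
        then show "y \<in> v ` carrier L" using z(1) by blast
      qed
      moreover have "v ` carrier L \<subseteq> carrier Y" using Hom_carrier[OF vH] by blast
      ultimately show "coker_exact N L Y s v"
        using b(3) inj unfolding coker_exact_def by auto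
    qed (use B(2) in \<open>auto simp: baer_data_def\<close>)
    then have "is_baer_sum C M N (ext_pair X1 f1 g1) (ext_pair X2 f2 g2) (ext_pair Y h k)"
      using baer_iff[OF E1 E2 EY] B(3) by blast
    then show "E \<in> ext_class \<phi> \<oplus>\<^bsub>Ext1 C M N\<^esub> ext_class \<psi>"
      unfolding E(1) Ext1_def ring.simps mem_Collect_eq
      by (rule bexI[of _ "ext_pair X1 f1 g1", OF bexI[of _ "ext_pair X2 f2 g2"]]) (simp_all add: R1 R2)
  qed
qed

lemma ext_multiple_iff:
  assumes E: "is_ext X f g" and E': "is_ext X' f' g'" and c: "c \<in> carrier K"
  shows "is_ext_multiple C M N c (ext_pair X f g) (ext_pair X' f' g') \<longleftrightarrow>
    (\<exists>h\<in>Hom X X'. (\<forall>n\<in>carrier N. h (f n) = f' (c \<odot>\<^bsub>N\<^esub> n)) \<and> (\<forall>x\<in>carrier X. g' (h x) = g x))"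
proof -
  note D = is_extD[OF E] and D' = is_extD[OF E']
  have ext: "ext_pair X f g \<in> extensions C M N" "ext_pair X' f' g' \<in> extensions C M N"
    using assms extensions_iff by auto
  have c2: "compose (carrier N) h f = compose (carrier N) f' (\<lambda>v\<in>carrier N. c \<odot>\<^bsub>N\<^esub> (\<lambda>v\<in>carrier N. v) v) \<longleftrightarrow>
     (\<forall>n\<in>carrier N. h (f n) = f' (c \<odot>\<^bsub>N\<^esub> n))" for h
    by (auto simp: compose_def fun_eq_iff)
  have c3: "compose (carrier X) g' h = g \<longleftrightarrow> (\<forall>x\<in>carrier X. g' (h x) = g x)" for h
    using D(5) by (rule compose_eq_iff)
  have "is_ext_multiple C M N c (ext_pair X f g) (ext_pair X' f' g') \<longleftrightarrow>
     (\<exists>h\<in>chom C X X'. ccomp C h (N, X, f) = ccomp C (N, X', f') (cscale C c (cid C N)) \<and> ccomp C (X', M, g') h = (X, M, g))"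
    using ext by (simp add: is_ext_multiple_def ext_pair_def)
  also have "\<dots> \<longleftrightarrow> (\<exists>h\<in>Hom X X'. h \<in> extensional (carrier X) \<and> (\<forall>n\<in>carrier N. h (f n) = f' (c \<odot>\<^bsub>N\<^esub> n)) \<and> (\<forall>x\<in>carrier X. g' (h x) = g x))"
    using D(1) D'(1) by (simp add: bex_chom c2[simplified] c3)
  also have "\<dots> \<longleftrightarrow> (\<exists>h\<in>Hom X X'. (\<forall>n\<in>carrier N. h (f n) = f' (c \<odot>\<^bsub>N\<^esub> n)) \<and> (\<forall>x\<in>carrier X. g' (h x) = g x))"
  proof
    assume "\<exists>h\<in>Hom X X'. (\<forall>n\<in>carrier N. h (f n) = f' (c \<odot>\<^bsub>N\<^esub> n)) \<and> (\<forall>x\<in>carrier X. g' (h x) = g x)"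
    then obtain h where "h \<in> Hom X X'" "\<forall>n\<in>carrier N. h (f n) = f' (c \<odot>\<^bsub>N\<^esub> n)" "\<forall>x\<in>carrier X. g' (h x) = g x" by blast
    then show "\<exists>h\<in>Hom X X'. h \<in> extensional (carrier X) \<and> (\<forall>n\<in>carrier N. h (f n) = f' (c \<odot>\<^bsub>N\<^esub> n)) \<and> (\<forall>x\<in>carrier X. g' (h x) = g x)"
      using Hom_restrict[OF D(1) D'(1), of h] Hom_carrier[OF D(2)] by (intro bexI[of _ "restrict h (carrier X)"]) auto
  qed blast
  finally show ?thesis .
qed

text \<open>Over a field the pushout is explicit. For c \<noteq> 0 the extension is kept and
  \<open>f\<close> is precomposed with division by \<open>c\<close>; for c = 0 the split extension
  works, with \<open>h\<close> the composite of \<open>g\<close> and its section.\<close>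

lemma ext_multiple_exists:
  assumes E: "is_ext X f g" and c: "c \<in> carrier K"
  obtains X' f' h g' where "is_ext X' f' g'" "h \<in> Hom X X'"
    "\<And>n. n \<in> carrier N \<Longrightarrow> h (f n) = f' (c \<odot>\<^bsub>N\<^esub> n)" "\<And>x. x \<in> carrier X \<Longrightarrow> g' (h x) = g x"
proof -
  note D = is_extD[OF E]
  interpret X: module K X by (rule D(9))
  show ?thesis
  proof (cases "c = \<zero>")
    case True
    obtain X' f' g' s where S: "is_ext X' f' g'" "s \<in> Hom M X'" "\<And>m. m \<in> carrier M \<Longrightarrow> g' (s m) = m"
      by (rule split_extension) (rule that; assumption)
    note D' = is_extD[OF S(1)]
    show ?thesis
    proof (rule that[OF S(1) Hom_comp[OF D(1) M_Obj D'(1) D(4) S(2)]])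
      show "s (g (f n)) = f' (c \<odot>\<^bsub>N\<^esub> n)" if "n \<in> carrier N" for n
        using that D(13) True Hom_zero_eq[OF S(2) M_Obj D'(1)] Hom_zero_eq[OF D'(2) N_Obj D'(1)] by simp
      show "g' (s (g x)) = g x" if "x \<in> carrier X" for x using S(3)[OF Hom_carrier[OF D(4) that]] .
    qed
  next
    case False
    have ic: "inv c \<in> carrier K" "c \<otimes> inv c = \<one>" "inv c \<otimes> c = \<one>" using c False K.field_Units by auto
    define f' where "f' = (\<lambda>n\<in>carrier N. f (inv c \<odot>\<^bsub>N\<^esub> n))"
    have inv_smult: "inv c \<odot>\<^bsub>N\<^esub> (c \<odot>\<^bsub>N\<^esub> n) = n" "c \<odot>\<^bsub>N\<^esub> (inv c \<odot>\<^bsub>N\<^esub> n) = n" if "n \<in> carrier N" for n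
      using that ic c by (simp_all flip: N.smult_assoc1)
    have fH: "f' \<in> Hom N X" unfolding f'_def
      by (intro Hom_restrict N_Obj D Hom_comp[OF N_Obj N_Obj D(1) Hom_smult[OF N_Obj N_Obj Hom_id[OF N_Obj] ic(1)] D(2)])
    have "f' ` carrier N = f ` carrier N"
    proof (intro equalityI subsetI)
      fix x assume "x \<in> f ` carrier N"
      then obtain n where n: "n \<in> carrier N" "x = f n" by blast
      have "x = f' (c \<odot>\<^bsub>N\<^esub> n)" using n c inv_smult by (simp add: f'_def)
      then show "x \<in> f' ` carrier N" using n c by auto
    qed (use ic in \<open>auto simp: f'_def\<close>)
    moreover have "inj_on f' (carrier N)"
    proof (rule inj_onI)
      fix x y assume xy: "x \<in> carrier N" "y \<in> carrier N" "f' x = f' y"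
      then have "inv c \<odot>\<^bsub>N\<^esub> x = inv c \<odot>\<^bsub>N\<^esub> y" using D(6) ic(1) by (auto simp: f'_def inj_on_def)
      then show "x = y" using inv_smult(2) xy by metis
    qed
    ultimately have E': "is_ext X f' g" using D fH unfolding is_ext_def by (auto simp: f'_def)
    show ?thesis
      by (rule that[OF E' Hom_id[OF D(1)]]) (use c inv_smult in \<open>auto simp: f'_def\<close>)
  qed
qed

lemma Ext1_smult:
  assumes "\<phi> \<in> cocycles" and c: "c \<in> carrier K"
  shows "c \<odot>\<^bsub>Ext1 C M N\<^esub> ext_class \<phi> = ext_class (\<lambda>m. c \<odot>\<^bsub>TA N\<^esub> \<phi> m)"
    and "(\<lambda>m. c \<odot>\<^bsub>TA N\<^esub> \<phi> m) \<in> cocycles"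
proof -
  obtain X f g where R: "represents X f g \<phi>" using assms(1) by (auto simp: cocycles_def)
  note E = represents_ext[OF R]
  note D = is_extD[OF E]
  obtain X' f' h g' where E': "is_ext X' f' g'" and h: "h \<in> Hom X X'"
    "\<And>n. n \<in> carrier N \<Longrightarrow> h (f n) = f' (c \<odot>\<^bsub>N\<^esub> n)" "\<And>x. x \<in> carrier X \<Longrightarrow> g' (h x) = g x"
    by (rule ext_multiple_exists[OF E c]) (rule that; assumption)
  have R': "represents X' f' g' (\<lambda>m. c \<odot>\<^bsub>TA N\<^esub> \<phi> m)"
    by (rule represents_pushforward[OF R E' h(1) c h(2,3)])
  then show "(\<lambda>m. c \<odot>\<^bsub>TA N\<^esub> \<phi> m) \<in> cocycles" by (rule cocycleI)
  show "c \<odot>\<^bsub>Ext1 C M N\<^esub> ext_class \<phi> = ext_class (\<lambda>m. c \<odot>\<^bsub>TA N\<^esub> \<phi> m)"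
  proof (intro equalityI subsetI)
    fix G assume "G \<in> c \<odot>\<^bsub>Ext1 C M N\<^esub> ext_class \<phi>"
    then obtain F where F: "F \<in> ext_class \<phi>" "is_ext_multiple C M N c F G" by (auto simp: Ext1_def)
    obtain Y k l where Y: "F = ext_pair Y k l" "represents Y k l \<phi>" using F(1) by (auto simp: ext_class_def)
    have "G \<in> extensions C M N" using F(2) by (auto simp: is_ext_multiple_def split: prod.splits)
    then obtain Z a b where Z: "G = ext_pair Z a b" "is_ext Z a b" using extensions_iff by blast
    obtain u where u: "u\<in>Hom Y Z" "\<forall>n\<in>carrier N. u (k n) = a (c \<odot>\<^bsub>N\<^esub> n)" "\<forall>x\<in>carrier Y. b (u x) = l x"
      using F(2) ext_multiple_iff[OF represents_ext[OF Y(2)] Z(2) c] unfolding Y Z by blast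
    show "G \<in> ext_class (\<lambda>m. c \<odot>\<^bsub>TA N\<^esub> \<phi> m)"
      unfolding Z(1) ext_class_mem by (rule represents_pushforward[OF Y(2) Z(2) u(1) c]) (use u in auto)
  next
    fix G assume "G \<in> ext_class (\<lambda>m. c \<odot>\<^bsub>TA N\<^esub> \<phi> m)"
    then obtain Z a b where Z: "G = ext_pair Z a b" "represents Z a b (\<lambda>m. c \<odot>\<^bsub>TA N\<^esub> \<phi> m)" by (auto simp: ext_class_def)
    note EZ = represents_ext[OF Z(2)]
    obtain u u' where u: "u \<in> Hom X' Z" "\<And>n. n \<in> carrier N \<Longrightarrow> u (f' n) = a n" "\<And>x. x \<in> carrier X' \<Longrightarrow> b (u x) = g' x"
      "u' \<in> Hom Z X'" "\<And>x. x \<in> carrier X' \<Longrightarrow> u' (u x) = x" "\<And>x. x \<in> carrier Z \<Longrightarrow> u (u' x) = x"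
      by (rule represents_morphism[OF R' Z(2)]) (rule that; assumption)
    have "is_ext_multiple C M N c (ext_pair X f g) (ext_pair Z a b)"
      unfolding ext_multiple_iff[OF E EZ c]
    proof (intro bexI conjI ballI)
      show "(\<lambda>x. u (h x)) \<in> Hom X Z" by (rule Hom_comp[OF D(1) is_extD(1)[OF E'] is_extD(1)[OF EZ] h(1) u(1)])
    qed (use h u(2,3) c Hom_carrier[OF h(1)] in auto)
    then show "G \<in> c \<odot>\<^bsub>Ext1 C M N\<^esub> ext_class \<phi>"
      unfolding Z(1) using R by (auto simp: Ext1_def intro!: bexI[of _ "ext_pair X f g"])
  qed
qed

text \<open>\<open>ext_class\<close> maps onto Ext1 and carries the pointwise operations on cocycles
  to those of Ext1, so each axiom is inherited from N \<otimes> A.\<close>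

lemma Ext1_module: "module K (Ext1 C M N)"
proof (intro moduleI abelian_groupI)
  note simps = Ext1_carrier Ext1_add Ext1_smult Ext1_zero zero_cocycle
  have cl: "\<phi> m \<in> carrier (TA N)" if "\<phi> \<in> cocycles" "m \<in> carrier M" for \<phi> m
    using module_hom_carrier[OF cocycle_hom] that by blast
  show "cring K" by (rule A.R.is_cring)
  show "x \<oplus>\<^bsub>Ext1 C M N\<^esub> y \<in> carrier (Ext1 C M N)" if "x \<in> carrier (Ext1 C M N)" "y \<in> carrier (Ext1 C M N)" for x y
    using that by (auto simp: simps)
  show "\<zero>\<^bsub>Ext1 C M N\<^esub> \<in> carrier (Ext1 C M N)" by (auto simp: simps)
  show "x \<oplus>\<^bsub>Ext1 C M N\<^esub> y \<oplus>\<^bsub>Ext1 C M N\<^esub> z = x \<oplus>\<^bsub>Ext1 C M N\<^esub> (y \<oplus>\<^bsub>Ext1 C M N\<^esub> z)"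
    if "x \<in> carrier (Ext1 C M N)" "y \<in> carrier (Ext1 C M N)" "z \<in> carrier (Ext1 C M N)" for x y z
    using that unfolding Ext1_carrier by (elim imageE) (simp add: simps, rule ext_class_cong, simp add: TN.a_assoc cl)
  show "x \<oplus>\<^bsub>Ext1 C M N\<^esub> y = y \<oplus>\<^bsub>Ext1 C M N\<^esub> x"
    if "x \<in> carrier (Ext1 C M N)" "y \<in> carrier (Ext1 C M N)" for x y
    using that unfolding Ext1_carrier by (elim imageE) (simp add: simps, rule ext_class_cong, simp add: TN.a_comm cl)
  show "\<zero>\<^bsub>Ext1 C M N\<^esub> \<oplus>\<^bsub>Ext1 C M N\<^esub> x = x" if "x \<in> carrier (Ext1 C M N)" for x
    using that unfolding Ext1_carrier by (elim imageE) (simp add: simps, rule ext_class_cong, simp add: cl)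
  show "\<exists>y\<in>carrier (Ext1 C M N). y \<oplus>\<^bsub>Ext1 C M N\<^esub> x = \<zero>\<^bsub>Ext1 C M N\<^esub>" if x: "x \<in> carrier (Ext1 C M N)" for x
  proof -
    obtain \<phi> where \<phi>: "\<phi> \<in> cocycles" "x = ext_class \<phi>" using x by (auto simp: simps)
    have m: "\<ominus> \<one> \<in> carrier K" by simp
    note \<psi> = Ext1_smult(2)[OF \<phi>(1) m]
    have "ext_class (\<lambda>m. (\<ominus> \<one>) \<odot>\<^bsub>TA N\<^esub> \<phi> m \<oplus>\<^bsub>TA N\<^esub> \<phi> m) = ext_class (\<lambda>m. \<zero>\<^bsub>TA N\<^esub>)"
      by (rule ext_class_cong) (simp add: cl \<phi>(1) TN.smult_l_minus TN.l_neg)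
    then show ?thesis
      using \<phi> \<psi> by (intro bexI[of _ "ext_class (\<lambda>m. (\<ominus> \<one>) \<odot>\<^bsub>TA N\<^esub> \<phi> m)"]) (simp_all add: simps)
  qed
  show "a \<odot>\<^bsub>Ext1 C M N\<^esub> x \<in> carrier (Ext1 C M N)" if "a \<in> carrier K" "x \<in> carrier (Ext1 C M N)" for a x
    using that by (auto simp: simps)
  show "(a \<oplus> b) \<odot>\<^bsub>Ext1 C M N\<^esub> x = a \<odot>\<^bsub>Ext1 C M N\<^esub> x \<oplus>\<^bsub>Ext1 C M N\<^esub> b \<odot>\<^bsub>Ext1 C M N\<^esub> x"
    if "a \<in> carrier K" "b \<in> carrier K" "x \<in> carrier (Ext1 C M N)" for a b x
    using that unfolding Ext1_carrier by (elim imageE) (simp add: simps, rule ext_class_cong, simp add: TN.smult_l_distr cl)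
  show "a \<odot>\<^bsub>Ext1 C M N\<^esub> (x \<oplus>\<^bsub>Ext1 C M N\<^esub> y) = a \<odot>\<^bsub>Ext1 C M N\<^esub> x \<oplus>\<^bsub>Ext1 C M N\<^esub> a \<odot>\<^bsub>Ext1 C M N\<^esub> y"
    if "a \<in> carrier K" "x \<in> carrier (Ext1 C M N)" "y \<in> carrier (Ext1 C M N)" for a x y
    using that unfolding Ext1_carrier by (elim imageE) (simp add: simps, rule ext_class_cong, simp add: TN.smult_r_distr cl)
  show "a \<otimes> b \<odot>\<^bsub>Ext1 C M N\<^esub> x = a \<odot>\<^bsub>Ext1 C M N\<^esub> (b \<odot>\<^bsub>Ext1 C M N\<^esub> x)"
    if "a \<in> carrier K" "b \<in> carrier K" "x \<in> carrier (Ext1 C M N)" for a b x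
    using that unfolding Ext1_carrier by (elim imageE) (simp add: simps, rule ext_class_cong, simp add: TN.smult_assoc1 cl)
  show "\<one> \<odot>\<^bsub>Ext1 C M N\<^esub> x = x" if "x \<in> carrier (Ext1 C M N)" for x
    using that unfolding Ext1_carrier by (elim imageE) (simp add: simps, rule ext_class_cong, simp add: cl)
qed

text \<open>\<open>X\<close> is spanned by the images of \<open>N\<close> and of a linear section.
  This bound keeps tuples of extensions inside the restricted ultraproduct.\<close>

lemma gen_ext:
  assumes E: "is_ext X f g" and "gen N n" "gen M m"
  shows "gen X (n + m)"
proof -
  note D = is_extD[OF E]
  obtain s where s: "s \<in> Lin M X" "\<And>m. m \<in> carrier M \<Longrightarrow> g (s m) = m" using ext_section[OF E] by blast
  have s2: "\<forall>m\<in>carrier M. g (s m) = m" using s(2) by blast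
  obtain r where r: "r \<in> Lin X N" "\<And>x. x \<in> carrier X \<Longrightarrow> f (r x) \<oplus>\<^bsub>X\<^esub> s (g x) = x"
    by (rule ext_retraction[OF E s(1) s2]) (rule that; assumption)
  show ?thesis
  proof (rule generated_by_sum[OF N.module_axioms M.module_axioms D(9) D(10) s(1) _ assms(2,3)])
    fix x assume x: "x \<in> carrier X"
    show "\<exists>v\<in>carrier N. \<exists>w\<in>carrier M. x = f v \<oplus>\<^bsub>X\<^esub> s w"
      by (intro bexI[of _ "r x"] bexI[of _ "g x"] r(2)[symmetric] x module_hom_carrier[OF r(1)] module_hom_carrier[OF D(11)])
  qed
qed

end


section \<open>Transfer to ultraproducts\<close>

context rep_setting
begin

abbreviation Catb :: "nat \<Rightarrow> ('k, ('k, 'a, 'v) comodule, ('k, 'a, 'v) rep_arrow) lincat" where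
  "Catb b \<equiv> Cat (\<lambda>X. gen X b)"

lemma dim_closed_gen: "dim_closed (\<lambda>X. gen X b)"
  by (auto simp: dim_closed_def)

lemma dim_closed_True: "dim_closed (\<lambda>_. True)"
  by (auto simp: dim_closed_def)

lemma Cat_sub: "f \<in> carr (Cat P) \<Longrightarrow> f \<in> carr (Cat (\<lambda>_. True))"
  by (cases f) (auto simp: Cat_carr)

text \<open>Both sides amount to \<open>ker_exact\<close>, which does not see the bound.\<close>

lemma kernel_absolute:
  assumes "f \<in> carr (Catb b)" "g \<in> carr (Catb b)"
  shows "is_kernel (Catb b) f g \<longleftrightarrow> is_kernel C f g"
proof -
  obtain N X f' where f: "f = (N, X, f')" by (cases f)
  obtain X' M g' where g: "g = (X', M, g')" by (cases g)
  show ?thesis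
  proof (cases "X = X'")
    case True
    then show ?thesis
      using kernel_iff[of N X f' "\<lambda>X. gen X b" M g'] kernel_iff[of N X f' "\<lambda>_. True" M g']
        assms Cat_sub[OF assms(1)] Cat_sub[OF assms(2)] dim_closed_gen dim_closed_True f g by (simp add: Cat_True)
  next
    case False
    then show ?thesis using Cat_simps(1,2)[of "\<lambda>_. True", unfolded Cat_True] f g by (simp add: is_kernel_def)
  qed
qed

lemma cokernel_absolute:
  assumes "f \<in> carr (Catb b)" "g \<in> carr (Catb b)"
  shows "is_cokernel (Catb b) g f \<longleftrightarrow> is_cokernel C g f"
proof -
  obtain N X f' where f: "f = (N, X, f')" by (cases f)
  obtain X' M g' where g: "g = (X', M, g')" by (cases g)
  show ?thesis
  proof (cases "X = X'")
    case True
    then show ?thesis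
      using cokernel_iff[of N X f' "\<lambda>X. gen X b" M g'] cokernel_iff[of N X f' "\<lambda>_. True" M g']
        assms Cat_sub[OF assms(1)] Cat_sub[OF assms(2)] dim_closed_gen dim_closed_True f g by (simp add: Cat_True)
  next
    case False
    then show ?thesis using Cat_simps(1,2)[of "\<lambda>_. True", unfolded Cat_True] f g by (simp add: is_cokernel_def)
  qed
qed

lemma gen_mono: "V \<in> Obj \<Longrightarrow> gen V n \<Longrightarrow> n \<le> m \<Longrightarrow> gen V m"
  using module.generated_by_mono[OF Obj_module] by blast

lemma Catb_mono: "f \<in> carr (Catb b) \<Longrightarrow> b \<le> b' \<Longrightarrow> f \<in> carr (Catb b')"
  by (cases f) (auto simp: Cat_carr intro: gen_mono)

text \<open>The sources of \<open>g\<close> and \<open>h\<close> are bounded by \<open>B\<close>, so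
  their direct sum is bounded by 2 * \<open>B\<close>; for \<open>b\<close> at least that large the
  subcategory contains the test objects of \<open>pullback_iff\<close>.\<close>

lemma pullback_absolute:
  assumes a: "g \<in> carr (Catb B)" "h \<in> carr (Catb B)" "p \<in> carr (Catb b)" "q \<in> carr (Catb b)" and b: "2 * B \<le> b"
  shows "is_pullback (Catb b) g h p q \<longleftrightarrow> is_pullback C g h p q"
proof -
  obtain X Z g' where g: "g = (X, Z, g')" by (cases g)
  obtain Y Z' h' where h: "h = (Y, Z', h')" by (cases h)
  obtain L X' p' where p: "p = (L, X', p')" by (cases p)
  obtain L' Y' q' where q: "q = (L', Y', q')" by (cases q)
  have a': "g \<in> carr (Catb b)" "h \<in> carr (Catb b)" using Catb_mono[OF a(1)] Catb_mono[OF a(2)] b by auto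
  note s = Cat_simps(1,2)[of "\<lambda>_. True", unfolded Cat_True]
  show ?thesis
  proof (cases "Z = Z' \<and> X = X' \<and> Y = Y' \<and> L = L'")
    case True
    have sum: "gen V b" if "V \<in> Obj" "\<And>n m. gen X n \<Longrightarrow> gen Y m \<Longrightarrow> gen V (n + m)" for V
      using that(2)[of B B] a(1,2) g h b gen_mono[OF that(1), of "B + B" b] by (auto simp: Cat_carr)
    have t: "(X, Z, g') \<in> carr (Catb b)" "(Y, Z, h') \<in> carr (Catb b)" "(L, X, p') \<in> carr (Catb b)" "(L, Y, q') \<in> carr (Catb b)"
      using a' a(3,4) g h p q True by auto
    show ?thesis
      using pullback_iff[OF t dim_closed_gen sum] pullback_iff[OF Cat_sub[OF t(1)] Cat_sub[OF t(2)] Cat_sub[OF t(3)] Cat_sub[OF t(4)] dim_closed_True TrueI]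
        True g h p q by (simp add: Cat_True)
  next
    case False
    then show ?thesis using s unfolding is_pullback_def g h p q by auto
  qed
qed

text \<open>A pullback injects into the direct sum. So the arrows that occur in Baer sums are
  bounded in terms of the extensions, and tuples of them define arrows of the restricted
  ultraproduct.\<close>

lemma pullback_bound:
  assumes a: "g \<in> carr (Catb B)" "h \<in> carr (Catb B)" and p: "is_pullback C g h p q"
  shows "p \<in> carr (Catb (2 * B))" "q \<in> carr (Catb (2 * B))"
proof -
  note s = Cat_simps(1,2)[of "\<lambda>_. True", unfolded Cat_True]
  obtain X Z g' where g: "g = (X, Z, g')" by (cases g)
  obtain Y Z' h' where h: "h = (Y, Z', h')" by (cases h)
  obtain L X' p' where pp: "p = (L, X', p')" by (cases p)
  obtain L' Y' q' where qq: "q = (L', Y', q')" by (cases q)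
  have e: "Z' = Z" "X' = X" "Y' = Y" "L' = L" and t: "p \<in> carr C" "q \<in> carr C"
    using p s unfolding is_pullback_def g h pp qq by auto
  have t: "(X, Z, g') \<in> carr (Cat (\<lambda>_. True))" "(Y, Z, h') \<in> carr (Cat (\<lambda>_. True))"
    "(L, X, p') \<in> carr (Cat (\<lambda>_. True))" "(L, Y, q') \<in> carr (Cat (\<lambda>_. True))"
    using Cat_sub[OF a(1)] Cat_sub[OF a(2)] t e g h pp qq by (auto simp: Cat_True)
  have "pullback_exact X Y L g' h' p' q'"
    using pullback_iff[OF t dim_closed_True TrueI] p e g h pp qq by (simp add: Cat_True)
  then have "jointly_inj L p' q'" by (simp add: pullback_exact_def)
  moreover have O: "X \<in> Obj" "Y \<in> Obj" "L \<in> Obj" "p' \<in> Hom L X" "q' \<in> Hom L Y" "gen X B" "gen Y B"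
    using t a g h by (auto simp: Cat_carr)
  ultimately have "gen L (B + B)" using gen_jointly_inj Hom_Lin by blast
  then show "p \<in> carr (Catb (2 * B))" "q \<in> carr (Catb (2 * B))"
    using t O gen_mono[of X B "2 * B"] gen_mono[of Y B "2 * B"] e pp qq by (auto simp: Cat_carr mult_2)
qed

end

section \<open>The clauses of the theorem of Los\<close>

locale ultra =
  fixes U :: "'i filter"
  assumes U_nontrivial: "U \<noteq> bot" and U_ultra: "eventually P U \<or> eventually (\<lambda>i. \<not> P i) U"
begin

abbreviation "ev P \<equiv> eventually P U"

lemma ev_False [simp]: "\<not> ev (\<lambda>i. False)"
  using U_nontrivial by (simp add: trivial_limit_def)

text \<open>Commuting with negation is the ultrafilter property, and implication follows with the
  rule for conjunctions. Below, these equivalences serve as rewrite rules that move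
  \<open>eventually\<close> through a formula.\<close>

lemma ev_not: "ev (\<lambda>i. \<not> P i) \<longleftrightarrow> \<not> ev P"
proof
  assume "ev (\<lambda>i. \<not> P i)"
  show "\<not> ev P"
  proof
    assume "ev P"
    with \<open>ev (\<lambda>i. \<not> P i)\<close> have "ev (\<lambda>i. False)" by eventually_elim simp
    then show False by simp
  qed
qed (use U_ultra in blast)

lemma ev_imp: "ev (\<lambda>i. P i \<longrightarrow> Q i) \<longleftrightarrow> (ev P \<longrightarrow> ev Q)"
proof -
  have "ev (\<lambda>i. P i \<longrightarrow> Q i) \<longleftrightarrow> \<not> ev (\<lambda>i. P i \<and> \<not> Q i)" by (simp flip: ev_not)
  then show ?thesis by (simp add: eventually_conj_iff ev_not)
qed

text \<open>A tuple of witnesses is chosen componentwise; where no witness exists its value is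
  arbitrary and harmless.\<close>

lemma ev_ex: "ev (\<lambda>i. \<exists>x. P i x) \<longleftrightarrow> (\<exists>x. ev (\<lambda>i. P i (x i)))"
proof
  assume "ev (\<lambda>i. \<exists>x. P i x)"
  then have "ev (\<lambda>i. P i (SOME x. P i x))" by eventually_elim (rule someI_ex)
  then show "\<exists>x. ev (\<lambda>i. P i (x i))" by (rule exI[of _ "\<lambda>i. SOME x. P i x"])
qed (auto elim: eventually_mono)

lemma ev_all: "ev (\<lambda>i. \<forall>x. P i x) \<longleftrightarrow> (\<forall>x. ev (\<lambda>i. P i (x i)))"
  using ev_ex[of "\<lambda>i x. \<not> P i x"] ev_not[of "\<lambda>i. \<forall>x. P i x"]
  by (auto simp: ev_not)

lemma uclass_eq_iff [simp]: "uclass U x = uclass U y \<longleftrightarrow> ev (\<lambda>i. x i = y i)"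
proof
  assume "uclass U x = uclass U y"
  moreover have "x \<in> uclass U x" by (simp add: uclass_def)
  ultimately show "ev (\<lambda>i. x i = y i)" by (simp add: uclass_def)
next
  assume e: "ev (\<lambda>i. x i = y i)"
  have "ev (\<lambda>i. z i = x i) \<longleftrightarrow> ev (\<lambda>i. z i = y i)" for z
  proof
    assume "ev (\<lambda>i. z i = x i)" then show "ev (\<lambda>i. z i = y i)" using e by eventually_elim simp
  next
    assume "ev (\<lambda>i. z i = y i)" then show "ev (\<lambda>i. z i = x i)" using e by eventually_elim simp
  qed
  then show "uclass U x = uclass U y" by (simp add: uclass_def)
qed

lemma umap_uclass [simp]: "umap U F (uclass U x) = uclass U (\<lambda>i. F i (x i))"
proof (intro equalityI subsetI)
  fix z assume "z \<in> umap U F (uclass U x)"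
  then obtain y where "ev (\<lambda>i. y i = x i)" "ev (\<lambda>i. z i = F i (y i))" by (auto simp: umap_def uclass_def)
  then have "ev (\<lambda>i. z i = F i (x i))" by eventually_elim simp
  then show "z \<in> uclass U (\<lambda>i. F i (x i))" by (simp add: uclass_def)
qed (auto simp: umap_def uclass_def intro!: exI[of _ x])

lemma umap2_uclass [simp]: "umap2 U F (uclass U x) (uclass U y) = uclass U (\<lambda>i. F i (x i) (y i))"
proof (intro equalityI subsetI)
  fix z assume "z \<in> umap2 U F (uclass U x) (uclass U y)"
  then obtain x' y' where "ev (\<lambda>i. x' i = x i)" "ev (\<lambda>i. y' i = y i)" "ev (\<lambda>i. z i = F i (x' i) (y' i))"
    by (auto simp: umap2_def uclass_def)
  then have "ev (\<lambda>i. z i = F i (x i) (y i))" by eventually_elim simp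
  then show "z \<in> uclass U (\<lambda>i. F i (x i) (y i))" by (simp add: uclass_def)
next
  fix z assume "z \<in> uclass U (\<lambda>i. F i (x i) (y i))"
  then show "z \<in> umap2 U F (uclass U x) (uclass U y)"
    unfolding umap2_def uclass_def by (auto intro!: exI[of _ x] exI[of _ y])
qed

text \<open>A member of the ultraproduct needs a representative lying in \<open>S i\<close> at every
  index, so values on the exceptional set are replaced by arbitrary elements; this is where
  nonemptiness enters.\<close>

lemma uproduct_iff:
  assumes "\<And>i. S i \<noteq> {}"
  shows "uclass U x \<in> uproduct U S \<longleftrightarrow> ev (\<lambda>i. x i \<in> S i)"
proof
  assume "uclass U x \<in> uproduct U S"
  then obtain y where "ev (\<lambda>i. x i = y i)" "\<forall>i. y i \<in> S i" by (auto simp: uproduct_def)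
  then show "ev (\<lambda>i. x i \<in> S i)" by (auto elim: eventually_mono)
next
  assume e: "ev (\<lambda>i. x i \<in> S i)"
  define y where "y i = (if x i \<in> S i then x i else (SOME z. z \<in> S i))" for i
  have "y i \<in> S i" for i using assms[of i] some_in_eq[of "S i"] by (auto simp: y_def)
  moreover have "uclass U x = uclass U y" using e by (auto simp: y_def elim: eventually_mono)
  ultimately show "uclass U x \<in> uproduct U S" unfolding uproduct_def by blast
qed

lemma uproduct_cases:
  assumes "X \<in> uproduct U S"
  obtains x where "X = uclass U x" "\<And>i. x i \<in> S i"
  using assms by (auto simp: uproduct_def)

text \<open>If uniqueness did not hold almost everywhere it would fail almost everywhere, and
  choosing two distinct solutions in each such component would give two distinct classes.\<close>

lemma ex1_uclass: "(\<exists>!u. \<exists>w. u = uclass U w \<and> ev (\<lambda>i. P i (w i))) \<longleftrightarrow> ev (\<lambda>i. \<exists>!x. P i x)"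
proof
  assume *: "\<exists>!u. \<exists>w. u = uclass U w \<and> ev (\<lambda>i. P i (w i))"
  then have ex: "ev (\<lambda>i. \<exists>x. P i x)" unfolding ev_ex by blast
  show "ev (\<lambda>i. \<exists>!x. P i x)"
  proof (rule ccontr)
    assume "\<not> ev (\<lambda>i. \<exists>!x. P i x)"
    then have "ev (\<lambda>i. \<not> (\<exists>!x. P i x))" by (simp add: ev_not)
    with ex have "ev (\<lambda>i. \<exists>z. P i (fst z) \<and> P i (snd z) \<and> fst z \<noteq> snd z)"
      by eventually_elim auto
    then obtain z where z: "ev (\<lambda>i. P i (fst (z i)) \<and> P i (snd (z i)) \<and> fst (z i) \<noteq> snd (z i))" unfolding ev_ex by blast
    then have z12: "ev (\<lambda>i. P i (fst (z i)))" "ev (\<lambda>i. P i (snd (z i)))" and ne: "ev (\<lambda>i. fst (z i) \<noteq> snd (z i))"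
      by (auto elim: eventually_mono)
    have "uclass U (\<lambda>i. fst (z i)) = uclass U (\<lambda>i. snd (z i))"
      by (rule ex1_implies_eq[OF *]) (rule exI conjI refl z12)+
    then show False using ne by (simp add: ev_not)
  qed
next
  assume e: "ev (\<lambda>i. \<exists>!x. P i x)"
  then have "ev (\<lambda>i. \<exists>x. P i x)" by (auto elim: eventually_mono)
  then obtain w where w: "ev (\<lambda>i. P i (w i))" unfolding ev_ex by blast
  show "\<exists>!u. \<exists>w. u = uclass U w \<and> ev (\<lambda>i. P i (w i))"
  proof (rule ex1I)
    show "\<exists>w'. uclass U w = uclass U w' \<and> ev (\<lambda>i. P i (w' i))" by (rule exI conjI refl w)+
    fix u assume "\<exists>w. u = uclass U w \<and> ev (\<lambda>i. P i (w i))"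
    then obtain w' where w': "u = uclass U w'" "ev (\<lambda>i. P i (w' i))" by blast
    have "ev (\<lambda>i. w' i = w i)" using e w w'(2) by eventually_elim auto
    then show "u = uclass U w" using w' by simp
  qed
qed

end

lemma full_subcat_simps [simp]:
  "cdom (full_subcat C P) = cdom C" "ccod (full_subcat C P) = ccod C" "cid (full_subcat C P) = cid C"
  "ccomp (full_subcat C P) = ccomp C" "czero (full_subcat C P) = czero C" "cadd (full_subcat C P) = cadd C"
  "cscale (full_subcat C P) = cscale C"
  "carr (full_subcat C P) = {f \<in> carr C. P (cdom C f) \<and> P (ccod C f)}"
  by (simp_all add: full_subcat_def)

lemma chom_full_subcat: "P X \<Longrightarrow> P Y \<Longrightarrow> chom (full_subcat C P) X Y = chom C X Y"
  by (auto simp: chom_def)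

text \<open>The single bound \<open>B\<close> puts the classes of the tuples \<open>M\<close> and
  \<open>N\<close> into the restricted ultraproduct. For base changes of modules over the integers
  it is a number of generators.\<close>

locale ultra_rep = ultra U for U :: "'i filter" +
  fixes k :: "'i \<Rightarrow> 'k ring" and A :: "'i \<Rightarrow> ('k, 'a) hopf"
    and M N :: "'i \<Rightarrow> ('k, 'a, 'v) comodule" and B :: nat
  assumes ext: "\<And>i. ext_setting (k i) (A i) (M i) (N i)"
    and gen_MN: "\<And>i. generated_by (k i) (M i) B" "\<And>i. generated_by (k i) (N i) B"
begin

abbreviation Cc :: "'i \<Rightarrow> ('k, ('k, 'a, 'v) comodule, ('k, 'a, 'v) rep_arrow) lincat" where
  "Cc i \<equiv> rep_cat (k i) (A i)"

abbreviation D :: "nat \<Rightarrow> 'i \<Rightarrow> ('k, ('k, 'a, 'v) comodule, ('k, 'a, 'v) rep_arrow) lincat" where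
  "D b i \<equiv> full_subcat (Cc i) (\<lambda>X. generated_by (k i) X b)"

abbreviation CU :: "(('i \<Rightarrow> 'k) set, ('i \<Rightarrow> ('k, 'a, 'v) comodule) set, ('i \<Rightarrow> ('k, 'a, 'v) rep_arrow) set) lincat" where
  "CU \<equiv> restricted_uproduct U k A"

lemma rep: "rep_setting TYPE('v) (k i) (A i)"
  using ext[of i] by (simp add: ext_setting_def)

lemma carr_obj:
  assumes "f \<in> carr (Cc i)"
  shows "cdom (Cc i) f \<in> rep_objects (k i) (A i)" "ccod (Cc i) f \<in> rep_objects (k i) (A i)"
  using assms by (auto simp: rep_cat_def)

lemma dim_bound: "f \<in> carr (Cc i) \<Longrightarrow> generated_by (k i) (cdom (Cc i) f) b \<longleftrightarrow> vectorspace.dim (k i) (cdom (Cc i) f) \<le> b"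
  "f \<in> carr (Cc i) \<Longrightarrow> generated_by (k i) (ccod (Cc i) f) b \<longleftrightarrow> vectorspace.dim (k i) (ccod (Cc i) f) \<le> b"
  using rep_setting.gen_iff_dim[OF rep] carr_obj by auto

lemma CU_simps [simp]:
  "cdom CU (uclass U f) = uclass U (\<lambda>i. cdom (Cc i) (f i))"
  "ccod CU (uclass U f) = uclass U (\<lambda>i. ccod (Cc i) (f i))"
  "cid CU (uclass U x) = uclass U (\<lambda>i. cid (Cc i) (x i))"
  "ccomp CU (uclass U g) (uclass U f) = uclass U (\<lambda>i. ccomp (Cc i) (g i) (f i))"
  "czero CU (uclass U x) (uclass U y) = uclass U (\<lambda>i. czero (Cc i) (x i) (y i))"
  "cadd CU (uclass U g) (uclass U f) = uclass U (\<lambda>i. cadd (Cc i) (g i) (f i))"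
  "cscale CU (uclass U c) (uclass U f) = uclass U (\<lambda>i. cscale (Cc i) (c i) (f i))"
  by (simp_all add: restricted_uproduct_def uproduct_cat_def)

lemma carr_nonempty: "carr (Cc i) \<noteq> {}"
proof -
  interpret ext_setting "k i" "A i" "TYPE('v)" "M i" "N i" by (rule ext)
  have "(M i, M i, restrict (\<lambda>v. v) (carrier (M i))) \<in> carr (Cc i)"
    using Hom_restrict[OF M_Obj M_Obj Hom_id[OF M_Obj]] M_Obj by (simp add: C_carr)
  then show ?thesis by blast
qed

abbreviation "bdd b f \<equiv> ev (\<lambda>i. f i \<in> carr (D b i))"

text \<open>The restricted ultraproduct is cut out by a condition on some representative of the
  class; here it becomes a condition on the given one.\<close>

lemma dim_class: "(\<exists>x\<in>uclass U X. \<exists>b. ev (\<lambda>i. vectorspace.dim (k i) (x i) \<le> b)) \<longleftrightarrow> (\<exists>b. ev (\<lambda>i. vectorspace.dim (k i) (X i) \<le> b))"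
proof
  assume "\<exists>x\<in>uclass U X. \<exists>b. ev (\<lambda>i. vectorspace.dim (k i) (x i) \<le> b)"
  then obtain x b where "ev (\<lambda>i. x i = X i)" "ev (\<lambda>i. vectorspace.dim (k i) (x i) \<le> b)" by (auto simp: uclass_def)
  then have "ev (\<lambda>i. vectorspace.dim (k i) (X i) \<le> b)" by eventually_elim simp
  then show "\<exists>b. ev (\<lambda>i. vectorspace.dim (k i) (X i) \<le> b)" by blast
next
  assume "\<exists>b. ev (\<lambda>i. vectorspace.dim (k i) (X i) \<le> b)"
  then show "\<exists>x\<in>uclass U X. \<exists>b. ev (\<lambda>i. vectorspace.dim (k i) (x i) \<le> b)"
    by (intro bexI[of _ X]) (simp_all add: uclass_def)
qed

text \<open>One number bounds domain and codomain together, the maximum of the two bounds. Thus the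
  arrows of the restricted ultraproduct are those coming, for some \<open>b\<close>, from the
  truncated categories \<open>D b i\<close>.\<close>

lemma carr_CU: "uclass U f \<in> carr CU \<longleftrightarrow> (\<exists>b. bdd b f)"
proof -
  have "uclass U f \<in> carr CU \<longleftrightarrow> ev (\<lambda>i. f i \<in> carr (Cc i)) \<and>
      (\<exists>b. ev (\<lambda>i. vectorspace.dim (k i) (cdom (Cc i) (f i)) \<le> b)) \<and> (\<exists>b. ev (\<lambda>i. vectorspace.dim (k i) (ccod (Cc i) (f i)) \<le> b))"
    using uproduct_iff[of "\<lambda>i. carr (Cc i)" f, OF carr_nonempty]
    by (simp add: restricted_uproduct_def uproduct_cat_def dim_class)
  also have "\<dots> \<longleftrightarrow> (\<exists>b. bdd b f)"
  proof
    assume "ev (\<lambda>i. f i \<in> carr (Cc i)) \<and>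
      (\<exists>b. ev (\<lambda>i. vectorspace.dim (k i) (cdom (Cc i) (f i)) \<le> b)) \<and> (\<exists>b. ev (\<lambda>i. vectorspace.dim (k i) (ccod (Cc i) (f i)) \<le> b))"
    then obtain b b' where "ev (\<lambda>i. f i \<in> carr (Cc i))" "ev (\<lambda>i. vectorspace.dim (k i) (cdom (Cc i) (f i)) \<le> b)"
      "ev (\<lambda>i. vectorspace.dim (k i) (ccod (Cc i) (f i)) \<le> b')" by blast
    then have "bdd (max b b') f" by eventually_elim (auto simp: dim_bound)
    then show "\<exists>b. bdd b f" by blast
  next
    assume "\<exists>b. bdd b f"
    then obtain b where b: "bdd b f" by blast
    then have "ev (\<lambda>i. f i \<in> carr (Cc i))" "ev (\<lambda>i. vectorspace.dim (k i) (cdom (Cc i) (f i)) \<le> b)"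
      "ev (\<lambda>i. vectorspace.dim (k i) (ccod (Cc i) (f i)) \<le> b)"
      by (auto simp: dim_bound elim!: eventually_mono)
    then show "ev (\<lambda>i. f i \<in> carr (Cc i)) \<and>
      (\<exists>b. ev (\<lambda>i. vectorspace.dim (k i) (cdom (Cc i) (f i)) \<le> b)) \<and> (\<exists>b. ev (\<lambda>i. vectorspace.dim (k i) (ccod (Cc i) (f i)) \<le> b))"
      by blast
  qed
  finally show ?thesis .
qed

lemma carr_CU_cases:
  assumes "F \<in> carr CU"
  obtains f b where "F = uclass U f" "bdd b f"
proof -
  have "F \<in> uproduct U (\<lambda>i. carr (Cc i))" using assms by (simp add: restricted_uproduct_def uproduct_cat_def)
  then obtain f where "F = uclass U f" by (rule uproduct_cases)
  then show ?thesis using that assms carr_CU by blast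
qed

lemma bdd_mono: "bdd b f \<Longrightarrow> b \<le> b' \<Longrightarrow> bdd b' f"
  by (erule eventually_mono)
    (auto dest: rep_setting.gen_mono[OF rep carr_obj(1)] rep_setting.gen_mono[OF rep carr_obj(2)])

text \<open>Bounds are monotone, so small values of \<open>b\<close> may be skipped; a truncated
  category is only used once it contains the arrows under consideration.\<close>

lemma bdd_all_ge: "(\<forall>b t. bdd b t \<longrightarrow> Q t) \<longleftrightarrow> (\<forall>b\<ge>b'. \<forall>t. bdd b t \<longrightarrow> Q t)"
proof
  assume *: "\<forall>b\<ge>b'. \<forall>t. bdd b t \<longrightarrow> Q t"
  show "\<forall>b t. bdd b t \<longrightarrow> Q t"
  proof (intro allI impI)
    fix b t assume "bdd b t"
    then have "bdd (max b b') t" by (rule bdd_mono) simp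
    then show "Q t" using *[rule_format, of "max b b'" t] by simp
  qed
qed simp

lemma ball_carr_CU: "(\<forall>F\<in>carr CU. Q F) \<longleftrightarrow> (\<forall>b f. bdd b f \<longrightarrow> Q (uclass U f))"
proof
  assume *: "\<forall>b f. bdd b f \<longrightarrow> Q (uclass U f)"
  show "\<forall>F\<in>carr CU. Q F"
  proof
    fix F assume "F \<in> carr CU"
    then obtain f b where "F = uclass U f" "bdd b f" by (rule carr_CU_cases)
    then show "Q F" using * by simp
  qed
qed (use carr_CU in auto)

lemma chom_CU:
  assumes "ev (\<lambda>i. generated_by (k i) (X i) b)" "ev (\<lambda>i. generated_by (k i) (Y i) b)"
  shows "F \<in> chom CU (uclass U X) (uclass U Y) \<longleftrightarrow> (\<exists>f. F = uclass U f \<and> ev (\<lambda>i. f i \<in> chom (Cc i) (X i) (Y i)))"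
proof
  assume F: "F \<in> chom CU (uclass U X) (uclass U Y)"
  then have "F \<in> carr CU" by (simp add: chom_def)
  then obtain f b where f: "F = uclass U f" "bdd b f" by (rule carr_CU_cases)
  have "ev (\<lambda>i. cdom (Cc i) (f i) = X i)" "ev (\<lambda>i. ccod (Cc i) (f i) = Y i)" using F f by (auto simp: chom_def)
  with f(2) have "ev (\<lambda>i. f i \<in> chom (Cc i) (X i) (Y i))" by eventually_elim (auto simp: chom_def)
  then show "\<exists>f. F = uclass U f \<and> ev (\<lambda>i. f i \<in> chom (Cc i) (X i) (Y i))" using f by blast
next
  assume "\<exists>f. F = uclass U f \<and> ev (\<lambda>i. f i \<in> chom (Cc i) (X i) (Y i))"
  then obtain f where f: "F = uclass U f" "ev (\<lambda>i. f i \<in> chom (Cc i) (X i) (Y i))" by blast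
  from f(2) assms have "bdd b f" by eventually_elim (auto simp: chom_def)
  moreover have "ev (\<lambda>i. cdom (Cc i) (f i) = X i)" "ev (\<lambda>i. ccod (Cc i) (f i) = Y i)"
    using f(2) by (auto simp: chom_def elim: eventually_mono)
  ultimately show "F \<in> chom CU (uclass U X) (uclass U Y)" using f(1) carr_CU by (auto simp: chom_def)
qed

lemma bdd_gen:
  assumes "bdd b f"
  shows "ev (\<lambda>i. generated_by (k i) (cdom (Cc i) (f i)) b)" "ev (\<lambda>i. generated_by (k i) (ccod (Cc i) (f i)) b)"
    "ev (\<lambda>i. f i \<in> carr (Cc i))"
  using assms by (auto elim: eventually_mono)

text \<open>Between objects bounded by \<open>b\<close> the truncated category has all arrows, so
  the unique arrow may be sought there, and \<open>ex1_uclass\<close> applies.\<close>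

lemma ex1_chom_CU:
  assumes "ev (\<lambda>i. generated_by (k i) (X i) b)" "ev (\<lambda>i. generated_by (k i) (Y i) b)"
    and "\<And>w. Q (uclass U w) \<longleftrightarrow> ev (\<lambda>i. q i (w i))"
  shows "(\<exists>!u. u \<in> chom CU (uclass U X) (uclass U Y) \<and> Q u) \<longleftrightarrow> ev (\<lambda>i. \<exists>!x. x \<in> chom (D b i) (X i) (Y i) \<and> q i x)"
proof -
  have "(\<exists>!u. u \<in> chom CU (uclass U X) (uclass U Y) \<and> Q u) \<longleftrightarrow>
      (\<exists>!u. \<exists>w. u = uclass U w \<and> ev (\<lambda>i. w i \<in> chom (Cc i) (X i) (Y i) \<and> q i (w i)))"
    unfolding chom_CU[OF assms(1,2)] by (rule arg_cong[of _ _ Ex1]) (auto simp: fun_eq_iff assms(3) eventually_conj_iff)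
  also have "\<dots> \<longleftrightarrow> ev (\<lambda>i. \<exists>!x. x \<in> chom (Cc i) (X i) (Y i) \<and> q i x)" by (rule ex1_uclass)
  also have "\<dots> \<longleftrightarrow> ev (\<lambda>i. \<exists>!x. x \<in> chom (D b i) (X i) (Y i) \<and> q i x)"
    using assms(1,2) by (intro iffI; elim eventually_rev_mp) (auto elim!: eventually_mono simp: chom_full_subcat)
  finally show ?thesis .
qed

text \<open>Each test arrow has some bound \<open>b\<close>, and for fixed \<open>b\<close> the test
  arrows are arbitrary tuples from \<open>D b i\<close>, so the clauses of Los apply. The quantifier
  over \<open>b\<close> stays outside \<open>eventually\<close>: at this point the exceptional set
  may depend on \<open>b\<close>.\<close>

lemma is_kernel_D:
  assumes f: "bdd B' f" and g: "bdd B' g"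
  shows "is_kernel CU (uclass U f) (uclass U g) \<longleftrightarrow> (\<forall>b\<ge>B'. ev (\<lambda>i. is_kernel (D b i) (f i) (g i)))"
proof -
  let ?E = "\<lambda>b t i. \<exists>!u. u \<in> chom (D b i) (cdom (Cc i) (t i)) (cdom (Cc i) (f i)) \<and> ccomp (Cc i) (f i) u = t i"
  have fg: "uclass U f \<in> carr CU" "uclass U g \<in> carr CU" using f g carr_CU by auto
  define K0 where "K0 \<longleftrightarrow> ev (\<lambda>i. ccod (Cc i) (f i) = cdom (Cc i) (g i)) \<and>
    ev (\<lambda>i. ccomp (Cc i) (g i) (f i) = czero (Cc i) (cdom (Cc i) (f i)) (ccod (Cc i) (g i)))"
  define A0 where "A0 t \<longleftrightarrow> ev (\<lambda>i. ccod (Cc i) (t i) = cdom (Cc i) (g i)) \<and>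
    ev (\<lambda>i. ccomp (Cc i) (g i) (t i) = czero (Cc i) (cdom (Cc i) (t i)) (ccod (Cc i) (g i)))" for t
  have ex1: "(\<exists>!u. u \<in> chom CU (uclass U (\<lambda>i. cdom (Cc i) (t i))) (uclass U (\<lambda>i. cdom (Cc i) (f i))) \<and> ccomp CU (uclass U f) u = uclass U t)
      \<longleftrightarrow> ev (?E b t)" if "bdd b t" "b \<ge> B'" for b t
    by (rule ex1_chom_CU[OF bdd_gen(1)[OF that(1)] bdd_gen(1)[OF bdd_mono[OF f that(2)]]]) simp
  have 1: "is_kernel CU (uclass U f) (uclass U g) \<longleftrightarrow> K0 \<and> (\<forall>b\<ge>B'. \<forall>t. bdd b t \<longrightarrow> A0 t \<longrightarrow> ev (?E b t))"
  proof -
    have "is_kernel CU (uclass U f) (uclass U g) \<longleftrightarrow> K0 \<and> (\<forall>b t. bdd b t \<longrightarrow> A0 t \<longrightarrow>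
      (\<exists>!u. u \<in> chom CU (uclass U (\<lambda>i. cdom (Cc i) (t i))) (uclass U (\<lambda>i. cdom (Cc i) (f i))) \<and> ccomp CU (uclass U f) u = uclass U t))"
      unfolding is_kernel_def ball_carr_CU K0_def A0_def using fg by (simp add: conj_assoc)
    also have "\<dots> \<longleftrightarrow> K0 \<and> (\<forall>b\<ge>B'. \<forall>t. bdd b t \<longrightarrow> A0 t \<longrightarrow>
      (\<exists>!u. u \<in> chom CU (uclass U (\<lambda>i. cdom (Cc i) (t i))) (uclass U (\<lambda>i. cdom (Cc i) (f i))) \<and> ccomp CU (uclass U f) u = uclass U t))"
      by (subst bdd_all_ge[of _ B']) (rule refl)
    also have "\<dots> \<longleftrightarrow> K0 \<and> (\<forall>b\<ge>B'. \<forall>t. bdd b t \<longrightarrow> A0 t \<longrightarrow> ev (?E b t))"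
      using ex1 by simp
    finally show ?thesis .
  qed
  have 2: "ev (\<lambda>i. is_kernel (D b i) (f i) (g i)) \<longleftrightarrow> K0 \<and> (\<forall>t. bdd b t \<longrightarrow> A0 t \<longrightarrow> ev (?E b t))" if "b \<ge> B'" for b
  proof -
    have "ev (\<lambda>i. f i \<in> carr (D b i))" "ev (\<lambda>i. g i \<in> carr (D b i))" using bdd_mono f g that by auto
    then show ?thesis
      unfolding is_kernel_def Ball_def K0_def A0_def by (simp only: eventually_conj_iff ev_all ev_imp full_subcat_simps(1-7)) simp
  qed
  show ?thesis using 1 2 by auto
qed

lemma is_cokernel_D:
  assumes f: "bdd B' f" and g: "bdd B' g"
  shows "is_cokernel CU (uclass U g) (uclass U f) \<longleftrightarrow> (\<forall>b\<ge>B'. ev (\<lambda>i. is_cokernel (D b i) (g i) (f i)))"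
proof -
  let ?E = "\<lambda>b t i. \<exists>!u. u \<in> chom (D b i) (ccod (Cc i) (g i)) (ccod (Cc i) (t i)) \<and> ccomp (Cc i) u (g i) = t i"
  have fg: "uclass U f \<in> carr CU" "uclass U g \<in> carr CU" using f g carr_CU by auto
  define K0 where "K0 \<longleftrightarrow> ev (\<lambda>i. ccod (Cc i) (f i) = cdom (Cc i) (g i)) \<and>
    ev (\<lambda>i. ccomp (Cc i) (g i) (f i) = czero (Cc i) (cdom (Cc i) (f i)) (ccod (Cc i) (g i)))"
  define A0 where "A0 t \<longleftrightarrow> ev (\<lambda>i. cdom (Cc i) (t i) = ccod (Cc i) (f i)) \<and>
    ev (\<lambda>i. ccomp (Cc i) (t i) (f i) = czero (Cc i) (cdom (Cc i) (f i)) (ccod (Cc i) (t i)))" for t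
  have ex1: "(\<exists>!u. u \<in> chom CU (uclass U (\<lambda>i. ccod (Cc i) (g i))) (uclass U (\<lambda>i. ccod (Cc i) (t i))) \<and> ccomp CU u (uclass U g) = uclass U t)
      \<longleftrightarrow> ev (?E b t)" if "bdd b t" "b \<ge> B'" for b t
    by (rule ex1_chom_CU[OF bdd_gen(2)[OF bdd_mono[OF g that(2)]] bdd_gen(2)[OF that(1)]]) simp
  have 1: "is_cokernel CU (uclass U g) (uclass U f) \<longleftrightarrow> K0 \<and> (\<forall>b\<ge>B'. \<forall>t. bdd b t \<longrightarrow> A0 t \<longrightarrow> ev (?E b t))"
  proof -
    have "is_cokernel CU (uclass U g) (uclass U f) \<longleftrightarrow> K0 \<and> (\<forall>b t. bdd b t \<longrightarrow> A0 t \<longrightarrow>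
      (\<exists>!u. u \<in> chom CU (uclass U (\<lambda>i. ccod (Cc i) (g i))) (uclass U (\<lambda>i. ccod (Cc i) (t i))) \<and> ccomp CU u (uclass U g) = uclass U t))"
      unfolding is_cokernel_def ball_carr_CU K0_def A0_def using fg by (simp add: conj_assoc)
    also have "\<dots> \<longleftrightarrow> K0 \<and> (\<forall>b\<ge>B'. \<forall>t. bdd b t \<longrightarrow> A0 t \<longrightarrow>
      (\<exists>!u. u \<in> chom CU (uclass U (\<lambda>i. ccod (Cc i) (g i))) (uclass U (\<lambda>i. ccod (Cc i) (t i))) \<and> ccomp CU u (uclass U g) = uclass U t))"
      by (subst bdd_all_ge[of _ B']) (rule refl)
    also have "\<dots> \<longleftrightarrow> K0 \<and> (\<forall>b\<ge>B'. \<forall>t. bdd b t \<longrightarrow> A0 t \<longrightarrow> ev (?E b t))"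
      using ex1 by simp
    finally show ?thesis .
  qed
  have 2: "ev (\<lambda>i. is_cokernel (D b i) (g i) (f i)) \<longleftrightarrow> K0 \<and> (\<forall>t. bdd b t \<longrightarrow> A0 t \<longrightarrow> ev (?E b t))" if "b \<ge> B'" for b
  proof -
    have "ev (\<lambda>i. f i \<in> carr (D b i))" "ev (\<lambda>i. g i \<in> carr (D b i))" using bdd_mono f g that by auto
    then show ?thesis
      unfolding is_cokernel_def Ball_def K0_def A0_def by (simp only: eventually_conj_iff ev_all ev_imp full_subcat_simps(1-7)) simp
  qed
  show ?thesis using 1 2 by auto
qed

lemma is_pullback_D:
  assumes g: "bdd B' g" and h: "bdd B' h" and p: "bdd B' p" and q: "bdd B' q"
  shows "is_pullback CU (uclass U g) (uclass U h) (uclass U p) (uclass U q) \<longleftrightarrow> (\<forall>b\<ge>B'. ev (\<lambda>i. is_pullback (D b i) (g i) (h i) (p i) (q i)))"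
proof -
  let ?E = "\<lambda>b s t i. \<exists>!u. u \<in> chom (D b i) (cdom (Cc i) (s i)) (cdom (Cc i) (p i)) \<and> ccomp (Cc i) (p i) u = s i \<and> ccomp (Cc i) (q i) u = t i"
  let ?E' = "\<lambda>s t. \<exists>!u. u \<in> chom CU (uclass U (\<lambda>i. cdom (Cc i) (s i))) (uclass U (\<lambda>i. cdom (Cc i) (p i))) \<and>
      ccomp CU (uclass U p) u = uclass U s \<and> ccomp CU (uclass U q) u = uclass U t"
  have fg: "uclass U g \<in> carr CU" "uclass U h \<in> carr CU" "uclass U p \<in> carr CU" "uclass U q \<in> carr CU" using assms carr_CU by auto
  define K0 where "K0 \<longleftrightarrow> ev (\<lambda>i. ccod (Cc i) (g i) = ccod (Cc i) (h i)) \<and> ev (\<lambda>i. cdom (Cc i) (p i) = cdom (Cc i) (q i)) \<and>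
    ev (\<lambda>i. ccod (Cc i) (p i) = cdom (Cc i) (g i)) \<and> ev (\<lambda>i. ccod (Cc i) (q i) = cdom (Cc i) (h i)) \<and>
    ev (\<lambda>i. ccomp (Cc i) (g i) (p i) = ccomp (Cc i) (h i) (q i))"
  define A0 where "A0 s t \<longleftrightarrow> ev (\<lambda>i. cdom (Cc i) (s i) = cdom (Cc i) (t i)) \<and> ev (\<lambda>i. ccod (Cc i) (s i) = cdom (Cc i) (g i)) \<and>
    ev (\<lambda>i. ccod (Cc i) (t i) = cdom (Cc i) (h i)) \<and> ev (\<lambda>i. ccomp (Cc i) (g i) (s i) = ccomp (Cc i) (h i) (t i))" for s t
  have ex1: "?E' s t \<longleftrightarrow> ev (?E b s t)" if "bdd b s" "b \<ge> B'" for b s t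
    by (rule ex1_chom_CU[OF bdd_gen(1)[OF that(1)] bdd_gen(1)[OF bdd_mono[OF p that(2)]]]) (simp add: eventually_conj_iff)
  have 1: "is_pullback CU (uclass U g) (uclass U h) (uclass U p) (uclass U q) \<longleftrightarrow>
    K0 \<and> (\<forall>b\<ge>B'. \<forall>s. bdd b s \<longrightarrow> (\<forall>t. bdd b t \<longrightarrow> A0 s t \<longrightarrow> ev (?E b s t)))"
  proof -
    have "is_pullback CU (uclass U g) (uclass U h) (uclass U p) (uclass U q) \<longleftrightarrow>
      K0 \<and> (\<forall>b s. bdd b s \<longrightarrow> (\<forall>b t. bdd b t \<longrightarrow> A0 s t \<longrightarrow> ?E' s t))"
      unfolding is_pullback_def ball_carr_CU K0_def A0_def using fg by (simp add: conj_assoc)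
    also have "\<dots> \<longleftrightarrow> K0 \<and> (\<forall>b\<ge>B'. \<forall>s. bdd b s \<longrightarrow> (\<forall>t. bdd b t \<longrightarrow> A0 s t \<longrightarrow> ?E' s t))"
    proof (rule arg_cong[of _ _ "(\<and>) K0"], rule iffI)
      assume *: "\<forall>b\<ge>B'. \<forall>s. bdd b s \<longrightarrow> (\<forall>t. bdd b t \<longrightarrow> A0 s t \<longrightarrow> ?E' s t)"
      show "\<forall>b s. bdd b s \<longrightarrow> (\<forall>b t. bdd b t \<longrightarrow> A0 s t \<longrightarrow> ?E' s t)"
      proof (intro allI impI)
        fix b s b' t assume "bdd b s" "bdd b' t" "A0 s t"
        \<comment> \<open>The two test arrows come with separate bounds; a common one reduces to the
          single bound of the assumption.\<close>
        moreover have "bdd (max B' (max b b')) s" by (rule bdd_mono[OF \<open>bdd b s\<close>]) simp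
        moreover have "bdd (max B' (max b b')) t" by (rule bdd_mono[OF \<open>bdd b' t\<close>]) simp
        ultimately show "?E' s t" using *[rule_format, of "max B' (max b b')" s t] by simp
      qed
    qed simp
    also have "\<dots> \<longleftrightarrow> K0 \<and> (\<forall>b\<ge>B'. \<forall>s. bdd b s \<longrightarrow> (\<forall>t. bdd b t \<longrightarrow> A0 s t \<longrightarrow> ev (?E b s t)))"
      using ex1 by simp
    finally show ?thesis .
  qed
  have 2: "ev (\<lambda>i. is_pullback (D b i) (g i) (h i) (p i) (q i)) \<longleftrightarrow>
      K0 \<and> (\<forall>s. bdd b s \<longrightarrow> (\<forall>t. bdd b t \<longrightarrow> A0 s t \<longrightarrow> ev (?E b s t)))" if "b \<ge> B'" for b
  proof -
    have "bdd b g" "bdd b h" "bdd b p" "bdd b q" using bdd_mono assms that by auto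
    then show ?thesis
      unfolding is_pullback_def Ball_def K0_def A0_def by (simp only: eventually_conj_iff ev_all ev_imp full_subcat_simps(1-7)) simp
  qed
  show ?thesis using 1 2 by auto
qed

lemma ev_cong:
  assumes "ev P" "\<And>i. P i \<Longrightarrow> Q i \<longleftrightarrow> R i"
  shows "ev Q \<longleftrightarrow> ev R"
  using assms(1) by (intro iffI; elim eventually_rev_mp) (auto elim!: eventually_mono simp: assms(2))

text \<open>Absoluteness makes the conditions for different \<open>b\<close> equivalent almost
  everywhere, so the quantifier over \<open>b\<close> disappears.\<close>

lemma kernel_los:
  assumes f: "bdd B' f" and g: "bdd B' g"
  shows "is_kernel CU (uclass U f) (uclass U g) \<longleftrightarrow> ev (\<lambda>i. is_kernel (Cc i) (f i) (g i))"
proof -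
  have "ev (\<lambda>i. is_kernel (D b i) (f i) (g i)) \<longleftrightarrow> ev (\<lambda>i. is_kernel (Cc i) (f i) (g i))" if "b \<ge> B'" for b
  proof (rule ev_cong)
    show "ev (\<lambda>i. f i \<in> carr (D b i) \<and> g i \<in> carr (D b i))"
      using bdd_mono[OF f that] bdd_mono[OF g that] by (simp only: eventually_conj_iff)
  qed (rule rep_setting.kernel_absolute[OF rep]; simp)
  then show ?thesis unfolding is_kernel_D[OF f g] by auto
qed

lemma cokernel_los:
  assumes f: "bdd B' f" and g: "bdd B' g"
  shows "is_cokernel CU (uclass U g) (uclass U f) \<longleftrightarrow> ev (\<lambda>i. is_cokernel (Cc i) (g i) (f i))"
proof -
  have "ev (\<lambda>i. is_cokernel (D b i) (g i) (f i)) \<longleftrightarrow> ev (\<lambda>i. is_cokernel (Cc i) (g i) (f i))" if "b \<ge> B'" for b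
  proof (rule ev_cong)
    show "ev (\<lambda>i. f i \<in> carr (D b i) \<and> g i \<in> carr (D b i))"
      using bdd_mono[OF f that] bdd_mono[OF g that] by (simp only: eventually_conj_iff)
  qed (rule rep_setting.cokernel_absolute[OF rep]; simp)
  then show ?thesis unfolding is_cokernel_D[OF f g] by auto
qed

lemma pullback_los:
  assumes a: "bdd B' g" "bdd B' h" "bdd B' p" "bdd B' q"
  shows "is_pullback CU (uclass U g) (uclass U h) (uclass U p) (uclass U q) \<longleftrightarrow>
    ev (\<lambda>i. is_pullback (Cc i) (g i) (h i) (p i) (q i))"
proof -
  \<comment> \<open>Absoluteness of pullbacks needs \<open>b\<close> at least twice the bound of
    \<open>g\<close> and \<open>h\<close>, so the range of \<open>b\<close> is made to start at 2 *
    \<open>B'\<close>.\<close>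
  have a2: "bdd (2 * B') g" "bdd (2 * B') h" "bdd (2 * B') p" "bdd (2 * B') q"
    by (rule bdd_mono[OF a(1)] bdd_mono[OF a(2)] bdd_mono[OF a(3)] bdd_mono[OF a(4)], simp)+
  have "ev (\<lambda>i. is_pullback (D b i) (g i) (h i) (p i) (q i)) \<longleftrightarrow> ev (\<lambda>i. is_pullback (Cc i) (g i) (h i) (p i) (q i))"
    if b: "b \<ge> 2 * B'" for b
  proof (rule ev_cong)
    show "ev (\<lambda>i. g i \<in> carr (D B' i) \<and> h i \<in> carr (D B' i) \<and> p i \<in> carr (D b i) \<and> q i \<in> carr (D b i))"
      using a(1,2) bdd_mono[OF a2(3) b] bdd_mono[OF a2(4) b] by (simp only: eventually_conj_iff)
  qed (rule rep_setting.pullback_absolute[OF rep _ _ _ _ b]; simp)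
  then show ?thesis unfolding is_pullback_D[OF a2] by auto
qed

end

section \<open>Extensions and Baer sums in the restricted ultraproduct\<close>

definition "baer_cond C N f1 g1 f2 g2 f g p1 p2 s j q \<longleftrightarrow>
           is_pullback C g1 g2 p1 p2 \<and>
           s \<in> chom C N (cdom C p1) \<and> ccomp C p1 s = f1 \<and>
           cadd C (ccomp C p2 s) f2 = czero C N (ccod C f2) \<and>
           j \<in> chom C N (cdom C p1) \<and> ccomp C p1 j = f1 \<and>
           ccomp C p2 j = czero C N (ccod C f2) \<and>
           is_cokernel C q s \<and> ccod C q = ccod C f \<and>
           ccomp C q j = f \<and> ccomp C g q = ccomp C g1 p1"

lemma is_baer_sum_cond:
  "is_baer_sum C M' N' (f1, g1) (f2, g2) (f, g) \<longleftrightarrow>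
     (f1, g1) \<in> extensions C M' N' \<and> (f2, g2) \<in> extensions C M' N' \<and> (f, g) \<in> extensions C M' N' \<and>
     (\<exists>p1 p2 s j q. baer_cond C N' f1 g1 f2 g2 f g p1 p2 s j q)"
  by (simp add: is_baer_sum_def baer_cond_def)

text \<open>The ends of \<open>s\<close>, \<open>j\<close> and \<open>q\<close> are
  \<open>N\<close>, the domain of \<open>p1\<close> and the codomain of \<open>f\<close>, so bounds
  for these objects bound the three arrows.\<close>

lemma baer_cond_arrows:
  assumes "baer_cond C N f1 g1 f2 g2 f g p1 p2 s j q"
  shows "s \<in> carr C \<and> cdom C s = N \<and> ccod C s = cdom C p1" "j \<in> carr C \<and> cdom C j = N \<and> ccod C j = cdom C p1"
    "q \<in> carr C \<and> cdom C q = cdom C p1 \<and> ccod C q = ccod C f"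
  using assms unfolding baer_cond_def chom_def is_cokernel_def by (elim conjE CollectE; simp)+

context ultra_rep
begin

abbreviation "MU \<equiv> uclass U M"
abbreviation "NU \<equiv> uclass U N"

lemma gen_MN_2: "generated_by (k i) (M i) (2 * B)" "generated_by (k i) (N i) (2 * B)"
proof -
  interpret ext_setting "k i" "A i" "TYPE('v)" "M i" "N i" by (rule ext)
  show "generated_by (k i) (M i) (2 * B)" "generated_by (k i) (N i) (2 * B)"
    using gen_mono[OF M_Obj gen_MN(1)] gen_mono[OF N_Obj gen_MN(2)] by auto
qed

text \<open>The constant is B + B: the dimension of the middle object is bounded by the sum of the
  bounds for sub and quotient.\<close>

lemma extension_bound:
  assumes "(f, g) \<in> extensions (Cc i) (M i) (N i)"
  shows "f \<in> carr (D (2 * B) i)" "g \<in> carr (D (2 * B) i)"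
proof -
  interpret ext_setting "k i" "A i" "TYPE('v)" "M i" "N i" by (rule ext)
  obtain X f' g' where E: "(f, g) = ext_pair X f' g'" "is_ext X f' g'" using assms extensions_iff by blast
  have "gen X (2 * B)" using gen_ext[OF E(2) gen_MN(2) gen_MN(1)] by (simp add: mult_2)
  then show "f \<in> carr (D (2 * B) i)" "g \<in> carr (D (2 * B) i)"
    using ext_carr[OF E(2)] E(1) gen_MN_2 by (auto simp: ext_pair_def)
qed

lemma extension_bdd:
  assumes "ev (\<lambda>i. (f i, g i) \<in> extensions (Cc i) (M i) (N i))"
  shows "bdd (2 * B) f" "bdd (2 * B) g"
  by (rule eventually_mono[OF assms], erule extension_bound)+

text \<open>From left to right a bound is available because the arrows belong to the restricted
  ultraproduct; from right to left it has to be produced, and it is 2 * \<open>B\<close>.\<close>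

lemma extension_los:
  "(uclass U f, uclass U g) \<in> extensions CU MU NU \<longleftrightarrow> ev (\<lambda>i. (f i, g i) \<in> extensions (Cc i) (M i) (N i))"
proof
  assume *: "(uclass U f, uclass U g) \<in> extensions CU MU NU"
  then have k: "is_kernel CU (uclass U f) (uclass U g)" "is_cokernel CU (uclass U g) (uclass U f)"
    and d: "ev (\<lambda>i. cdom (Cc i) (f i) = N i)" "ev (\<lambda>i. ccod (Cc i) (g i) = M i)"
    by (auto simp: extensions_def)
  then have "uclass U f \<in> carr CU" "uclass U g \<in> carr CU" by (auto simp: is_kernel_def)
  then obtain b b' where "bdd b f" "bdd b' g" using carr_CU by blast
  then have b: "bdd (max b b') f" "bdd (max b b') g" using bdd_mono[of f b "max b b'"] bdd_mono[of g b' "max b b'"] by auto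
  have "ev (\<lambda>i. is_kernel (Cc i) (f i) (g i))" "ev (\<lambda>i. is_cokernel (Cc i) (g i) (f i))"
    using k kernel_los[OF b] cokernel_los[OF b] by auto
  with d show "ev (\<lambda>i. (f i, g i) \<in> extensions (Cc i) (M i) (N i))"
    by eventually_elim (simp add: extensions_def)
next
  assume e: "ev (\<lambda>i. (f i, g i) \<in> extensions (Cc i) (M i) (N i))"
  have b: "bdd (2 * B) f" "bdd (2 * B) g"
    by (rule eventually_mono[OF e], erule extension_bound)+
  have "ev (\<lambda>i. is_kernel (Cc i) (f i) (g i))" "ev (\<lambda>i. is_cokernel (Cc i) (g i) (f i))"
    "ev (\<lambda>i. cdom (Cc i) (f i) = N i)" "ev (\<lambda>i. ccod (Cc i) (g i) = M i)"
    using e by (auto simp: extensions_def elim: eventually_mono)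
  then show "(uclass U f, uclass U g) \<in> extensions CU MU NU"
    using kernel_los[OF b] cokernel_los[OF b] by (simp add: extensions_def)
qed

lemma extensions_CU_cases:
  assumes "E \<in> extensions CU MU NU"
  obtains f g where "E = (uclass U f, uclass U g)" "ev (\<lambda>i. (f i, g i) \<in> extensions (Cc i) (M i) (N i))"
proof -
  obtain F G where FG: "E = (F, G)" by (cases E)
  then have "F \<in> carr CU" "G \<in> carr CU" using assms by (auto simp: extensions_def is_kernel_def)
  from \<open>F \<in> carr CU\<close> obtain f b where "F = uclass U f" "bdd b f" by (rule carr_CU_cases)
  moreover from \<open>G \<in> carr CU\<close> obtain g b' where "G = uclass U g" "bdd b' g" by (rule carr_CU_cases)
  ultimately show ?thesis using that extension_los assms FG by blast
qed

text \<open>An arrow between objects bounded by \<open>b\<close> is itself bounded, so a tuple of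
  witnesses always defines an arrow of the restricted ultraproduct.\<close>

lemma bex_chom_CU:
  assumes "ev (\<lambda>i. generated_by (k i) (X i) b)" "ev (\<lambda>i. generated_by (k i) (Y i) b)"
    and "\<And>w. bdd b w \<Longrightarrow> Q (uclass U w) \<longleftrightarrow> ev (\<lambda>i. q i (w i))"
  shows "(\<exists>F\<in>chom CU (uclass U X) (uclass U Y). Q F) \<longleftrightarrow> ev (\<lambda>i. \<exists>f\<in>chom (Cc i) (X i) (Y i). q i f)"
proof -
  have b: "bdd b w" if "ev (\<lambda>i. w i \<in> chom (Cc i) (X i) (Y i))" for w
    using that assms(1,2) by eventually_elim (auto simp: chom_def)
  have "(\<exists>F\<in>chom CU (uclass U X) (uclass U Y). Q F) \<longleftrightarrow> (\<exists>w. ev (\<lambda>i. w i \<in> chom (Cc i) (X i) (Y i)) \<and> Q (uclass U w))"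
    unfolding Bex_def chom_CU[OF assms(1,2)] by fast
  also have "\<dots> \<longleftrightarrow> (\<exists>w. ev (\<lambda>i. w i \<in> chom (Cc i) (X i) (Y i)) \<and> ev (\<lambda>i. q i (w i)))"
    by (rule ex_cong1, rule conj_cong, rule refl, rule assms(3), rule b)
  also have "\<dots> \<longleftrightarrow> ev (\<lambda>i. \<exists>f\<in>chom (Cc i) (X i) (Y i). q i f)"
    unfolding Bex_def ev_ex eventually_conj_iff ..
  finally show ?thesis .
qed

lemma iso_los:
  assumes h: "bdd b h"
  shows "is_iso CU (uclass U h) \<longleftrightarrow> ev (\<lambda>i. is_iso (Cc i) (h i))"
proof -
  have c: "uclass U h \<in> carr CU" using h carr_CU by blast
  have "(\<exists>G\<in>chom CU (ccod CU (uclass U h)) (cdom CU (uclass U h)). ccomp CU G (uclass U h) = cid CU (cdom CU (uclass U h)) \<and>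
         ccomp CU (uclass U h) G = cid CU (ccod CU (uclass U h))) \<longleftrightarrow>
      ev (\<lambda>i. \<exists>g\<in>chom (Cc i) (ccod (Cc i) (h i)) (cdom (Cc i) (h i)). ccomp (Cc i) g (h i) = cid (Cc i) (cdom (Cc i) (h i)) \<and>
         ccomp (Cc i) (h i) g = cid (Cc i) (ccod (Cc i) (h i)))"
    unfolding CU_simps
    by (rule bex_chom_CU[OF bdd_gen(2)[OF h] bdd_gen(1)[OF h]]) (simp add: eventually_conj_iff)
  then show ?thesis
    unfolding is_iso_def eventually_conj_iff using c bdd_gen(3)[OF h] by simp
qed

lemma ext_equiv_los:
  "((uclass U f, uclass U g), (uclass U f', uclass U g')) \<in> ext_equiv CU MU NU \<longleftrightarrow>
     ev (\<lambda>i. ((f i, g i), (f' i, g' i)) \<in> ext_equiv (Cc i) (M i) (N i))"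
proof -
  \<comment> \<open>The existence statement is transferred under the assumption \<open>e\<close>,
    which supplies the bounds for the middle objects; without \<open>e\<close> both sides of the
    claim are false.\<close>
  define e where "e \<longleftrightarrow> ev (\<lambda>i. (f i, g i) \<in> extensions (Cc i) (M i) (N i)) \<and> ev (\<lambda>i. (f' i, g' i) \<in> extensions (Cc i) (M i) (N i))"
  have "(\<exists>h \<in> chom CU (ccod CU (uclass U f)) (ccod CU (uclass U f')). is_iso CU h \<and> ccomp CU h (uclass U f) = uclass U f' \<and> ccomp CU (uclass U g') h = uclass U g)
    \<longleftrightarrow> ev (\<lambda>i. \<exists>h \<in> chom (Cc i) (ccod (Cc i) (f i)) (ccod (Cc i) (f' i)). is_iso (Cc i) h \<and> ccomp (Cc i) h (f i) = f' i \<and> ccomp (Cc i) (g' i) h = g i)"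
    if e
  proof -
    have b: "bdd (2 * B) f" "bdd (2 * B) f'"
      using that extension_bdd(1) unfolding e_def by blast+
    show ?thesis
      unfolding CU_simps
      by (rule bex_chom_CU[OF bdd_gen(2)[OF b(1)] bdd_gen(2)[OF b(2)]],
          unfold CU_simps uclass_eq_iff eventually_conj_iff, subst iso_los, assumption, rule refl)
  qed
  then show ?thesis
    unfolding ext_equiv_def by (auto simp: extension_los e_def eventually_conj_iff)
qed

lemma ext_multiple_los:
  "is_ext_multiple CU MU NU (uclass U c) (uclass U f, uclass U g) (uclass U f', uclass U g') \<longleftrightarrow>
     ev (\<lambda>i. is_ext_multiple (Cc i) (M i) (N i) (c i) (f i, g i) (f' i, g' i))"
proof -
  define e where "e \<longleftrightarrow> ev (\<lambda>i. (f i, g i) \<in> extensions (Cc i) (M i) (N i)) \<and> ev (\<lambda>i. (f' i, g' i) \<in> extensions (Cc i) (M i) (N i))"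
  have "(\<exists>h \<in> chom CU (ccod CU (uclass U f)) (ccod CU (uclass U f')).
      ccomp CU h (uclass U f) = ccomp CU (uclass U f') (cscale CU (uclass U c) (cid CU NU)) \<and> ccomp CU (uclass U g') h = uclass U g)
    \<longleftrightarrow> ev (\<lambda>i. \<exists>h \<in> chom (Cc i) (ccod (Cc i) (f i)) (ccod (Cc i) (f' i)).
      ccomp (Cc i) h (f i) = ccomp (Cc i) (f' i) (cscale (Cc i) (c i) (cid (Cc i) (N i))) \<and> ccomp (Cc i) (g' i) h = g i)"
    if e
  proof -
    have b: "bdd (2 * B) f" "bdd (2 * B) f'"
      using that extension_bdd(1) unfolding e_def by blast+
    show ?thesis
      unfolding CU_simps
      by (rule bex_chom_CU[OF bdd_gen(2)[OF b(1)] bdd_gen(2)[OF b(2)]]) (simp add: eventually_conj_iff)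
  qed
  then show ?thesis
    unfolding is_ext_multiple_def by (auto simp: extension_los e_def eventually_conj_iff)
qed

lemma baer_cond_los:
  assumes "bdd b g1" "bdd b g2" "bdd b p1" "bdd b p2" "bdd b s" "bdd b q" "bdd b j"
  shows "baer_cond CU NU (uclass U f1) (uclass U g1) (uclass U f2) (uclass U g2) (uclass U f) (uclass U g)
       (uclass U p1) (uclass U p2) (uclass U s) (uclass U j) (uclass U q) \<longleftrightarrow>
    ev (\<lambda>i. baer_cond (Cc i) (N i) (f1 i) (g1 i) (f2 i) (g2 i) (f i) (g i) (p1 i) (p2 i) (s i) (j i) (q i))"
proof -
  have "uclass U s \<in> carr CU" "uclass U j \<in> carr CU" using assms carr_CU by auto
  then show ?thesis
    unfolding baer_cond_def pullback_los[OF assms(1-4)] cokernel_los[OF assms(5,6)] chom_def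
    using bdd_gen(3)[OF assms(5)] bdd_gen(3)[OF assms(7)] by (simp add: eventually_conj_iff)
qed

text \<open>The auxiliary arrows must be bounded to pass between the two sides. In the restricted
  ultraproduct they are so by definition; componentwise, \<open>pullback_bound\<close> bounds the
  fibre product, and \<open>baer_cond_arrows\<close> then bounds the remaining arrows.\<close>

lemma baer_los:
  "is_baer_sum CU MU NU (uclass U f1, uclass U g1) (uclass U f2, uclass U g2) (uclass U f, uclass U g) \<longleftrightarrow>
     ev (\<lambda>i. is_baer_sum (Cc i) (M i) (N i) (f1 i, g1 i) (f2 i, g2 i) (f i, g i))"
proof -
  define e where "e \<longleftrightarrow> ev (\<lambda>i. (f1 i, g1 i) \<in> extensions (Cc i) (M i) (N i)) \<and> ev (\<lambda>i. (f2 i, g2 i) \<in> extensions (Cc i) (M i) (N i)) \<and>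
    ev (\<lambda>i. (f i, g i) \<in> extensions (Cc i) (M i) (N i))"
  have "(\<exists>p1 p2 s j q. baer_cond CU NU (uclass U f1) (uclass U g1) (uclass U f2) (uclass U g2) (uclass U f) (uclass U g) p1 p2 s j q)
    \<longleftrightarrow> ev (\<lambda>i. \<exists>p1 p2 s j q. baer_cond (Cc i) (N i) (f1 i) (g1 i) (f2 i) (g2 i) (f i) (g i) p1 p2 s j q)" (is "?L \<longleftrightarrow> ?R")
    if ee: e
  proof
    have b0: "bdd (2 * B) f1" "bdd (2 * B) g1" "bdd (2 * B) g2" "bdd (2 * B) f"
      using ee extension_bdd unfolding e_def by blast+
    assume ?L
    then obtain P1 P2 S J Q where c: "baer_cond CU NU (uclass U f1) (uclass U g1) (uclass U f2) (uclass U g2) (uclass U f) (uclass U g) P1 P2 S J Q"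
      by blast
    then have "P1 \<in> carr CU" "P2 \<in> carr CU" "S \<in> carr CU" "J \<in> carr CU" "Q \<in> carr CU"
      by (auto simp: baer_cond_def is_pullback_def chom_def is_cokernel_def)
    note c5 = this
    from c5(1) obtain p1 b1 where p1: "P1 = uclass U p1" "bdd b1 p1" by (rule carr_CU_cases)
    from c5(2) obtain p2 b2 where p2: "P2 = uclass U p2" "bdd b2 p2" by (rule carr_CU_cases)
    from c5(3) obtain s b3 where s: "S = uclass U s" "bdd b3 s" by (rule carr_CU_cases)
    from c5(4) obtain j b4 where j: "J = uclass U j" "bdd b4 j" by (rule carr_CU_cases)
    from c5(5) obtain q b5 where q: "Q = uclass U q" "bdd b5 q" by (rule carr_CU_cases)
    note pq = p1(1) p2(1) s(1) j(1) q(1) and b = p1(2) p2(2) s(2) j(2) q(2)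
    \<comment> \<open>Any number above all these bounds would do; the sum is one.\<close>
    let ?b = "2 * B + b1 + b2 + b3 + b4 + b5"
    have "ev (\<lambda>i. baer_cond (Cc i) (N i) (f1 i) (g1 i) (f2 i) (g2 i) (f i) (g i) (p1 i) (p2 i) (s i) (j i) (q i))"
      using c unfolding pq
      by (subst (asm) baer_cond_los[where b = ?b])
        (rule bdd_mono[OF b0(2)] bdd_mono[OF b0(3)] bdd_mono[OF b(1)] bdd_mono[OF b(2)] bdd_mono[OF b(3)] bdd_mono[OF b(4)] bdd_mono[OF b(5)], simp)+
    then show ?R by (rule eventually_mono) blast
  next
    have b0: "bdd (2 * B) f1" "bdd (2 * B) g1" "bdd (2 * B) g2" "bdd (2 * B) f"
      using ee extension_bdd unfolding e_def by blast+
    assume ?R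
    then obtain p1 p2 s j q where c: "ev (\<lambda>i. baer_cond (Cc i) (N i) (f1 i) (g1 i) (f2 i) (g2 i) (f i) (g i) (p1 i) (p2 i) (s i) (j i) (q i))"
      unfolding ev_ex by blast
    \<comment> \<open>The middle objects are bounded by 2 * \<open>B\<close>, and passing to their
      fibre product doubles this.\<close>
    have p1: "bdd (2 * (2 * B)) p1"
      by (rule eventually_rev_mp[OF c], rule eventually_rev_mp[OF b0(2)], rule eventually_mono[OF b0(3)], intro impI,
          rule rep_setting.pullback_bound(1)[OF rep], assumption, assumption, unfold baer_cond_def, elim conjE)
    have p2: "bdd (2 * (2 * B)) p2"
      by (rule eventually_rev_mp[OF c], rule eventually_rev_mp[OF b0(2)], rule eventually_mono[OF b0(3)], intro impI,
          rule rep_setting.pullback_bound(2)[OF rep], assumption, assumption, unfold baer_cond_def, elim conjE)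
    let ?b = "2 * (2 * B)"
    have gN: "generated_by (k i) (N i) (4 * B)" for i
    proof -
      interpret ext_setting "k i" "A i" "TYPE('v)" "M i" "N i" by (rule ext)
      show ?thesis using gen_mono[OF N_Obj gen_MN(2)] by auto
    qed
    have s: "bdd ?b s" using c p1 by eventually_elim (drule baer_cond_arrows(1), simp add: gN)
    have j: "bdd ?b j" using c p1 by eventually_elim (drule baer_cond_arrows(2), simp add: gN)
    have f': "bdd ?b f" by (rule bdd_mono[OF b0(4)]) simp
    have q: "bdd ?b q" using c p1 f' by eventually_elim (drule baer_cond_arrows(3), simp)
    have g': "bdd ?b g1" "bdd ?b g2" by (rule bdd_mono[OF b0(2)] bdd_mono[OF b0(3)], simp)+
    show ?L using c baer_cond_los[OF g' p1 p2 s q j] by blast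
  qed
  then show ?thesis
    unfolding is_baer_sum_cond by (auto simp: extension_los e_def eventually_conj_iff)
qed

end

section \<open>Vector spaces over an ultraproduct of fields\<close>

context ultra
begin

lemma uproduct_ring_simps [simp]:
  "carrier (uproduct_ring U k) = uproduct U (\<lambda>i. carrier (k i))"
  "uclass U x \<otimes>\<^bsub>uproduct_ring U k\<^esub> uclass U y = uclass U (\<lambda>i. x i \<otimes>\<^bsub>k i\<^esub> y i)"
  "\<one>\<^bsub>uproduct_ring U k\<^esub> = uclass U (\<lambda>i. \<one>\<^bsub>k i\<^esub>)"
  "\<zero>\<^bsub>uproduct_ring U k\<^esub> = uclass U (\<lambda>i. \<zero>\<^bsub>k i\<^esub>)"
  "uclass U x \<oplus>\<^bsub>uproduct_ring U k\<^esub> uclass U y = uclass U (\<lambda>i. x i \<oplus>\<^bsub>k i\<^esub> y i)"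
  by (simp_all add: uproduct_ring_def)

lemma uproductI: "(\<And>i. x i \<in> S i) \<Longrightarrow> uclass U x \<in> uproduct U S"
  unfolding uproduct_def by blast

lemma uproduct_cring:
  assumes "\<And>i. cring (k i)"
  shows "cring (uproduct_ring U k)"
proof (intro cringI abelian_groupI comm_monoidI)
  let ?R = "uproduct_ring U k"
  interpret cring "k i" for i by (rule assms)
  show "\<one>\<^bsub>?R\<^esub> \<otimes>\<^bsub>?R\<^esub> x = x" if x: "x \<in> carrier ?R" for x
  proof -
    obtain f where f: "x = uclass U f" "\<And>i. f i \<in> carrier (k i)" using x by (auto elim: uproduct_cases)
    then show ?thesis by simp
  qed
  show "\<exists>y\<in>carrier ?R. y \<oplus>\<^bsub>?R\<^esub> x = \<zero>\<^bsub>?R\<^esub>" if x: "x \<in> carrier ?R" for x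
  proof -
    obtain f where f: "x = uclass U f" "\<And>i. f i \<in> carrier (k i)" using x by (auto elim: uproduct_cases)
    show ?thesis
      by (rule bexI[of _ "uclass U (\<lambda>i. \<ominus>\<^bsub>k i\<^esub> f i)"]) (auto simp: f l_neg intro!: uproductI)
  qed
qed (use assms in \<open>auto elim!: uproduct_cases intro!: uproductI
      simp: cring.cring_simprules ring.ring_simprules cring.axioms(1)\<close>)

lemma uproduct_field:
  assumes "\<And>i. field (k i)"
  shows "field (uproduct_ring U k)"
proof -
  let ?R = "uproduct_ring U k"
  interpret k: field "k i" for i by (rule assms)
  interpret R: cring ?R by (rule uproduct_cring) unfold_locales
  have inv: "\<exists>y\<in>carrier ?R. x \<otimes>\<^bsub>?R\<^esub> y = \<one>\<^bsub>?R\<^esub>" if x: "x \<in> carrier ?R" "x \<noteq> \<zero>\<^bsub>?R\<^esub>" for x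
  proof -
    obtain f where f: "x = uclass U f" "\<And>i. f i \<in> carrier (k i)" using x by (auto elim: uproduct_cases)
    have nz: "ev (\<lambda>i. f i \<noteq> \<zero>\<^bsub>k i\<^esub>)" using x f by (simp add: ev_not)
    \<comment> \<open>The value 1 where \<open>f i\<close> vanishes keeps every component in the
      carrier; almost everywhere it is not taken.\<close>
    define g where "g i = (if f i = \<zero>\<^bsub>k i\<^esub> then \<one>\<^bsub>k i\<^esub> else inv\<^bsub>k i\<^esub> (f i))" for i
    have "g i \<in> carrier (k i)" for i using f(2)[of i] k.field_Units[of i] by (auto simp: g_def)
    moreover have "ev (\<lambda>i. f i \<otimes>\<^bsub>k i\<^esub> g i = \<one>\<^bsub>k i\<^esub>)"
      using nz by eventually_elim (use f(2) k.field_Units in \<open>auto simp: g_def\<close>)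
    ultimately show ?thesis using f by (intro bexI[of _ "uclass U g"]) (auto intro!: uproductI)
  qed
  have nz: "\<zero>\<^bsub>?R\<^esub> \<otimes>\<^bsub>?R\<^esub> y \<noteq> \<one>\<^bsub>?R\<^esub>" if "y \<in> carrier ?R" for y
    using that by (auto elim!: uproduct_cases)
  have "Units ?R = carrier ?R - {\<zero>\<^bsub>?R\<^esub>}"
  proof (intro equalityI subsetI)
    fix x assume x: "x \<in> Units ?R"
    then obtain y where "y \<in> carrier ?R" "x \<otimes>\<^bsub>?R\<^esub> y = \<one>\<^bsub>?R\<^esub>" using R.Units_r_inv_ex by blast
    then have "x \<noteq> \<zero>\<^bsub>?R\<^esub>" using nz by metis
    then show "x \<in> carrier ?R - {\<zero>\<^bsub>?R\<^esub>}" using R.Units_closed[OF x] by blast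
  next
    fix x assume x: "x \<in> carrier ?R - {\<zero>\<^bsub>?R\<^esub>}"
    then obtain y where y: "y \<in> carrier ?R" "x \<otimes>\<^bsub>?R\<^esub> y = \<one>\<^bsub>?R\<^esub>" using inv[of x] by blast
    show "x \<in> Units ?R"
      unfolding Units_def using x y R.m_comm[of y x] by (intro CollectI conjI bexI[of _ y]) simp_all
  qed
  then show ?thesis by (rule R.cring_fieldI)
qed

end

text \<open>\<open>VU\<close> is the ultraproduct of the \<open>V i\<close>, and \<open>hat w\<close> is the class of the tuple \<open>w\<close> in it.\<close>

locale ultra_module = ultra U for U :: "'i filter" +
  fixes k :: "'i \<Rightarrow> 'k ring" and V :: "'i \<Rightarrow> ('k, 'v) module" and VU :: "(('i \<Rightarrow> 'k) set, 'w) module"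
    and hat :: "('i \<Rightarrow> 'v) \<Rightarrow> 'w"
  assumes k_field: "\<And>i. field (k i)" and V_module: "\<And>i. module (k i) (V i)"
    and hat_eq [simp]: "hat w = hat w' \<longleftrightarrow> ev (\<lambda>i. w i = w' i)"
    and carr_VU: "X \<in> carrier VU \<longleftrightarrow> (\<exists>w. X = hat w \<and> ev (\<lambda>i. w i \<in> carrier (V i)))"
    and hat_add [simp]: "hat w \<oplus>\<^bsub>VU\<^esub> hat w' = hat (\<lambda>i. w i \<oplus>\<^bsub>V i\<^esub> w' i)"
    and hat_smult [simp]: "uclass U c \<odot>\<^bsub>VU\<^esub> hat w = hat (\<lambda>i. c i \<odot>\<^bsub>V i\<^esub> w i)"
    and hat_zero [simp]: "\<zero>\<^bsub>VU\<^esub> = hat (\<lambda>i. \<zero>\<^bsub>V i\<^esub>)"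
begin

abbreviation "RU \<equiv> uproduct_ring U k"

lemma hat_carr: "hat w \<in> carrier VU \<longleftrightarrow> ev (\<lambda>i. w i \<in> carrier (V i))"
proof
  assume "hat w \<in> carrier VU"
  then obtain w' where "ev (\<lambda>i. w i = w' i)" "ev (\<lambda>i. w' i \<in> carrier (V i))" unfolding carr_VU by auto
  then show "ev (\<lambda>i. w i \<in> carrier (V i))" by eventually_elim simp
qed (use carr_VU in blast)

lemma VU_cases:
  assumes "X \<in> carrier VU"
  obtains w where "X = hat w" "\<And>i. w i \<in> carrier (V i)"
proof -
  interpret module "k i" "V i" for i by (rule V_module)
  obtain w where w: "X = hat w" "ev (\<lambda>i. w i \<in> carrier (V i))" using assms carr_VU by blast
  show ?thesis
    by (rule that[of "\<lambda>i. if w i \<in> carrier (V i) then w i else \<zero>\<^bsub>V i\<^esub>"])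
      (use w in \<open>auto elim: eventually_mono\<close>)
qed

lemma RU_field: "field RU"
  by (rule uproduct_field) (rule k_field)

lemma VU_module: "module RU VU"
proof -
  interpret V: module "k i" "V i" for i by (rule V_module)
  show ?thesis
  proof (intro moduleI abelian_groupI)
    show "cring RU" using RU_field by (simp add: field_def domain_def)
    show "\<exists>y\<in>carrier VU. y \<oplus>\<^bsub>VU\<^esub> x = \<zero>\<^bsub>VU\<^esub>" if x: "x \<in> carrier VU" for x
    proof -
      obtain f where f: "x = hat f" "\<And>i. f i \<in> carrier (V i)" using x VU_cases by blast
      show ?thesis
        by (rule bexI[of _ "hat (\<lambda>i. \<ominus>\<^bsub>V i\<^esub> f i)"]) (auto simp: f V.M.l_neg hat_carr)
    qed
  qed (auto elim!: uproduct_cases VU_cases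
      simp: hat_carr V.smult_l_distr V.smult_r_distr V.smult_assoc1 V.M.a_ac)
qed

lemma VU_vectorspace: "vectorspace RU VU"
  using VU_module RU_field by (simp add: vectorspace_def)

lemma hat_lcomb: "lcomb VU (\<lambda>j. uclass U (c j)) (\<lambda>j. hat (e j)) n = hat (\<lambda>i. lcomb (V i) (\<lambda>j. c j i) (\<lambda>j. e j i) n)"
  by (induction n) auto

text \<open>As \<open>n\<close> is fixed, \<open>n\<close> classes of tuples amount to a tuple of
  lists of length \<open>n\<close>, and by \<open>hat_lcomb\<close> linear combinations are formed
  componentwise.\<close>

lemma gen_los: "generated_by RU VU n \<longleftrightarrow> ev (\<lambda>i. generated_by (k i) (V i) n)"
proof
  assume "generated_by RU VU n"
  then obtain E where E: "\<And>j. j < n \<Longrightarrow> E j \<in> carrier VU"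
    and gen: "\<And>X. X \<in> carrier VU \<Longrightarrow> \<exists>c. (\<forall>j<n. c j \<in> carrier RU) \<and> X = lcomb VU c E n"
    unfolding generated_by_def by blast
  have "\<exists>w. \<forall>j<n. E j = hat (w j) \<and> (\<forall>i. w j i \<in> carrier (V i))"
    using E by (intro choice_iff'[THEN iffD1] allI impI) (metis VU_cases)
  then obtain e where e: "\<And>j. j < n \<Longrightarrow> E j = hat (e j)" "\<And>j i. j < n \<Longrightarrow> e j i \<in> carrier (V i)" by blast
  \<comment> \<open>Stated for every tuple \<open>v\<close>, so that \<open>ev_all\<close> turns it
    into a statement about all vectors of almost every component.\<close>
  have "ev (\<lambda>i. v i \<in> carrier (V i) \<longrightarrow> (\<exists>c. (\<forall>j<n. c j \<in> carrier (k i)) \<and> v i = lcomb (V i) c (\<lambda>j. e j i) n))" for v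
    unfolding ev_imp
  proof
    assume "ev (\<lambda>i. v i \<in> carrier (V i))"
    then have "hat v \<in> carrier VU" by (simp add: hat_carr)
    then obtain c where c: "\<And>j. j < n \<Longrightarrow> c j \<in> carrier RU" "hat v = lcomb VU c E n" using gen by blast
    have "\<exists>d. \<forall>j<n. c j = uclass U (d j) \<and> (\<forall>i. d j i \<in> carrier (k i))"
      using c(1) by (intro choice_iff'[THEN iffD1] allI impI) (metis uproduct_cases uproduct_ring_simps(1))
    then obtain d where d: "\<And>j. j < n \<Longrightarrow> c j = uclass U (d j)" "\<And>j i. j < n \<Longrightarrow> d j i \<in> carrier (k i)" by blast
    have "hat v = lcomb VU (\<lambda>j. uclass U (d j)) (\<lambda>j. hat (e j)) n"
      unfolding c(2) by (rule lcomb_cong) (simp_all add: d e)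
    then have "ev (\<lambda>i. v i = lcomb (V i) (\<lambda>j. d j i) (\<lambda>j. e j i) n)" by (simp add: hat_lcomb)
    then show "ev (\<lambda>i. \<exists>c. (\<forall>j<n. c j \<in> carrier (k i)) \<and> v i = lcomb (V i) c (\<lambda>j. e j i) n)"
    proof (rule eventually_mono)
      fix i assume "v i = lcomb (V i) (\<lambda>j. d j i) (\<lambda>j. e j i) n"
      then show "\<exists>c. (\<forall>j<n. c j \<in> carrier (k i)) \<and> v i = lcomb (V i) c (\<lambda>j. e j i) n"
        using d(2) by (intro exI[of _ "\<lambda>j. d j i"]) simp
    qed
  qed
  then have "ev (\<lambda>i. \<forall>v\<in>carrier (V i). \<exists>c. (\<forall>j<n. c j \<in> carrier (k i)) \<and> v = lcomb (V i) c (\<lambda>j. e j i) n)"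
    unfolding Ball_def ev_all by blast
  then show "ev (\<lambda>i. generated_by (k i) (V i) n)"
  proof (rule eventually_mono)
    fix i assume "\<forall>v\<in>carrier (V i). \<exists>c. (\<forall>j<n. c j \<in> carrier (k i)) \<and> v = lcomb (V i) c (\<lambda>j. e j i) n"
    then show "generated_by (k i) (V i) n"
      unfolding generated_by_def using e(2) by (intro exI[of _ "\<lambda>j. e j i"]) simp
  qed
next
  interpret k: field "k i" for i by (rule k_field)
  assume "ev (\<lambda>i. generated_by (k i) (V i) n)"
  then obtain e where e: "ev (\<lambda>i. (\<forall>j<n. e i j \<in> carrier (V i)) \<and>
      (\<forall>v\<in>carrier (V i). \<exists>c. (\<forall>j<n. c j \<in> carrier (k i)) \<and> v = lcomb (V i) c (e i) n))"
    unfolding generated_by_def ev_ex by blast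
  show "generated_by RU VU n"
    unfolding generated_by_def
  proof (intro exI[of _ "\<lambda>j. hat (\<lambda>i. e i j)"] conjI allI impI ballI)
    show "hat (\<lambda>i. e i j) \<in> carrier VU" if "j < n" for j
      using e that by (auto simp: hat_carr elim: eventually_mono)
    fix X assume "X \<in> carrier VU"
    then obtain v where v: "X = hat v" "\<And>i. v i \<in> carrier (V i)" by (rule VU_cases) blast
    have "ev (\<lambda>i. \<exists>c. (\<forall>j<n. c j \<in> carrier (k i)) \<and> v i = lcomb (V i) c (e i) n)"
      using e by (rule eventually_mono) (use v(2) in blast)
    then obtain c where c: "ev (\<lambda>i. (\<forall>j<n. c i j \<in> carrier (k i)) \<and> v i = lcomb (V i) (c i) (e i) n)"
      unfolding ev_ex by blast
    have "uclass U (\<lambda>i. c i j) \<in> carrier RU" if "j < n" for j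
    proof -
      have "ev (\<lambda>i. c i j \<in> carrier (k i))" using c that by (auto elim: eventually_mono)
      then show ?thesis by (subst uproduct_ring_simps, subst uproduct_iff) auto
    qed
    moreover have "X = lcomb VU (\<lambda>j. uclass U (\<lambda>i. c i j)) (\<lambda>j. hat (\<lambda>i. e i j)) n"
      using c by (auto simp: v(1) hat_lcomb elim: eventually_mono)
    ultimately show "\<exists>c. (\<forall>j<n. c j \<in> carrier RU) \<and> X = lcomb VU c (\<lambda>j. hat (\<lambda>i. e i j)) n"
      by (intro exI[of _ "\<lambda>j. uclass U (\<lambda>i. c i j)"]) blast
  qed
qed

text \<open>Only the finitely many m < n have to be excluded, and a finite conjunction passes
  through \<open>eventually\<close>.\<close>

lemma dim_los: "has_dim RU VU n \<longleftrightarrow> ev (\<lambda>i. has_dim (k i) (V i) n)"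
proof -
  have V: "vectorspace (k i) (V i)" for i using V_module k_field by (simp add: vectorspace_def)
  have "ev (\<lambda>i. \<forall>m\<in>{..<n}. \<not> generated_by (k i) (V i) m) \<longleftrightarrow> (\<forall>m\<in>{..<n}. \<not> generated_by RU VU m)"
    by (simp add: eventually_ball_finite_distrib ev_not gen_los)
  then show ?thesis
    by (simp add: has_dim_iff[OF V] has_dim_iff[OF VU_vectorspace] eventually_conj_iff gen_los Ball_def)
qed

end

section \<open>Ext1 of the restricted ultraproduct\<close>

context ultra_rep
begin

abbreviation V :: "'i \<Rightarrow> ('k, (('k, 'a, 'v) rep_arrow \<times> ('k, 'a, 'v) rep_arrow) set) module" where
  "V i \<equiv> Ext1 (Cc i) (M i) (N i)"

text \<open>An element of Ext1 in the restricted ultraproduct is a set of pairs of classes of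
  arrows, not the class of a tuple of sets. \<open>hat\<close> converts a tuple of sets of pairs
  into the former shape.\<close>

definition hat :: "('i \<Rightarrow> ('f \<times> 'g) set) \<Rightarrow> (('i \<Rightarrow> 'f) set \<times> ('i \<Rightarrow> 'g) set) set" where
  "hat w = {(uclass U f, uclass U g) | f g. ev (\<lambda>i. (f i, g i) \<in> w i)}"

lemma hat_mem: "(uclass U f, uclass U g) \<in> hat w \<longleftrightarrow> ev (\<lambda>i. (f i, g i) \<in> w i)"
proof
  assume "(uclass U f, uclass U g) \<in> hat w"
  then obtain f' g' where "ev (\<lambda>i. f i = f' i)" "ev (\<lambda>i. g i = g' i)" "ev (\<lambda>i. (f' i, g' i) \<in> w i)"
    by (auto simp: hat_def)
  then show "ev (\<lambda>i. (f i, g i) \<in> w i)" by eventually_elim simp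
qed (unfold hat_def, blast)

lemma hat_eqI:
  assumes "\<And>E. E \<in> X \<Longrightarrow> \<exists>f g. E = (uclass U f, uclass U g)"
    and "\<And>f g. (uclass U f, uclass U g) \<in> X \<longleftrightarrow> ev (\<lambda>i. (f i, g i) \<in> w i)"
  shows "X = hat w"
proof (intro equalityI subsetI)
  fix E assume "E \<in> X"
  then obtain f g where "E = (uclass U f, uclass U g)" using assms(1) by blast
  then show "E \<in> hat w" using \<open>E \<in> X\<close> assms(2) by (simp add: hat_mem)
next
  fix E assume "E \<in> hat w"
  then obtain f g where "E = (uclass U f, uclass U g)" "ev (\<lambda>i. (f i, g i) \<in> w i)" by (auto simp: hat_def)
  then show "E \<in> X" using assms(2) by simp
qed

text \<open>A tuple of pairs is the same as a pair of tuples, so inclusion is tested on tuples, and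
  the clause for universal quantifiers gives inclusion in almost every component. This makes
  \<open>hat\<close> injective up to equality almost everywhere.\<close>

lemma hat_subset: "hat w \<subseteq> hat w' \<longleftrightarrow> ev (\<lambda>i. w i \<subseteq> w' i)"
proof
  assume s: "hat w \<subseteq> hat w'"
  have "ev (\<lambda>i. p i \<in> w i \<longrightarrow> p i \<in> w' i)" for p
    using s hat_mem[of "\<lambda>i. fst (p i)" "\<lambda>i. snd (p i)" w] hat_mem[of "\<lambda>i. fst (p i)" "\<lambda>i. snd (p i)" w']
    by (auto simp: ev_imp)
  then show "ev (\<lambda>i. w i \<subseteq> w' i)" unfolding subset_iff ev_all by blast
next
  assume "ev (\<lambda>i. w i \<subseteq> w' i)"
  then have sub: "ev (\<lambda>i. p i \<in> w' i)" if "ev (\<lambda>i. p i \<in> w i)" for p using that by eventually_elim blast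
  show "hat w \<subseteq> hat w'"
  proof
    fix E assume "E \<in> hat w"
    then obtain f g where E: "E = (uclass U f, uclass U g)" "ev (\<lambda>i. (f i, g i) \<in> w i)" by (auto simp: hat_def)
    then show "E \<in> hat w'" using sub[of "\<lambda>i. (f i, g i)"] by (simp add: hat_mem)
  qed
qed

lemma hat_eq_iff: "hat w = hat w' \<longleftrightarrow> ev (\<lambda>i. w i = w' i)"
  by (simp add: set_eq_subset hat_subset eventually_conj_iff)

lemma ext_class_los:
  assumes "E \<in> extensions CU MU NU" "E = (uclass U f, uclass U g)"
  shows "ext_equiv CU MU NU `` {E} = hat (\<lambda>i. ext_equiv (Cc i) (M i) (N i) `` {(f i, g i)})"
proof (rule hat_eqI)
  fix E' assume "E' \<in> ext_equiv CU MU NU `` {E}"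
  then have "E' \<in> extensions CU MU NU" by (auto simp: ext_equiv_def)
  then show "\<exists>f g. E' = (uclass U f, uclass U g)" by (rule extensions_CU_cases) blast
next
  fix f' g'
  show "(uclass U f', uclass U g') \<in> ext_equiv CU MU NU `` {E} \<longleftrightarrow>
      ev (\<lambda>i. (f' i, g' i) \<in> ext_equiv (Cc i) (M i) (N i) `` {(f i, g i)})"
    using ext_equiv_los[of f g f' g'] by (simp add: assms(2))
qed

lemma carr_Ext1_CU: "X \<in> carrier (Ext1 CU MU NU) \<longleftrightarrow> (\<exists>w. X = hat w \<and> ev (\<lambda>i. w i \<in> carrier (V i)))"
proof
  assume "X \<in> carrier (Ext1 CU MU NU)"
  then obtain E where E: "E \<in> extensions CU MU NU" "X = ext_equiv CU MU NU `` {E}" by (auto simp: Ext1_def quotient_def)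
  obtain f g where fg: "E = (uclass U f, uclass U g)" "ev (\<lambda>i. (f i, g i) \<in> extensions (Cc i) (M i) (N i))"
    using E(1) by (rule extensions_CU_cases)
  have "ev (\<lambda>i. ext_equiv (Cc i) (M i) (N i) `` {(f i, g i)} \<in> carrier (V i))"
    using fg(2) by (rule eventually_mono) (auto simp: Ext1_def quotient_def)
  then show "\<exists>w. X = hat w \<and> ev (\<lambda>i. w i \<in> carrier (V i))" using ext_class_los[OF E(1) fg(1)] E(2) by blast
next
  assume "\<exists>w. X = hat w \<and> ev (\<lambda>i. w i \<in> carrier (V i))"
  then obtain w where w: "X = hat w" "ev (\<lambda>i. w i \<in> carrier (V i))" by blast
  have "ev (\<lambda>i. \<exists>E. E \<in> extensions (Cc i) (M i) (N i) \<and> w i = ext_equiv (Cc i) (M i) (N i) `` {E})"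
    using w(2) by (rule eventually_mono) (simp add: Ext1_def quotient_def Bex_def)
  then obtain E where E: "ev (\<lambda>i. E i \<in> extensions (Cc i) (M i) (N i) \<and> w i = ext_equiv (Cc i) (M i) (N i) `` {E i})"
    unfolding ev_ex by blast
  let ?f = "\<lambda>i. fst (E i)" and ?g = "\<lambda>i. snd (E i)"
  have e: "(uclass U ?f, uclass U ?g) \<in> extensions CU MU NU"
    unfolding extension_los using E by (auto elim: eventually_mono)
  have "X = ext_equiv CU MU NU `` {(uclass U ?f, uclass U ?g)}"
    unfolding w(1) ext_class_los[OF e refl] hat_eq_iff using E by (auto elim: eventually_mono)
  then show "X \<in> carrier (Ext1 CU MU NU)" using e by (auto simp: Ext1_def quotient_def)
qed

lemma bex_hat: "(\<exists>E\<in>hat w. Q E) \<longleftrightarrow> (\<exists>f g. ev (\<lambda>i. (f i, g i) \<in> w i) \<and> Q (uclass U f, uclass U g))"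
  by (auto simp: hat_def)

lemma ev_ex_pair: "ev (\<lambda>i. \<exists>E\<in>w i. Q i E) \<longleftrightarrow> (\<exists>f g. ev (\<lambda>i. (f i, g i) \<in> w i) \<and> ev (\<lambda>i. Q i (f i, g i)))"
proof -
  have "ev (\<lambda>i. \<exists>E\<in>w i. Q i E) \<longleftrightarrow> ev (\<lambda>i. \<exists>f g. (f, g) \<in> w i \<and> Q i (f, g))" by (simp add: Bex_def)
  then show ?thesis unfolding ev_ex eventually_conj_iff .
qed

text \<open>The sum of two classes consists of all Baer sums of their members. So membership is an
  existence statement about representatives, which \<open>baer_los\<close> transfers.\<close>

lemma Ext1_CU_add: "hat w \<oplus>\<^bsub>Ext1 CU MU NU\<^esub> hat w' = hat (\<lambda>i. w i \<oplus>\<^bsub>V i\<^esub> w' i)"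
proof (rule hat_eqI)
  fix E assume "E \<in> hat w \<oplus>\<^bsub>Ext1 CU MU NU\<^esub> hat w'"
  then have "E \<in> extensions CU MU NU" by (auto simp: Ext1_def is_baer_sum_def)
  then show "\<exists>f g. E = (uclass U f, uclass U g)" by (rule extensions_CU_cases) blast
next
  fix f g
  have "(uclass U f, uclass U g) \<in> hat w \<oplus>\<^bsub>Ext1 CU MU NU\<^esub> hat w' \<longleftrightarrow>
      (\<exists>E1\<in>hat w. \<exists>E2\<in>hat w'. is_baer_sum CU MU NU E1 E2 (uclass U f, uclass U g))"
    by (simp add: Ext1_def)
  also have "\<dots> \<longleftrightarrow> ev (\<lambda>i. \<exists>E1\<in>w i. \<exists>E2\<in>w' i. is_baer_sum (Cc i) (M i) (N i) E1 E2 (f i, g i))"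
    unfolding bex_hat ev_ex_pair baer_los ..
  also have "\<dots> \<longleftrightarrow> ev (\<lambda>i. (f i, g i) \<in> w i \<oplus>\<^bsub>V i\<^esub> w' i)" by (simp add: Ext1_def)
  finally show "(uclass U f, uclass U g) \<in> hat w \<oplus>\<^bsub>Ext1 CU MU NU\<^esub> hat w' \<longleftrightarrow> ev (\<lambda>i. (f i, g i) \<in> w i \<oplus>\<^bsub>V i\<^esub> w' i)" .
qed

lemma Ext1_CU_smult: "uclass U c \<odot>\<^bsub>Ext1 CU MU NU\<^esub> hat w = hat (\<lambda>i. c i \<odot>\<^bsub>V i\<^esub> w i)"
proof (rule hat_eqI)
  fix E assume "E \<in> uclass U c \<odot>\<^bsub>Ext1 CU MU NU\<^esub> hat w"
  then have "E \<in> extensions CU MU NU" by (auto simp: Ext1_def is_ext_multiple_def)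
  then show "\<exists>f g. E = (uclass U f, uclass U g)" by (rule extensions_CU_cases) blast
next
  fix f g
  have "(uclass U f, uclass U g) \<in> uclass U c \<odot>\<^bsub>Ext1 CU MU NU\<^esub> hat w \<longleftrightarrow>
      (\<exists>E\<in>hat w. is_ext_multiple CU MU NU (uclass U c) E (uclass U f, uclass U g))"
    by (simp add: Ext1_def)
  also have "\<dots> \<longleftrightarrow> ev (\<lambda>i. \<exists>E\<in>w i. is_ext_multiple (Cc i) (M i) (N i) (c i) E (f i, g i))"
    unfolding bex_hat ev_ex_pair ext_multiple_los ..
  also have "\<dots> \<longleftrightarrow> ev (\<lambda>i. (f i, g i) \<in> c i \<odot>\<^bsub>V i\<^esub> w i)" by (simp add: Ext1_def)
  finally show "(uclass U f, uclass U g) \<in> uclass U c \<odot>\<^bsub>Ext1 CU MU NU\<^esub> hat w \<longleftrightarrow> ev (\<lambda>i. (f i, g i) \<in> c i \<odot>\<^bsub>V i\<^esub> w i)" .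
qed

lemma Ext1_CU_zero: "\<zero>\<^bsub>Ext1 CU MU NU\<^esub> = hat (\<lambda>i. \<zero>\<^bsub>V i\<^esub>)"
proof (rule hat_eqI)
  fix E assume "E \<in> \<zero>\<^bsub>Ext1 CU MU NU\<^esub>"
  then have "E \<in> extensions CU MU NU" by (auto simp: Ext1_def)
  then show "\<exists>f g. E = (uclass U f, uclass U g)" by (rule extensions_CU_cases) blast
next
  fix f g
  have "(\<exists>s\<in>chom CU MU (ccod CU (uclass U f)). ccomp CU (uclass U g) s = cid CU MU) \<longleftrightarrow>
      ev (\<lambda>i. \<exists>s\<in>chom (Cc i) (M i) (ccod (Cc i) (f i)). ccomp (Cc i) (g i) s = cid (Cc i) (M i))"
    if "ev (\<lambda>i. (f i, g i) \<in> extensions (Cc i) (M i) (N i))"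
    unfolding CU_simps
    by (rule bex_chom_CU[OF always_eventually[OF allI[OF gen_MN_2(1)]] bdd_gen(2)[OF extension_bdd(1)[OF that]]]) simp
  then show "(uclass U f, uclass U g) \<in> \<zero>\<^bsub>Ext1 CU MU NU\<^esub> \<longleftrightarrow> ev (\<lambda>i. (f i, g i) \<in> \<zero>\<^bsub>V i\<^esub>)"
    by (auto simp: Ext1_def extension_los eventually_conj_iff)
qed

theorem Ext1_dim_los:
  "has_dim (uproduct_ring U k) (Ext1 CU MU NU) n \<longleftrightarrow> ev (\<lambda>i. has_dim (k i) (V i) n)"
proof -
  interpret ultra_module U k V "Ext1 CU MU NU" hat
  proof (intro ultra_module.intro ultra_module_axioms.intro)
    show "ultra U" by (rule ultra_axioms)
    show "field (k i)" for i using rep[of i] by (simp add: rep_setting_def)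
    show "module (k i) (V i)" for i by (rule ext_setting.Ext1_module[OF ext])
  qed (rule hat_eq_iff carr_Ext1_CU Ext1_CU_add Ext1_CU_smult Ext1_CU_zero)+
  show ?thesis by (rule dim_los)
qed

end


section \<open>Base change\<close>

lemma module_extend_simps [simp]:
  "carrier (module.extend V m) = carrier V" "monoid.mult (module.extend V m) = monoid.mult V"
  "monoid.one (module.extend V m) = monoid.one V" "ring.zero (module.extend V m) = ring.zero V"
  "ring.add (module.extend V m) = ring.add V" "smult (module.extend V m) = smult V"
  by (simp_all add: module.defs)

text \<open>Base changes are module records extended by coalgebra or comodule fields, and
  constructions on modules do not see the extension.\<close>

lemma tensor_extend [simp]:
  "tensor R (module.extend V m) W = tensor R V W" "tensor R W (module.extend V m) = tensor R W V"
  "pure_tensor R (module.extend V m) W = pure_tensor R V W" "pure_tensor R W (module.extend V m) = pure_tensor R W V"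
proof -
  have 1: "tensor_null R (module.extend V m) W = tensor_null R V W" "tensor_null R W (module.extend V m) = tensor_null R W V"
    by (simp_all add: tensor_null_def tensor_rels_def)
  then show 2: "pure_tensor R (module.extend V m) W = pure_tensor R V W" "pure_tensor R W (module.extend V m) = pure_tensor R W V"
    by (simp_all add: pure_tensor_def fun_eq_iff)
  have "tensor_group R (module.extend V m) W = tensor_group R V W" "tensor_group R W (module.extend V m) = tensor_group R W V"
    by (simp_all add: tensor_group_def 1)
  then show "tensor R (module.extend V m) W = tensor R V W" "tensor R W (module.extend V m) = tensor R W V"
    by (simp_all add: tensor_def 2)
qed

lemma module_extend_iff [simp]: "module R (module.extend V m) \<longleftrightarrow> module R V"
proof -
  have "abelian_group (module.extend V m) \<longleftrightarrow> abelian_group V"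
    unfolding abelian_group_def abelian_monoid_def comm_monoid_def comm_monoid_axioms_def monoid_def
      abelian_group_axioms_def comm_group_def group_def group_axioms_def Units_def by simp
  then show ?thesis
    unfolding module_def module_axioms_def by simp
qed

lemma module_hom_extend [simp]:
  "module_hom R (module.extend V m) W = module_hom R V W" "module_hom R W (module.extend V m) = module_hom R W V"
  by (simp_all add: module_hom_def)

text \<open>The action of the integers on a module is determined by the action of 1. The induction
  runs upwards and downwards from 0, the downward step by cancellation.\<close>

lemma int_additive:
  assumes M: "module \<Z> M" and P: "abelian_group P"
    and f: "\<And>x. x \<in> carrier M \<Longrightarrow> f x \<in> carrier P"
      "\<And>x y. x \<in> carrier M \<Longrightarrow> y \<in> carrier M \<Longrightarrow> f (x \<oplus>\<^bsub>M\<^esub> y) = f x \<oplus>\<^bsub>P\<^esub> f y"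
    and x: "x \<in> carrier M"
  shows "f (r \<odot>\<^bsub>M\<^esub> x) = [r] \<cdot>\<^bsub>P\<^esub> f x"
proof -
  interpret M: module \<Z> M by fact
  interpret P: abelian_group P by fact
  have cl: "s \<odot>\<^bsub>M\<^esub> x \<in> carrier M" for s :: int using M.smult_closed[of s x] x by simp
  have step: "(s + 1) \<odot>\<^bsub>M\<^esub> x = s \<odot>\<^bsub>M\<^esub> x \<oplus>\<^bsub>M\<^esub> x" for s :: int
    using M.smult_l_distr[of s 1 x] M.smult_one[of x] x by simp
  have fstep: "f ((s + 1) \<odot>\<^bsub>M\<^esub> x) = f (s \<odot>\<^bsub>M\<^esub> x) \<oplus>\<^bsub>P\<^esub> f x" for s
    unfolding step using f(2)[OF cl x] .
  have pstep: "[(s + 1)] \<cdot>\<^bsub>P\<^esub> f x = [s] \<cdot>\<^bsub>P\<^esub> f x \<oplus>\<^bsub>P\<^esub> f x" for s :: int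
    using P.add.int_pow_mult[of "f x" s 1] f(1)[OF x] P.add.int_pow_1[of "f x"] by simp
  show ?thesis
  proof (induction r rule: int_induct[of _ 0])
    case base
    have "f (0 \<odot>\<^bsub>M\<^esub> x) \<oplus>\<^bsub>P\<^esub> f x = \<zero>\<^bsub>P\<^esub> \<oplus>\<^bsub>P\<^esub> f x"
      using fstep[of 0] M.smult_one[of x] x f(1) by simp
    then show ?case using f(1) cl x by (simp add: P.add.right_cancel)
  next
    case (step1 i)
    then show ?case by (simp add: fstep pstep)
  next
    case (step2 i)
    then have "f ((i - 1) \<odot>\<^bsub>M\<^esub> x) \<oplus>\<^bsub>P\<^esub> f x = [(i - 1)] \<cdot>\<^bsub>P\<^esub> f x \<oplus>\<^bsub>P\<^esub> f x"
      using fstep[of "i - 1"] pstep[of "i - 1"] by simp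
    then show ?case using f(1) cl x by (simp add: P.add.right_cancel)
  qed
qed

text \<open>Over the integers biadditivity implies balancing, both sides being the same integer
  multiple of \<open>b x y\<close>. Lifts out of an integral tensor product then only need
  additivity checks.\<close>

lemma int_balancedI:
  assumes M: "module \<Z> M" and N: "module \<Z> N" and P: "abelian_group P"
    and b: "\<And>x y. x \<in> carrier M \<Longrightarrow> y \<in> carrier N \<Longrightarrow> b x y \<in> carrier P"
      "\<And>x x' y. x \<in> carrier M \<Longrightarrow> x' \<in> carrier M \<Longrightarrow> y \<in> carrier N \<Longrightarrow>
        b (x \<oplus>\<^bsub>M\<^esub> x') y = b x y \<oplus>\<^bsub>P\<^esub> b x' y"
      "\<And>x y y'. x \<in> carrier M \<Longrightarrow> y \<in> carrier N \<Longrightarrow> y' \<in> carrier N \<Longrightarrow>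
        b x (y \<oplus>\<^bsub>N\<^esub> y') = b x y \<oplus>\<^bsub>P\<^esub> b x y'"
  shows "balanced \<Z> M N P b"
proof (rule balancedI)
  fix r :: int and x y assume x: "x \<in> carrier M" and y: "y \<in> carrier N"
  have "b (r \<odot>\<^bsub>M\<^esub> x) y = [r] \<cdot>\<^bsub>P\<^esub> b x y"
    by (rule int_additive[OF M P, where f = "\<lambda>x. b x y"]) (use b x y in auto)
  also have "\<dots> = b x (r \<odot>\<^bsub>N\<^esub> y)"
    by (rule int_additive[OF N P, symmetric]) (use b x y in auto)
  finally show "b (r \<odot>\<^bsub>M\<^esub> x) y = b x (r \<odot>\<^bsub>N\<^esub> y)" .
qed (use b in auto)

lemma int_algebra_simps [simp]:
  "carrier (int_algebra K) = carrier K" "monoid.mult (int_algebra K) = monoid.mult K"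
  "monoid.one (int_algebra K) = monoid.one K" "ring.zero (int_algebra K) = ring.zero K"
  "ring.add (int_algebra K) = ring.add K" "smult (int_algebra K) n x = [n] \<cdot>\<^bsub>K\<^esub> x"
  by (simp_all add: int_algebra_def)

lemma (in cring) int_algebra_module: "module \<Z> (int_algebra R)"
proof (rule moduleI)
  show "cring \<Z>" by (rule int_is_cring)
  show "abelian_group (int_algebra R)"
    by (rule abelian_groupI) (auto simp: a_ac intro: bexI[of _ "\<ominus> _"] l_neg)
qed (auto simp: add.int_pow_mult add.int_pow_distrib add.int_pow_pow mult.commute)

lemma base_change_simps [simp]:
  "carrier (base_change K M) = carrier (tensor \<Z> M (int_algebra K))"
  "ring.zero (base_change K M) = ring.zero (tensor \<Z> M (int_algebra K))"
  "ring.add (base_change K M) = ring.add (tensor \<Z> M (int_algebra K))"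
  "smult (base_change K M) c = tensor_lift (tensor \<Z> M (int_algebra K)) (\<lambda>x d. bc_pure K M x (c \<otimes>\<^bsub>K\<^esub> d))"
  by (simp_all add: base_change_def Let_def)

locale scalar_extension = K: cring K + M: module \<Z> M for K (structure) and M :: "(int, 'm, 'z) module_scheme"
begin

sublocale L: module \<Z> "int_algebra K" by (rule K.int_algebra_module)

sublocale TM: two_modules \<Z> M "int_algebra K" by unfold_locales

abbreviation "V \<equiv> base_change K M"
abbreviation "pt \<equiv> bc_pure K M"

lemma pt_closed [simp]: "x \<in> carrier M \<Longrightarrow> c \<in> carrier K \<Longrightarrow> pt x c \<in> carrier V"
  using TM.pure_closed[of x c] by simp

lemma pt_add:
  "\<lbrakk>x \<in> carrier M; y \<in> carrier M; c \<in> carrier K\<rbrakk> \<Longrightarrow> pt (x \<oplus>\<^bsub>M\<^esub> y) c = pt x c \<oplus>\<^bsub>V\<^esub> pt y c"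
  "\<lbrakk>x \<in> carrier M; c \<in> carrier K; d \<in> carrier K\<rbrakk> \<Longrightarrow> pt x (c \<oplus> d) = pt x c \<oplus>\<^bsub>V\<^esub> pt x d"
  using TM.pure_add_left[of x y c] TM.pure_add_right[of x c d] by simp_all

lemma bc_induct [consumes 1, case_names pure add]:
  assumes "v \<in> carrier V"
    and "\<And>x c. x \<in> carrier M \<Longrightarrow> c \<in> carrier K \<Longrightarrow> P (pt x c)"
    and "\<And>v w. v \<in> carrier V \<Longrightarrow> w \<in> carrier V \<Longrightarrow> P v \<Longrightarrow> P w \<Longrightarrow> P (v \<oplus>\<^bsub>V\<^esub> w)"
  shows "P v"
  using assms TM.tensor_induct[of v P] by simp

lemma bc_lift:
  assumes P: "abelian_group P"
    and b: "\<And>x c. x \<in> carrier M \<Longrightarrow> c \<in> carrier K \<Longrightarrow> b x c \<in> carrier P"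
      "\<And>x y c. x \<in> carrier M \<Longrightarrow> y \<in> carrier M \<Longrightarrow> c \<in> carrier K \<Longrightarrow> b (x \<oplus>\<^bsub>M\<^esub> y) c = b x c \<oplus>\<^bsub>P\<^esub> b y c"
      "\<And>x c d. x \<in> carrier M \<Longrightarrow> c \<in> carrier K \<Longrightarrow> d \<in> carrier K \<Longrightarrow> b x (c \<oplus> d) = b x c \<oplus>\<^bsub>P\<^esub> b x d"
  shows bc_lift_pure: "\<And>x c. x \<in> carrier M \<Longrightarrow> c \<in> carrier K \<Longrightarrow> tensor_lift P b (pt x c) = b x c"
    and bc_lift_closed: "\<And>v. v \<in> carrier V \<Longrightarrow> tensor_lift P b v \<in> carrier P"
    and bc_lift_add: "\<And>v w. v \<in> carrier V \<Longrightarrow> w \<in> carrier V \<Longrightarrow>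
      tensor_lift P b (v \<oplus>\<^bsub>V\<^esub> w) = tensor_lift P b v \<oplus>\<^bsub>P\<^esub> tensor_lift P b w"
proof -
  have bal: "balanced \<Z> M (int_algebra K) P b"
    by (rule int_balancedI[OF M.module_axioms L.module_axioms P]) (use b in auto)
  show "\<And>x c. x \<in> carrier M \<Longrightarrow> c \<in> carrier K \<Longrightarrow> tensor_lift P b (pt x c) = b x c"
    "\<And>v. v \<in> carrier V \<Longrightarrow> tensor_lift P b v \<in> carrier P"
    "\<And>v w. v \<in> carrier V \<Longrightarrow> w \<in> carrier V \<Longrightarrow> tensor_lift P b (v \<oplus>\<^bsub>V\<^esub> w) = tensor_lift P b v \<oplus>\<^bsub>P\<^esub> tensor_lift P b w"
    using TM.tensor_lift_pure[OF P bal] TM.tensor_lift_closed[OF P bal] TM.tensor_lift_add[OF P bal] by simp_all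
qed

lemma smult_bc:
  assumes "c \<in> carrier K"
  shows smult_bc_pure: "\<And>x d. x \<in> carrier M \<Longrightarrow> d \<in> carrier K \<Longrightarrow> c \<odot>\<^bsub>V\<^esub> pt x d = pt x (c \<otimes> d)"
    and smult_bc_closed: "\<And>v. v \<in> carrier V \<Longrightarrow> c \<odot>\<^bsub>V\<^esub> v \<in> carrier V"
    and smult_bc_add: "\<And>v w. v \<in> carrier V \<Longrightarrow> w \<in> carrier V \<Longrightarrow> c \<odot>\<^bsub>V\<^esub> (v \<oplus>\<^bsub>V\<^esub> w) = c \<odot>\<^bsub>V\<^esub> v \<oplus>\<^bsub>V\<^esub> c \<odot>\<^bsub>V\<^esub> w"
proof -
  have p: "pt x (c \<otimes> d) \<in> carrier (tensor \<Z> M (int_algebra K))" if "x \<in> carrier M" "d \<in> carrier K" for x d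
    using pt_closed[of x "c \<otimes> d"] that assms by simp
  have a: "pt (x \<oplus>\<^bsub>M\<^esub> y) (c \<otimes> d) = pt x (c \<otimes> d) \<oplus>\<^bsub>tensor \<Z> M (int_algebra K)\<^esub> pt y (c \<otimes> d)"
    if "x \<in> carrier M" "y \<in> carrier M" "d \<in> carrier K" for x y d
    using pt_add(1)[of x y "c \<otimes> d"] that assms by simp
  have b: "pt x (c \<otimes> (d \<oplus> e)) = pt x (c \<otimes> d) \<oplus>\<^bsub>tensor \<Z> M (int_algebra K)\<^esub> pt x (c \<otimes> e)"
    if "x \<in> carrier M" "d \<in> carrier K" "e \<in> carrier K" for x d e
    using pt_add(2)[of x "c \<otimes> d" "c \<otimes> e"] that assms by (simp add: K.r_distr)
  note l = bc_lift[OF TM.T.abelian_group_axioms, of "\<lambda>x d. pt x (c \<otimes> d)"]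
  show "c \<odot>\<^bsub>V\<^esub> pt x d = pt x (c \<otimes> d)" if "x \<in> carrier M" "d \<in> carrier K" for x d
    by (subst base_change_simps(4), rule l(1), rule p, assumption+, rule a, assumption+, rule b, assumption+, rule that(1), rule that(2))
  show "c \<odot>\<^bsub>V\<^esub> v \<in> carrier V" if "v \<in> carrier V" for v
    by (subst base_change_simps(4), subst base_change_simps(1), rule l(2), rule p, assumption+, rule a, assumption+, rule b, assumption+, rule that)
  show "c \<odot>\<^bsub>V\<^esub> (v \<oplus>\<^bsub>V\<^esub> w) = c \<odot>\<^bsub>V\<^esub> v \<oplus>\<^bsub>V\<^esub> c \<odot>\<^bsub>V\<^esub> w" if "v \<in> carrier V" "w \<in> carrier V" for v w
    by (subst (1 2 3) base_change_simps(4), subst (2) base_change_simps(3), rule l(3), rule p, assumption+, rule a, assumption+, rule b, assumption+, rule that(1), rule that(2))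
qed

lemma bc_abelian_group: "abelian_group V"
  by (rule abelian_groupI) (auto simp: TM.T.a_ac intro: bexI[of _ "\<ominus>\<^bsub>tensor \<Z> M (int_algebra K)\<^esub> _"] TM.T.l_neg)

sublocale V: abelian_group V by (rule bc_abelian_group)

lemma bc_module: "module K V"
proof (rule moduleI)
  \<comment> \<open>The operations of \<open>V\<close> are kept folded, so that the rules for
    \<open>pt\<close> and for the scalar action match them.\<close>
  note [simp del] = base_change_simps
  show "cring K" by (rule K.is_cring)
  show "abelian_group V" by (rule bc_abelian_group)
  show "a \<odot>\<^bsub>V\<^esub> v \<in> carrier V" if "a \<in> carrier K" "v \<in> carrier V" for a v
    using smult_bc_closed that .
  show "a \<odot>\<^bsub>V\<^esub> (v \<oplus>\<^bsub>V\<^esub> w) = a \<odot>\<^bsub>V\<^esub> v \<oplus>\<^bsub>V\<^esub> a \<odot>\<^bsub>V\<^esub> w" if "a \<in> carrier K" "v \<in> carrier V" "w \<in> carrier V" for a v w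
    using smult_bc_add that .
  show "(a \<oplus> b) \<odot>\<^bsub>V\<^esub> v = a \<odot>\<^bsub>V\<^esub> v \<oplus>\<^bsub>V\<^esub> b \<odot>\<^bsub>V\<^esub> v" if ab: "a \<in> carrier K" "b \<in> carrier K" and v: "v \<in> carrier V" for a b v
    using v
  proof (induction v rule: bc_induct)
    case (pure x c)
    then show ?case using ab by (simp add: smult_bc_pure K.l_distr pt_add)
  next
    case (add v w)
    then show ?case using ab smult_bc_closed by (simp add: smult_bc_add V.a_ac)
  qed
  show "(a \<otimes> b) \<odot>\<^bsub>V\<^esub> v = a \<odot>\<^bsub>V\<^esub> (b \<odot>\<^bsub>V\<^esub> v)" if ab: "a \<in> carrier K" "b \<in> carrier K" and v: "v \<in> carrier V" for a b v
    using v
  proof (induction v rule: bc_induct)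
    case (pure x c)
    then show ?case using ab by (simp add: smult_bc_pure K.m_assoc)
  next
    case (add v w)
    then show ?case using ab smult_bc_closed by (simp add: smult_bc_add)
  qed
  show "\<one> \<odot>\<^bsub>V\<^esub> v = v" if v: "v \<in> carrier V" for v
    using v by (induction v rule: bc_induct) (simp_all add: smult_bc_pure smult_bc_add)
qed

declare base_change_simps [simp del]

sublocale V: module K V by (rule bc_module)

lemma pt_smult: "x \<in> carrier M \<Longrightarrow> c \<in> carrier K \<Longrightarrow> pt x c = c \<odot>\<^bsub>V\<^esub> pt x \<one>"
  by (simp add: smult_bc_pure)

text \<open>Extension of scalars is left adjoint to restriction: a linear map out of the base change
  is given by an additive map \<beta> on \<open>M\<close>. Both \<open>b\<close> and \<beta> occur
  because the structure maps are defined by lifting functions of two arguments.\<close>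

lemma bc_hom:
  assumes P: "module K P"
    and b: "\<And>x c. x \<in> carrier M \<Longrightarrow> c \<in> carrier K \<Longrightarrow> b x c = c \<odot>\<^bsub>P\<^esub> \<beta> x"
      "\<And>x. x \<in> carrier M \<Longrightarrow> \<beta> x \<in> carrier P"
      "\<And>x y. x \<in> carrier M \<Longrightarrow> y \<in> carrier M \<Longrightarrow> \<beta> (x \<oplus>\<^bsub>M\<^esub> y) = \<beta> x \<oplus>\<^bsub>P\<^esub> \<beta> y"
  shows bc_hom_pure: "\<And>x c. x \<in> carrier M \<Longrightarrow> c \<in> carrier K \<Longrightarrow> tensor_lift P b (pt x c) = c \<odot>\<^bsub>P\<^esub> \<beta> x"
    and bc_hom_hom: "tensor_lift P b \<in> module_hom K V P"
proof -
  interpret P: module K P by fact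
  note l = bc_lift[OF P.abelian_group_axioms, of b]
  have c: "\<And>x c. x \<in> carrier M \<Longrightarrow> c \<in> carrier K \<Longrightarrow> b x c \<in> carrier P"
    and a: "\<And>x y c. x \<in> carrier M \<Longrightarrow> y \<in> carrier M \<Longrightarrow> c \<in> carrier K \<Longrightarrow> b (x \<oplus>\<^bsub>M\<^esub> y) c = b x c \<oplus>\<^bsub>P\<^esub> b y c"
    and a': "\<And>x c d. x \<in> carrier M \<Longrightarrow> c \<in> carrier K \<Longrightarrow> d \<in> carrier K \<Longrightarrow> b x (c \<oplus> d) = b x c \<oplus>\<^bsub>P\<^esub> b x d"
    using b by (simp_all add: P.smult_r_distr P.smult_l_distr)
  show p: "tensor_lift P b (pt x c) = c \<odot>\<^bsub>P\<^esub> \<beta> x" if "x \<in> carrier M" "c \<in> carrier K" for x c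
    using l(1)[OF c a a' that] b(1)[OF that] by simp
  show "tensor_lift P b \<in> module_hom K V P"
  proof (rule module_homI)
    show cl: "tensor_lift P b v \<in> carrier P" if "v \<in> carrier V" for v using l(2)[OF c a a' that] .
    show ad: "tensor_lift P b (v \<oplus>\<^bsub>V\<^esub> w) = tensor_lift P b v \<oplus>\<^bsub>P\<^esub> tensor_lift P b w" if "v \<in> carrier V" "w \<in> carrier V" for v w
      using l(3)[OF c a a' that] .
    show "tensor_lift P b (r \<odot>\<^bsub>V\<^esub> v) = r \<odot>\<^bsub>P\<^esub> tensor_lift P b v" if r: "r \<in> carrier K" and v: "v \<in> carrier V" for r v
      using v
    proof (induction v rule: bc_induct)
      case (pure x c)
      then show ?case using r b(2) by (simp add: smult_bc_pure p P.smult_assoc1)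
    next
      case (add v w)
      then show ?case using r cl by (simp add: smult_bc_add ad smult_bc_closed P.smult_r_distr)
    qed
  qed
qed

text \<open>The elements x \<otimes> 1 span the base change, since x \<otimes> c is \<open>c\<close>
  times x \<otimes> 1.\<close>

lemma bc_hom_eq:
  assumes P: "module K P" and f: "f \<in> module_hom K V P" and g: "g \<in> module_hom K V P"
    and eq: "\<And>x. x \<in> carrier M \<Longrightarrow> f (pt x \<one>) = g (pt x \<one>)" and v: "v \<in> carrier V"
  shows "f v = g v"
  using v
proof (induction v rule: bc_induct)
  case (pure x c)
  then show ?case using eq f g pt_smult[of x c] by (simp add: module_hom_simps)
next
  case (add v w)
  then show ?case using f g by (simp add: module_hom_simps)
qed

end

lemma lcomb_extend [simp]: "lcomb (module.extend V m) c e n = lcomb V c e n"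
  by (induction n) auto

lemma generated_by_extend [simp]: "generated_by K (module.extend V m) n \<longleftrightarrow> generated_by K V n"
  by (simp add: generated_by_def)

lemma (in module) lcomb_add:
  assumes "\<And>j. j < n \<Longrightarrow> c j \<in> carrier R" "\<And>j. j < n \<Longrightarrow> d j \<in> carrier R" "\<And>j. j < n \<Longrightarrow> e j \<in> carrier M"
  shows "lcomb M (\<lambda>j. c j \<oplus> d j) e n = lcomb M c e n \<oplus>\<^bsub>M\<^esub> lcomb M d e n"
  using assms
proof (induction n)
  case (Suc n)
  then show ?case using lcomb_closed[of n c e] lcomb_closed[of n d e] by (simp add: smult_l_distr M.a_ac)
qed simp

context scalar_extension
begin

lemma pt_lcomb:
  assumes "\<And>j. j < n \<Longrightarrow> e j \<in> carrier M" "c \<in> carrier K"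
  shows "pt (lcomb M r e n) c = lcomb V (\<lambda>j. [r j] \<cdot>\<^bsub>K\<^esub> c) (\<lambda>j. pt (e j) \<one>) n"
  using assms(1)
proof (induction n)
  case 0
  show ?case using TM.pure_zero_left[of c] assms(2) by (simp add: base_change_simps)
next
  case (Suc n)
  have "pt (r n \<odot>\<^bsub>M\<^esub> e n) c = pt (e n) ([r n] \<cdot>\<^bsub>K\<^esub> c)"
    using TM.pure_balanced[of "r n" "e n" c] Suc.prems assms(2) by simp
  also have "\<dots> = ([r n] \<cdot>\<^bsub>K\<^esub> c) \<odot>\<^bsub>V\<^esub> pt (e n) \<one>"
    by (rule pt_smult) (use Suc.prems assms(2) in auto)
  finally show ?case
    using Suc M.lcomb_closed[of n r e] assms(2) M.smult_closed[of "r n" "e n"] by (simp add: pt_add)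
qed

text \<open>The elements e j \<otimes> 1 generate, integer coefficients being absorbed into the
  right factor. Their number does not depend on \<open>K\<close>, which is the source of the uniform
  bound.\<close>

lemma bc_generated:
  assumes "generated_by \<Z> M n"
  shows "generated_by K V n"
proof -
  obtain e where e: "\<And>j. j < n \<Longrightarrow> e j \<in> carrier M" "\<And>x. x \<in> carrier M \<Longrightarrow> \<exists>r. x = lcomb M r e n"
    using assms unfolding generated_by_def by blast
  let ?d = "\<lambda>j. pt (e j) \<one>"
  have d: "\<And>j. j < n \<Longrightarrow> ?d j \<in> carrier V" using e(1) by simp
  have "\<exists>c. (\<forall>j<n. c j \<in> carrier K) \<and> v = lcomb V c ?d n" if "v \<in> carrier V" for v
    using that
  proof (induction v rule: bc_induct)
    case (pure x c)
    obtain r where "x = lcomb M r e n" using e(2) pure(1) by blast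
    then show ?case
      using pt_lcomb[of n e c r] e(1) pure(2) by (intro exI[of _ "\<lambda>j. [r j] \<cdot>\<^bsub>K\<^esub> c"]) simp
  next
    case (add v w)
    then obtain c c' where "\<And>j. j < n \<Longrightarrow> c j \<in> carrier K" "v = lcomb V c ?d n"
      "\<And>j. j < n \<Longrightarrow> c' j \<in> carrier K" "w = lcomb V c' ?d n" by blast
    then show ?case
      using V.lcomb_add[of n c c' ?d] d by (intro exI[of _ "\<lambda>j. c j \<oplus> c' j"]) simp
  qed
  then show ?thesis unfolding generated_by_def by (intro exI[of _ ?d] conjI ballI allI impI d)
qed

end

section \<open>Base change of the coalgebra structure\<close>

locale coalgebra_extension = K: cring K + coalgebra_data \<Z> A
  for K (structure) and A :: "(int, 'a, 'x) hopf_scheme"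
begin

sublocale B: scalar_extension K A by unfold_locales

abbreviation "B \<equiv> base_change K A"
abbreviation "BK \<equiv> base_change_hopf K A"

sublocale BB: two_modules K B B by unfold_locales

lemma scalar_extension: "module \<Z> M \<Longrightarrow> scalar_extension K M"
  by (simp add: scalar_extension_def K.is_cring)

abbreviation "pure2 M x a \<equiv> pure_tensor K (base_change K M) B x a"

text \<open>The canonical additive map from the integral tensor product of \<open>M\<close> and
  \<open>A\<close> to the tensor product over \<open>K\<close> of their base changes. Coaction and
  comultiplication of a base change are the linear extensions of its composites with the integral
  ones.\<close>

definition "extend2 M = tensor_lift (tensor K (base_change K M) B) (\<lambda>x a. pure2 M (bc_pure K M x \<one>) (bc_pure K A a \<one>))"

context
  fixes M :: "(int, 'm, 'y) module_scheme"
  assumes M: "module \<Z> M"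
begin

interpretation V: scalar_extension K M by (rule scalar_extension[OF M])
interpretation MA: two_modules \<Z> M A by (rule TA_intro[OF M])
interpretation VB: two_modules K V.V B by unfold_locales

lemma extend2_balanced:
  assumes "c \<in> carrier K"
  shows "balanced \<Z> M A (tensor K V.V B) (\<lambda>x a. pure2 M (bc_pure K M x c) (bc_pure K A a \<one>))"
  by (rule int_balancedI[OF M A.module_axioms VB.T.abelian_group_axioms])
    (use assms in \<open>auto simp: V.pt_add B.pt_add VB.pure_add_left VB.pure_add_right\<close>)

lemma extend2_pure: "x \<in> carrier M \<Longrightarrow> a \<in> carrier A \<Longrightarrow>
    extend2 M (pure_tensor \<Z> M A x a) = pure2 M (bc_pure K M x \<one>) (bc_pure K A a \<one>)"
  unfolding extend2_def by (rule MA.tensor_lift_pure[OF VB.T.abelian_group_axioms extend2_balanced]) auto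

lemma extend2_closed: "t \<in> carrier (tensor \<Z> M A) \<Longrightarrow> extend2 M t \<in> carrier (tensor K V.V B)"
  unfolding extend2_def by (rule MA.tensor_lift_closed[OF VB.T.abelian_group_axioms extend2_balanced]) auto

lemma extend2_add: "s \<in> carrier (tensor \<Z> M A) \<Longrightarrow> t \<in> carrier (tensor \<Z> M A) \<Longrightarrow>
    extend2 M (s \<oplus>\<^bsub>tensor \<Z> M A\<^esub> t) = extend2 M s \<oplus>\<^bsub>tensor K V.V B\<^esub> extend2 M t"
  unfolding extend2_def by (rule MA.tensor_lift_add[OF VB.T.abelian_group_axioms extend2_balanced]) auto

text \<open>In the definitions the scalar \<open>c\<close> sits in the first inner factor. Drawing
  it out brings the lifted function into the form that \<open>bc_hom\<close> expects,
  \<open>c\<close> times an additive function.\<close>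

lemma extend2_scale:
  assumes c: "c \<in> carrier K" and t: "t \<in> carrier (tensor \<Z> M A)"
  shows "tensor_lift (tensor K V.V B) (\<lambda>x a. pure2 M (bc_pure K M x c) (bc_pure K A a \<one>)) t =
    c \<odot>\<^bsub>tensor K V.V B\<^esub> extend2 M t"
  using t
proof (induction t rule: MA.tensor_induct)
  case (pure x a)
  then show ?case
    using MA.tensor_lift_pure[OF VB.T.abelian_group_axioms extend2_balanced[OF c]] c V.pt_smult[of x c]
    by (simp add: extend2_pure)
next
  case (add s t)
  then show ?case
    using MA.tensor_lift_add[OF VB.T.abelian_group_axioms extend2_balanced[OF c]] c
    by (simp add: extend2_add extend2_closed VB.T.smult_r_distr)
qed

text \<open>Formulated for any linear \<delta>, so that it gives the coaction of a base change and,
  with \<open>A\<close> in place of \<open>M\<close>, the comultiplication.\<close>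

lemma extended_coact:
  assumes d: "\<delta> \<in> module_hom \<Z> M (tensor \<Z> M A)"
  defines "E \<equiv> tensor_lift (tensor K V.V B) (\<lambda>m c. tensor_lift (tensor K V.V B)
              (\<lambda>x a. pure2 M (bc_pure K M x c) (bc_pure K A a \<one>)) (\<delta> m))"
  shows extended_coact_pure: "\<And>x c. x \<in> carrier M \<Longrightarrow> c \<in> carrier K \<Longrightarrow>
      E (bc_pure K M x c) = c \<odot>\<^bsub>tensor K V.V B\<^esub> extend2 M (\<delta> x)"
    and extended_coact_hom: "E \<in> module_hom K V.V (tensor K V.V B)"
proof -
  note s = module_hom_simps[OF d]
  have b: "tensor_lift (tensor K V.V B) (\<lambda>x a. pure2 M (bc_pure K M x c) (bc_pure K A a \<one>)) (\<delta> m) =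
      c \<odot>\<^bsub>tensor K V.V B\<^esub> extend2 M (\<delta> m)" if "m \<in> carrier M" "c \<in> carrier K" for m c
    by (rule extend2_scale) (use that s in auto)
  have cl: "extend2 M (\<delta> m) \<in> carrier (tensor K V.V B)" if "m \<in> carrier M" for m by (rule extend2_closed) (use that s in auto)
  have ad: "extend2 M (\<delta> (m \<oplus>\<^bsub>M\<^esub> m')) = extend2 M (\<delta> m) \<oplus>\<^bsub>tensor K V.V B\<^esub> extend2 M (\<delta> m')" if "m \<in> carrier M" "m' \<in> carrier M" for m m'
    using that s by (simp add: extend2_add)
  show "E (bc_pure K M x c) = c \<odot>\<^bsub>tensor K V.V B\<^esub> extend2 M (\<delta> x)" if "x \<in> carrier M" "c \<in> carrier K" for x c
    unfolding E_def by (rule V.bc_hom_pure[OF VB.tensor_module b cl ad that])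
  show "E \<in> module_hom K V.V (tensor K V.V B)"
    unfolding E_def by (rule V.bc_hom_hom[OF VB.tensor_module b cl ad])
qed

end

lemma BK_eq: obtains s where "BK = module.extend B (hopf.fields
    (tensor_lift (tensor K B B) (\<lambda>a c. tensor_lift (tensor K B B)
        (\<lambda>x y. pure2 A (bc_pure K A x c) (bc_pure K A y \<one>)) (comult A a)))
    (tensor_lift K (\<lambda>a c. [counit A a] \<cdot>\<^bsub>K\<^esub> c)) s)"
  by (simp add: base_change_hopf_def Let_def)

lemma BK_tensor [simp]:
  "tensor K X BK = tensor K X B" "tensor K BK X = tensor K B X"
  "pure_tensor K X BK = pure_tensor K X B" "pure_tensor K BK X = pure_tensor K B X"
  "module_hom K BK W = module_hom K B W" "module_hom K W BK = module_hom K W B" "module K BK = module K B"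
  "carrier BK = carrier B" "a \<oplus>\<^bsub>BK\<^esub> b = a \<oplus>\<^bsub>B\<^esub> b" "c \<odot>\<^bsub>BK\<^esub> a = c \<odot>\<^bsub>B\<^esub> a"
  by (rule BK_eq; simp)+

lemma BK_comult: "comult BK = tensor_lift (tensor K B B) (\<lambda>a c. tensor_lift (tensor K B B)
        (\<lambda>x y. pure2 A (bc_pure K A x c) (bc_pure K A y \<one>)) (comult A a))"
  by (rule BK_eq) (simp add: module.defs hopf.defs)

lemma BK_counit: "counit BK = tensor_lift K (\<lambda>a c. [counit A a] \<cdot>\<^bsub>K\<^esub> c)"
  by (rule BK_eq) (simp add: module.defs hopf.defs)

lemma comult_BK_pure: "a \<in> carrier A \<Longrightarrow> comult BK (bc_pure K A a \<one>) = extend2 A (comult A a)"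
  unfolding BK_comult
  by (subst extended_coact_pure[OF A.module_axioms comult_hom])
    (use module_hom_carrier[OF comult_hom] extend2_closed[OF A.module_axioms] in auto)

lemma counit_add_pow: "a \<in> carrier A \<Longrightarrow> b \<in> carrier A \<Longrightarrow> c \<in> carrier K \<Longrightarrow>
   [counit A (a \<oplus>\<^bsub>A\<^esub> b)] \<cdot>\<^bsub>K\<^esub> c = [counit A a] \<cdot>\<^bsub>K\<^esub> c \<oplus> [counit A b] \<cdot>\<^bsub>K\<^esub> c"
  by (simp add: counit_add K.add.int_pow_mult)

lemma counit_BK:
  shows counit_BK_pure: "\<And>a c. a \<in> carrier A \<Longrightarrow> c \<in> carrier K \<Longrightarrow> counit BK (bc_pure K A a c) = [counit A a] \<cdot>\<^bsub>K\<^esub> c"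
    and counit_BK_closed: "\<And>b. b \<in> carrier B \<Longrightarrow> counit BK b \<in> carrier K"
    and counit_BK_add: "\<And>a b. a \<in> carrier B \<Longrightarrow> b \<in> carrier B \<Longrightarrow> counit BK (a \<oplus>\<^bsub>B\<^esub> b) = counit BK a \<oplus> counit BK b"
  unfolding BK_counit
  by (rule B.bc_lift[OF K.abelian_group_axioms]; simp add: counit_add_pow K.add.int_pow_distrib)+

lemma counit_BK_smult:
  assumes r: "r \<in> carrier K" and b: "b \<in> carrier B"
  shows "counit BK (r \<odot>\<^bsub>B\<^esub> b) = r \<otimes> counit BK b"
  using b
proof (induction b rule: B.bc_induct)
  case (pure a c)
  then show ?case using r by (simp add: B.smult_bc_pure counit_BK_pure K.add_pow_rdistr_int)
next
  case (add a b)
  then show ?case using r by (simp add: B.smult_bc_add B.smult_bc_closed counit_BK_add counit_BK_closed K.r_distr)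
qed

sublocale H: coalgebra_data K BK
proof (intro coalgebra_data.intro coalgebra_data_axioms.intro)
  show "module K BK" using B.bc_module by simp
  show "comult BK \<in> module_hom K BK (tensor K BK BK)"
    unfolding BK_comult using extended_coact_hom[OF A.module_axioms comult_hom] by simp
qed (simp_all add: counit_BK_closed counit_BK_add counit_BK_smult)

end

lemma hopf_coalgebra: "hopf_algebra R A \<Longrightarrow> coalgebra_data R A"
  unfolding hopf_algebra_def hopf_algebra_axioms_def coalgebra_data_def coalgebra_data_axioms_def algebra_def
  by (auto simp: ring_hom_def)

section \<open>Base change of comodules\<close>

context coalgebra_extension
begin

abbreviation "MK M \<equiv> base_change_comodule K A M"

lemma MK_simps [simp]:
  "tensor K (MK M) X = tensor K (base_change K M) X" "pure_tensor K (MK M) X = pure_tensor K (base_change K M) X"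
  "module_hom K (MK M) W = module_hom K (base_change K M) W" "module_hom K W (MK M) = module_hom K W (base_change K M)"
  "module K (MK M) = module K (base_change K M)" "generated_by K (MK M) n = generated_by K (base_change K M) n"
  "carrier (MK M) = carrier (base_change K M)" "c \<odot>\<^bsub>MK M\<^esub> v = c \<odot>\<^bsub>base_change K M\<^esub> v"
  by (simp_all add: base_change_comodule_def Let_def)

lemma MK_coact: "coact (MK M) = tensor_lift (tensor K (base_change K M) B) (\<lambda>m c. tensor_lift (tensor K (base_change K M) B)
        (\<lambda>x a. pure2 M (bc_pure K M x c) (bc_pure K A a \<one>)) (coact M m))"
  by (simp add: base_change_comodule_def Let_def module.defs comodule.defs)

text \<open>At \<open>x \<otimes> 1\<close> the two sides of each comodule law for the base change are the images under
  \<open>extend2\<close> and \<open>extend3\<close> of the two sides of the law over the integers.\<close>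

definition "extend3 M = tensor_lift (tensor K (base_change K M) (tensor K B B))
   (\<lambda>x s. pure_tensor K (base_change K M) (tensor K B B) (bc_pure K M x \<one>) (extend2 A s))"

context
  fixes M :: "(int, 'a, 'm) comodule"
  assumes comod: "comodule \<Z> A M"
begin

interpretation M: comodule \<Z> A M by (rule comod)
interpretation V: scalar_extension K M by (rule scalar_extension[OF M.module_axioms])
interpretation MA: two_modules \<Z> M A by (rule TA_intro[OF M.module_axioms])
interpretation MAA: two_modules \<Z> M "tensor \<Z> A A" by (rule TAA_intro[OF M.module_axioms])
interpretation VB: two_modules K V.V B by unfold_locales
interpretation VBB: two_modules K V.V "tensor K B B"
  using BB.tensor_module V.bc_module by blast

lemma MK_module: "module K (MK M)"
  using V.bc_module by simp

lemma extend3_balanced: "balanced \<Z> M (tensor \<Z> A A) (tensor K V.V (tensor K B B))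
    (\<lambda>x s. pure_tensor K V.V (tensor K B B) (bc_pure K M x \<one>) (extend2 A s))"
  by (rule int_balancedI[OF M.module_axioms AA.tensor_module VBB.T.abelian_group_axioms])
    (auto simp: V.pt_add VBB.pure_add_left VBB.pure_add_right extend2_closed[OF A.module_axioms] extend2_add[OF A.module_axioms])

lemma extend3:
  shows extend3_pure: "\<And>x s. x \<in> carrier M \<Longrightarrow> s \<in> carrier (tensor \<Z> A A) \<Longrightarrow>
      extend3 M (pure_tensor \<Z> M (tensor \<Z> A A) x s) = pure_tensor K V.V (tensor K B B) (bc_pure K M x \<one>) (extend2 A s)"
    and extend3_add: "\<And>s t. s \<in> carrier (TAA M) \<Longrightarrow> t \<in> carrier (TAA M) \<Longrightarrow>
      extend3 M (s \<oplus>\<^bsub>TAA M\<^esub> t) = extend3 M s \<oplus>\<^bsub>tensor K V.V (tensor K B B)\<^esub> extend3 M t"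
  unfolding extend3_def
  using MAA.tensor_lift_pure[OF VBB.T.abelian_group_axioms extend3_balanced]
    MAA.tensor_lift_add[OF VBB.T.abelian_group_axioms extend3_balanced] by blast+

lemma coact_MK_pure:
  assumes "x \<in> carrier M"
  shows "coact (MK M) (bc_pure K M x \<one>) = extend2 M (coact M x)"
proof -
  have "extend2 M (coact M x) \<in> carrier (tensor K V.V B)"
    by (rule extend2_closed[OF M.module_axioms]) (use module_hom_carrier[OF M.coact_linear] assms in auto)
  then show ?thesis
    unfolding MK_coact using extended_coact_pure[OF M.module_axioms M.coact_linear assms, of \<one>] by simp
qed

lemma MK_coact_hom: "coact (MK M) \<in> module_hom K V.V (tensor K V.V B)"
  unfolding MK_coact by (rule extended_coact_hom[OF M.module_axioms M.coact_linear])

lemma extend2_tcomult: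
  assumes "t \<in> carrier (tensor \<Z> M A)"
  shows "tcomult K (MK M) BK (extend2 M t) = extend3 M (tcomult \<Z> M A t)"
  using assms
proof (induction t rule: MA.tensor_induct)
  case (pure x a)
  have "comult A a \<in> carrier (tensor \<Z> A A)" using module_hom_carrier[OF comult_hom] pure by blast
  then show ?case
    using pure H.tcomult_pure[OF MK_module, of "bc_pure K M x \<one>" "bc_pure K A a \<one>"]
    by (simp add: extend2_pure[OF M.module_axioms] tcomult_pure[OF M.module_axioms] extend3_pure comult_BK_pure)
next
  case (add s t)
  then show ?case
    using module_hom_simps[OF H.tcomult_hom[OF MK_module]] module_hom_simps[OF tcomult_hom[OF M.module_axioms]]
    by (simp add: extend2_add[OF M.module_axioms] extend2_closed[OF M.module_axioms] extend3_add)
qed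

lemma extend2_tappend:
  assumes "t \<in> carrier (tensor \<Z> M A)" "a \<in> carrier A"
  shows "H.tappend (MK M) (bc_pure K A a \<one>) (extend2 M t) = extend3 M (tappend M a t)"
proof -
  have a: "bc_pure K A a \<one> \<in> carrier BK" using assms(2) by simp
  show ?thesis
    using assms(1)
  proof (induction t rule: MA.tensor_induct)
    case (pure x b)
    then show ?case
      using assms(2) H.tappend_pure[OF MK_module a, of "bc_pure K M x \<one>" "bc_pure K A b \<one>"]
      by (simp add: extend2_pure[OF M.module_axioms] extend2_pure[OF A.module_axioms] tappend_pure[OF M.module_axioms] extend3_pure)
  next
    case (add s t)
    then show ?case
      using module_hom_simps[OF H.tappend_hom[OF MK_module a]] module_hom_simps[OF tappend_hom[OF M.module_axioms assms(2)]]
      by (simp add: extend2_add[OF M.module_axioms] extend2_closed[OF M.module_axioms] extend3_add)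
  qed
qed

lemma extend2_tcoact:
  assumes "t \<in> carrier (tensor \<Z> M A)"
  shows "tcoact K (MK M) BK (coact (MK M)) (extend2 M t) = extend3 M (tcoact \<Z> M A (coact M) t)"
proof -
  have c: "coact (MK M) \<in> module_hom K (MK M) (H.TA (MK M))" using MK_coact_hom by simp
  show ?thesis
    using assms
  proof (induction t rule: MA.tensor_induct)
    case (pure x a)
    have "coact M x \<in> carrier (tensor \<Z> M A)" using module_hom_carrier[OF M.coact_linear] pure by blast
    then show ?case
      using pure H.tcoact_pure[OF MK_module MK_module c, of "bc_pure K M x \<one>" "bc_pure K A a \<one>"]
      by (simp add: extend2_pure[OF M.module_axioms] tcoact_pure[OF M.module_axioms M.module_axioms M.coact_linear]
          extend2_tappend coact_MK_pure)
  next
    case (add s t)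
    then show ?case
      using module_hom_simps[OF H.tcoact_hom[OF MK_module MK_module c]]
        module_hom_simps[OF tcoact_hom[OF M.module_axioms M.module_axioms M.coact_linear]]
      by (simp add: extend2_add[OF M.module_axioms] extend2_closed[OF M.module_axioms] extend3_add)
  qed
qed

lemma extend2_tcounit:
  assumes "t \<in> carrier (tensor \<Z> M A)"
  shows "tcounit (MK M) BK (extend2 M t) = bc_pure K M (tcounit M A t) \<one>"
  using assms
proof (induction t rule: MA.tensor_induct)
  case (pure x a)
  have "bc_pure K M (counit A a \<odot>\<^bsub>M\<^esub> x) \<one> = bc_pure K M x ([counit A a] \<cdot>\<^bsub>K\<^esub> \<one>)"
    using V.TM.pure_balanced[of "counit A a" x \<one>] pure by simp
  also have "\<dots> = ([counit A a] \<cdot>\<^bsub>K\<^esub> \<one>) \<odot>\<^bsub>V.V\<^esub> bc_pure K M x \<one>"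
    by (rule V.pt_smult) (use pure in auto)
  finally show ?case
    using pure H.tcounit_pure[OF MK_module, of "bc_pure K M x \<one>" "bc_pure K A a \<one>"]
    by (simp add: extend2_pure[OF M.module_axioms] tcounit_pure[OF M.module_axioms] counit_BK_pure)
next
  case (add s t)
  then show ?case
    using module_hom_simps[OF H.tcounit_hom[OF MK_module]] module_hom_simps[OF tcounit_hom[OF M.module_axioms]]
    by (simp add: extend2_add[OF M.module_axioms] extend2_closed[OF M.module_axioms] V.pt_add base_change_comodule_def Let_def)
qed

lemma base_change_is_comodule: "comodule K BK (MK M)"
proof (intro comodule.intro comodule_axioms.intro)
  show "module K (MK M)" by (rule MK_module)
  show c: "coact (MK M) \<in> module_hom K (MK M) (tensor K (MK M) BK)" using MK_coact_hom by simp
  have cl: "coact M x \<in> carrier (tensor \<Z> M A)" if "x \<in> carrier M" for x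
    using module_hom_carrier[OF M.coact_linear that] .
  fix v assume "v \<in> carrier (MK M)"
  then have v: "v \<in> carrier V.V" by simp
  \<comment> \<open>Both sides are linear over \<open>K\<close> in \<open>v\<close>, so it is enough
    to compare them at x \<otimes> 1.\<close>
  have "tcomult K (MK M) BK (coact (MK M) v) = tcoact K (MK M) BK (coact (MK M)) (coact (MK M) v)"
  proof (rule V.bc_hom_eq[OF _ _ _ _ v])
    show "module K (H.TAA (MK M))" using VBB.tensor_module by simp
    show "(\<lambda>v. tcomult K (MK M) BK (coact (MK M) v)) \<in> module_hom K V.V (H.TAA (MK M))"
      using module_hom_compose[OF c H.tcomult_hom[OF MK_module]] by simp
    show "(\<lambda>v. tcoact K (MK M) BK (coact (MK M)) (coact (MK M) v)) \<in> module_hom K V.V (H.TAA (MK M))"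
      using module_hom_compose[OF c H.tcoact_hom[OF MK_module MK_module c]] by simp
    show "tcomult K (MK M) BK (coact (MK M) (bc_pure K M x \<one>)) =
        tcoact K (MK M) BK (coact (MK M)) (coact (MK M) (bc_pure K M x \<one>))" if "x \<in> carrier M" for x
      using M.coact_coassoc[OF that] extend2_tcomult[OF cl[OF that]] extend2_tcoact[OF cl[OF that]]
      by (simp add: coact_MK_pure[OF that] tcomult_def[of \<Z>] tcoact_def[of \<Z>])
  qed
  then show "tensor_lift (tensor K (MK M) (tensor K BK BK)) (\<lambda>w a. pure_tensor K (MK M) (tensor K BK BK) w (comult BK a)) (coact (MK M) v) =
      tensor_lift (tensor K (MK M) (tensor K BK BK)) (\<lambda>w a. tensor_lift (tensor K (MK M) (tensor K BK BK))
        (\<lambda>u b. pure_tensor K (MK M) (tensor K BK BK) u (pure_tensor K BK BK b a)) (coact (MK M) w)) (coact (MK M) v)"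
    unfolding tcomult_def tcoact_def .
  have "tcounit (MK M) BK (coact (MK M) v) = v"
  proof (rule V.bc_hom_eq[OF V.bc_module _ _ _ v, where g = "\<lambda>v. v"])
    show "(\<lambda>v. tcounit (MK M) BK (coact (MK M) v)) \<in> module_hom K V.V V.V"
      using module_hom_compose[OF c H.tcounit_hom[OF MK_module]] by simp
    show "(\<lambda>v. v) \<in> module_hom K V.V V.V" by (rule module_homI) auto
    show "tcounit (MK M) BK (coact (MK M) (bc_pure K M x \<one>)) = bc_pure K M x \<one>" if "x \<in> carrier M" for x
      using M.coact_counit[OF that] extend2_tcounit[OF cl[OF that]]
      by (simp add: coact_MK_pure[OF that] tcounit_def[of M])
  qed
  then show "tensor_lift (MK M) (\<lambda>w a. counit BK a \<odot>\<^bsub>MK M\<^esub> w) (coact (MK M) v) = v"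
    unfolding tcounit_def .
qed

lemma MK_generated: "generated_by \<Z> M n \<Longrightarrow> generated_by K (MK M) n"
  using V.bc_generated by simp

lemma MK_rep_object:
  assumes "field K" "generated_by \<Z> M n"
  shows "MK M \<in> rep_objects K BK"
proof -
  have "vectorspace K (MK M)" using assms(1) MK_module by (simp add: vectorspace_def)
  then show ?thesis
    using vectorspace.generated_by_iff[of K "MK M" n] MK_generated[OF assms(2)] base_change_is_comodule
    by (simp add: rep_objects_def)
qed

end

end

text \<open>This supplies the infinity that direct sums of base changes need, whatever the types of
  the factors: the multiples of one generator already give infinitely many formal combinations. The
  singletons used are mere elements of the type, not tensors.\<close>

lemma infinite_tensor_type: "infinite (UNIV :: ('m, 'n) tensor set)"
proof -
  fix z :: "'m \<times> 'n"
  have "inj (\<lambda>n::nat. {frag_cmul (int n) (frag_of z)})"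
  proof (rule injI)
    fix x y :: nat assume "{frag_cmul (int x) (frag_of z)} = {frag_cmul (int y) (frag_of z)}"
    then have "poly_mapping.lookup (frag_cmul (int x) (frag_of z)) z = poly_mapping.lookup (frag_cmul (int y) (frag_of z)) z"
      by simp
    then show "x = y" by (simp add: lookup_frag_of)
  qed
  then have "infinite (range (\<lambda>n::nat. {frag_cmul (int n) (frag_of z)}))" by (simp add: finite_image_iff)
  then show ?thesis by (rule infinite_super[OF subset_UNIV])
qed


section \<open>Existence of ultrafilters and the theorem\<close>

text \<open>Smaller filters are finer. Zorn's lemma gives a minimal proper filter below the one
  generated by \<open>S\<close> and the cofinite sets; minimality makes it an ultrafilter, and
  containing all cofinite sets it is not principal.\<close>

lemma nonprincipal_ultrafilter_containing:
  assumes "infinite S"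
  obtains U where "nonprincipal_ultrafilter U" "eventually (\<lambda>i. i \<in> S) U"
proof -
  let ?F = "inf cofinite (principal S)"
  let ?A = "{F. F \<noteq> bot \<and> F \<le> ?F}"
  have F: "?F \<in> ?A"
    using assms by (simp add: trivial_limit_def eventually_inf_principal eventually_cofinite)
  have "\<exists>m\<in>?A. \<forall>a\<in>?A. a \<le> m \<longrightarrow> a = m"
  proof (rule predicate_Zorn)
    show "partial_order_on ?A (relation_of (\<lambda>F G. G \<le> F) ?A)"
      by (rule partial_order_on_relation_ofI) auto
    fix C assume C: "C \<in> Chains (relation_of (\<lambda>F G. G \<le> F) ?A)"
    show "\<exists>u\<in>?A. \<forall>a\<in>C. u \<le> a"
    proof (cases "C = {}")
      case True
      then show ?thesis using F by blast
    next
      case False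
      have sub: "C \<subseteq> ?A" using C by (auto simp: Chains_def relation_of_def)
      have "\<exists>x\<in>C. x \<le> inf G H" if "G \<in> C" "H \<in> C" for G H
      proof -
        have "G \<le> H \<or> H \<le> G" using C that by (auto simp: Chains_def relation_of_def)
        then show ?thesis using that by (auto simp: inf.absorb1 inf.absorb2)
      qed
      then have "eventually P (Inf C) \<longleftrightarrow> (\<exists>b\<in>C. eventually P b)" for P
        by (rule eventually_Inf_base[OF False])
      \<comment> \<open>For a chain, an event of the infimum is already an event of some member, so
        the infimum stays proper.\<close>
      then have "Inf C \<noteq> bot" using sub by (auto simp: trivial_limit_def)
      moreover obtain G where G: "G \<in> C" using False by blast
      have "Inf C \<le> ?F" by (rule order_trans[OF Inf_lower[OF G]]) (use sub G in auto)
      ultimately show ?thesis by (intro bexI[of _ "Inf C"]) (auto intro: Inf_lower)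
    qed
  qed
  then obtain U where U: "U \<noteq> bot" "U \<le> ?F" and min: "\<And>G. G \<noteq> bot \<Longrightarrow> G \<le> ?F \<Longrightarrow> G \<le> U \<Longrightarrow> G = U" by blast
  have ultra: "eventually P U \<or> eventually (\<lambda>i. \<not> P i) U" for P
  proof (rule disjCI)
    assume n: "\<not> eventually (\<lambda>i. \<not> P i) U"
    \<comment> \<open>Adjoining the event \<open>P\<close> keeps the filter proper if the complement
      of \<open>P\<close> is not an event, so by minimality \<open>P\<close> was already an event of
      \<open>U\<close>.\<close>
    let ?G = "inf U (principal {i. P i})"
    have "?G \<noteq> bot" using n by (simp add: trivial_limit_def eventually_inf_principal)
    moreover have "?G \<le> ?F" by (rule order_trans[OF inf_le1 U(2)])
    ultimately have "?G = U" by (rule min) simp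
    moreover have "eventually P ?G" by (simp add: eventually_inf_principal)
    ultimately show "eventually P U" by simp
  qed
  have ev: "eventually P U" if "finite {i. i \<in> S \<and> \<not> P i}" for P
    using U(2) that by (auto simp: le_filter_def eventually_inf_principal eventually_cofinite)
  have "U \<noteq> principal {i}" for i
  proof
    assume p: "U = principal {i}"
    have "eventually (\<lambda>j. j \<noteq> i) U" by (rule ev) simp
    then show False by (simp add: p eventually_principal)
  qed
  then have "nonprincipal_ultrafilter U" using U(1) ultra by (simp add: nonprincipal_ultrafilter_def)
  moreover have "eventually (\<lambda>i. i \<in> S) U" by (rule ev) simp
  ultimately show ?thesis by (rule that)
qed

lemma comodule_generated:
  assumes "comodule \<Z> A M" "\<exists>S. finite S \<and> S \<subseteq> carrier M \<and> module.span \<Z> M S = carrier M"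
  obtains n where "generated_by \<Z> M n"
  using assms module.generated_by_span unfolding comodule_def by blast

lemma ext_setting_base_change:
  fixes A :: "(int, 'a) hopf" and M N :: "(int, 'a, 'm) comodule" and K :: "'k ring"
  assumes "field K" "hopf_algebra \<Z> A" "comodule \<Z> A M" "generated_by \<Z> M m" "comodule \<Z> A N" "generated_by \<Z> N n"
  shows "ext_setting K (base_change_hopf K A) (base_change_comodule K A M) (base_change_comodule K A N)"
    and "generated_by K (base_change_comodule K A M) m" "generated_by K (base_change_comodule K A N) n"
proof -
  interpret K: field K by fact
  interpret coalgebra_extension K A
    by (intro coalgebra_extension.intro hopf_coalgebra assms(2) K.is_cring)
  show "generated_by K (MK M) m" "generated_by K (MK N) n" using MK_generated assms(3-6) by auto
  show "ext_setting K BK (MK M) (MK N)"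
    by (intro ext_setting.intro ext_setting_axioms.intro rep_setting.intro rep_setting_axioms.intro
        H.coalgebra_data_axioms assms(1) infinite_tensor_type MK_rep_object[OF assms(3) assms(1,4)] MK_rep_object[OF assms(5) assms(1,6)])
qed

theorem theorem1p3p2:
  fixes A :: "(int, 'a) hopf"
    and M N :: "(int, 'a, 'm) comodule"
    and k :: "'i \<Rightarrow> 'k ring"
  assumes "hopf_algebra \<Z> A"
    and "\<exists>S. finite S \<and> S \<subseteq> carrier A \<and> generate_ring A S = carrier A"
    and "comodule \<Z> A M"
    and "\<exists>S. finite S \<and> S \<subseteq> carrier M \<and> module.span \<Z> M S = carrier M"
    and "comodule \<Z> A N"
    and "\<exists>S. finite S \<and> S \<subseteq> carrier N \<and> module.span \<Z> N S = carrier N"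
    and "\<And>i. field (k i)"
    and "\<exists>n. \<forall>U. nonprincipal_ultrafilter U \<longrightarrow>
           has_dim (uproduct_ring U k)
             (Ext1 (restricted_uproduct U k (\<lambda>i. base_change_hopf (k i) A))
               (uclass U (\<lambda>i. base_change_comodule (k i) A M))
               (uclass U (\<lambda>i. base_change_comodule (k i) A N))) n"
  shows "\<exists>n. finite {i. \<not> has_dim (k i)
           (Ext1 (rep_cat (k i) (base_change_hopf (k i) A))
             (base_change_comodule (k i) A M) (base_change_comodule (k i) A N)) n}"
proof -
  \<comment> \<open>The number \<open>n\<close> is fixed before any ultrafilter. The ultrafilter
    below is chosen in dependence on \<open>n\<close>, and the dimension for it is still
    \<open>n\<close>.\<close>
  obtain n where n: "\<And>U. nonprincipal_ultrafilter U \<Longrightarrow> has_dim (uproduct_ring U k)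
             (Ext1 (restricted_uproduct U k (\<lambda>i. base_change_hopf (k i) A))
               (uclass U (\<lambda>i. base_change_comodule (k i) A M))
               (uclass U (\<lambda>i. base_change_comodule (k i) A N))) n"
    using assms(8) by blast
  obtain a where a: "generated_by \<Z> M a" using assms(3,4) by (rule comodule_generated)
  obtain b where b: "generated_by \<Z> N b" using assms(5,6) by (rule comodule_generated)
  have module: "module \<Z> M" "module \<Z> N" using assms(3,5) by (simp_all add: comodule_def)
  \<comment> \<open>The maximum of the two numbers of generators over the integers serves as the
    common bound in \<open>ultra_rep\<close>.\<close>
  note gen = module.generated_by_mono[OF module(1) a, of "max a b"] module.generated_by_mono[OF module(2) b, of "max a b"]
  note ext = ext_setting_base_change[OF assms(7,1,3) gen(1)[OF max.cobounded1] assms(5) gen(2)[OF max.cobounded2]]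
  let ?S = "{i. \<not> has_dim (k i) (Ext1 (rep_cat (k i) (base_change_hopf (k i) A))
             (base_change_comodule (k i) A M) (base_change_comodule (k i) A N)) n}"
  have "finite ?S"
  proof (rule ccontr)
    assume "infinite ?S"
    then obtain U where U: "nonprincipal_ultrafilter U" and S: "eventually (\<lambda>i. i \<in> ?S) U"
      by (rule nonprincipal_ultrafilter_containing)
    interpret ultra_rep U k "\<lambda>i. base_change_hopf (k i) A" "\<lambda>i. base_change_comodule (k i) A M"
      "\<lambda>i. base_change_comodule (k i) A N" "max a b"
    proof (intro ultra_rep.intro ultra_rep_axioms.intro ultra.intro)
      show "U \<noteq> bot" "eventually P U \<or> eventually (\<lambda>i. \<not> P i) U" for P
        using U by (auto simp: nonprincipal_ultrafilter_def)
    qed (rule ext)+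
    have "eventually (\<lambda>i. i \<notin> ?S) U" using Ext1_dim_los n[OF U] by simp
    with S have "eventually (\<lambda>i. False) U" by eventually_elim simp
    then show False by simp
  qed
  then show ?thesis by blast
qed

end
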